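(* Let $n\ge 3$, $\alpha>0$, $\beta>1$, and let $\Omega_{\alpha\beta}\subset\mathbb{C}^n$ be the higher-dimensional worm domain defined in the context. Then the Bergman projection for $\Omega_{\alpha\beta}$ does not map $L^p(\Omega_{\alpha\beta})$ to $L^p(\Omega_{\alpha\beta})$ whenever $$0<\frac1p\le\frac12-\frac{\pi}{2n\alpha\ln\beta}\qquad\text{or}\qquad \frac12+\frac{\pi}{2n\alpha\ln\beta}\le\frac1p<1 .$$ (When $L^p(\Omega_{\alpha\beta})\not\subset L^2(\Omega_{\alpha\beta})$ this means that there is no constant $C$ with $\|Pf\|_{L^p(\Omega_{\alpha\beta})}\le C\|f\|_{L^p(\Omega_{\alpha\beta})}$ for all $f\in L^p(\Omega_{\alpha\beta})\cap L^2(\Omega_{\alpha\beta})$, where $P$ is the Bergman projection.)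
   Context: Points of $\mathbb{C}^n$ are written $z=(z_1,z',z_n)$ with $z'=(z_2,\dots,z_{n-1})$ and $|z'|^2=|z_2|^2+\cdots+|z_{n-1}|^2$. For $M>0$ let $\sigma(t)=Me^{-1/t}$ for $t>0$ and $\sigma(t)=0$ for $t\le 0$. Define $\Omega_{\alpha\beta}=\{(z_1,z',z_n)\in\mathbb{C}^n: r(z_1,z',z_n)<0\}$ where (for $z_n\neq 0$; points with $z_n=0$ are not in $\Omega_{\alpha\beta}$) $$r(z_1,z',z_n)=\left|z_1-e^{2i\alpha\ln|z_n|}\right|^2+|z'|^2-1+\sigma(|z_n|^2-\beta^2)+\sigma(1-|z_n|^2).$$ The constant $M$ is fixed and sufficiently large (depending on the other parameters), so that $\Omega_{\alpha\beta}$ is a bounded pseudoconvex domain with smooth boundary. The Bergman projection of a domain $\Omega$ is the orthogonal projection from $L^2(\Omega)$ onto the closed subspace $A^2(\Omega)$ of square-integrable holomorphic functions on $\Omega$. *)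

theory Defs
  imports "HOL-Analysis.Analysis"
begin

(* C^n for n >= 3, with its points written (z_1, z', z_n), z' in C^(n-2); here n = CARD('m) + 2.
   The norm and the Lebesgue measure of this type are those of C^n = R^(2n). *)
type_synonym 'm cspace = "complex \<times> (complex ^ 'm) \<times> complex"

definition cscale :: "complex \<Rightarrow> 'm::finite cspace \<Rightarrow> 'm cspace" where
  "cscale c z = (case z of (z1, z', zn) \<Rightarrow> (c * z1, c *s z', c * zn))"

(* The intended sets are open: complex differentiability, i.e. a complex-linear Frechet
   derivative at every point. *)
definition holomorphic_fun_on :: "('m::finite cspace \<Rightarrow> complex) \<Rightarrow> 'm cspace set \<Rightarrow> bool" where
  "holomorphic_fun_on f S \<longleftrightarrow>
     (\<forall>z\<in>S. \<exists>D. (f has_derivative D) (at z) \<and> (\<forall>c v. D (cscale c v) = c * D v))"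


definition Lp :: "'m::finite cspace set \<Rightarrow> real \<Rightarrow> ('m cspace \<Rightarrow> complex) set" where
  "Lp \<Omega> p = {f. f \<in> borel_measurable (lebesgue_on \<Omega>) \<and>
                integrable (lebesgue_on \<Omega>) (\<lambda>z. norm (f z) powr p)}"

definition Lp_norm :: "'m::finite cspace set \<Rightarrow> real \<Rightarrow> ('m cspace \<Rightarrow> complex) \<Rightarrow> real" where
  "Lp_norm \<Omega> p f = (LINT z|lebesgue_on \<Omega>. norm (f z) powr p) powr (1 / p)"

definition bergman_space :: "'m::finite cspace set \<Rightarrow> ('m cspace \<Rightarrow> complex) set" where
  "bergman_space \<Omega> = {f \<in> Lp \<Omega> 2. holomorphic_fun_on f \<Omega>}"

(* Orthogonal projection of L^2 onto the Bergman space.  The value is a function on the whole type,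
   made unique by requiring it to vanish off the domain. Only meaningful for f in Lp \<Omega> 2. *)
definition bergman_projection ::
    "'m::finite cspace set \<Rightarrow> ('m cspace \<Rightarrow> complex) \<Rightarrow> 'm cspace \<Rightarrow> complex" where
  "bergman_projection \<Omega> f = (THE g. g \<in> bergman_space \<Omega> \<and> (\<forall>z. z \<notin> \<Omega> \<longrightarrow> g z = 0) \<and>
     (\<forall>h\<in>bergman_space \<Omega>. (LINT z|lebesgue_on \<Omega>. (f z - g z) * cnj (h z)) = 0))"

(* If L^p is not contained in L^2, "maps L^p to L^p" means an L^p bound on the intersection of L^p
   and L^2. There, membership in Lp is what makes the norm of the projection finite. *)
definition bergman_projection_maps_Lp :: "'m::finite cspace set \<Rightarrow> real \<Rightarrow> bool" where
  "bergman_projection_maps_Lp \<Omega> p \<longleftrightarrow>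
     (if Lp \<Omega> p \<subseteq> Lp \<Omega> 2
      then \<forall>f\<in>Lp \<Omega> p. bergman_projection \<Omega> f \<in> Lp \<Omega> p
      else \<exists>C. \<forall>f\<in>Lp \<Omega> p \<inter> Lp \<Omega> 2.
             bergman_projection \<Omega> f \<in> Lp \<Omega> p \<and>
             Lp_norm \<Omega> p (bergman_projection \<Omega> f) \<le> C * Lp_norm \<Omega> p f)"


(* For open S this is the usual notion of a C^k function on S: all directional derivatives of f
   are C^(k-1). *)
primrec Ck_on :: "nat \<Rightarrow> 'a::real_normed_vector set \<Rightarrow> ('a \<Rightarrow> real) \<Rightarrow> bool" where
  "Ck_on 0 S f \<longleftrightarrow> continuous_on S f"
| "Ck_on (Suc k) S f \<longleftrightarrow>
     (\<forall>x\<in>S. f differentiable (at x)) \<and> (\<forall>v. Ck_on k S (\<lambda>x. frechet_derivative f (at x) v))"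

(* Local C^infinity defining functions with nonvanishing gradient. *)
definition smooth_boundary :: "'a::real_normed_vector set \<Rightarrow> bool" where
  "smooth_boundary \<Omega> \<longleftrightarrow>
     (\<forall>x\<in>frontier \<Omega>. \<exists>U \<rho>. open U \<and> x \<in> U \<and> (\<forall>k. Ck_on k U \<rho>) \<and>
        (\<forall>y\<in>U. frechet_derivative \<rho> (at y) \<noteq> (\<lambda>v. 0)) \<and> \<Omega> \<inter> U = {y \<in> U. \<rho> y < 0})"

(* Continuous plurisubharmonic functions: sub-mean value property on every complex disc
   whose closure lies in S. *)
definition cont_psh_on :: "'m::finite cspace set \<Rightarrow> ('m cspace \<Rightarrow> real) \<Rightarrow> bool" where
  "cont_psh_on S u \<longleftrightarrow> continuous_on S u \<and>
     (\<forall>z w. (\<forall>c. norm c \<le> 1 \<longrightarrow> z + cscale c w \<in> S) \<longrightarrow>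
        u z \<le> (1 / (2 * pi)) * integral {0..2 * pi} (\<lambda>t. u (z + cscale (cis t) w)))"

(* Existence of a continuous plurisubharmonic exhaustion function. *)
definition pseudoconvex :: "'m::finite cspace set \<Rightarrow> bool" where
  "pseudoconvex \<Omega> \<longleftrightarrow> (\<exists>u. cont_psh_on \<Omega> u \<and> (\<forall>c. compact {z \<in> \<Omega>. u z \<le> c}))"


definition worm_sigma :: "real \<Rightarrow> real \<Rightarrow> real" where
  "worm_sigma M t = (if t > 0 then M * exp (- 1 / t) else 0)"

definition worm_r :: "real \<Rightarrow> real \<Rightarrow> real \<Rightarrow> 'm::finite cspace \<Rightarrow> real" where
  "worm_r \<alpha> \<beta> M z = (case z of (z1, z', zn) \<Rightarrow>
     (cmod (z1 - exp (2 * \<i> * of_real (\<alpha> * ln (cmod zn)))))\<^sup>2 + (norm z')\<^sup>2 - 1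
     + worm_sigma M ((cmod zn)\<^sup>2 - \<beta>\<^sup>2) + worm_sigma M (1 - (cmod zn)\<^sup>2))"

definition worm_domain :: "real \<Rightarrow> real \<Rightarrow> real \<Rightarrow> 'm::finite cspace set" where
  "worm_domain \<alpha> \<beta> M = {(z1, z', zn). zn \<noteq> 0 \<and> worm_r \<alpha> \<beta> M (z1, z', zn) < 0}"

end

theory Submission
  imports Defs "HOL-Complex_Analysis.Complex_Analysis"
begin

text \<open>
  Let n = CARD('m) + 2 and let s = \<pi> / (2 \<alpha> ln \<beta>), so that the exponents excluded are those with |1/p - 1/2| \<ge> s / n. Near z_1 = 0 the domain contains, for every z_n with
  1 < |z_n| < \<beta>, a region |z'|^2 < 2 |z_1| cos (arg z_1 - \<theta>) with \<theta> = 2 \<alpha> ln |z_n|, up to a smaller term. Its part |z_1| < \<rho> has mass of order \<rho>^n (worm_mass_bound), so the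
  power z_1^b belongs to L^q precisely when b q > - n. Powers of z_1 are defined by a global branch of log z_1 (worm_log).

  The source of irregularity is that, for the critical exponent b = - n/2 - s, the function h = z_1^b / z_n formally pairs to 0 with every holomorphic function. The total winding of \<theta>
  is \<pi> / s, one full period of exp (2 i s \<theta>), so that the primitive of this exponential vanishes at both ends |z_n| = 1 and |z_n| = \<beta>. Integrating by parts along a
  linear vector field that follows the winding therefore produces no boundary terms (worm_key_identity, pairing_bound).

  On the other hand h is, in the relevant sense, a limit of Bergman functions: if f minus its projection g pairs absolutely integrably with |z_1|^b, then f and g have the same pairing with
  h (worm_power_orthogonal). For b = - n/2 - s + \<eta> this applies to every bounded f, if P is bounded on L^p with p > 2 and 1/p \<le> 1/2 - s/n, because then h lies in the
  dual space L^q. Taking for f the phase of h on the ring \<epsilon>/2 < |z_1| < \<epsilon>, the pairing with f is of order \<epsilon>^(b+n), whereas the pairing with g is a small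
  multiple of the same quantity (projection_estimate): points with |z_1| much larger than \<epsilon> contribute little by the L^2 bound for g, and the others contribute \<eta> times
  the product of the norm of g in L^p and of h in L^q, which is of order \<eta>^(1/p). Letting \<eta> tend to 0 gives a contradiction (no_uniform_bound).

  The reduction of both ranges of exponents to a norm bound for p > 2 is functional analysis: P is self-adjoint, and invariance of L^p implies boundedness by a gliding hump argument
  (Lp_bound_of_maps). The existence of P rests on an interior estimate for holomorphic functions, itself obtained from the same integration by parts (interior_estimate).
\<close>

section \<open>Divergence theorem for locally Lipschitz functions and linear vector fields\<close>

text \<open>Local Lipschitz continuity is the regularity at which integration by parts is used: it survives the
  corners created by clamping the angular variable, which a differentiability assumption would not.\<close>

definition loc_lip :: "('a::metric_space \<Rightarrow> 'b::metric_space) \<Rightarrow> 'a \<Rightarrow> bool" where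
  "loc_lip f x \<longleftrightarrow> (\<exists>e>0. \<exists>C. C-lipschitz_on (ball x e) f)"

lemma loc_lipI: "e > 0 \<Longrightarrow> C-lipschitz_on (ball x e) f \<Longrightarrow> loc_lip f x"
  unfolding loc_lip_def by blast

lemma loc_lip_const: "loc_lip (\<lambda>_. c) x"
  by (rule loc_lipI[of 1 0]) (auto intro!: lipschitz_onI)

lemma loc_lip_cong_ev:
  assumes "loc_lip f x" "\<forall>\<^sub>F y in nhds x. g y = f y"
  shows "loc_lip g x"
proof -
  obtain e C where e: "e > 0" "C-lipschitz_on (ball x e) f" using assms(1) unfolding loc_lip_def by blast
  obtain d where d: "d > 0" "\<And>y. dist y x < d \<Longrightarrow> g y = f y"
    using assms(2) unfolding eventually_nhds_metric by blast
  show ?thesis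
    by (rule loc_lipI[of "min d e" C])
      (use e d in \<open>auto simp: lipschitz_on_def dist_commute\<close>)
qed

lemma loc_lip_isCont: "loc_lip f x \<Longrightarrow> isCont f x"
  unfolding loc_lip_def
  by (metis lipschitz_on_continuous_within centre_in_ball at_within_open open_ball)

lemma loc_lip_compose:
  assumes "loc_lip f x" "loc_lip g (f x)"
  shows "loc_lip (\<lambda>y. g (f y)) x"
proof -
  obtain e C where e: "e > 0" "C-lipschitz_on (ball x e) f" using assms(1) unfolding loc_lip_def by blast
  obtain d D where d: "d > 0" "D-lipschitz_on (ball (f x) d) g" using assms(2) unfolding loc_lip_def by blast
  obtain r where r: "r > 0" "\<And>y. dist y x < r \<Longrightarrow> dist (f y) (f x) < d"
    using loc_lip_isCont[OF assms(1)] d(1) unfolding continuous_at_eps_delta by metis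
  have "(D * C)-lipschitz_on (ball x (min e r)) (g \<circ> f)"
  proof (rule lipschitz_on_compose)
    show "C-lipschitz_on (ball x (min e r)) f"
      by (rule lipschitz_on_subset[OF e(2)]) auto
    show "D-lipschitz_on (f ` ball x (min e r)) g"
      by (rule lipschitz_on_subset[OF d(2)]) (use r in \<open>auto simp: dist_commute\<close>)
  qed
  then show ?thesis using e r by (intro loc_lipI[of "min e r" "D*C"]) (auto simp: o_def)
qed

lemma loc_lip_bounded_linear: "bounded_linear f \<Longrightarrow> loc_lip f x"
proof -
  assume "bounded_linear f"
  then interpret bounded_linear f .
  obtain K where K: "\<And>x. norm (f x) \<le> norm x * K" "K > 0" using pos_bounded by blast
  show ?thesis
    by (rule loc_lipI[of 1 K])
     (use K(1)[of "y - z" for y z] K(2) in \<open>auto intro!: lipschitz_onI simp: dist_norm diff[symmetric] mult.commute\<close>)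
qed

lemma loc_lip_Pair:
  assumes "loc_lip f x" "loc_lip g x" shows "loc_lip (\<lambda>y. (f y, g y)) x"
proof -
  obtain e C where e: "e > 0" "C-lipschitz_on (ball x e) f" using assms(1) unfolding loc_lip_def by blast
  obtain d D where d: "d > 0" "D-lipschitz_on (ball x d) g" using assms(2) unfolding loc_lip_def by blast
  have "(sqrt (C\<^sup>2 + D\<^sup>2))-lipschitz_on (ball x (min e d)) (\<lambda>y. (f y, g y))"
    by (rule lipschitz_on_Pair; rule lipschitz_on_subset[OF e(2)] lipschitz_on_subset[OF d(2)]) auto
  then show ?thesis using e d by (intro loc_lipI[of "min e d"]) auto
qed

lemma loc_lip_diff:
  fixes f g :: "'a::metric_space \<Rightarrow> 'b::real_normed_vector"
  assumes "loc_lip f x" "loc_lip g x" shows "loc_lip (\<lambda>y. f y - g y) x"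
  using loc_lip_compose[OF loc_lip_Pair[OF assms], of "\<lambda>p. fst p - snd p"]
  by (auto intro: loc_lip_bounded_linear bounded_linear_sub bounded_linear_fst bounded_linear_snd)

lemma loc_lip_mult:
  fixes f g :: "'a::metric_space \<Rightarrow> 'b::real_normed_algebra"
  assumes "loc_lip f x" "loc_lip g x" shows "loc_lip (\<lambda>y. f y * g y) x"
proof -
  obtain e C where e: "e > 0" "C-lipschitz_on (ball x e) f" using assms(1) unfolding loc_lip_def by blast
  obtain d D where d: "d > 0" "D-lipschitz_on (ball x d) g" using assms(2) unfolding loc_lip_def by blast
  define r where "r = min 1 (min e d)"
  have r: "r > 0" "r \<le> 1" "r \<le> e" "r \<le> d" using e d by (auto simp: r_def)
  have CD: "C \<ge> 0" "D \<ge> 0" using e d lipschitz_on_nonneg by blast+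
  have bf: "norm (f y) \<le> norm (f x) + C" if "y \<in> ball x r" for y
  proof -
    have "dist (f y) (f x) \<le> C * dist y x"
      using lipschitz_onD[OF e(2), of y x] that r by auto
    also have "\<dots> \<le> C * 1" using that r CD by (intro mult_left_mono) (auto simp: dist_commute)
    finally show ?thesis using norm_triangle_sub[of "f y" "f x"] by (simp add: dist_norm)
  qed
  have bg: "norm (g y) \<le> norm (g x) + D" if "y \<in> ball x r" for y
  proof -
    have "dist (g y) (g x) \<le> D * dist y x"
      using lipschitz_onD[OF d(2), of y x] that r by auto
    also have "\<dots> \<le> D * 1" using that r CD by (intro mult_left_mono) (auto simp: dist_commute)
    finally show ?thesis using norm_triangle_sub[of "g y" "g x"] by (simp add: dist_norm)
  qed
  define L where "L = (norm (f x) + C) * D + C * (norm (g x) + D)"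
  have "L-lipschitz_on (ball x r) (\<lambda>y. f y * g y)"
  proof (rule lipschitz_onI)
    show "0 \<le> L" using CD by (simp add: L_def)
    fix y z assume y: "y \<in> ball x r" and z: "z \<in> ball x r"
    have "f y * g y - f z * g z = f y * (g y - g z) + (f y - f z) * g z"
      by (simp add: algebra_simps)
    then have "norm (f y * g y - f z * g z) \<le> norm (f y) * norm (g y - g z) + norm (f y - f z) * norm (g z)"
      by (smt (verit) norm_triangle_ineq norm_mult_ineq)
    also have "\<dots> \<le> (norm (f x) + C) * (D * dist y z) + (C * dist y z) * (norm (g x) + D)"
      using bf[OF y] bg[OF z] lipschitz_onD[OF e(2), of y z] lipschitz_onD[OF d(2), of y z] y z r CD
      by (intro add_mono mult_mono) (auto simp: dist_norm)
    finally show "dist (f y * g y) (f z * g z) \<le> L * dist y z"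
      by (simp add: dist_norm L_def algebra_simps)
  qed
  then show ?thesis using r loc_lipI by blast
qed

lemma loc_lip_bounded_derivative:
  fixes f :: "'a::real_normed_vector \<Rightarrow> 'b::real_normed_vector"
  assumes "e > 0" "\<And>y. y \<in> ball x e \<Longrightarrow> (f has_derivative f' y) (at y)"
    "\<And>y v. y \<in> ball x e \<Longrightarrow> norm (f' y v) \<le> B * norm v"
  shows "loc_lip f x"
proof (rule loc_lipI[OF assms(1)])
  show "\<bar>B\<bar>-lipschitz_on (ball x e) f"
  proof (rule lipschitz_onI)
    fix y z assume yz: "y \<in> ball x e" "z \<in> ball x e"
    have "norm (f y - f z) \<le> \<bar>B\<bar> * norm (y - z)"
    proof (rule differentiable_bound[OF convex_ball _ _ yz(1,2)])
      fix w assume w: "w \<in> ball x e"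
      show "(f has_derivative f' w) (at w within ball x e)"
        using assms(2)[OF w] by (rule has_derivative_at_withinI)
      show "onorm (f' w) \<le> \<bar>B\<bar>"
      proof (rule onorm_bound)
        show "0 \<le> \<bar>B\<bar>" by simp
        fix v show "norm (f' w v) \<le> \<bar>B\<bar> * norm v" 
          using assms(3)[OF w, of v] mult_right_mono[of B "\<bar>B\<bar>" "norm v"] by force
      qed
    qed
    then show "dist (f y) (f z) \<le> \<bar>B\<bar> * dist y z" by (simp add: dist_norm)
  qed auto
qed

lemma loc_lip_real_C1:
  fixes f :: "real \<Rightarrow> 'b::real_normed_vector"
  assumes "open S" "x \<in> S" "\<And>y. y \<in> S \<Longrightarrow> (f has_vector_derivative f' y) (at y)" "continuous_on S f'"
  shows "loc_lip f x"
proof -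
  obtain e where e: "e > 0" "cball x e \<subseteq> S" using assms(1,2) open_contains_cball by blast
  have "compact (f' ` cball x e)"
    by (rule compact_continuous_image) (use assms(4) e(2) continuous_on_subset in auto)
  then obtain B where B: "\<And>y. y \<in> cball x e \<Longrightarrow> norm (f' y) \<le> B"
    by (meson bounded_iff compact_imp_bounded image_eqI)
  show ?thesis
  proof (rule loc_lip_bounded_derivative[OF e(1)])
    fix y assume y: "y \<in> ball x e"
    show "(f has_derivative (\<lambda>h. h *\<^sub>R f' y)) (at y)"
      using assms(3)[of y] y e(2) unfolding has_vector_derivative_def by force
    fix v show "norm (v *\<^sub>R f' y) \<le> B * norm v"
      using mult_left_mono[OF B[of y], of "\<bar>v\<bar>"] y by (simp add: mult.commute)
  qed
qed

lemma loc_lip_norm: "loc_lip (norm :: 'a::real_normed_vector \<Rightarrow> real) x"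
  by (rule loc_lipI[of 1 1]) (auto intro!: lipschitz_onI simp: dist_norm norm_triangle_ineq3)

text \<open>Compactness of the support turns the local constants into one constant valid for all small
  translations; this supplies the dominating function for difference quotients.\<close>

lemma loc_lip_uniform:
  fixes F :: "'a::euclidean_space \<Rightarrow> 'b::real_normed_vector"
  assumes lip: "\<And>x. loc_lip F x" and K: "compact K" and off: "\<And>x. x \<notin> K \<Longrightarrow> F x = 0"
  obtains \<epsilon> C where "\<epsilon> > 0" "C \<ge> 0" "\<And>x v. norm v < \<epsilon> \<Longrightarrow> norm (F (x + v) - F x) \<le> C * norm v"
proof -
  obtain e c where ec: "\<And>x. e x > 0" "\<And>x. (c x)-lipschitz_on (ball x (e x)) F"
    using lip unfolding loc_lip_def by metis
  obtain D where D: "D \<subseteq> K" "finite D" "K \<subseteq> (\<Union>x\<in>D. ball x (e x))"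
    using compactE_image[OF K, of K "\<lambda>x. ball x (e x)"] ec(1) by force
  obtain \<epsilon> where eps: "\<epsilon> > 0" "\<And>x. x \<in> K \<Longrightarrow> \<exists>G\<in>(\<lambda>x. ball x (e x)) ` D. ball x \<epsilon> \<subseteq> G"
    using Heine_Borel_lemma[OF K, of "(\<lambda>x. ball x (e x)) ` D"] D(3) by auto
  define C where "C = (\<Sum>x\<in>D. c x)"
  have cn: "c x \<ge> 0" for x using ec(2) lipschitz_on_nonneg by blast
  have Ck: "norm (F y - F z) \<le> C * norm (y - z)" if "x \<in> K" "y \<in> ball x \<epsilon>" "z \<in> ball x \<epsilon>" for x y z
  proof -
    obtain G where G: "G \<in> (\<lambda>x. ball x (e x)) ` D" "ball x \<epsilon> \<subseteq> G" using eps(2)[of x] \<open>x \<in> K\<close> by auto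
    then obtain w where w: "w \<in> D" "ball x \<epsilon> \<subseteq> ball w (e w)" by auto
    have "norm (F y - F z) \<le> c w * norm (y - z)"
      using lipschitz_onD[OF ec(2)[of w], of y z] subsetD[OF w(2) that(2)] subsetD[OF w(2) that(3)]
      by (simp add: dist_norm)
    also have "c w \<le> C" unfolding C_def using w(1) D(2) cn by (intro member_le_sum) auto
    finally show ?thesis by (simp add: mult_right_mono)
  qed
  have "norm (F (x + v) - F x) \<le> C * norm v" if "norm v < \<epsilon>" for x v
  proof -
    consider "x \<in> K" | "x + v \<in> K" | "x \<notin> K" "x + v \<notin> K" by blast
    then show ?thesis
    proof cases
      case 1 then show ?thesis using Ck[of x "x+v" x] that eps(1) by (simp add: dist_norm)
    next
      case 2 then show ?thesis using Ck[of "x+v" "x+v" x] that eps(1) by (simp add: dist_norm)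
    next
      case 3 then show ?thesis using off cn by (simp add: C_def sum_nonneg)
    qed
  qed
  then show thesis using that[of \<epsilon> C] eps(1) cn by (simp add: C_def sum_nonneg)
qed

lemma directional_quotient_tendsto:
  fixes F :: "'a::real_normed_vector \<Rightarrow> 'b::real_normed_vector"
  assumes "(F has_derivative D) (at x)" "h \<longlonglongrightarrow> (0::real)" "\<And>k. h k \<noteq> 0"
  shows "(\<lambda>k. (1 / h k) *\<^sub>R (F (x + h k *\<^sub>R v) - F x)) \<longlonglongrightarrow> D v"
proof -
  have "((\<lambda>t. x + t *\<^sub>R v) has_derivative (\<lambda>t. t *\<^sub>R v)) (at 0)"
    by (auto intro!: derivative_eq_intros)
  then have "((\<lambda>t::real. F (x + t *\<^sub>R v)) has_derivative (\<lambda>t. D (t *\<^sub>R v))) (at 0)"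
    using has_derivative_compose[of "\<lambda>t. x + t *\<^sub>R v" "\<lambda>t. t *\<^sub>R v" 0 UNIV F D] assms(1) by simp
  then have "((\<lambda>t. norm (F (x + t *\<^sub>R v) - F x - D (t *\<^sub>R v)) / norm t) \<longlongrightarrow> 0) (at 0)"
    by (simp add: has_derivative_at)
  moreover have "filterlim h (at 0) sequentially"
    using assms(2,3) by (auto simp: filterlim_at)
  ultimately have "(\<lambda>k. norm (F (x + h k *\<^sub>R v) - F x - D (h k *\<^sub>R v)) / norm (h k)) \<longlonglongrightarrow> 0"
    by (rule filterlim_compose[where g="\<lambda>t. norm (F (x + t *\<^sub>R v) - F x - D (t *\<^sub>R v)) / norm t"])
  moreover have "norm (F (x + h k *\<^sub>R v) - F x - D (h k *\<^sub>R v)) / norm (h k) =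
      norm ((1 / h k) *\<^sub>R (F (x + h k *\<^sub>R v) - F x) - D v)" for k
  proof -
    have "D (h k *\<^sub>R v) = h k *\<^sub>R D v"
      using assms(1) by (simp add: has_derivative_linear linear_cmul)
    then have "(1 / h k) *\<^sub>R (F (x + h k *\<^sub>R v) - F x) - D v =
        (1 / h k) *\<^sub>R (F (x + h k *\<^sub>R v) - F x - D (h k *\<^sub>R v))"
      using assms(3)[of k] by (simp add: scaleR_right_diff_distrib)
    then show ?thesis by simp
  qed
  ultimately show ?thesis
    using Lim_null tendsto_norm_zero_cancel by fastforce
qed

text \<open>Lebesgue measure is translation invariant, so every difference quotient of F has integral 0. The
  quotients are bounded by the Lipschitz constant and converge off the null set N to the derivative,
  so dominated convergence gives the claim.\<close>

lemma directional_derivative_integral_zero: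
  fixes F :: "'a::euclidean_space \<Rightarrow> complex"
  assumes lip: "\<And>x. loc_lip F x" and K: "compact K" and off: "\<And>x. x \<notin> K \<Longrightarrow> F x = 0"
    and N: "N \<in> null_sets lborel" and der: "\<And>x. x \<notin> N \<Longrightarrow> (F has_derivative F' x) (at x)"
  shows "has_bochner_integral lborel (\<lambda>x. indicator (- N) x *\<^sub>R F' x v) 0"
proof -
  obtain \<epsilon> C where eps: "\<epsilon> > 0" "C \<ge> 0" "\<And>x v. norm v < \<epsilon> \<Longrightarrow> norm (F (x + v) - F x) \<le> C * norm v"
    using loc_lip_uniform[OF lip K off] by blast
  have cont: "continuous_on UNIV F"
    using lip loc_lip_isCont continuous_at_imp_continuous_on by blast
  have Fm[measurable]: "F \<in> borel_measurable borel"
    using cont by (rule borel_measurable_continuous_onI)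
  obtain R where R: "K \<subseteq> cball 0 R" 
    using compact_imp_bounded[OF K] unfolding bounded_pos by (metis mem_cball_0 subsetI)
  have "bounded (F ` K)"
    using compact_continuous_image[OF continuous_on_subset[OF cont] K] compact_imp_bounded by blast
  then obtain B where B: "\<And>x. x \<in> K \<Longrightarrow> norm (F x) \<le> B" "B > 0"
    by (meson bounded_pos image_eqI)
  have Fi: "integrable lborel F"
  proof (rule Bochner_Integration.integrable_bound[of _ "\<lambda>x. B * indicator (cball 0 R) x"])
    show "integrable lborel (\<lambda>x::'a. B * indicator (cball 0 R) x)"
      by (intro integrable_mult_right integrable_real_indicator)
        (use emeasure_lborel_cball_finite[of "0::'a" R] in auto)
    show "AE x in lborel. norm (F x) \<le> norm (B * indicator (cball 0 R) x :: real)"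
    proof (intro AE_I2)
      fix x show "norm (F x) \<le> norm (B * indicator (cball 0 R) x :: real)"
        using B(1)[of x] B(2) subsetD[OF R, of x] off[of x] by (cases "x \<in> K") (auto simp: indicator_def)
    qed
  qed simp
  define h where "h k = \<epsilon> / ((norm v + 1) * (real k + 1))" for k
  have hpos: "h k > 0" for k using eps(1) by (simp add: h_def add_nonneg_pos)
  have h0: "h \<longlonglongrightarrow> 0"
  proof -
    have "(\<lambda>k. (\<epsilon> / (norm v + 1)) * (1 / (real (Suc k)))) \<longlonglongrightarrow> (\<epsilon> / (norm v + 1)) * 0"
      by (intro tendsto_intros LIMSEQ_Suc[OF lim_1_over_n])
    then show ?thesis unfolding h_def by (simp add: algebra_simps)
  qed
  have hv: "norm (h k *\<^sub>R v) < \<epsilon>" for k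
  proof -
    have "norm v < (norm v + 1) * (real k + 1)"
      by (smt (verit, best) mult_cancel_left1 mult_left_mono norm_ge_zero of_nat_0_le_iff)
    then have "\<epsilon> * (norm v / ((norm v + 1) * (real k + 1))) < \<epsilon> * 1"
      using eps(1) by (intro mult_strict_left_mono) (auto simp: divide_less_eq add_nonneg_pos)
    then show ?thesis using hpos[of k] eps(1) by (simp add: h_def)
  qed
  define q where "q k x = (1 / h k) *\<^sub>R (F (x + h k *\<^sub>R v) - F x)" for k x
  have qm[measurable]: "q k \<in> borel_measurable borel" for k
    unfolding q_def by measurable
  have tr: "has_bochner_integral lborel (\<lambda>x. F (x + c)) (integral\<^sup>L lborel F)" for c
  proof -
    have "integrable (distr lborel borel ((+) c)) F" "integral\<^sup>L (distr lborel borel ((+) c)) F = integral\<^sup>L lborel F"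
      using Fi by (simp_all add: lborel_distr_plus)
    then show ?thesis
      by (simp add: integrable_distr_eq integral_distr has_bochner_integral_iff add.commute)
  qed
  have qi: "has_bochner_integral lborel (q k) 0" for k
    unfolding q_def 
    using has_bochner_integral_scaleR_right[OF has_bochner_integral_diff[OF tr[of "h k *\<^sub>R v"] tr[of 0]], of "1 / h k"]
    by simp
  define w where "w x = C * norm v * indicator (cball 0 (R + \<epsilon>)) x" for x :: 'a
  have wi: "integrable lborel w" unfolding w_def
    by (intro integrable_mult_right integrable_real_indicator)
      (use emeasure_lborel_cball_finite[of "0::'a" "R + \<epsilon>"] in auto)
  have qb: "norm (q k x) \<le> w x" for k x
  proof (cases "x \<in> cball 0 (R + \<epsilon>)")
    case True
    have "norm (q k x) \<le> (1 / h k) * (C * norm (h k *\<^sub>R v))"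
      unfolding q_def using mult_left_mono[OF eps(3)[OF hv[of k], of x], of "1 / h k"] hpos[of k] by simp
    also have "\<dots> = C * norm v" using hpos[of k] by simp
    finally show ?thesis using True by (simp add: w_def)
  next
    case False
    then have "x \<notin> K" "x + h k *\<^sub>R v \<notin> K"
      using R hv[of k] eps(1) norm_triangle_ineq4[of "x + h k *\<^sub>R v" "h k *\<^sub>R v"] by auto
    then show ?thesis using off False by (simp add: w_def q_def)
  qed
  have lim: "(\<lambda>k. q k x) \<longlonglongrightarrow> F' x v" if "x \<notin> N" for x
    unfolding q_def using directional_quotient_tendsto[OF der[OF that] h0] hpos by (metis less_irrefl)
  have Nm[measurable]: "N \<in> sets borel" using N by auto
  have gm: "(\<lambda>x. indicator (- N) x *\<^sub>R F' x v) \<in> borel_measurable borel"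
  proof (rule borel_measurable_LIMSEQ_metric)
    show "(\<lambda>x. indicator (- N) x *\<^sub>R q k x) \<in> borel_measurable borel" for k by measurable
    show "(\<lambda>k. indicator (- N) x *\<^sub>R q k x) \<longlonglongrightarrow> indicator (- N) x *\<^sub>R F' x v" for x
      by (cases "x \<in> N") (auto simp: lim)
  qed
  have AEl: "AE x in lborel. (\<lambda>k. q k x) \<longlonglongrightarrow> indicator (- N) x *\<^sub>R F' x v"
    using AE_not_in[OF N] by eventually_elim (auto simp: lim)
  have "integrable lborel (\<lambda>x. indicator (- N) x *\<^sub>R F' x v)"
    by (rule integrable_dominated_convergence[OF _ _ wi AEl]) (use gm qb in auto)
  moreover have "(\<lambda>k. integral\<^sup>L lborel (q k)) \<longlonglongrightarrow> integral\<^sup>L lborel (\<lambda>x. indicator (- N) x *\<^sub>R F' x v)"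
    by (rule integral_dominated_convergence[OF _ _ wi AEl]) (use gm qb in auto)
  then have "integral\<^sup>L lborel (\<lambda>x. indicator (- N) x *\<^sub>R F' x v) = 0"
    using qi by (simp add: has_bochner_integral_iff LIMSEQ_const_iff)
  ultimately show ?thesis by (simp add: has_bochner_integral_iff)
qed

text \<open>The divergence of F A, for a linear field A, is the derivative of F along A plus the trace of A times F.
  It suffices to apply the previous lemma to each coordinate (A x \<bullet> e) F.\<close>

lemma linear_field_divergence:
  fixes F :: "'a::euclidean_space \<Rightarrow> complex"
  assumes lip: "\<And>x. loc_lip F x" and K: "compact K" and off: "\<And>x. x \<notin> K \<Longrightarrow> F x = 0"
    and N: "N \<in> null_sets lborel" and der: "\<And>x. x \<notin> N \<Longrightarrow> (F has_derivative F' x) (at x)"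
    and A: "linear A" and tr: "tr = (\<Sum>e\<in>Basis. A e \<bullet> e)"
  shows "has_bochner_integral lborel (\<lambda>x. indicator (- N) x *\<^sub>R (F' x (A x) + of_real tr * F x)) 0"
proof -
  have bA: "bounded_linear A" using A linear_conv_bounded_linear by blast
  have bAe: "bounded_linear (\<lambda>x. complex_of_real (A x \<bullet> e))" for e
    by (intro bounded_linear_compose[OF bounded_linear_of_real] 
        bounded_linear_compose[OF bounded_linear_inner_left] bA)
  have 1: "has_bochner_integral lborel
     (\<lambda>x. indicator (- N) x *\<^sub>R (of_real (A x \<bullet> e) * F' x e + of_real (A e \<bullet> e) * F x)) 0" for e
  proof (rule directional_derivative_integral_zero[of "\<lambda>x. of_real (A x \<bullet> e) * F x" K N 
         "\<lambda>x v. of_real (A x \<bullet> e) * F' x v + of_real (A v \<bullet> e) * F x" e])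
    show "loc_lip (\<lambda>x. complex_of_real (A x \<bullet> e) * F x) x" for x
      by (intro loc_lip_mult loc_lip_bounded_linear bAe lip)
    show "((\<lambda>x. of_real (A x \<bullet> e) * F x) has_derivative
            (\<lambda>v. of_real (A x \<bullet> e) * F' x v + of_real (A v \<bullet> e) * F x)) (at x)" if "x \<notin> N" for x
      by (rule has_derivative_mult[OF bounded_linear_imp_has_derivative[OF bAe] der[OF that]])
  qed (use K off N in auto)
  have "has_bochner_integral lborel (\<lambda>x. \<Sum>e\<in>Basis.
     indicator (- N) x *\<^sub>R (of_real (A x \<bullet> e) * F' x e + of_real (A e \<bullet> e) * F x)) (\<Sum>e\<in>(Basis::'a set). 0)"
    by (intro has_bochner_integral_sum 1)
  moreover have "(\<Sum>e\<in>Basis. indicator (- N) x *\<^sub>R (of_real (A x \<bullet> e) * F' x e + of_real (A e \<bullet> e) * F x))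
    = indicator (- N) x *\<^sub>R (F' x (A x) + of_real tr * F x)" for x
  proof (cases "x \<in> N")
    case False
    have "F' x (A x) = F' x (\<Sum>e\<in>Basis. (A x \<bullet> e) *\<^sub>R e)" by (simp add: euclidean_representation)
    also have "\<dots> = (\<Sum>e\<in>Basis. (A x \<bullet> e) *\<^sub>R F' x e)"
      using has_derivative_linear[OF der[OF False]] by (simp add: linear_sum linear_cmul)
    finally show ?thesis using False
      by (simp add: tr sum.distrib sum_distrib_right scaleR_conv_of_real)
  qed auto
  ultimately show ?thesis by simp
qed

section \<open>Integration by parts against holomorphic functions\<close>

lemma cscale_simps [simp]:
  "fst (cscale c z) = c * fst z" "fst (snd (cscale c z)) = c *s fst (snd z)" 
  "snd (snd (cscale c z)) = c * snd (snd z)"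
  by (auto simp: cscale_def case_prod_beta)

lemma cscale_eq: "cscale c z = (c * fst z, c *s fst (snd z), c * snd (snd z))"
  by (simp add: cscale_def case_prod_beta)

lemma inner_i_vector: "(\<i> *s v) \<bullet> (v :: complex ^ 'm::finite) = 0"
  by (simp add: inner_vec_def inner_complex_def algebra_simps)

lemma inner_i_cscale: "cscale \<i> z \<bullet> z = 0"
  by (simp add: inner_prod_def inner_i_vector inner_complex_def cscale_eq)

lemma norm_vector_smult: "norm (c *s (v :: complex ^ 'm::finite)) = norm c * norm v"
  by (simp add: norm_vec_def L2_set_def norm_mult power_mult_distrib sum_distrib_left[symmetric] real_sqrt_mult)

lemma norm_cscale: "norm (cscale c z) = norm c * norm z"
  by (cases z) (auto simp: cscale_def norm_Pair norm_mult norm_vector_smult power_mult_distrib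
      distrib_left[symmetric] real_sqrt_mult)

lemma cscale_add_left: "cscale (a + b) z = cscale a z + cscale b z"
  by (cases z) (auto simp: cscale_def vector_sadd_rdistrib algebra_simps)

lemma cscale_add_right: "cscale a (z + w) = cscale a z + cscale a w"
  by (cases z; cases w) (auto simp: cscale_def vector_add_ldistrib algebra_simps)

lemma cscale_of_real: "cscale (of_real r) z = r *\<^sub>R z"
  by (cases z) (auto simp: cscale_def vec_eq_iff scaleR_conv_of_real[where 'a=complex])

lemma cscale_assoc: "cscale a (cscale b z) = cscale (a * b) z"
  by (cases z) (auto simp: cscale_def vector_smult_assoc)

lemma cscale_1 [simp]: "cscale 1 z = z"
  by (cases z) (auto simp: cscale_def)

lemma cscale_0 [simp]: "cscale 0 z = 0"
  by (cases z) (auto simp: cscale_def zero_prod_def)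

lemma cscale_scaleR: "cscale (r *\<^sub>R a) z = r *\<^sub>R cscale a z"
  by (metis cscale_assoc cscale_of_real scaleR_conv_of_real)

lemma linear_cscale_right: "linear (cscale c)"
proof (rule linearI)
  show "cscale c (r *\<^sub>R z) = r *\<^sub>R cscale c z" for r z
    by (metis cscale_assoc cscale_of_real mult.commute)
qed (rule cscale_add_right)

lemma bounded_linear_cscale_left: "bounded_linear (\<lambda>c. cscale c z)"
  by (rule bounded_linear_intro[of _ "norm z"]) (auto simp: cscale_add_left cscale_scaleR norm_cscale)

lemma holomorphic_fun_onE:
  assumes "holomorphic_fun_on f S" "z \<in> S"
  obtains D where "(f has_derivative D) (at z)" "\<And>c v. D (cscale c v) = c * D v"
  using assms unfolding holomorphic_fun_on_def by blast

lemma holomorphic_fun_on_continuous: "holomorphic_fun_on f S \<Longrightarrow> continuous_on S f"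
  unfolding holomorphic_fun_on_def
  by (intro continuous_at_imp_continuous_on ballI) (blast intro: has_derivative_continuous)

lemma holomorphic_fun_on_subset: "holomorphic_fun_on f S \<Longrightarrow> T \<subseteq> S \<Longrightarrow> holomorphic_fun_on f T"
  unfolding holomorphic_fun_on_def by blast

lemma holomorphic_fun_on_cong:
  assumes "open S" "\<And>z. z \<in> S \<Longrightarrow> f z = g z" "holomorphic_fun_on f S"
  shows "holomorphic_fun_on g S"
  unfolding holomorphic_fun_on_def
proof
  fix z assume z: "z \<in> S"
  from holomorphic_fun_onE[OF assms(3) z] obtain D where
    "(f has_derivative D) (at z)" "\<And>c v. D (cscale c v) = c * D v" by metis
  then show "\<exists>D. (g has_derivative D) (at z) \<and> (\<forall>c v. D (cscale c v) = c * D v)"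
    using has_derivative_transform_within_open[OF _ assms(1) z, of f D UNIV g] assms(2) by blast
qed

lemma holomorphic_fun_on_const: "holomorphic_fun_on (\<lambda>z. c) S"
  unfolding holomorphic_fun_on_def by (intro ballI exI[of _ "\<lambda>v. 0"]) auto

lemma holomorphic_fun_on_add:
  assumes "holomorphic_fun_on f S" "holomorphic_fun_on g S"
  shows "holomorphic_fun_on (\<lambda>z. f z + g z) S"
  unfolding holomorphic_fun_on_def
proof
  fix z assume z: "z \<in> S"
  obtain D where D: "(f has_derivative D) (at z)" "\<And>c v. D (cscale c v) = c * D v"
    using holomorphic_fun_onE[OF assms(1) z] by metis
  obtain E where E: "(g has_derivative E) (at z)" "\<And>c v. E (cscale c v) = c * E v"
    using holomorphic_fun_onE[OF assms(2) z] by metis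
  show "\<exists>D. ((\<lambda>z. f z + g z) has_derivative D) (at z) \<and> (\<forall>c v. D (cscale c v) = c * D v)"
    by (rule exI[of _ "\<lambda>v. D v + E v"]) (auto intro!: derivative_intros D(1) E(1) simp: D(2) E(2) algebra_simps)
qed

lemma holomorphic_fun_on_mult:
  assumes "holomorphic_fun_on f S" "holomorphic_fun_on g S"
  shows "holomorphic_fun_on (\<lambda>z. f z * g z) S"
  unfolding holomorphic_fun_on_def
proof
  fix z assume z: "z \<in> S"
  obtain D where D: "(f has_derivative D) (at z)" "\<And>c v. D (cscale c v) = c * D v"
    using holomorphic_fun_onE[OF assms(1) z] by metis
  obtain E where E: "(g has_derivative E) (at z)" "\<And>c v. E (cscale c v) = c * E v"
    using holomorphic_fun_onE[OF assms(2) z] by metis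
  show "\<exists>D. ((\<lambda>z. f z * g z) has_derivative D) (at z) \<and> (\<forall>c v. D (cscale c v) = c * D v)"
    using has_derivative_mult[OF D(1) E(1)]
    by (intro exI[of _ "\<lambda>v. f z * E v + D v * g z"]) (auto simp: D(2) E(2) algebra_simps)
qed

lemma holomorphic_fun_on_compose:
  assumes "holomorphic_fun_on f S" "\<And>z. z \<in> S \<Longrightarrow> (h has_field_derivative h' z) (at (f z))"
  shows "holomorphic_fun_on (\<lambda>z. h (f z)) S"
  unfolding holomorphic_fun_on_def
proof
  fix z assume z: "z \<in> S"
  obtain D where D: "(f has_derivative D) (at z)" "\<And>c v. D (cscale c v) = c * D v"
    using holomorphic_fun_onE[OF assms(1) z] by metis
  show "\<exists>D. ((\<lambda>z. h (f z)) has_derivative D) (at z) \<and> (\<forall>c v. D (cscale c v) = c * D v)"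
    by (rule exI[of _ "\<lambda>v. h' z * D v"]) 
      (use has_derivative_compose[OF D(1)] assms(2)[OF z] in \<open>auto simp: has_field_derivative_def D(2)\<close>)
qed

lemma holomorphic_fun_slice:
  assumes f: "holomorphic_fun_on f S" and T: "\<And>c. c \<in> T \<Longrightarrow> z + cscale c w \<in> S"
  shows "(\<lambda>c. f (z + cscale c w)) holomorphic_on T"
proof (rule holomorphic_onI)
  fix c assume c: "c \<in> T"
  obtain D where D: "(f has_derivative D) (at (z + cscale c w))" "\<And>c v. D (cscale c v) = c * D v"
    using holomorphic_fun_onE[OF f T[OF c]] by metis
  have "((\<lambda>c. z + cscale c w) has_derivative (\<lambda>c. cscale c w)) (at c within T)"
    using has_derivative_add[OF has_derivative_const bounded_linear_imp_has_derivative[OF bounded_linear_cscale_left]]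
    by fastforce
  from has_derivative_compose[OF this D(1)]
  show "(\<lambda>c. f (z + cscale c w)) field_differentiable at c within T"
    unfolding field_differentiable_def has_field_derivative_def by (intro exI[of _ "D w"]) (simp add: D(2) mult_commute_abs)
qed

text \<open>Cauchy estimate, obtained on the complex line through z in the direction v.\<close>

lemma holomorphic_fun_derivative_bound:
  assumes f: "holomorphic_fun_on f S" and S: "open S" and e: "e > 0" "cball z e \<subseteq> S"
    and B: "\<And>y. y \<in> cball z e \<Longrightarrow> norm (f y) \<le> B" and D: "(f has_derivative D) (at z)"
  shows "norm (D v) \<le> B / e * norm v"
proof (cases "v = 0")
  case True then show ?thesis using has_derivative_linear[OF D] by (simp add: linear_0)
next
  case False
  define w where "w = (1 / norm v) *\<^sub>R v"
  have nw: "norm w = 1" using False by (simp add: w_def)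
  define T where "T = (\<lambda>c. z + cscale c w) -` S"
  have oT: "open T" unfolding T_def
    by (intro open_vimage S continuous_intros linear_continuous_on bounded_linear_cscale_left)
  have sub: "cball 0 e \<subseteq> T"
  proof
    fix c assume "c \<in> cball (0::complex) e"
    then have "z + cscale c w \<in> cball z e" by (simp add: norm_cscale nw dist_norm)
    then have "z + cscale c w \<in> S" using e(2) by blast
    then show "c \<in> T" by (simp add: T_def)
  qed
  have hol: "(\<lambda>c. f (z + cscale c w)) holomorphic_on T"
    by (rule holomorphic_fun_slice[OF f]) (auto simp: T_def)
  have "norm ((deriv ^^ 1) (\<lambda>c. f (z + cscale c w)) 0) \<le> fact 1 * B / e ^ 1"
  proof (rule Cauchy_inequality)
    show "(\<lambda>c. f (z + cscale c w)) holomorphic_on ball 0 e"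
      by (rule holomorphic_on_subset[OF hol]) (use sub in auto)
    show "continuous_on (cball 0 e) (\<lambda>c. f (z + cscale c w))"
      using continuous_on_subset[OF holomorphic_on_imp_continuous_on[OF hol] sub] .
    show "norm (f (z + cscale c w)) \<le> B" if "norm (0 - c) = e" for c
      using that by (intro B) (auto simp: norm_cscale nw dist_norm)
  qed (rule e)
  moreover have "deriv (\<lambda>c. f (z + cscale c w)) 0 = D w"
  proof (rule DERIV_imp_deriv)
    have "((\<lambda>c. z + cscale c w) has_derivative (\<lambda>c. cscale c w)) (at 0)"
      using has_derivative_add[OF has_derivative_const bounded_linear_imp_has_derivative[OF bounded_linear_cscale_left]]
      by fastforce
    then have "((\<lambda>c. f (z + cscale c w)) has_derivative (\<lambda>c. D (cscale c w))) (at 0)"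
      using has_derivative_compose[of "\<lambda>c. z + cscale c w" "\<lambda>c. cscale c w" 0 UNIV f D] D by simp
    moreover obtain D' where D': "(f has_derivative D') (at z)" "\<And>c v. D' (cscale c v) = c * D' v"
      using f e unfolding holomorphic_fun_on_def by (metis centre_in_cball less_imp_le subsetD)
    moreover have "D' = D" using has_derivative_unique[OF D'(1) D] .
    ultimately show "((\<lambda>c. f (z + cscale c w)) has_field_derivative D w) (at 0)"
      unfolding has_field_derivative_def by (simp add: mult_commute_abs)
  qed
  ultimately have 1: "norm (D w) \<le> B / e" by simp
  have "v = norm v *\<^sub>R w" using False by (simp add: w_def)
  then have "D v = norm v *\<^sub>R D w" using has_derivative_linear[OF D] by (metis linear_cmul)
  then show ?thesis using mult_left_mono[OF 1, of "norm v"] by (simp add: mult.commute)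
qed

lemma holomorphic_fun_loc_lip:
  assumes f: "holomorphic_fun_on f S" and S: "open S" "z \<in> S"
  shows "loc_lip f z"
proof -
  obtain e where e: "e > 0" "cball z e \<subseteq> S" using S open_contains_cball by blast
  have "compact (f ` cball z e)"
    by (rule compact_continuous_image[OF continuous_on_subset[OF holomorphic_fun_on_continuous[OF f] e(2)]]) auto
  then obtain B where B: "\<And>y. y \<in> cball z e \<Longrightarrow> norm (f y) \<le> B"
    by (meson bounded_iff compact_imp_bounded image_eqI)
  obtain D where D: "\<And>y. y \<in> S \<Longrightarrow> (f has_derivative D y) (at y)"
    using f unfolding holomorphic_fun_on_def by metis
  show ?thesis
  proof (rule loc_lip_bounded_derivative[where e="e/2" and f'=D and B="B / (e/2)"])
    fix y assume y: "y \<in> ball z (e/2)"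
    have sub: "cball y (e/2) \<subseteq> cball z e"
      using y e(1) by (intro subsetI) (smt (verit) dist_triangle field_sum_of_halves mem_ball mem_cball)
    have yS: "y \<in> S" using sub e by force
    show "(f has_derivative D y) (at y)" by (rule D[OF yS])
    show "norm (D y v) \<le> B / (e/2) * norm v" for v
      by (rule holomorphic_fun_derivative_bound[OF f S(1) _ _ _ D[OF yS]]) (use sub e B in auto)
  qed (use e in auto)
qed

text \<open>The operator v \<mapsto> D v + i D (i v) annihilates holomorphic g, so in the divergence formula for g H along
  A + i (i A) all derivatives fall on H. The constant t1 + i t2 is the divergence of this complex field. The factor H
  is locally Lipschitz and differentiable almost everywhere.\<close>

lemma dbar_field_integral:
  fixes g H :: "'m::finite cspace \<Rightarrow> complex" and A :: "'m cspace \<Rightarrow> 'm cspace"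
  assumes U: "open U" and K: "compact K" "K \<subseteq> U" and g: "holomorphic_fun_on g U"
    and Hl: "\<And>x. x \<in> U \<Longrightarrow> loc_lip H x" and H0: "\<And>x. x \<in> U - K \<Longrightarrow> H x = 0"
    and N: "N \<in> null_sets lborel" and Hd: "\<And>x. x \<in> U - N \<Longrightarrow> (H has_derivative H' x) (at x)"
    and A: "linear A" and tr: "t1 = (\<Sum>e\<in>Basis. A e \<bullet> e)" "t2 = (\<Sum>e\<in>Basis. cscale \<i> (A e) \<bullet> e)"
  shows "has_bochner_integral lborel (\<lambda>x. indicator (U - N) x *\<^sub>R
     (g x * (H' x (A x) + \<i> * H' x (cscale \<i> (A x)) + (of_real t1 + \<i> * of_real t2) * H x))) 0"
proof -
  obtain G where G: "\<And>x. x \<in> U \<Longrightarrow> (g has_derivative G x) (at x)" "\<And>x c v. x \<in> U \<Longrightarrow> G x (cscale c v) = c * G x v"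
    using g unfolding holomorphic_fun_on_def by metis
  define F where "F x = (if x \<in> U then g x * H x else 0)" for x
  define F' where "F' x v = (if x \<in> U then g x * H' x v + G x v * H x else 0)" for x v
  have evU: "\<forall>\<^sub>F y in nhds x. F y = g y * H y" if "x \<in> U" for x
    using eventually_nhds_in_open[OF U that] by eventually_elim (simp add: F_def)
  have F0: "F x = 0" if "x \<notin> K" for x using H0[of x] that by (auto simp: F_def)
  have ev0: "\<forall>\<^sub>F y in nhds x. F y = 0" if "x \<notin> U" for x
  proof -
    have "open (-K)" "x \<in> - K" using K that compact_imp_closed by blast+
    from eventually_nhds_in_open[OF this] show ?thesis by eventually_elim (simp add: F0)
  qed
  have lip: "loc_lip F x" for x
  proof (cases "x \<in> U")
    case True
    then show ?thesis
      by (intro loc_lip_cong_ev[OF loc_lip_mult evU] holomorphic_fun_loc_lip[OF g U] Hl)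
  next
    case False then show ?thesis using loc_lip_cong_ev[OF loc_lip_const ev0] by blast
  qed
  have der: "(F has_derivative F' x) (at x)" if "x \<notin> N" for x
  proof (cases "x \<in> U")
    case True
    have "((\<lambda>x. g x * H x) has_derivative (\<lambda>v. g x * H' x v + G x v * H x)) (at x)"
      by (rule has_derivative_mult) (use True that G Hd in auto)
    then have "(F has_derivative (\<lambda>v. g x * H' x v + G x v * H x)) (at x)"
      by (rule has_derivative_transform_within_open[OF _ U True]) (simp add: F_def)
    then show ?thesis using True by (simp add: F'_def[abs_def])
  next
    case False
    have "((\<lambda>_. 0) has_derivative (\<lambda>v. 0)) (at x)" by simp
    then have "(F has_derivative (\<lambda>v. 0)) (at x)"
      by (rule has_derivative_transform_within_open[of _ _ _ _ "- K"])
         (use False K compact_imp_closed F0 in auto)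
    then show ?thesis using False by (simp add: F'_def[abs_def])
  qed
  have 1: "has_bochner_integral lborel (\<lambda>x. indicator (- N) x *\<^sub>R (F' x (A x) + of_real t1 * F x)) 0"
    using linear_field_divergence[of F K N F' A t1] lip K(1) F0 N der A tr(1) by blast
  have 2: "has_bochner_integral lborel (\<lambda>x. indicator (- N) x *\<^sub>R (F' x ((cscale \<i> \<circ> A) x) + of_real t2 * F x)) 0"
    using linear_field_divergence[of F K N F' "cscale \<i> \<circ> A" t2] lip K(1) F0 N der
      linear_compose[OF A linear_cscale_right] by (simp add: tr(2))
  have "has_bochner_integral lborel (\<lambda>x. indicator (- N) x *\<^sub>R (F' x (A x) + of_real t1 * F x)
      + \<i> * (indicator (- N) x *\<^sub>R (F' x ((cscale \<i> \<circ> A) x) + of_real t2 * F x))) (0 + \<i> * 0)"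
    by (intro has_bochner_integral_add has_bochner_integral_mult_right 1 2)
  moreover have "indicator (- N) x *\<^sub>R (F' x (A x) + of_real t1 * F x)
      + \<i> * (indicator (- N) x *\<^sub>R (F' x ((cscale \<i> \<circ> A) x) + of_real t2 * F x)) = 
     indicator (U - N) x *\<^sub>R
     (g x * (H' x (A x) + \<i> * H' x (cscale \<i> (A x)) + (of_real t1 + \<i> * of_real t2) * H x))" for x
    by (cases "x \<in> U"; cases "x \<in> N") (auto simp: F'_def F_def G(2) algebra_simps)
  ultimately show ?thesis by simp
qed

lemma DERIV_max_0_power:
  assumes "k \<ge> 1"
  shows "((\<lambda>x::real. (max 0 x) ^ Suc k) has_real_derivative (real (Suc k) * (max 0 x) ^ k)) (at x)"
proof -
  consider "x < 0" | "x > 0" | "x = 0" by linarith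
  then show ?thesis
  proof cases
    case 1
    have "((\<lambda>x. 0) has_real_derivative 0) (at x)" by simp
    then have "((\<lambda>x::real. (max 0 x) ^ Suc k) has_real_derivative 0) (at x)"
      by (rule has_field_derivative_transform_within_open[of _ _ _ "{..<0}"]) (use 1 in auto)
    then show ?thesis using 1 assms by (simp add: max_def power_0_left)
  next
    case 2
    have "((\<lambda>x. x ^ Suc k) has_real_derivative (real (Suc k) * x ^ k)) (at x)"
      using DERIV_pow[of "Suc k" x] by simp
    then have "((\<lambda>x::real. (max 0 x) ^ Suc k) has_real_derivative (real (Suc k) * x ^ k)) (at x)"
      by (rule has_field_derivative_transform_within_open[of _ _ _ "{0<..}"]) (use 2 in auto)
    then show ?thesis using 2 by simp
  next
    case 3
    have "(\<lambda>h. (max 0 (0 + h) ^ Suc k - max 0 0 ^ Suc k) / h) \<midarrow>0\<rightarrow> (0::real)"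
    proof (rule Lim_null_comparison)
      show "\<forall>\<^sub>F h in at 0. norm ((max 0 (0 + h) ^ Suc k - max 0 0 ^ Suc k) / h) \<le> \<bar>h\<bar> ^ k"
        by (intro always_eventually allI) (auto simp: max_def)
      have "((\<lambda>h::real. \<bar>h\<bar> ^ k) \<longlongrightarrow> \<bar>0\<bar> ^ k) (at 0)" by (intro tendsto_intros)
      then show "((\<lambda>h::real. \<bar>h\<bar> ^ k) \<longlongrightarrow> 0) (at 0)" using assms by (simp add: power_0_left)
    qed
    then show ?thesis using 3 assms by (simp add: DERIV_def power_0_left)
  qed
qed

text \<open>The cubic 3 x^2 - 2 x^3 between 0 and 1, continued by 0 on the left and by 1 on the right. Writing it with positive
  parts gives one formula, differentiable everywhere, instead of three cases.\<close>

definition smoothstep :: "real \<Rightarrow> real" where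
  "smoothstep x = 3 * (max 0 x)^2 - 2 * (max 0 x)^3 + 3 * (max 0 (x - 1))^2 + 2 * (max 0 (x - 1))^3"

definition smoothstep' :: "real \<Rightarrow> real" where
  "smoothstep' x = 6 * max 0 x - 6 * (max 0 x)^2 + 6 * max 0 (x - 1) + 6 * (max 0 (x - 1))^2"

lemma smoothstep_eq_0: "x \<le> 0 \<Longrightarrow> smoothstep x = 0"
  by (simp add: smoothstep_def max_def)

lemma smoothstep_eq_1: "x \<ge> 1 \<Longrightarrow> smoothstep x = 1"
  by (simp add: smoothstep_def max_def algebra_simps power2_eq_square power3_eq_cube)

lemma smoothstep'_eq_0: "x \<le> 0 \<or> x \<ge> 1 \<Longrightarrow> smoothstep' x = 0"
  by (auto simp: smoothstep'_def max_def algebra_simps power2_eq_square)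

lemma smoothstep'_eq: "0 \<le> x \<Longrightarrow> x \<le> 1 \<Longrightarrow> smoothstep' x = 6 * x * (1 - x)"
  by (auto simp: smoothstep'_def max_def algebra_simps power2_eq_square)

lemma smoothstep'_bounds: "0 \<le> smoothstep' x" "smoothstep' x \<le> 3 / 2"
proof -
  have "0 \<le> smoothstep' x \<and> smoothstep' x \<le> 3 / 2"
  proof (cases "0 \<le> x \<and> x \<le> 1")
    case True
    have "0 \<le> (x - 1/2)\<^sup>2" by simp
    then show ?thesis using True by (simp add: smoothstep'_eq algebra_simps power2_eq_square mult_left_le)
  next
    case False
    then have "smoothstep' x = 0" by (intro smoothstep'_eq_0) auto
    then show ?thesis by simp
  qed
  then show "0 \<le> smoothstep' x" "smoothstep' x \<le> 3 / 2" by auto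
qed

lemma smoothstep_DERIV [derivative_intros]: "(smoothstep has_real_derivative smoothstep' x) (at x)"
proof -
  have sh: "((\<lambda>x::real. (max 0 (x - 1)) ^ Suc k) has_real_derivative (real (Suc k) * (max 0 (x - 1)) ^ k)) (at x)" 
    if "k \<ge> 1" for k
    using DERIV_shift[of "\<lambda>x. (max 0 x) ^ Suc k" "real (Suc k) * (max 0 (x - 1)) ^ k" x "-1"]
      DERIV_max_0_power[OF that, of "x - 1"] by simp
  have "(smoothstep has_real_derivative (3 * (real (Suc 1) * (max 0 x) ^ 1) - 2 * (real (Suc 2) * (max 0 x) ^ 2)
     + 3 * (real (Suc 1) * (max 0 (x - 1)) ^ 1) + 2 * (real (Suc 2) * (max 0 (x - 1)) ^ 2))) (at x)"
    unfolding smoothstep_def[abs_def]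
    using DERIV_add[OF DERIV_add[OF DERIV_diff[OF DERIV_cmult[OF DERIV_max_0_power[of 1 x]] DERIV_cmult[OF DERIV_max_0_power[of 2 x]]]
       DERIV_cmult[OF sh[of 1]]] DERIV_cmult[OF sh[of 2]], of 3 2 3 2] by (simp add: eval_nat_numeral)
  then show ?thesis by (simp add: smoothstep'_def algebra_simps)
qed

lemma smoothstep'_continuous: "continuous_on S smoothstep'"
  unfolding smoothstep'_def[abs_def] by (intro continuous_intros)

lemma smoothstep_bounds: "0 \<le> smoothstep x" "smoothstep x \<le> 1"
proof -
  have mono: "smoothstep a \<le> smoothstep b" if "a \<le> b" for a b
    using DERIV_nonneg_imp_nondecreasing[OF that, of smoothstep] smoothstep_DERIV smoothstep'_bounds by blast
  show "0 \<le> smoothstep x" using mono[of "min x 0" x] smoothstep_eq_0[of "min x 0"] by simp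
  show "smoothstep x \<le> 1" using mono[of x "max x 1"] smoothstep_eq_1[of "max x 1"] by simp
qed

section \<open>Hoelder inequality and a uniform boundedness principle\<close>

lemma conjugate_exponent_gt_1:
  fixes p q :: real
  assumes "p > 1" "1 / p + 1 / q = 1" shows "q > 1"
proof -
  have "1 / p < 1" "1 / p > 0" using assms(1) by auto
  then have "1 / q > 0" "1 / q < 1" using assms(2) by linarith+
  then show ?thesis by (simp add: divide_less_eq_1)
qed

lemma borel_measurable_cnj [measurable (raw)]:
  "f \<in> borel_measurable M \<Longrightarrow> (\<lambda>x. cnj (f x)) \<in> borel_measurable M"
  by (rule borel_measurable_continuous_on) (intro continuous_intros)

lemma borel_measurable_complex_of_real [measurable (raw)]:
  "f \<in> borel_measurable M \<Longrightarrow> (\<lambda>x. complex_of_real (f x)) \<in> borel_measurable M"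
  by (rule borel_measurable_continuous_on) (intro continuous_intros)

lemma holder:
  fixes f g :: "'a \<Rightarrow> complex"
  assumes pq: "p > 1" "1 / p + 1 / q = 1"
    and f[measurable]: "f \<in> borel_measurable M" and g[measurable]: "g \<in> borel_measurable M"
    and fi: "integrable M (\<lambda>x. norm (f x) powr p)" and gi: "integrable M (\<lambda>x. norm (g x) powr q)"
  shows "integrable M (\<lambda>x. f x * g x)"
    and "(LINT x|M. norm (f x * g x)) \<le> (LINT x|M. norm (f x) powr p) powr (1/p) * (LINT x|M. norm (g x) powr q) powr (1/q)"
proof -
  have q: "q > 1" by (rule conjugate_exponent_gt_1[OF pq])
  have bd: "norm (f x * g x) \<le> norm (f x) powr p / p + norm (g x) powr q / q" for x
    using Youngs_inequality[OF pq(1) q pq(2), of "norm (f x)" "norm (g x)"] by (simp add: norm_mult)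
  show int: "integrable M (\<lambda>x. f x * g x)"
  proof (rule Bochner_Integration.integrable_bound[of _ "\<lambda>x. norm (f x) powr p / p + norm (g x) powr q / q"])
    show "AE x in M. norm (f x * g x) \<le> norm (norm (f x) powr p / p + norm (g x) powr q / q)"
      using bd by (intro AE_I2) (smt (verit) real_norm_def)
  qed (use fi gi in auto)
  define A where "A = (LINT x|M. norm (f x) powr p)"
  define B where "B = (LINT x|M. norm (g x) powr q)"
  have AB: "A \<ge> 0" "B \<ge> 0" by (auto simp: A_def B_def intro!: integral_nonneg_AE)
  show "(LINT x|M. norm (f x * g x)) \<le> A powr (1/p) * B powr (1/q)"
  proof (cases "A = 0 \<or> B = 0")
    case True
    have "AE x in M. norm (f x * g x) = 0"
    proof (cases "A = 0")
      case True
      then have "AE x in M. norm (f x) powr p = 0"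
        unfolding A_def using fi by (subst (asm) integral_nonneg_eq_0_iff_AE) auto
      then show ?thesis by eventually_elim (use pq in auto)
    next
      case False
      with \<open>A = 0 \<or> B = 0\<close> have "AE x in M. norm (g x) powr q = 0"
        unfolding B_def using gi by (subst (asm) integral_nonneg_eq_0_iff_AE) auto
      then show ?thesis by eventually_elim (use pq in auto)
    qed
    then have "(LINT x|M. norm (f x * g x)) = (LINT x|M. 0)"
      by (intro integral_cong_AE) auto
    then show ?thesis by simp
  next
    case False
    with AB have pos: "A > 0" "B > 0" by auto
    define a where "a = A powr (1/p)"
    define b where "b = B powr (1/q)"
    have ab: "a > 0" "b > 0" using pos by (auto simp: a_def b_def)
    have apA: "a powr p = A" "b powr q = B" using pos pq q by (auto simp: a_def b_def powr_powr)
    have pw: "norm (f x * g x) \<le> a * b * (norm (f x) powr p / (p * A) + norm (g x) powr q / (q * B))" for x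
    proof -
      have "(norm (f x) / a) * (norm (g x) / b) \<le> (norm (f x) / a) powr p / p + (norm (g x) / b) powr q / q"
        by (rule Youngs_inequality[OF pq(1) q pq(2)]) (use ab in auto)
      also have "\<dots> = norm (f x) powr p / (p * A) + norm (g x) powr q / (q * B)"
        using ab by (simp add: powr_divide apA mult.commute)
      finally show ?thesis using ab by (simp add: norm_mult field_simps)
    qed
    have "(LINT x|M. norm (f x * g x)) \<le> (LINT x|M. a * b * (norm (f x) powr p / (p * A) + norm (g x) powr q / (q * B)))"
      using int fi gi pw by (intro integral_mono) auto
    also have "\<dots> = a * b * (A / (p * A) + B / (q * B))"
      using fi gi by (simp add: A_def B_def)
    also have "A / (p * A) + B / (q * B) = 1" using pos pq by simp
    finally show ?thesis by (simp add: a_def b_def)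
  qed
qed

text \<open>A quantitative uniform boundedness principle by the gliding hump, so that completeness of L^p is used only in
  the form of an absolutely convergent series. The function f is the sum of 3^(-k) s_k w_k, where w_k is the unit
  vector of L^p dual to v_k; the sign s_k is chosen so that the partial sum up to k already
  pairs with v_k to at least 3^(-k) times the norm of v_k. The tail of the series can destroy at most half of it.\<close>

lemma weakly_bounded_imp_norm_bounded:
  fixes v :: "nat \<Rightarrow> 'a \<Rightarrow> complex"
  assumes pq: "p > 1" "1 / p + 1 / q = 1"
    and v[measurable]: "\<And>j. v j \<in> borel_measurable M"
    and vi: "\<And>j. integrable M (\<lambda>x. norm (v j x) powr q)"
    and big: "\<And>j. (LINT x|M. norm (v j x) powr q) powr (1 / q) \<ge> 4 ^ j"
  obtains f where "f \<in> borel_measurable M" "integrable M (\<lambda>x. norm (f x) powr p)"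
    "\<And>j. norm (LINT x|M. f x * v j x) \<ge> (4/3) ^ j / 2"
proof -
  have q: "q > 1" by (rule conjugate_exponent_gt_1[OF pq])
  have pq': "(q - 1) * p = q"
    using pq q by (simp add: field_simps)
  define I where "I j = (LINT x|M. norm (v j x) powr q)" for j
  define n where "n j = I j powr (1/q)" for j
  have n4: "n j \<ge> 4 ^ j" for j using big by (simp add: n_def I_def)
  have npos: "n j > 0" for j using n4[of j] by (smt (verit) zero_less_power)
  have nI: "n j powr q = I j" for j
    using npos[of j] q by (auto simp: n_def powr_powr I_def integral_nonneg_AE)
  define w where "w j x = cnj (v j x) * of_real (norm (v j x) powr (q - 2) * n j powr (1 - q))" for j x
  have wm[measurable]: "w j \<in> borel_measurable M" for j
    unfolding w_def by measurable
  have wn: "norm (w j x) = norm (v j x) powr (q - 1) * n j powr (1 - q)" for j x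
  proof (cases "v j x = 0")
    case False
    have "norm (v j x) * norm (v j x) powr (q - 2) = norm (v j x) powr (q - 1)"
      using powr_mult_base[of "norm (v j x)" "q - 2"] by simp
    then show ?thesis by (simp add: w_def norm_mult)
  qed (use q in \<open>simp add: w_def\<close>)
  have wp: "norm (w j x) powr p = norm (v j x) powr q / I j" for j x
  proof -
    have "norm (w j x) powr p = norm (v j x) powr ((q - 1) * p) * n j powr ((1 - q) * p)"
      by (simp add: wn powr_mult powr_powr)
    also have "(1 - q) * p = - q" using pq' by (simp add: algebra_simps)
    finally show ?thesis using nI[of j] npos[of j] by (simp add: pq' powr_minus divide_inverse)
  qed
  have Ipos: "I j > 0" for j using nI[of j] npos[of j] by (metis powr_gt_zero less_irrefl)
  have wi: "integrable M (\<lambda>x. norm (w j x) powr p)" for j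
    unfolding wp using vi by simp
  have w1: "(LINT x|M. norm (w j x) powr p) = 1" for j
    unfolding wp using Ipos[of j] by (simp add: I_def)
  have wv: "w j x * v j x = of_real (norm (v j x) powr q * n j powr (1 - q))" for j x
  proof (cases "v j x = 0")
    case False
    have "w j x * v j x = (v j x * cnj (v j x)) * of_real (norm (v j x) powr (q - 2) * n j powr (1 - q))"
      by (simp add: w_def)
    also have "v j x * cnj (v j x) = of_real (norm (v j x) powr 2)"
      using False by (simp add: complex_norm_square[symmetric] powr_numeral)
    also have "of_real (norm (v j x) powr 2) * of_real (norm (v j x) powr (q - 2) * n j powr (1 - q))
      = complex_of_real (norm (v j x) powr 2 * norm (v j x) powr (q - 2) * n j powr (1 - q))"
      by simp
    also have "norm (v j x) powr 2 * norm (v j x) powr (q - 2) = norm (v j x) powr q"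
      using powr_add[of "norm (v j x)" 2 "q - 2"] by simp
    finally show ?thesis .
  qed (use q in \<open>simp add: w_def\<close>)
  define a where "a i j = (LINT x|M. w i x * v j x)" for i j
  have diag: "a j j = of_real (n j)" for j
  proof -
    have "a j j = of_real (LINT x|M. norm (v j x) powr q * n j powr (1 - q))"
      unfolding a_def wv by (rule integral_complex_of_real)
    also have "(LINT x|M. norm (v j x) powr q * n j powr (1 - q)) = n j powr q * n j powr (1 - q)"
      by (simp add: nI I_def)
    also have "\<dots> = n j" using npos[of j] by (simp add: powr_add[symmetric])
    finally show ?thesis .
  qed
  have wvi: "integrable M (\<lambda>x. w i x * v j x)" for i j
    by (rule holder(1)[OF pq wm v wi vi])
  have wvn: "(LINT x|M. norm (w i x * v j x)) \<le> n j" for i j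
    using holder(2)[OF pq wm v wi vi, of i j] by (simp add: w1 n_def I_def)
  have an: "norm (a i j) \<le> n j" for i j
    unfolding a_def by (rule order_trans[OF integral_norm_bound wvn])
  define P where "P s j r \<longleftrightarrow> \<bar>r\<bar> = 1 \<and>
     norm ((\<Sum>i<j. of_real (s i / 3 ^ i) * a i j) + of_real (r / 3 ^ j) * a j j) \<ge> n j / 3 ^ j"
    for s :: "nat \<Rightarrow> real" and j r
  have "\<exists>s. \<forall>j. P s j (s j)"
  proof (rule dependent_wellorder_choice)
    fix r f g and x :: nat assume "\<And>y. y < x \<Longrightarrow> (f y :: real) = g y"
    then show "P f x r = P g x r" unfolding P_def by simp
  next
    fix j and f :: "nat \<Rightarrow> real"
    define S where "S = (\<Sum>i<j. of_real (f i / 3 ^ i) * a i j)"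
    define T where "T = complex_of_real (1 / 3 ^ j) * a j j"
    have "norm T = n j / 3 ^ j" using npos[of j] by (simp add: T_def diag norm_mult norm_divide norm_power)
    moreover have "2 * norm T \<le> norm (S + T) + norm (S - T)"
      using norm_triangle_ineq4[of "S + T" "S - T"] by (simp add: norm_mult flip: mult_2)
    ultimately have "norm (S + T) \<ge> n j / 3 ^ j \<or> norm (S - T) \<ge> n j / 3 ^ j" by linarith
    then have "P f j 1 \<or> P f j (-1)"
      unfolding P_def by (auto simp: S_def T_def)
    then show "\<exists>r. P f j r" by blast
  qed
  then obtain s where s: "\<And>j. P s j (s j)" by blast
  have s1: "\<bar>s j\<bar> = 1" for j using s unfolding P_def by blast
  define h where "h k x = (2/3) powr (real k * p) * norm (w k x) powr p" for k x
  have hi: "integrable M (h k)" for k unfolding h_def using wi by simp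
  have hI: "(LINT x|M. norm (h k x)) = ((2/3) powr p) ^ k" for k
  proof -
    have "(LINT x|M. norm (h k x)) = (2/3) powr (real k * p)"
      using w1[of k] by (simp add: h_def)
    also have "\<dots> = ((2/3) powr p) powr real k" by (simp only: powr_powr mult.commute)
    also have "\<dots> = ((2/3) powr p) ^ k" by (rule powr_realpow) simp
    finally show ?thesis .
  qed
  have c1: "(2/3) powr p < (1::real)"
    using powr_less_mono2[of p "2/3" 1] pq(1) by simp
  have hsum: "summable (\<lambda>k. LINT x|M. norm (h k x))"
    unfolding hI using c1 by (intro summable_geometric) auto
  have hAE: "AE x in M. summable (\<lambda>k. norm (h k x))"
  proof -
    have "(\<integral>\<^sup>+ x. (\<Sum>k. ennreal (norm (h k x))) \<partial>M) = (\<Sum>k. \<integral>\<^sup>+ x. ennreal (norm (h k x)) \<partial>M)"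
      by (intro nn_integral_suminf) (use hi in auto)
    also have "\<dots> = (\<Sum>k. ennreal (LINT x|M. norm (h k x)))"
      using hi by (intro arg_cong[where f=suminf] ext nn_integral_eq_integral) auto
    also have "\<dots> \<noteq> \<infinity>"
      using hsum by (simp add: ennreal_suminf_neq_top integral_nonneg_AE)
    finally have "AE x in M. (\<Sum>k. ennreal (norm (h k x))) \<noteq> \<infinity>"
      by (intro nn_integral_noteq_infinite) (use hi in auto)
    then show ?thesis
      by eventually_elim (auto intro: summable_suminf_not_top)
  qed
  define H where "H x = (\<Sum>k. h k x)" for x
  have Hi: "integrable M H" unfolding H_def by (rule integrable_suminf[OF hi hAE hsum])
  define F where "F k x = complex_of_real (s k / 3 ^ k) * w k x" for k x
  have h0: "h k x \<ge> 0" for k x by (simp add: h_def)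
  have Fb: "norm (F k x) \<le> (1/2) ^ k * H x powr (1/p)" if "summable (\<lambda>k. norm (h k x))" for k x
  proof -
    have "h k x \<le> H x" unfolding H_def
      using sum_le_suminf[of "\<lambda>k. h k x" "{k}"] that h0 by simp
    then have "h k x powr (1/p) \<le> H x powr (1/p)" using pq h0 by (intro powr_mono2) auto
    moreover have "h k x powr (1/p) = (2/3) ^ k * norm (w k x)"
      using pq by (simp add: h_def powr_mult powr_powr powr_realpow)
    ultimately have "(1/2)^k * ((2/3) ^ k * norm (w k x)) \<le> (1/2)^k * H x powr (1/p)"
      by (intro mult_left_mono) auto
    moreover have "norm (F k x) = (1/2)^k * ((2/3) ^ k * norm (w k x))"
      using s1[of k] by (simp add: F_def norm_mult norm_divide norm_power power_divide)
    ultimately show ?thesis by simp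
  qed
  have geo: "summable (\<lambda>k. (1/2) ^ k * c)" "(\<Sum>k. (1/2) ^ k * c) = 2 * c" for c :: real
    using suminf_mult2[OF summable_geometric[of "1/2::real"], of c] suminf_geometric[of "1/2::real"]
    by (auto intro!: summable_mult2 summable_geometric)
  have Fs: "summable (\<lambda>k. norm (F k x))" and Fn: "norm (\<Sum>k. F k x) \<le> 2 * H x powr (1/p)"
    if "summable (\<lambda>k. norm (h k x))" for x
  proof -
    show *: "summable (\<lambda>k. norm (F k x))"
      by (rule summable_comparison_test'[OF geo(1)[of "H x powr (1/p)"], of 0]) (use Fb[OF that] in auto)
    have "norm (\<Sum>k. F k x) \<le> (\<Sum>k. norm (F k x))" by (rule summable_norm[OF *])
    also have "\<dots> \<le> (\<Sum>k. (1/2) ^ k * H x powr (1/p))" by (rule suminf_le[OF Fb[OF that] * geo(1)])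
    also have "\<dots> = 2 * H x powr (1/p)" by (rule geo(2))
    finally show "norm (\<Sum>k. F k x) \<le> 2 * H x powr (1/p)" .
  qed
  define f where "f x = (\<Sum>k. F k x)" for x
  have Fm[measurable]: "F k \<in> borel_measurable M" for k unfolding F_def by measurable
  have fm[measurable]: "f \<in> borel_measurable M" unfolding f_def by measurable
  have fi: "integrable M (\<lambda>x. norm (f x) powr p)"
  proof (rule Bochner_Integration.integrable_bound[of _ "\<lambda>x. 2 powr p * H x"])
    show "AE x in M. norm (norm (f x) powr p) \<le> norm (2 powr p * H x)"
      using hAE
    proof eventually_elim
      case (elim x)
      have H0: "H x \<ge> 0" unfolding H_def using h0 elim by (auto intro!: suminf_nonneg)
      have "norm (f x) powr p \<le> (2 * H x powr (1/p)) powr p"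
        using Fn[OF elim] pq by (intro powr_mono2) (auto simp: f_def)
      also have "\<dots> = 2 powr p * H x" using H0 pq by (simp add: powr_mult powr_powr)
      finally show ?case using H0 by simp
    qed
  qed (use Hi in auto)
  have lower: "norm (LINT x|M. f x * v j x) \<ge> (4/3) ^ j / 2" for j
  proof -
    have Gi: "integrable M (\<lambda>x. F k x * v j x)" for k
      unfolding F_def mult.assoc by (rule integrable_mult_right[OF wvi])
    have Gnorm: "(LINT x|M. norm (F k x * v j x)) \<le> (1/3) ^ k * n j" for k
    proof -
      have "(LINT x|M. norm (F k x * v j x)) = (1/3)^k * (LINT x|M. norm (w k x * v j x))"
        unfolding F_def using s1[of k]
        by (simp add: norm_mult norm_divide norm_power power_divide mult.assoc flip: integral_mult_right_zero)
      also have "\<dots> \<le> (1/3)^k * n j" using wvn by (intro mult_left_mono) auto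
      finally show ?thesis .
    qed
    have gs: "summable (\<lambda>k. (1/3) ^ k * n j)" by (auto intro!: summable_mult2 summable_geometric)
    have Gsum: "summable (\<lambda>k. LINT x|M. norm (F k x * v j x))"
      by (rule summable_comparison_test'[OF gs, of 0]) (use Gnorm in \<open>auto simp: abs_of_nonneg integral_nonneg_AE\<close>)
    have GAE: "AE x in M. summable (\<lambda>k. norm (F k x * v j x))"
      using hAE by eventually_elim (auto simp: norm_mult intro!: summable_mult2 Fs)
    have fv: "(LINT x|M. f x * v j x) = (LINT x|M. (\<Sum>k. F k x * v j x))"
    proof (rule integral_cong_AE)
      show "AE x in M. f x * v j x = (\<Sum>k. F k x * v j x)"
        using hAE by eventually_elim
          (auto simp: f_def intro!: suminf_mult2 summable_norm_cancel[OF Fs])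
    qed auto
    define t where "t k = (LINT x|M. F k x * v j x)" for k
    have tn: "norm (t k) \<le> (1/3)^k * n j" for k
      unfolding t_def by (rule order_trans[OF integral_norm_bound Gnorm])
    have tk: "t k = of_real (s k / 3 ^ k) * a k j" for k
      unfolding t_def F_def a_def mult.assoc by (rule integral_mult_right_zero)
    have ts: "summable (\<lambda>k. norm (t k))"
      by (rule summable_comparison_test'[OF gs, of 0]) (use tn in auto)
    have "(LINT x|M. f x * v j x) = (\<Sum>k. t k)"
      unfolding fv t_def by (rule integral_suminf[OF Gi GAE Gsum])
    also have "\<dots> = (\<Sum>k. t (k + Suc j)) + (\<Sum>k<Suc j. t k)"
      by (rule suminf_split_initial_segment[OF summable_norm_cancel[OF ts]])
    finally have eq: "(LINT x|M. f x * v j x) = (\<Sum>k. t (k + Suc j)) + (\<Sum>k<Suc j. t k)" .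
    have "norm (\<Sum>k<Suc j. t k) \<ge> n j / 3 ^ j"
      using s[of j] unfolding P_def tk by simp
    moreover have "norm (\<Sum>k. t (k + Suc j)) \<le> (n j / 3 ^ j) / 2"
    proof -
      have sh: "summable (\<lambda>k. norm (t (k + Suc j)))" using ts by (subst summable_iff_shift)
      have "norm (\<Sum>k. t (k + Suc j)) \<le> (\<Sum>k. norm (t (k + Suc j)))" by (rule summable_norm[OF sh])
      also have "\<dots> \<le> (\<Sum>k. (1/3)^k * ((1/3)^Suc j * n j))"
      proof (rule suminf_le[OF _ sh])
        show "norm (t (k + Suc j)) \<le> (1/3)^k * ((1/3)^Suc j * n j)" for k
          using tn[of "k + Suc j"] by (simp only: power_add mult.assoc)
      qed (auto intro!: summable_mult2 summable_geometric)
      also have "\<dots> = (3/2) * ((1/3)^Suc j * n j)"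
        using suminf_mult2[OF summable_geometric[of "1/3::real"], of "(1/3)^Suc j * n j"] 
          suminf_geometric[of "1/3::real"] by simp
      also have "\<dots> = (n j / 3 ^ j) / 2" by (simp add: power_divide)
      finally show ?thesis .
    qed
    ultimately have "norm (LINT x|M. f x * v j x) \<ge> (n j / 3 ^ j) / 2"
      unfolding eq using norm_diff_ineq[of "\<Sum>k<Suc j. t k" "\<Sum>k. t (k + Suc j)"] by (simp add: add.commute)
    moreover have "n j / 3 ^ j \<ge> (4/3) ^ j" using n4[of j] by (simp add: power_divide divide_right_mono)
    then have "(4/3) ^ j / 2 \<le> (n j / 3 ^ j) / 2" by (rule divide_right_mono) simp
    ultimately show ?thesis by (rule order_trans[rotated])
  qed
  show thesis by (rule that[OF fm fi lower])
qed

section \<open>An interior estimate for holomorphic functions\<close>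

lemma DIM_cspace: "DIM('m::finite cspace) = 2 * (CARD('m) + 2)"
  by simp

lemma trace_id_cspace: "(\<Sum>e\<in>Basis. e \<bullet> (e::'m::finite cspace)) = 2 * real (CARD('m) + 2)"
proof -
  have "(\<Sum>e\<in>Basis. e \<bullet> (e::'m::finite cspace)) = (\<Sum>e\<in>(Basis::'m cspace set). 1)"
    by (intro sum.cong) (auto simp: inner_Basis)
  then show ?thesis by (simp add: DIM_cspace)
qed

lemma ln_norm_has_derivative:
  fixes w :: "'a::real_inner"
  assumes "w \<noteq> 0"
  shows "((\<lambda>w. ln (norm w)) has_derivative (\<lambda>v. (v \<bullet> w) / (norm w)\<^sup>2)) (at w)"
proof -
  have "((\<lambda>w. ln (norm w)) has_derivative (\<lambda>v. (v \<bullet> sgn w) * (1 / norm w))) (at w)"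
    using assms by (auto intro!: derivative_eq_intros has_derivative_norm simp: divide_inverse mult.commute)
  moreover have "(v \<bullet> sgn w) * (1 / norm w) = (v \<bullet> w) / (norm w)\<^sup>2" for v
    by (simp add: sgn_div_norm divide_inverse power2_eq_square)
  ultimately show ?thesis by simp
qed

lemma loc_lip_ln: "(x::real) > 0 \<Longrightarrow> loc_lip ln x"
  by (rule loc_lip_real_C1[of "{0<..}" x ln "\<lambda>x. 1 / x"])
     (auto simp flip: has_real_derivative_iff_has_vector_derivative intro!: derivative_eq_intros continuous_intros)

lemma loc_lip_DERIV:
  fixes f :: "real \<Rightarrow> real"
  assumes "\<And>y. (f has_real_derivative f' y) (at y)" "continuous_on UNIV f'"
  shows "loc_lip f x"
  by (rule loc_lip_real_C1[of UNIV x f f']) (use assms in \<open>auto simp flip: has_real_derivative_iff_has_vector_derivative\<close>)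

lemma loc_lip_of_real: "loc_lip f x \<Longrightarrow> loc_lip (\<lambda>y. complex_of_real (f y)) x"
  by (rule loc_lip_compose[of f x complex_of_real]) (auto intro: loc_lip_bounded_linear bounded_linear_of_real)

context
  fixes n c :: real
begin

text \<open>The product of |w|^(-2n), at x = ln |w|, with a cutoff to the annulus exp (-a/2) < |w| < exp (c/2). The power is chosen
  to make the radial field divergence free, so that only derivatives of the cutoff remain.\<close>

definition radial_bump :: "real \<Rightarrow> real \<Rightarrow> real" where
  "radial_bump a x = exp (- 2 * n * x) * (smoothstep (a + 2 * x) * smoothstep (c - 2 * x))"

definition radial_bump' :: "real \<Rightarrow> real \<Rightarrow> real" where
  "radial_bump' a x = - 2 * n * radial_bump a x + exp (- 2 * n * x) * 
      (2 * smoothstep' (a + 2 * x) * smoothstep (c - 2 * x) - 2 * smoothstep (a + 2 * x) * smoothstep' (c - 2 * x))"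

lemma radial_bump_DERIV: "(radial_bump a has_real_derivative radial_bump' a x) (at x)"
proof -
  have 1: "((\<lambda>x. smoothstep (a + 2 * x)) has_real_derivative (smoothstep' (a + 2 * x) * 2)) (at x)"
    by (rule DERIV_chain2[OF smoothstep_DERIV]) (auto intro!: derivative_eq_intros)
  have 2: "((\<lambda>x. smoothstep (c - 2 * x)) has_real_derivative (smoothstep' (c - 2 * x) * (-2))) (at x)"
    by (rule DERIV_chain2[OF smoothstep_DERIV]) (auto intro!: derivative_eq_intros)
  have 3: "((\<lambda>x. exp (- 2 * n * x)) has_real_derivative (exp (- 2 * n * x) * (- 2 * n))) (at x)"
    by (auto intro!: derivative_eq_intros)
  show ?thesis unfolding radial_bump_def[abs_def] radial_bump'_def
    using DERIV_mult[OF 3 DERIV_mult[OF 1 2]] by (simp add: radial_bump_def algebra_simps)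
qed

lemma radial_bump'_eq:
  assumes "a \<ge> 2 - c"
  shows "radial_bump' a x + 2 * n * radial_bump a x = 
    2 * (exp (- 2 * n * x) * smoothstep' (a + 2 * x) - exp (- 2 * n * x) * smoothstep' (c - 2 * x))"
proof (cases "a + 2 * x \<le> 1")
  case True
  then have "c - 2 * x \<ge> 1" using assms by linarith
  then show ?thesis by (simp add: radial_bump'_def smoothstep_eq_1 smoothstep'_eq_0 algebra_simps)
next
  case False
  then show ?thesis by (simp add: radial_bump'_def smoothstep_eq_1 smoothstep'_eq_0 algebra_simps)
qed

end

lemma smoothstep_continuous: "continuous_on S smoothstep"
  unfolding smoothstep_def[abs_def] by (intro continuous_intros)

lemma borel_measurable_smoothstep' [measurable]: "smoothstep' \<in> borel_measurable borel"
  by (rule borel_measurable_continuous_onI[OF smoothstep'_continuous])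

lemma integrable_bounded_support:
  fixes f :: "'a::euclidean_space \<Rightarrow> 'b::{banach, second_countable_topology}"
  assumes "f \<in> borel_measurable borel" "\<And>x. norm (f x) \<le> B" "\<And>x. x \<notin> cball 0 R \<Longrightarrow> f x = 0"
  shows "integrable lborel f"
proof (rule Bochner_Integration.integrable_bound[of _ "\<lambda>x. B * indicator (cball 0 R) x"])
  show "integrable lborel (\<lambda>x::'a. B * indicator (cball 0 R) x)"
    by (intro integrable_mult_right integrable_real_indicator)
      (use emeasure_lborel_cball_finite[of "0::'a" R] in auto)
  have "B \<ge> 0" using assms(2)[of 0] norm_ge_zero order_trans by blast
  then show "AE x in lborel. norm (f x) \<le> norm (B * indicator (cball 0 R) x :: real)"
    using assms(2,3) by (intro AE_I2) (auto simp: indicator_def)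
qed (use assms(1) in simp)

lemma integral_lborel_pos:
  fixes f :: "'a::euclidean_space \<Rightarrow> real"
  assumes "integrable lborel f" "\<And>x. f x \<ge> 0" "open T" "T \<noteq> {}" "\<And>x. x \<in> T \<Longrightarrow> f x > 0"
  shows "integral\<^sup>L lborel f > 0"
proof (rule ccontr)
  assume "\<not> ?thesis"
  moreover have "integral\<^sup>L lborel f \<ge> 0" using assms(2) by (simp add: integral_nonneg_AE)
  ultimately have "integral\<^sup>L lborel f = 0" by simp
  then have "AE x in lborel. f x = 0"
    using assms(1,2) by (subst (asm) integral_nonneg_eq_0_iff_AE) auto
  then have "AE x in lborel. x \<notin> T" by eventually_elim (use assms(5) in force)
  then have "T \<in> null_sets lborel" 
    using assms(3) by (simp add: AE_iff_null_sets)
  then have "negligible T" by (simp add: negligible_iff_null_sets null_sets_completionI)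
  then show False using assms(3,4) open_not_negligible by blast
qed

definition ring_weight :: "'m::finite itself \<Rightarrow> (real \<Rightarrow> real) \<Rightarrow> 'm cspace \<Rightarrow> real" where
  "ring_weight _ \<phi> w = (if w = 0 then 0 else 
     exp (- 2 * real (CARD('m) + 2) * ln (norm w)) * smoothstep' (\<phi> (2 * ln (norm w))))"

text \<open>Integration by parts with the radial field shows that a fixed average of f over the sphere-like shell near radius R
  equals the same average over an arbitrarily small shell around z, and hence, by continuity, a multiple of f z.
  This is the only form of the mean value property that is needed, and it gives bounds by the integral of |f| directly.\<close>

lemma interior_estimate:
  fixes R :: real
  assumes R: "R > 0"
  shows "\<exists>C>0. \<forall>f S z. open S \<longrightarrow> holomorphic_fun_on f S \<longrightarrow> cball z R \<subseteq> S \<longrightarrow>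
    norm (f (z :: 'm::finite cspace)) \<le> C * (LINT w|lborel. indicator (cball 0 R) w * norm (f (z + w)))"
proof -
  define c where "c = 2 * ln R"
  define n where "n = real (CARD('m) + 2)"
  define \<Phi> where "\<Phi> a = ring_weight TYPE('m) (\<lambda>y. a + y)" for a
  define \<Psi> where "\<Psi> = ring_weight TYPE('m) (\<lambda>y. c - y)"
  have npos: "n > 0" by (simp add: n_def)
  have meas[measurable]: "ring_weight TYPE('m) \<phi> \<in> borel_measurable borel" if [measurable]: "\<phi> \<in> borel_measurable borel" for \<phi>
    unfolding ring_weight_def by measurable
  have \<Phi>m[measurable]: "\<Phi> a \<in> borel_measurable borel" for a unfolding \<Phi>_def by measurable
  have \<Psi>m[measurable]: "\<Psi> \<in> borel_measurable borel" unfolding \<Psi>_def by measurable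
  have nonneg: "\<Phi> a w \<ge> 0" "\<Psi> w \<ge> 0" for a w
    by (auto simp: \<Phi>_def \<Psi>_def ring_weight_def smoothstep'_bounds)
  have \<Phi>0: "norm w < exp ((1 - a) / 2)" if "\<Phi> a w \<noteq> 0" for a w
  proof -
    from that have w: "w \<noteq> 0" "smoothstep' (a + 2 * ln (norm w)) \<noteq> 0" by (auto simp: \<Phi>_def ring_weight_def split: if_splits)
    then have "a + 2 * ln (norm w) < 1" using smoothstep'_eq_0 by (meson not_le)
    then have "ln (norm w) < (1 - a) / 2" by simp
    then show ?thesis using w by (metis exp_less_mono exp_ln zero_less_norm_iff)
  qed
  have \<Phi>b: "\<Phi> a w \<le> exp (n * a) * (3/2)" for a w
  proof (cases "w = 0 \<or> a + 2 * ln (norm w) \<le> 0")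
    case True then show ?thesis by (auto simp: \<Phi>_def ring_weight_def smoothstep'_eq_0)
  next
    case False
    then have "- (2 * ln (norm w)) \<le> a" by linarith
    then have "n * - (2 * ln (norm w)) \<le> n * a" using npos by (intro mult_left_mono) auto
    then show ?thesis using False
      unfolding \<Phi>_def ring_weight_def n_def[symmetric] if_not_P[OF conjunct1[OF False[unfolded de_Morgan_disj]]]
      by (intro mult_mono smoothstep'_bounds) (auto simp: algebra_simps)
  qed
  have Rc: "R = exp (c / 2)" using R by (simp add: c_def)
  have \<Psi>0: "norm w < R" if "\<Psi> w \<noteq> 0" for w
  proof -
    from that have w: "w \<noteq> 0" "smoothstep' (c - 2 * ln (norm w)) \<noteq> 0" by (auto simp: \<Psi>_def ring_weight_def split: if_splits)
    then have "c - 2 * ln (norm w) > 0" using smoothstep'_eq_0 by (meson not_le)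
    then have "ln (norm w) < c / 2" by simp
    then show ?thesis using w unfolding Rc by (metis exp_less_mono exp_ln zero_less_norm_iff)
  qed
  have \<Psi>b: "\<Psi> w \<le> exp (n * (1 - c)) * (3/2)" for w
  proof (cases "w = 0 \<or> c - 2 * ln (norm w) \<ge> 1")
    case True then show ?thesis by (auto simp: \<Psi>_def ring_weight_def smoothstep'_eq_0)
  next
    case False
    then have "- (2 * ln (norm w)) \<le> 1 - c" by linarith
    then have "n * - (2 * ln (norm w)) \<le> n * (1 - c)" using npos by (intro mult_left_mono) auto
    then show ?thesis using False
      unfolding \<Psi>_def ring_weight_def n_def[symmetric] if_not_P[OF conjunct1[OF False[unfolded de_Morgan_disj]]]
      by (intro mult_mono smoothstep'_bounds) (auto simp: algebra_simps)
  qed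
  have key: "(LINT w|lborel. g w * of_real (\<Phi> a w)) = (LINT w|lborel. g w * of_real (\<Psi> w)) \<and>
      integrable lborel (\<lambda>w. g w * of_real (\<Phi> a w)) \<and> integrable lborel (\<lambda>w. g w * of_real (\<Psi> w))"
    if a: "a \<ge> 2 - c" and S: "open S" "cball 0 R \<subseteq> S" and g: "holomorphic_fun_on g S" 
      and gm[measurable]: "g \<in> borel_measurable borel" and gB: "\<And>w. w \<in> cball 0 R \<Longrightarrow> norm (g w) \<le> B" for a S g B
  proof -
    have B: "B \<ge> 0" using order_trans[OF norm_ge_zero gB[of 0]] R by simp
    have aR: "exp ((1 - a) / 2) \<le> R" unfolding Rc using a by simp
    have i1: "integrable lborel (\<lambda>w. g w * of_real (\<Phi> a w))"
    proof (rule integrable_bounded_support[of _ "B * (exp (n * a) * (3/2))" "exp ((1 - a)/2)"])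
      show "norm (g w * of_real (\<Phi> a w)) \<le> B * (exp (n * a) * (3/2))" for w
      proof (cases "\<Phi> a w = 0")
        case False
        then have "w \<in> cball 0 R" using \<Phi>0[of a w] aR by simp
        then show ?thesis
          unfolding norm_mult using gB[of w] \<Phi>b[of a w] nonneg(1)[of a w] B by (intro mult_mono) auto
      qed (use B in simp)
    qed (use \<Phi>0 in force)+
    have i2: "integrable lborel (\<lambda>w. g w * of_real (\<Psi> w))"
    proof (rule integrable_bounded_support[of _ "B * (exp (n * (1 - c)) * (3/2))" R])
      show "norm (g w * of_real (\<Psi> w)) \<le> B * (exp (n * (1 - c)) * (3/2))" for w
      proof (cases "\<Psi> w = 0")
        case False
        then have "w \<in> cball 0 R" using \<Psi>0[of w] by simp
        then show ?thesis
          unfolding norm_mult using gB[of w] \<Psi>b[of w] nonneg(2)[of w] B by (intro mult_mono) auto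
      qed (use B in simp)
    qed (use \<Psi>0 in force)+
    define U where "U = S - {0}"
    define K where "K = {w :: 'm cspace. exp (- a / 2) \<le> norm w} \<inter> cball 0 R"
    define H where "H w = complex_of_real (radial_bump n c a (ln (norm w)))" for w :: "'m cspace"
    define H' where "H' w v = complex_of_real ((v \<bullet> w) / (norm w)\<^sup>2 * radial_bump' n c a (ln (norm w)))" 
      for w v :: "'m cspace"
    have "has_bochner_integral lborel (\<lambda>x. indicator (U - {}) x *\<^sub>R
     (g x * (H' x (id x) + \<i> * H' x (cscale \<i> (id x)) + (of_real (2 * n) + \<i> * of_real 0) * H x))) 0"
    proof (rule dbar_field_integral)
      show "open U" using S by (simp add: U_def open_delete)
      show "compact K" unfolding K_def
        by (intro closed_Int_compact closed_Collect_le continuous_intros) auto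
      show "K \<subseteq> U" using S by (auto simp: K_def U_def)
      show "holomorphic_fun_on g U" by (rule holomorphic_fun_on_subset[OF g]) (auto simp: U_def)
      show "loc_lip H x" if "x \<in> U" for x unfolding H_def
      proof (intro loc_lip_of_real loc_lip_compose[of "\<lambda>w. ln (norm w)" x "radial_bump n c a"])
        show "loc_lip (\<lambda>w. ln (norm w)) x" using that
          by (intro loc_lip_compose[of norm x ln] loc_lip_norm loc_lip_ln) (auto simp: U_def)
        show "loc_lip (radial_bump n c a) (ln (norm x))"
        proof (rule loc_lip_DERIV[OF radial_bump_DERIV])
          show "continuous_on UNIV (radial_bump' n c a)"
            unfolding radial_bump'_def[abs_def] radial_bump_def[abs_def]
            by (intro continuous_intros continuous_on_compose2[OF smoothstep_continuous[of UNIV]]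
                continuous_on_compose2[OF smoothstep'_continuous[of UNIV]]) auto
        qed
      qed
      show "H x = 0" if "x \<in> U - K" for x
      proof -
        have x0: "norm x > 0" using that by (auto simp: U_def)
        from that have "norm x < exp (- a / 2) \<or> norm x > exp (c / 2)" by (auto simp: K_def Rc)
        then have "ln (norm x) < - a / 2 \<or> ln (norm x) > c / 2"
          using x0 by (metis exp_less_cancel_iff exp_ln)
        then have "a + 2 * ln (norm x) \<le> 0 \<or> c - 2 * ln (norm x) \<le> 0" by linarith
        then show ?thesis by (auto simp: H_def radial_bump_def smoothstep_eq_0)
      qed
      show "(H has_derivative H' x) (at x)" if "x \<in> U - {}" for x
      proof -
        have "((\<lambda>w. radial_bump n c a (ln (norm w))) has_derivative 
            (\<lambda>v. (v \<bullet> x) / (norm x)\<^sup>2 * radial_bump' n c a (ln (norm x)))) (at x)"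
          using has_derivative_compose[OF ln_norm_has_derivative[of x]
             radial_bump_DERIV[of n c a "ln (norm x)", unfolded has_field_derivative_def]] that
          by (simp add: U_def mult.commute)
        then show ?thesis unfolding H_def[abs_def] H'_def[abs_def]
          by (rule has_derivative_of_real)
      qed
      show "2 * n = (\<Sum>e\<in>Basis. id e \<bullet> (e::'m cspace))" using trace_id_cspace[where 'm='m] by (simp add: n_def)
      show "0 = (\<Sum>e\<in>Basis. cscale \<i> (id e) \<bullet> (e::'m cspace))" by (simp add: inner_i_cscale)
      show "linear (id :: 'm cspace \<Rightarrow> 'm cspace)" by (rule linear_id)
    qed simp_all
    moreover have "indicator (U - {}) x *\<^sub>R
     (g x * (H' x (id x) + \<i> * H' x (cscale \<i> (id x)) + (of_real (2 * n) + \<i> * of_real 0) * H x)) =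
      2 * (g x * of_real (\<Phi> a x) - g x * of_real (\<Psi> x))" for x
    proof (cases "x \<in> U")
      case True
      then have x0: "x \<noteq> 0" by (simp add: U_def)
      have "H' x (id x) + \<i> * H' x (cscale \<i> (id x)) + (of_real (2 * n) + \<i> * of_real 0) * H x
        = of_real (radial_bump' n c a (ln (norm x)) + 2 * n * radial_bump n c a (ln (norm x)))"
        using x0 by (simp add: H'_def H_def inner_i_cscale dot_square_norm)
      also have "\<dots> = 2 * (of_real (\<Phi> a x) - of_real (\<Psi> x))"
        unfolding radial_bump'_eq[OF a] using x0 by (simp add: \<Phi>_def \<Psi>_def ring_weight_def n_def)
      finally have eq: "H' x (id x) + \<i> * H' x (cscale \<i> (id x)) + (of_real (2 * n) + \<i> * of_real 0) * H x
        = 2 * (of_real (\<Phi> a x) - of_real (\<Psi> x))" .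
      show ?thesis unfolding eq using True by (simp add: algebra_simps)
    next
      case False
      then have "\<Psi> x = 0" "\<Phi> a x = 0"
      proof -
        from False subsetD[OF S(2), of x] have "x = 0 \<or> norm x > R" by (auto simp: U_def)
        moreover have "exp ((1 - a) / 2) \<le> R" unfolding Rc using a by simp
        ultimately have nx: "\<not> (x \<noteq> 0 \<and> norm x < R)" "\<not> (x \<noteq> 0 \<and> norm x < exp ((1 - a) / 2))" by auto
        have z: "\<Psi> 0 = 0" "\<Phi> a 0 = 0" by (simp_all add: \<Phi>_def \<Psi>_def ring_weight_def)
        show "\<Psi> x = 0" using nx(1) \<Psi>0[of x] z(1) by metis
        show "\<Phi> a x = 0" using nx(2) \<Phi>0[of a x] z(2) by metis
      qed
      then show ?thesis using False by simp
    qed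
    ultimately have "has_bochner_integral lborel (\<lambda>x. 2 * (g x * of_real (\<Phi> a x) - g x * of_real (\<Psi> x))) 0" by simp
    then have "(LINT x|lborel. 2 * (g x * of_real (\<Phi> a x) - g x * of_real (\<Psi> x))) = 0" by (simp add: has_bochner_integral_iff)
    then have "(LINT x|lborel. g x * of_real (\<Phi> a x)) - (LINT x|lborel. g x * of_real (\<Psi> x)) = 0"
      using i1 i2 by simp
    then show ?thesis using i1 i2 by simp
  qed
  define c0 where "c0 = (LINT w|lborel. \<Psi> w)"
  have one: "integrable lborel (\<Phi> a)" "(LINT w|lborel. \<Phi> a w) = c0" "integrable lborel \<Psi>" if "a \<ge> 2 - c" for a
  proof -
    have *: "(LINT w|lborel. 1 * complex_of_real (\<Phi> a w)) = (LINT w|lborel. 1 * complex_of_real (\<Psi> w)) \<and>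
      integrable lborel (\<lambda>w. 1 * complex_of_real (\<Phi> a w)) \<and> integrable lborel (\<lambda>w. 1 * complex_of_real (\<Psi> w))"
      by (rule key[OF that, of UNIV "\<lambda>_. 1" 1]) (auto simp: holomorphic_fun_on_const)
    then show "integrable lborel (\<Phi> a)" "integrable lborel \<Psi>" by (auto simp: complex_of_real_integrable_eq)
    with * show "(LINT w|lborel. \<Phi> a w) = c0" by (simp add: c0_def)
  qed
  have \<Psi>i: "integrable lborel \<Psi>" by (rule one(3)[OF order_refl])
  have c0: "c0 > 0" unfolding c0_def
  proof (rule integral_lborel_pos[OF \<Psi>i nonneg(2)])
    define T where "T = {w :: 'm cspace. exp ((c - 1)/2) < norm w} \<inter> {w. norm w < exp (c/2)}"
    show "open T" unfolding T_def by (intro open_Int open_Collect_less continuous_intros)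
    show "T \<noteq> {}"
    proof -
      obtain w :: "'m cspace" where "norm w = exp ((c - 1/2)/2)" using vector_choose_size[OF exp_ge_zero] by blast
      then have "w \<in> T" by (simp add: T_def)
      then show ?thesis by blast
    qed
    fix w assume w: "w \<in> T"
    then have w0: "norm w > 0" unfolding T_def by (smt (verit) Int_iff exp_gt_zero mem_Collect_eq)
    have "(c - 1) / 2 < ln (norm w)" "ln (norm w) < c / 2"
      using w w0 ln_less_cancel_iff[of "exp ((c - 1) / 2)" "norm w"] ln_less_cancel_iff[of "norm w" "exp (c / 2)"]
      unfolding T_def by auto
    then have "smoothstep' (c - 2 * ln (norm w)) > 0" by (subst smoothstep'_eq) auto
    then show "\<Psi> w > 0" using w0 by (auto simp: \<Psi>_def ring_weight_def)
  qed
  define C where "C = exp (n * (1 - c)) * (3/2) / c0"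
  show ?thesis
  proof (intro exI[of _ C] conjI allI impI)
    show "C > 0" using c0 by (simp add: C_def)
    fix f :: "'m cspace \<Rightarrow> complex" and S z
    assume S: "open S" and f: "holomorphic_fun_on f S" and z: "cball z R \<subseteq> S"
    have cf: "continuous_on (cball z R) f" using holomorphic_fun_on_continuous[OF f] z continuous_on_subset by blast
    have "compact (f ` cball z R)" by (rule compact_continuous_image[OF cf]) auto
    then obtain B where B: "\<And>y. y \<in> cball z R \<Longrightarrow> norm (f y) \<le> B"
      by (meson bounded_iff compact_imp_bounded image_eqI)
    define S' where "S' = (\<lambda>w. z + w) -` S"
    have S': "open S'" unfolding S'_def by (intro open_vimage S continuous_intros)
    have S'R: "cball 0 R \<subseteq> S'"
    proof
      fix w assume "w \<in> cball (0 :: 'm cspace) R"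
      then have "z + w \<in> cball z R" by (simp add: dist_norm)
      then have "z + w \<in> S" using z by blast
      then show "w \<in> S'" by (simp add: S'_def)
    qed
    have hol: "holomorphic_fun_on (\<lambda>w. f (z + w)) S'"
      unfolding holomorphic_fun_on_def
    proof
      fix w assume "w \<in> S'"
      then have "z + w \<in> S" by (simp add: S'_def)
      then obtain D where D: "(f has_derivative D) (at (z + w))" "\<And>c v. D (cscale c v) = c * D v"
        using holomorphic_fun_onE[OF f] by metis
      have "((\<lambda>w. z + w) has_derivative (\<lambda>v. v)) (at w)" by (auto intro!: derivative_eq_intros)
      from has_derivative_compose[OF this D(1)] D(2)
      show "\<exists>D. ((\<lambda>w. f (z + w)) has_derivative D) (at w) \<and> (\<forall>c v. D (cscale c v) = c * D v)" by blast
    qed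
    define g where "g w = (if w \<in> S' then f (z + w) else 0)" for w
    have gh: "holomorphic_fun_on g S'"
      by (rule holomorphic_fun_on_cong[OF S' _ hol]) (simp add: g_def)
    have gm[measurable]: "g \<in> borel_measurable borel"
      unfolding g_def
      by (intro borel_measurable_continuous_on_if holomorphic_fun_on_continuous[OF hol] borel_open S') auto
    have gB: "norm (g w) \<le> B" if "w \<in> cball 0 R" for w
      using B[of "z + w"] that subsetD[OF S'R that] by (auto simp: g_def dist_norm)
    note I = key[OF _ S' S'R gh gm gB]
    define I2 where "I2 = (LINT w|lborel. g w * of_real (\<Psi> w))"
    have "norm (I2 - f z * of_real c0) \<le> \<epsilon> * c0" if eps: "\<epsilon> > 0" for \<epsilon>
    proof -
      have "isCont f z" using holomorphic_fun_on_continuous[OF f] S z R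
        by (meson centre_in_cball continuous_on_eq_continuous_at less_imp_le subsetD)
      then obtain d where d: "d > 0" "\<And>y. dist y z < d \<Longrightarrow> dist (f y) (f z) < \<epsilon>"
        using eps unfolding continuous_at_eps_delta by metis
      define a where "a = max (2 - c) (1 - 2 * ln (min d R))"
      have a: "a \<ge> 2 - c" by (simp add: a_def)
      have "(1 - a) / 2 \<le> ln (min d R)" by (simp add: a_def)
      then have ed: "exp ((1 - a) / 2) \<le> min d R" using d R by (metis exp_le_cancel_iff exp_ln min_less_iff_conj)
      have i3: "integrable lborel (\<lambda>w. f z * of_real (\<Phi> a w))"
        using one(1)[OF a] by (intro integrable_mult_right) (simp add: complex_of_real_integrable_eq)
      have "I2 - f z * of_real c0 = (LINT w|lborel. g w * of_real (\<Phi> a w)) - (LINT w|lborel. f z * of_real (\<Phi> a w))"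
        using I[OF a] one(2)[OF a] by (simp add: I2_def)
      also have "\<dots> = (LINT w|lborel. (g w - f z) * of_real (\<Phi> a w))"
        using I[OF a] i3 by (simp add: left_diff_distrib)
      also have "norm \<dots> \<le> (LINT w|lborel. \<epsilon> * \<Phi> a w)"
      proof (rule order_trans[OF integral_norm_bound integral_mono])
        show "integrable lborel (\<lambda>w. norm ((g w - f z) * of_real (\<Phi> a w)))"
          using I[OF a] i3 by (intro integrable_norm) (simp add: left_diff_distrib)
        show "integrable lborel (\<lambda>w. \<epsilon> * \<Phi> a w)" using one(1)[OF a] by simp
        show "norm ((g w - f z) * of_real (\<Phi> a w)) \<le> \<epsilon> * \<Phi> a w" for w
        proof (cases "\<Phi> a w = 0")
          case False
          then have "norm w < min d R" using \<Phi>0[of a w] ed by linarith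
          then have "norm (g w - f z) \<le> \<epsilon>" using d(2)[of "z + w"] subsetD[OF S'R, of w] by (auto simp: g_def dist_norm)
          then show ?thesis using nonneg(1)[of a w] by (simp add: norm_mult mult_right_mono)
        qed simp
      qed
      also have "\<dots> = \<epsilon> * c0" using one(2)[OF a] by simp
      finally show ?thesis .
    qed
    then have "norm (I2 - f z * of_real c0) \<le> 0 + \<epsilon>" if "\<epsilon> > 0" for \<epsilon>
      using that c0 by (metis add_0 divide_pos_pos nonzero_eq_divide_eq order_less_irrefl)
    then have "norm (I2 - f z * of_real c0) \<le> 0" by (rule field_le_epsilon)
    then have "norm (f z) * c0 = norm I2" using c0 by (simp add: norm_mult)
    also have "\<dots> \<le> (LINT w|lborel. exp (n * (1 - c)) * (3/2) * (indicator (cball 0 R) w * norm (f (z + w))))"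
      unfolding I2_def
    proof (rule order_trans[OF integral_norm_bound integral_mono])
      show "integrable lborel (\<lambda>w. norm (g w * of_real (\<Psi> w)))" using I[OF order_refl] by auto
      have "B \<ge> 0" using order_trans[OF norm_ge_zero gB[of 0]] R by simp
      then have "integrable lborel (\<lambda>w. indicator (cball 0 R) w * norm (g w))"
        by (intro integrable_bounded_support[of _ B R]) (use gB in \<open>auto simp: indicator_def\<close>)
      moreover have "indicator (cball 0 R) w * norm (g w) = indicator (cball 0 R) w * norm (f (z + w))" for w
        using subsetD[OF S'R, of w] by (auto simp: g_def indicator_def)
      ultimately show "integrable lborel (\<lambda>w. exp (n * (1 - c)) * (3/2) * (indicator (cball 0 R) w * norm (f (z + w))))"
        by simp
      show "norm (g w * of_real (\<Psi> w)) \<le> exp (n * (1 - c)) * (3/2) * (indicator (cball 0 R) w * norm (f (z + w)))" for w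
      proof (cases "w \<in> cball 0 R")
        case True
        then show ?thesis
          using mult_right_mono[OF \<Psi>b[of w], of "norm (g w)"] nonneg(2)[of w] subsetD[OF S'R True]
          by (auto simp: g_def norm_mult mult.commute indicator_def)
      next
        case False
        then have "\<Psi> w = 0" using \<Psi>0[of w] by force
        then show ?thesis by simp
      qed
    qed
    also have "\<dots> = exp (n * (1 - c)) * (3/2) * (LINT w|lborel. indicator (cball 0 R) w * norm (f (z + w)))"
      by (rule integral_mult_right_zero)
    finally show "norm (f z) \<le> C * (LINT w|lborel. indicator (cball 0 R) w * norm (f (z + w)))"
      using c0 by (simp add: C_def field_simps)
  qed
qed

section \<open>Projection onto closed subspaces of square-integrable functions\<close>

definition L2 :: "'a measure \<Rightarrow> ('a \<Rightarrow> complex) set" where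
  "L2 M = {f \<in> borel_measurable M. integrable M (\<lambda>x. (norm (f x))\<^sup>2)}"

definition sqint :: "'a measure \<Rightarrow> ('a \<Rightarrow> complex) \<Rightarrow> real" where
  "sqint M f = (LINT x|M. (norm (f x))\<^sup>2)"

lemma sqint_nonneg: "sqint M f \<ge> 0" by (simp add: sqint_def integral_nonneg_AE)

lemma L2_D: "f \<in> L2 M \<Longrightarrow> f \<in> borel_measurable M" "f \<in> L2 M \<Longrightarrow> integrable M (\<lambda>x. (norm (f x))\<^sup>2)"
  by (auto simp: L2_def)

lemma norm_add_sq_le: "(norm (a + b :: complex))\<^sup>2 \<le> 2 * (norm a)\<^sup>2 + 2 * (norm b)\<^sup>2"
proof -
  have "(norm (a + b))\<^sup>2 \<le> (norm a + norm b)\<^sup>2" by (intro power_mono norm_triangle_ineq) auto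
  also have "\<dots> \<le> 2 * (norm a)\<^sup>2 + 2 * (norm b)\<^sup>2"
    using sum_squares_bound[of "norm a" "norm b"] by (simp add: power2_sum)
  finally show ?thesis .
qed

lemma L2_add: "f \<in> L2 M \<Longrightarrow> g \<in> L2 M \<Longrightarrow> (\<lambda>x. f x + g x) \<in> L2 M"
proof -
  assume fg: "f \<in> L2 M" "g \<in> L2 M"
  note [measurable] = L2_D(1)[OF fg(1)] L2_D(1)[OF fg(2)]
  have "integrable M (\<lambda>x. (norm (f x + g x))\<^sup>2)"
    by (rule Bochner_Integration.integrable_bound[of _ "\<lambda>x. 2 * (norm (f x))\<^sup>2 + 2 * (norm (g x))\<^sup>2"])
      (use L2_D(2)[OF fg(1)] L2_D(2)[OF fg(2)] norm_add_sq_le in \<open>auto intro!: AE_I2\<close>)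
  then show ?thesis by (simp add: L2_def)
qed

lemma L2_mult: "f \<in> L2 M \<Longrightarrow> (\<lambda>x. c * f x) \<in> L2 M"
  by (auto simp: L2_def norm_mult power_mult_distrib)

lemma L2_uminus: "f \<in> L2 M \<Longrightarrow> (\<lambda>x. - f x) \<in> L2 M"
  by (auto simp: L2_def)

lemma L2_diff: "f \<in> L2 M \<Longrightarrow> g \<in> L2 M \<Longrightarrow> (\<lambda>x. f x - g x) \<in> L2 M"
  using L2_add[of f M "\<lambda>x. - g x"] L2_uminus[of g M] by simp

lemma L2_cnj: "f \<in> L2 M \<Longrightarrow> (\<lambda>x. cnj (f x)) \<in> L2 M"
  by (auto simp: L2_def)

lemma L2_inner_integrable: "f \<in> L2 M \<Longrightarrow> g \<in> L2 M \<Longrightarrow> integrable M (\<lambda>x. f x * g x)"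
proof -
  assume fg: "f \<in> L2 M" "g \<in> L2 M"
  note [measurable] = L2_D(1)[OF fg(1)] L2_D(1)[OF fg(2)]
  show ?thesis
  proof (rule Bochner_Integration.integrable_bound[of _ "\<lambda>x. (norm (f x))\<^sup>2 + (norm (g x))\<^sup>2"])
    show "AE x in M. norm (f x * g x) \<le> norm ((norm (f x))\<^sup>2 + (norm (g x))\<^sup>2)"
    proof (intro AE_I2)
      fix x
      have "2 * (norm (f x) * norm (g x)) \<le> (norm (f x))\<^sup>2 + (norm (g x))\<^sup>2"
        using sum_squares_bound[of "norm (f x)" "norm (g x)"] by (simp add: mult.assoc)
      moreover have "0 \<le> norm (f x) * norm (g x)" by simp
      ultimately have "norm (f x) * norm (g x) \<le> (norm (f x))\<^sup>2 + (norm (g x))\<^sup>2" by linarith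
      then show "norm (f x * g x) \<le> norm ((norm (f x))\<^sup>2 + (norm (g x))\<^sup>2)" by (simp add: norm_mult)
    qed
  qed (use L2_D(2)[OF fg(1)] L2_D(2)[OF fg(2)] in auto)
qed

lemma norm_diff_square_complex: "(norm (a - b :: complex))\<^sup>2 = (norm a)\<^sup>2 + (norm b)\<^sup>2 - 2 * Re (a * cnj b)"
  unfolding cmod_power2 by (simp add: power2_eq_square algebra_simps)

lemma sqint_diff: 
  assumes "f \<in> L2 M" "g \<in> L2 M"
  shows "sqint M (\<lambda>x. f x - g x) = sqint M f + sqint M g - 2 * Re (LINT x|M. f x * cnj (g x))"
proof -
  have i: "integrable M (\<lambda>x. f x * cnj (g x))" by (rule L2_inner_integrable[OF assms(1) L2_cnj[OF assms(2)]])
  define r where "r x = Re (f x * cnj (g x))" for x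
  have ri: "integrable M r" unfolding r_def[abs_def] using i by (rule integrable_Re)
  have rI: "(LINT x|M. r x) = Re (LINT x|M. f x * cnj (g x))"
    unfolding r_def by (rule integral_Re[OF i])
  show ?thesis
    unfolding sqint_def norm_diff_square_complex r_def[symmetric] rI[symmetric]
    using L2_D(2)[OF assms(1)] L2_D(2)[OF assms(2)] ri by simp
qed

lemma sqint_mult: "sqint M (\<lambda>x. c * f x) = (norm c)\<^sup>2 * sqint M f"
  by (simp add: sqint_def norm_mult power_mult_distrib)

lemma cauchy_schwarz_L2:
  assumes "f \<in> L2 M" "g \<in> L2 M"
  shows "(LINT x|M. norm (f x * g x)) \<le> sqrt (sqint M f) * sqrt (sqint M g)"
proof -
  have "(LINT x|M. norm (f x * g x)) \<le> (LINT x|M. norm (f x) powr 2) powr (1/2) * (LINT x|M. norm (g x) powr 2) powr (1/2)"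
    by (rule holder(2)) (use assms in \<open>auto simp: L2_def\<close>)
  then show ?thesis by (simp add: sqint_def powr_half_sqrt integral_nonneg_AE)
qed

text \<open>The classical proof with a minimizing sequence and the parallelogram law. Completeness is asked of V only in the form
  of almost everywhere limits of Cauchy sequences, which is what holomorphic functions provide.\<close>

lemma L2_projection_exists:
  assumes V: "V \<subseteq> L2 M" "V \<noteq> {}" "\<And>g h c. g \<in> V \<Longrightarrow> h \<in> V \<Longrightarrow> (\<lambda>x. g x + c * h x) \<in> V"
    and closed: "\<And>g. (\<And>k. g k \<in> V) \<Longrightarrow> (\<And>e. e > 0 \<Longrightarrow> \<exists>N. \<forall>k\<ge>N. \<forall>l\<ge>N. sqint M (\<lambda>x. g k x - g l x) < e)
        \<Longrightarrow> \<exists>h\<in>V. AE x in M. (\<lambda>k. g k x) \<longlonglongrightarrow> h x"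
    and f: "f \<in> L2 M"
  obtains g where "g \<in> V" "\<And>h. h \<in> V \<Longrightarrow> (LINT x|M. (f x - g x) * cnj (h x)) = 0"
proof -
  define d where "d = (INF g\<in>V. sqint M (\<lambda>x. f x - g x))"
  have bdd: "bdd_below ((\<lambda>g. sqint M (\<lambda>x. f x - g x)) ` V)"
    by (rule bdd_belowI[of _ 0]) (auto simp: sqint_nonneg)
  have dle: "d \<le> sqint M (\<lambda>x. f x - g x)" if "g \<in> V" for g
    unfolding d_def by (rule cINF_lower[OF bdd that])
  have "\<exists>g\<in>V. sqint M (\<lambda>x. f x - g x) < d + 1 / (real k + 1)" for k
    using cINF_less_iff[OF V(2) bdd, of "d + 1 / (real k + 1)"] unfolding d_def by simp
  then obtain g where g: "\<And>k. g k \<in> V" "\<And>k. sqint M (\<lambda>x. f x - g k x) < d + 1 / (real k + 1)" by metis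
  have gL: "g k \<in> L2 M" for k using g(1) V(1) by blast
  have cau: "sqint M (\<lambda>x. g k x - g l x) \<le> 2 / (real k + 1) + 2 / (real l + 1)" for k l
  proof -
    define m where "m x = (1/2) * g k x + (1/2) * g l x" for x
    have "(\<lambda>x. (0 * g k x + (1/2) * g k x) + (1/2) * g l x) \<in> V"
    proof -
      have "(\<lambda>x. g k x + (-1) * g k x) \<in> V" by (rule V(3)[OF g(1) g(1)])
      then have "(\<lambda>x. (g k x + (-1) * g k x) + (1/2) * g k x) \<in> V" by (rule V(3)[OF _ g(1)])
      then have "(\<lambda>x. ((g k x + (-1) * g k x) + (1/2) * g k x) + (1/2) * g l x) \<in> V" by (rule V(3)[OF _ g(1)])
      then show ?thesis by simp
    qed
    then have mV: "m \<in> V" by (simp add: m_def[abs_def])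
    have par: "(norm (a - b))\<^sup>2 + 4 * (norm (w - ((1/2) * a + (1/2) * b)))\<^sup>2 = 2 * (norm (w - a))\<^sup>2 + 2 * (norm (w - b))\<^sup>2" for a b w :: complex
      unfolding cmod_power2 by (simp add: power2_eq_square field_simps)
    have i: "integrable M (\<lambda>x. (norm (f x - g k x))\<^sup>2)" "integrable M (\<lambda>x. (norm (f x - g l x))\<^sup>2)" 
       "integrable M (\<lambda>x. (norm (f x - m x))\<^sup>2)" "integrable M (\<lambda>x. (norm (g k x - g l x))\<^sup>2)"
      using L2_diff[OF f gL] L2_diff[OF gL gL] L2_diff[OF f, of m] mV V(1) by (auto simp: L2_def)
    have "sqint M (\<lambda>x. g k x - g l x) + 4 * sqint M (\<lambda>x. f x - m x) = 
       (LINT x|M. (norm (g k x - g l x))\<^sup>2 + 4 * (norm (f x - m x))\<^sup>2)"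
      using i by (simp add: sqint_def)
    also have "\<dots> = (LINT x|M. 2 * (norm (f x - g k x))\<^sup>2 + 2 * (norm (f x - g l x))\<^sup>2)"
      unfolding m_def par ..
    also have "\<dots> = 2 * sqint M (\<lambda>x. f x - g k x) + 2 * sqint M (\<lambda>x. f x - g l x)"
      using i by (simp add: sqint_def)
    finally show ?thesis using dle[OF mV] g(2)[of k] g(2)[of l] by simp
  qed
  obtain h where h: "h \<in> V" "AE x in M. (\<lambda>k. g k x) \<longlonglongrightarrow> h x"
  proof -
    have "\<exists>N. \<forall>k\<ge>N. \<forall>l\<ge>N. sqint M (\<lambda>x. g k x - g l x) < e" if e: "e > 0" for e
    proof -
      obtain N where N: "4 / e < real N" using reals_Archimedean2 by blast
      have "sqint M (\<lambda>x. g k x - g l x) < e" if "k \<ge> N" "l \<ge> N" for k l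
      proof -
        have "2 / (real k + 1) < e / 2" "2 / (real l + 1) < e / 2"
          using N that e by (auto simp: field_simps) (smt (verit) mult_left_mono of_nat_mono)+
        then show ?thesis using cau[of k l] by linarith
      qed
      then show ?thesis by blast
    qed
    from closed[OF g(1) this] show thesis using that by blast
  qed
  have hL: "h \<in> L2 M" using h(1) V(1) by blast
  have le: "sqint M (\<lambda>x. f x - h x) \<le> d"
  proof -
    note [measurable] = L2_D(1)[OF f] L2_D(1)[OF gL] L2_D(1)[OF hL]
    have eq: "(\<integral>\<^sup>+x. ennreal ((norm (f x - u x))\<^sup>2) \<partial>M) = ennreal (sqint M (\<lambda>x. f x - u x))" if "u \<in> L2 M" for u
      unfolding sqint_def using L2_D(2)[OF L2_diff[OF f that]] by (intro nn_integral_eq_integral) auto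
    have "(\<integral>\<^sup>+x. ennreal ((norm (f x - h x))\<^sup>2) \<partial>M) = (\<integral>\<^sup>+x. liminf (\<lambda>k. ennreal ((norm (f x - g k x))\<^sup>2)) \<partial>M)"
    proof (rule nn_integral_cong_AE)
      show "AE x in M. ennreal ((norm (f x - h x))\<^sup>2) = liminf (\<lambda>k. ennreal ((norm (f x - g k x))\<^sup>2))"
        using h(2)
      proof eventually_elim
        case (elim x)
        have "(\<lambda>k. ennreal ((norm (f x - g k x))\<^sup>2)) \<longlonglongrightarrow> ennreal ((norm (f x - h x))\<^sup>2)"
          by (intro tendsto_intros tendsto_ennrealI elim)
        from lim_imp_Liminf[OF _ this] show ?case by simp
      qed
    qed
    also have "\<dots> \<le> liminf (\<lambda>k. \<integral>\<^sup>+x. ennreal ((norm (f x - g k x))\<^sup>2) \<partial>M)"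
      by (rule nn_integral_liminf) measurable
    also have "\<dots> \<le> liminf (\<lambda>k. ennreal (d + 1 / (real (Suc k))))"
    proof (rule Liminf_mono[OF always_eventually], rule allI)
      fix k show "(\<integral>\<^sup>+x. ennreal ((norm (f x - g k x))\<^sup>2) \<partial>M) \<le> ennreal (d + 1 / (real (Suc k)))"
        unfolding eq[OF gL] using g(2)[of k] by (intro ennreal_leI) (simp add: add.commute)
    qed
    also have "\<dots> = ennreal (d + 0)"
    proof (rule lim_imp_Liminf)
      show "(\<lambda>k. ennreal (d + 1 / (real (Suc k)))) \<longlonglongrightarrow> ennreal (d + 0)"
        by (intro tendsto_intros tendsto_ennrealI LIMSEQ_Suc[OF lim_1_over_n])
    qed simp
    finally have "ennreal (sqint M (\<lambda>x. f x - h x)) \<le> ennreal d" by (simp add: eq[OF hL])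
    moreover have "d \<ge> 0" unfolding d_def by (rule cINF_greatest[OF V(2)]) (simp add: sqint_nonneg)
    ultimately show ?thesis by simp
  qed
  have "(LINT x|M. (f x - h x) * cnj (u x)) = 0" if u: "u \<in> V" for u
  proof -
    have uL: "u \<in> L2 M" using u V(1) by blast
    define a where "a = (LINT x|M. (f x - h x) * cnj (u x))"
    have fh: "(\<lambda>x. f x - h x) \<in> L2 M" by (rule L2_diff[OF f hL])
    have ineq: "2 * (norm a)\<^sup>2 \<le> t * ((norm a)\<^sup>2 * sqint M u)" if t: "t > 0" for t :: real
    proof -
      define c where "c = of_real t * a"
      have "d \<le> sqint M (\<lambda>x. f x - (h x + c * u x))" by (rule dle[OF V(3)[OF h(1) u]])
      also have "\<dots> = sqint M (\<lambda>x. (f x - h x) - c * u x)" by (simp add: algebra_simps)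
      also have "\<dots> = sqint M (\<lambda>x. f x - h x) + (norm c)\<^sup>2 * sqint M u - 2 * Re (LINT x|M. (f x - h x) * cnj (c * u x))"
        by (subst sqint_diff[OF fh L2_mult[OF uL]]) (simp add: sqint_mult)
      also have "(LINT x|M. (f x - h x) * cnj (c * u x)) = cnj c * a"
        by (simp add: a_def mult.left_commute)
      also have "Re (cnj c * a) = t * (norm a)\<^sup>2"
      proof -
        have "cnj c * a = of_real (t * (norm a)\<^sup>2)"
          using complex_norm_square[of a] by (simp add: c_def mult_ac)
        then show ?thesis by (simp only: Re_complex_of_real)
      qed
      finally have "2 * (t * (norm a)\<^sup>2) \<le> (norm c)\<^sup>2 * sqint M u" using le by linarith
      also have "(norm c)\<^sup>2 = t\<^sup>2 * (norm a)\<^sup>2" by (simp add: c_def norm_mult power_mult_distrib)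
      finally have "t * (2 * (norm a)\<^sup>2) \<le> t * (t * ((norm a)\<^sup>2 * sqint M u))" by (simp add: power2_eq_square mult_ac)
      then show ?thesis using t by simp
    qed
    have "norm a = 0"
    proof (rule ccontr)
      assume "norm a \<noteq> 0"
      then have a: "(norm a)\<^sup>2 > 0" by simp
      have "2 * (norm a)\<^sup>2 \<le> (1 / (sqint M u + 1)) * ((norm a)\<^sup>2 * sqint M u)"
        by (rule ineq) (use sqint_nonneg[of M u] in simp)
      also have "\<dots> = (norm a)\<^sup>2 * (sqint M u / (sqint M u + 1))" by simp
      also have "\<dots> \<le> (norm a)\<^sup>2 * 1" using sqint_nonneg[of M u] by (intro mult_left_mono) auto
      finally show False using a by simp
    qed
    then show ?thesis by (simp add: a_def)
  qed
  then show thesis using that[OF h(1)] by blast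
qed

section \<open>The Bergman projection\<close>

lemma Lp_2_eq_L2: "Lp \<Omega> 2 = L2 (lebesgue_on \<Omega>)"
  by (simp add: Lp_def L2_def)

lemma holomorphic_fun_measurable:
  assumes "open \<Omega>" "holomorphic_fun_on f \<Omega>"
  shows "f \<in> borel_measurable (lebesgue_on \<Omega>)"
  by (rule continuous_imp_measurable_on_sets_lebesgue[OF holomorphic_fun_on_continuous[OF assms(2)]])
    (use assms(1) in auto)

lemma integral_lebesgue_on_eq:
  fixes u :: "'a::euclidean_space \<Rightarrow> 'b::{banach, second_countable_topology}"
  assumes "\<Omega> \<in> sets lebesgue" "u \<in> borel_measurable lborel" "\<And>x. x \<notin> \<Omega> \<Longrightarrow> u x = 0"
  shows "(LINT x|lebesgue_on \<Omega>. u x) = (LINT x|lborel. u x)"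
proof -
  have "(LINT x|lebesgue_on \<Omega>. u x) = (LINT x|lebesgue. indicator \<Omega> x *\<^sub>R u x)"
    by (rule integral_restrict_space) (use assms(1) in auto)
  also have "(\<lambda>x. indicator \<Omega> x *\<^sub>R u x) = u" using assms(3) by (auto simp: indicator_def fun_eq_iff)
  also have "(LINT x|lebesgue. u x) = (LINT x|lborel. u x)" by (rule integral_completion[OF assms(2)])
  finally show ?thesis .
qed

lemma bergman_pointwise_estimate:
  fixes R :: real
  assumes R: "R > 0"
  shows "\<exists>C>0. \<forall>f \<Omega> z. open \<Omega> \<longrightarrow> f \<in> bergman_space \<Omega> \<longrightarrow> cball z R \<subseteq> \<Omega> \<longrightarrow>
    norm (f (z :: 'm::finite cspace)) \<le> C * sqrt (sqint (lebesgue_on \<Omega>) f)"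
proof -
  obtain C where C: "C > 0" "\<And>f S z. open S \<Longrightarrow> holomorphic_fun_on f S \<Longrightarrow> cball z R \<subseteq> S \<Longrightarrow>
    norm (f (z :: 'm cspace)) \<le> C * (LINT w|lborel. indicator (cball 0 R) w * norm (f (z + w)))"
    using interior_estimate[OF R, where 'm='m] by blast
  define V where "V = unit_ball_vol (real DIM('m cspace)) * R ^ DIM('m cspace)"
  have V: "V > 0" unfolding V_def using R by (intro mult_pos_pos unit_ball_vol_pos zero_less_power) auto
  show ?thesis
  proof (intro exI[of _ "C * sqrt V"] conjI allI impI)
    show "C * sqrt V > 0" using C(1) V by simp
    fix f and \<Omega> and z :: "'m cspace" assume \<Omega>: "open \<Omega>" and f: "f \<in> bergman_space \<Omega>" and z: "cball z R \<subseteq> \<Omega>"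
    from f have hol: "holomorphic_fun_on f \<Omega>" and fL: "f \<in> L2 (lebesgue_on \<Omega>)"
      by (auto simp: bergman_space_def Lp_2_eq_L2)
    define u where "u x = indicator (cball z R) x * norm (f x)" for x
    have cf: "continuous_on (cball z R) (\<lambda>x. norm (f x))"
      by (intro continuous_on_norm continuous_on_subset[OF holomorphic_fun_on_continuous[OF hol] z])
    have um: "u \<in> borel_measurable borel"
      using borel_measurable_continuous_on_indicator[OF _ cf] unfolding u_def by simp
    define v where "v = (indicator (cball z R) :: 'm cspace \<Rightarrow> complex)"
    have vm: "v \<in> borel_measurable (lebesgue_on \<Omega>)" unfolding v_def
      by (intro borel_measurable_indicator) (use z in \<open>auto simp: sets_restrict_space_iff \<Omega> borel_open image_iff\<close>)
    have ind_eq: "(norm (v x))\<^sup>2 = indicator (cball z R) x" for x by (simp add: v_def indicator_def)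
    have i1: "integrable lebesgue (\<lambda>x. indicator (cball z R) x :: real)"
      by (intro integrable_real_indicator) (use emeasure_lborel_cball_finite[of z R] in auto)
    have cI: "(LINT x|lborel. indicator (cball z R) x :: real) = V"
      using content_cball[of R z] R by (simp add: V_def measure_def)
    have "integrable (lebesgue_on \<Omega>) (\<lambda>x. indicator (cball z R) x :: real)"
    proof (subst integrable_restrict_space)
      show "integrable lebesgue (\<lambda>x. indicator \<Omega> x *\<^sub>R (indicator (cball z R) x :: real))"
        using i1 by (rule integrable_mult_indicator[rotated]) (use \<Omega> in auto)
    qed (use \<Omega> in auto)
    then have vL: "v \<in> L2 (lebesgue_on \<Omega>)" using vm by (simp add: L2_def ind_eq)
    have sv: "sqint (lebesgue_on \<Omega>) v = V"
      unfolding sqint_def ind_eq cI[symmetric]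
      by (rule integral_lebesgue_on_eq) (use \<Omega> z in \<open>auto simp: indicator_def\<close>)
    have "(LINT w|lborel. indicator (cball 0 R) w * norm (f (z + w))) = (LINT w|lborel. u (z + w))"
      by (intro Bochner_Integration.integral_cong) (auto simp: u_def indicator_def dist_norm)
    also have "\<dots> = (LINT x|distr lborel borel ((+) z). u x)"
      by (rule integral_distr[symmetric]) (use um in auto)
    also have "\<dots> = (LINT x|lborel. u x)" by (simp add: lborel_distr_plus)
    also have "\<dots> = (LINT x|lebesgue_on \<Omega>. u x)"
    proof (rule integral_lebesgue_on_eq[symmetric])
      show "u \<in> borel_measurable lborel" using um by simp
    qed (use \<Omega> z in \<open>auto simp: u_def indicator_def\<close>)
    also have "\<dots> = (LINT x|lebesgue_on \<Omega>. norm (f x * v x))"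
      by (intro Bochner_Integration.integral_cong) (auto simp: u_def v_def norm_mult indicator_def)
    also have "\<dots> \<le> sqrt (sqint (lebesgue_on \<Omega>) f) * sqrt (sqint (lebesgue_on \<Omega>) v)"
      by (rule cauchy_schwarz_L2[OF fL vL])
    finally have "(LINT w|lborel. indicator (cball 0 R) w * norm (f (z + w))) \<le> sqrt V * sqrt (sqint (lebesgue_on \<Omega>) f)"
      by (simp add: sv mult.commute)
    from order_trans[OF C(2)[OF \<Omega> hol z] mult_left_mono[OF this, of C]] C(1)
    show "norm (f z) \<le> C * sqrt V * sqrt (sqint (lebesgue_on \<Omega>) f)" by (simp add: mult.assoc)
  qed
qed

lemma bergman_space_lincomb:
  assumes "g \<in> bergman_space \<Omega>" "h \<in> bergman_space \<Omega>"
  shows "(\<lambda>x. g x + c * h x) \<in> bergman_space \<Omega>"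
  using assms unfolding bergman_space_def Lp_2_eq_L2
  by (auto intro!: L2_add L2_mult holomorphic_fun_on_add holomorphic_fun_on_mult holomorphic_fun_on_const)

lemma bergman_space_diff:
  assumes "g \<in> bergman_space \<Omega>" "h \<in> bergman_space \<Omega>"
  shows "(\<lambda>x. g x - h x) \<in> bergman_space \<Omega>"
  using bergman_space_lincomb[OF assms, of "-1"] by simp

text \<open>A Cauchy sequence converges locally uniformly by the pointwise estimate, and the Cauchy estimates carry
  complex differentiability over to the limit.\<close>

lemma bergman_space_closed:
  fixes g :: "nat \<Rightarrow> 'm::finite cspace \<Rightarrow> complex"
  assumes \<Omega>: "open \<Omega>" and g: "\<And>k. g k \<in> bergman_space \<Omega>"
    and cau: "\<And>e. e > 0 \<Longrightarrow> \<exists>N. \<forall>k\<ge>N. \<forall>l\<ge>N. sqint (lebesgue_on \<Omega>) (\<lambda>x. g k x - g l x) < e"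
  obtains h where "h \<in> bergman_space \<Omega>" "\<And>z. z \<in> \<Omega> \<Longrightarrow> (\<lambda>k. g k z) \<longlonglongrightarrow> h z"
proof -
  let ?M = "lebesgue_on \<Omega>"
  have gL: "g k \<in> L2 ?M" and gh: "holomorphic_fun_on (g k) \<Omega>" for k
    using g by (auto simp: bergman_space_def Lp_2_eq_L2)
  obtain D where D: "\<And>k z. z \<in> \<Omega> \<Longrightarrow> (g k has_derivative D k z) (at z)"
     "\<And>k z c v. z \<in> \<Omega> \<Longrightarrow> D k z (cscale c v) = c * D k z v"
    using gh unfolding holomorphic_fun_on_def by metis
  have unif: "\<exists>N. \<forall>k\<ge>N. \<forall>l\<ge>N. \<forall>y\<in>cball z R. norm (g k y - g l y) < e" 
    if R: "R > 0" "cball z (2 * R) \<subseteq> \<Omega>" and e: "e > 0" for z R e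
  proof -
    obtain C where C: "C > 0" "\<And>f z. f \<in> bergman_space \<Omega> \<Longrightarrow> cball z R \<subseteq> \<Omega> \<Longrightarrow>
      norm (f (z :: 'm cspace)) \<le> C * sqrt (sqint ?M f)"
      using bergman_pointwise_estimate[OF R(1), where 'm='m] \<Omega> by blast
    obtain N where N: "\<And>k l. k \<ge> N \<Longrightarrow> l \<ge> N \<Longrightarrow> sqint ?M (\<lambda>x. g k x - g l x) < (e / C)\<^sup>2"
      using cau[of "(e / C)\<^sup>2"] e C(1) by auto
    show ?thesis
    proof (intro exI[of _ N] allI impI ballI)
      fix k l y assume kl: "k \<ge> N" "l \<ge> N" and y: "y \<in> cball z R"
      have sub: "cball y R \<subseteq> \<Omega>"
      proof
        fix x assume "x \<in> cball y R"
        then have "dist z x \<le> 2 * R" using y dist_triangle[of z x y] by auto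
        then show "x \<in> \<Omega>" using R(2) by (meson mem_cball subsetD)
      qed
      have "norm (g k y - g l y) \<le> C * sqrt (sqint ?M (\<lambda>x. g k x - g l x))"
        using C(2)[OF bergman_space_diff[OF g[of k] g[of l]] sub] .
      also have "sqrt (sqint ?M (\<lambda>x. g k x - g l x)) < e / C"
        by (rule real_less_lsqrt) (use N[OF kl] sqint_nonneg e C(1) in auto)
      then have "C * sqrt (sqint ?M (\<lambda>x. g k x - g l x)) < e" using C(1) by (simp add: field_simps)
      finally show "norm (g k y - g l y) < e" .
    qed
  qed
  have "\<exists>h. (\<lambda>k. g k z) \<longlonglongrightarrow> h" if z: "z \<in> \<Omega>" for z
  proof -
    obtain r where r: "r > 0" "cball z r \<subseteq> \<Omega>" using \<Omega> z open_contains_cball by blast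
    have "Cauchy (\<lambda>k. g k z)"
    proof (rule CauchyI)
      fix e :: real assume "e > 0"
      from unif[of "r/2" z, OF _ _ this] r obtain N where "\<forall>k\<ge>N. \<forall>l\<ge>N. \<forall>y\<in>cball z (r/2). norm (g k y - g l y) < e" by auto
      then show "\<exists>N. \<forall>m\<ge>N. \<forall>n\<ge>N. norm (g m z - g n z) < e" using r by (intro exI[of _ N]) auto
    qed
    then show ?thesis using Cauchy_convergent convergent_def by blast
  qed
  then obtain h where h: "\<And>z. z \<in> \<Omega> \<Longrightarrow> (\<lambda>k. g k z) \<longlonglongrightarrow> h z" by metis
  have "holomorphic_fun_on h \<Omega>"
    unfolding holomorphic_fun_on_def
  proof
    fix z assume z: "z \<in> \<Omega>"
    obtain r where r: "r > 0" "cball z r \<subseteq> \<Omega>" using \<Omega> z open_contains_cball by blast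
    define R where "R = r / 4"
    have R: "R > 0" using r by (simp add: R_def)
    have sub2: "cball y R \<subseteq> cball z (r/2)" if "y \<in> ball z R" for y
    proof
      fix x assume "x \<in> cball y R"
      then show "x \<in> cball z (r/2)" using that dist_triangle[of z x y] by (auto simp: R_def)
    qed
    have subO: "ball z R \<subseteq> \<Omega>" using r by (auto simp: R_def subset_iff)
    have Dcau: "\<exists>N. \<forall>k\<ge>N. \<forall>l\<ge>N. \<forall>y\<in>ball z R. \<forall>v. norm (D k y v - D l y v) \<le> e * norm v" if e: "e > 0" for e
    proof -
      obtain N where N: "\<forall>k\<ge>N. \<forall>l\<ge>N. \<forall>y\<in>cball z (r/2). norm (g k y - g l y) < e * R"
        using unif[of "r/2" z "e * R"] r e R by auto
      show ?thesis
      proof (intro exI[of _ N] allI impI ballI)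
        fix k l y v assume kl: "k \<ge> N" "l \<ge> N" and y: "y \<in> ball z R"
        have yO: "y \<in> \<Omega>" using y subO by blast
        have "norm (D k y v - D l y v) \<le> (e * R) / R * norm v"
        proof (rule holomorphic_fun_derivative_bound[OF _ \<Omega> R])
          show "holomorphic_fun_on (\<lambda>x. g k x - g l x) \<Omega>"
            using bergman_space_diff[OF g[of k] g[of l]] by (simp add: bergman_space_def)
          have "cball z (r/2) \<subseteq> cball z r" using r by (intro subset_cball) auto
          then show "cball y R \<subseteq> \<Omega>" using sub2[OF y] r by blast
          show "norm (g k x - g l x) \<le> e * R" if "x \<in> cball y R" for x
            using N kl sub2[OF y] that by (meson less_imp_le subsetD)
          show "((\<lambda>x. g k x - g l x) has_derivative (\<lambda>v. D k y v - D l y v)) (at y)"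
            by (rule has_derivative_diff[OF D(1)[OF yO] D(1)[OF yO]])
        qed
        then show "norm (D k y v - D l y v) \<le> e * norm v" using R by simp
      qed
    qed
    have "\<exists>L. (\<lambda>k. D k y v) \<longlonglongrightarrow> L" if y: "y \<in> ball z R" for y v
    proof -
      have "Cauchy (\<lambda>k. D k y v)"
      proof (rule CauchyI)
        fix e :: real assume e: "e > 0"
        then have "e / (norm v + 1) > 0" by (simp add: add_nonneg_pos)
        from Dcau[OF this] obtain N where N: "\<And>k l. k \<ge> N \<Longrightarrow> l \<ge> N \<Longrightarrow> norm (D k y v - D l y v) \<le> e / (norm v + 1) * norm v"
          using y by blast
        have "e / (norm v + 1) * norm v < e" using e by (simp add: divide_less_eq add_nonneg_pos)
        then show "\<exists>N. \<forall>m\<ge>N. \<forall>n\<ge>N. norm (D m y v - D n y v) < e" using N by (meson le_less_trans)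
      qed
      then show ?thesis using Cauchy_convergent convergent_def by blast
    qed
    then obtain E where E: "\<And>y v. y \<in> ball z R \<Longrightarrow> (\<lambda>k. D k y v) \<longlonglongrightarrow> E y v" by metis
    have zR: "z \<in> ball z R" using R by simp
    have "\<exists>G. \<forall>y\<in>ball z R. (\<lambda>k. g k y) \<longlonglongrightarrow> G y \<and> (G has_derivative E y) (at y within ball z R)"
    proof (rule has_derivative_sequence[where f=g and f'=D and g'=E and S="ball z R", OF convex_ball _ _ zR h[OF z]])
      show "(g k has_derivative D k y) (at y within ball z R)" if "y \<in> ball z R" for k y
        using D(1) that subO by (meson has_derivative_at_withinI subsetD)
      show "\<forall>\<^sub>F k in sequentially. \<forall>y\<in>ball z R. \<forall>v. norm (D k y v - E y v) \<le> e * norm v" if e: "e > 0" for e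
      proof -
        obtain N where N: "\<forall>k\<ge>N. \<forall>l\<ge>N. \<forall>y\<in>ball z R. \<forall>v. norm (D k y v - D l y v) \<le> e * norm v"
          using Dcau[OF e] by blast
        show ?thesis
        proof (rule eventually_sequentiallyI[of N], intro ballI allI)
          fix k y v assume k: "k \<ge> N" and y: "y \<in> ball z R"
          have "(\<lambda>l. norm (D k y v - D l y v)) \<longlonglongrightarrow> norm (D k y v - E y v)"
            by (intro tendsto_intros E y)
          then show "norm (D k y v - E y v) \<le> e * norm v"
            by (rule LIMSEQ_le_const2) (use N k y in blast)
        qed
      qed
    qed
    then obtain G where G: "\<And>y. y \<in> ball z R \<Longrightarrow> (\<lambda>k. g k y) \<longlonglongrightarrow> G y" 
      "\<And>y. y \<in> ball z R \<Longrightarrow> (G has_derivative E y) (at y within ball z R)" by blast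
    have "(G has_derivative E z) (at z)" using G(2)[OF zR] unfolding at_within_open[OF zR open_ball] .
    then have "(h has_derivative E z) (at z)"
    proof (rule has_derivative_transform_within_open[OF _ open_ball zR])
      fix y assume y: "y \<in> ball z R"
      then have "y \<in> \<Omega>" using subO by blast
      then show "G y = h y" using LIMSEQ_unique[OF G(1)[OF y] h] by simp
    qed
    moreover have "E z (cscale c v) = c * E z v" for c v
    proof -
      have "(\<lambda>k. D k z (cscale c v)) \<longlonglongrightarrow> c * E z v"
        unfolding D(2)[OF z] by (intro tendsto_intros E zR)
      then show ?thesis by (rule LIMSEQ_unique[OF E[OF zR]])
    qed
    ultimately show "\<exists>D. (h has_derivative D) (at z) \<and> (\<forall>c v. D (cscale c v) = c * D v)" by blast
  qed
  note hh = this
  have hm[measurable]: "h \<in> borel_measurable ?M" by (rule holomorphic_fun_measurable[OF \<Omega> hh])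
  note [measurable] = L2_D(1)[OF gL]
  obtain N where N: "\<And>k l. k \<ge> N \<Longrightarrow> l \<ge> N \<Longrightarrow> sqint ?M (\<lambda>x. g k x - g l x) < 1" using cau[of 1] by auto
  have dint: "integrable ?M (\<lambda>x. (norm (g N x - h x))\<^sup>2)"
  proof (rule integrableI_bounded)
    have "(\<integral>\<^sup>+x. ennreal (norm ((norm (g N x - h x))\<^sup>2)) \<partial>?M) = (\<integral>\<^sup>+x. liminf (\<lambda>k. ennreal ((norm (g N x - g k x))\<^sup>2)) \<partial>?M)"
    proof (rule nn_integral_cong)
      fix x assume "x \<in> space ?M"
      then have x: "x \<in> \<Omega>" by simp
      have "(\<lambda>k. ennreal ((norm (g N x - g k x))\<^sup>2)) \<longlonglongrightarrow> ennreal ((norm (g N x - h x))\<^sup>2)"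
        by (intro tendsto_intros tendsto_ennrealI h x)
      from lim_imp_Liminf[OF _ this]
      show "ennreal (norm ((norm (g N x - h x))\<^sup>2)) = liminf (\<lambda>k. ennreal ((norm (g N x - g k x))\<^sup>2))" by simp
    qed
    also have "\<dots> \<le> liminf (\<lambda>k. \<integral>\<^sup>+x. ennreal ((norm (g N x - g k x))\<^sup>2) \<partial>?M)"
      by (rule nn_integral_liminf) measurable
    also have "\<dots> \<le> liminf (\<lambda>k. 1)"
    proof (rule Liminf_mono, rule eventually_sequentiallyI[of N])
      fix k assume k: "k \<ge> N"
      have "(\<integral>\<^sup>+x. ennreal ((norm (g N x - g k x))\<^sup>2) \<partial>?M) = ennreal (sqint ?M (\<lambda>x. g N x - g k x))"
        unfolding sqint_def using L2_D(2)[OF L2_diff[OF gL gL]] by (intro nn_integral_eq_integral) auto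
      also have "\<dots> \<le> ennreal 1" using N[of N k] k by (intro ennreal_leI) auto
      finally show "(\<integral>\<^sup>+x. ennreal ((norm (g N x - g k x))\<^sup>2) \<partial>?M) \<le> 1" by simp
    qed
    also have "liminf (\<lambda>k. 1::ennreal) = 1" by (rule Liminf_const) simp
    finally show "(\<integral>\<^sup>+x. ennreal (norm ((norm (g N x - h x))\<^sup>2)) \<partial>?M) < \<infinity>"
      by (simp add: order_le_less_trans)
  qed measurable
  then have "(\<lambda>x. g N x - h x) \<in> L2 ?M" by (simp add: L2_def)
  from L2_diff[OF gL[of N] this] have "h \<in> L2 ?M" by simp
  then have "h \<in> bergman_space \<Omega>" using hh by (simp add: bergman_space_def Lp_2_eq_L2)
  then show thesis using that h by blast
qed

text \<open>Existence is the projection theorem. Two candidates differ by a Bergman function orthogonal to itself, which vanishes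
  almost everywhere and hence, by continuity, everywhere on \<Omega>; the normalization off \<Omega> makes the function unique.\<close>

lemma bergman_projection_spec:
  fixes f :: "'m::finite cspace \<Rightarrow> complex"
  assumes \<Omega>: "open \<Omega>" and f: "f \<in> Lp \<Omega> 2"
  shows "bergman_projection \<Omega> f \<in> bergman_space \<Omega>"
    and "z \<notin> \<Omega> \<Longrightarrow> bergman_projection \<Omega> f z = 0"
    and "h \<in> bergman_space \<Omega> \<Longrightarrow> (LINT z|lebesgue_on \<Omega>. (f z - bergman_projection \<Omega> f z) * cnj (h z)) = 0"
proof -
  let ?M = "lebesgue_on \<Omega>"
  let ?P = "\<lambda>g. g \<in> bergman_space \<Omega> \<and> (\<forall>z. z \<notin> \<Omega> \<longrightarrow> g z = 0) \<and>
     (\<forall>h\<in>bergman_space \<Omega>. (LINT z|?M. (f z - g z) * cnj (h z)) = 0)"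
  have fL: "f \<in> L2 ?M" using f by (simp add: Lp_2_eq_L2)
  have z0: "(\<lambda>_. 0) \<in> bergman_space \<Omega>"
    by (simp add: bergman_space_def Lp_2_eq_L2 L2_def holomorphic_fun_on_const)
  obtain g where g: "g \<in> bergman_space \<Omega>" "\<And>h. h \<in> bergman_space \<Omega> \<Longrightarrow> (LINT x|?M. (f x - g x) * cnj (h x)) = 0"
  proof (rule L2_projection_exists[of "bergman_space \<Omega>" ?M f])
    show "bergman_space \<Omega> \<subseteq> L2 ?M" by (auto simp: bergman_space_def Lp_2_eq_L2)
    show "bergman_space \<Omega> \<noteq> {}" using z0 by blast
    show "\<exists>h\<in>bergman_space \<Omega>. AE x in ?M. (\<lambda>k. g k x) \<longlonglongrightarrow> h x" 
      if gk: "\<And>k. g k \<in> bergman_space \<Omega>" and ck: "\<And>e. e > 0 \<Longrightarrow> \<exists>N. \<forall>k\<ge>N. \<forall>l\<ge>N. sqint ?M (\<lambda>x. g k x - g l x) < e" for g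
    proof -
      obtain h where h: "h \<in> bergman_space \<Omega>" "\<And>z. z \<in> \<Omega> \<Longrightarrow> (\<lambda>k. g k z) \<longlonglongrightarrow> h z"
        using bergman_space_closed[OF \<Omega> gk ck] by metis
      then show ?thesis by (intro bexI[of _ h]) auto
    qed
  qed (use fL bergman_space_lincomb in auto)
  define g' where "g' z = (if z \<in> \<Omega> then g z else 0)" for z
  have g'b: "g' \<in> bergman_space \<Omega>"
  proof -
    have hg: "holomorphic_fun_on g \<Omega>" "g \<in> L2 ?M" using g(1) by (auto simp: bergman_space_def Lp_2_eq_L2)
    have hol: "holomorphic_fun_on g' \<Omega>"
      by (rule holomorphic_fun_on_cong[OF \<Omega> _ hg(1)]) (simp add: g'_def)
    have "integrable ?M (\<lambda>x. (norm (g' x))\<^sup>2)"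
      by (rule Bochner_Integration.integrable_cong[THEN iffD1, OF refl _ L2_D(2)[OF hg(2)]]) (simp add: g'_def)
    then show ?thesis using hol holomorphic_fun_measurable[OF \<Omega> hol] by (simp add: bergman_space_def Lp_2_eq_L2 L2_def)
  qed
  have "(LINT x|?M. (f x - g' x) * cnj (h x)) = 0" if "h \<in> bergman_space \<Omega>" for h
  proof -
    have "(LINT x|?M. (f x - g' x) * cnj (h x)) = (LINT x|?M. (f x - g x) * cnj (h x))"
      by (intro Bochner_Integration.integral_cong) (auto simp: g'_def)
    then show ?thesis using g(2)[OF that] by simp
  qed
  then have P: "?P g'" using g'b by (auto simp: g'_def)
  have uniq: "k = g'" if k: "?P k" for k
  proof -
    define d where "d = (\<lambda>x. k x - g' x)"
    have d: "d \<in> bergman_space \<Omega>" unfolding d_def using k P bergman_space_diff by blast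
    then have dL: "d \<in> L2 ?M" by (auto simp: bergman_space_def Lp_2_eq_L2)
    have i: "integrable ?M (\<lambda>x. (f x - u x) * cnj (d x))" if "u \<in> bergman_space \<Omega>" for u
      using that by (intro L2_inner_integrable L2_diff fL L2_cnj dL) (auto simp: bergman_space_def Lp_2_eq_L2)
    have "(LINT x|?M. (f x - g' x) * cnj (d x)) - (LINT x|?M. (f x - k x) * cnj (d x)) = 0"
      using k P d by simp
    also have "(LINT x|?M. (f x - g' x) * cnj (d x)) - (LINT x|?M. (f x - k x) * cnj (d x))
      = (LINT x|?M. (f x - g' x) * cnj (d x) - (f x - k x) * cnj (d x))"
      by (rule Bochner_Integration.integral_diff[symmetric]) (use i k P in auto)
    also have "\<dots> = (LINT x|?M. complex_of_real ((norm (d x))\<^sup>2))"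
    proof (intro Bochner_Integration.integral_cong refl)
      fix x
      have "(f x - g' x) * cnj (d x) - (f x - k x) * cnj (d x) = d x * cnj (d x)"
        by (simp add: d_def algebra_simps)
      then show "(f x - g' x) * cnj (d x) - (f x - k x) * cnj (d x) = complex_of_real ((norm (d x))\<^sup>2)"
        by (simp only: complex_norm_square)
    qed
    also have "\<dots> = of_real (sqint ?M d)" unfolding sqint_def by (rule integral_complex_of_real)
    finally have s0: "sqint ?M d = 0" by simp
    have "d z = 0" if z: "z \<in> \<Omega>" for z
    proof -
      obtain r where r: "r > 0" "cball z r \<subseteq> \<Omega>" using \<Omega> z open_contains_cball by blast
      from bergman_pointwise_estimate[OF r(1), where 'm='m] \<Omega> d r(2) s0 have "norm (d z) \<le> 0" by fastforce
      then show ?thesis by simp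
    qed
    moreover have "k z = 0" "g' z = 0" if "z \<notin> \<Omega>" for z using k P that by blast+
    ultimately have "k z = g' z" for z by (cases "z \<in> \<Omega>") (simp_all add: d_def)
    then show ?thesis by blast
  qed
  have eq: "bergman_projection \<Omega> f = g'"
    unfolding bergman_projection_def by (rule the_equality, rule P, rule uniq, assumption)
  show "bergman_projection \<Omega> f \<in> bergman_space \<Omega>" using P unfolding eq by (rule conjunct1)
  show "bergman_projection \<Omega> f z = 0" if "z \<notin> \<Omega>" using that by (simp add: eq g'_def)
  show "(LINT z|?M. (f z - bergman_projection \<Omega> f z) * cnj (h z)) = 0" if "h \<in> bergman_space \<Omega>"
    using conjunct2[OF conjunct2[OF P]] that unfolding eq by (rule bspec)
qed

section \<open>From mapping properties to a bound on bounded functions\<close>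

lemma fatou_integrable:
  fixes u :: "'a \<Rightarrow> real"
  assumes "\<And>m. integrable M (U m)" "\<And>m x. U m x \<ge> 0" "u \<in> borel_measurable M" "\<And>x. x \<in> space M \<Longrightarrow> (\<lambda>m. U m x) \<longlonglongrightarrow> u x"
    "\<And>m::nat. (LINT x|M. U m x) \<le> B"
  shows "integrable M u" "(LINT x|M. u x) \<le> B"
proof -
  have B: "B \<ge> 0" by (rule order_trans[OF integral_nonneg_AE assms(5)[of 0]]) (simp add: assms(2))
  have u0: "u x \<ge> 0" if "x \<in> space M" for x
    by (rule LIMSEQ_le_const[OF assms(4)[OF that]]) (simp add: assms(2))
  have "(\<integral>\<^sup>+x. ennreal (u x) \<partial>M) = (\<integral>\<^sup>+x. liminf (\<lambda>m. ennreal (U m x)) \<partial>M)"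
  proof (rule nn_integral_cong)
    fix x assume "x \<in> space M"
    then have "(\<lambda>m. ennreal (U m x)) \<longlonglongrightarrow> ennreal (u x)" by (intro tendsto_ennrealI assms(4))
    from lim_imp_Liminf[OF _ this] show "ennreal (u x) = liminf (\<lambda>m. ennreal (U m x))" by simp
  qed
  also have "\<dots> \<le> liminf (\<lambda>m. \<integral>\<^sup>+x. ennreal (U m x) \<partial>M)"
    by (rule nn_integral_liminf) (use assms(1) in auto)
  also have "\<dots> \<le> liminf (\<lambda>m::nat. ennreal B)"
  proof (rule Liminf_mono, rule always_eventually, rule allI)
    fix m
    have "(\<integral>\<^sup>+x. ennreal (U m x) \<partial>M) = ennreal (LINT x|M. U m x)"
      by (rule nn_integral_eq_integral) (use assms in auto)
    then show "(\<integral>\<^sup>+x. ennreal (U m x) \<partial>M) \<le> ennreal B" using assms(5) by (simp add: ennreal_leI)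
  qed
  also have "\<dots> = ennreal B" by (rule Liminf_const) simp
  finally have le: "(\<integral>\<^sup>+x. ennreal (u x) \<partial>M) \<le> ennreal B" .
  show "integrable M u"
    by (rule integrableI_nonneg) (use assms(3) u0 le in \<open>auto intro!: AE_I2 simp: le_less_trans\<close>)
  then have "(\<integral>\<^sup>+x. ennreal (u x) \<partial>M) = ennreal (LINT x|M. u x)"
    by (rule nn_integral_eq_integral) (use u0 in auto)
  then show "(LINT x|M. u x) \<le> B" using le B by simp
qed

lemma Lp_subset_finite_measure:
  assumes "finite_measure (lebesgue_on \<Omega>)" "0 < r" "r \<le> s"
  shows "Lp \<Omega> s \<subseteq> Lp \<Omega> r"
proof
  interpret finite_measure "lebesgue_on \<Omega>" by (rule assms(1))
  fix f assume f: "f \<in> Lp \<Omega> s"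
  then have [measurable]: "f \<in> borel_measurable (lebesgue_on \<Omega>)" by (simp add: Lp_def)
  have "integrable (lebesgue_on \<Omega>) (\<lambda>x. norm (f x) powr r)"
  proof (rule Bochner_Integration.integrable_bound[of _ "\<lambda>x. 1 + norm (f x) powr s"])
    show "AE x in lebesgue_on \<Omega>. norm (norm (f x) powr r) \<le> norm (1 + norm (f x) powr s)"
    proof (intro AE_I2)
      fix x
      have "norm (f x) powr r \<le> 1 + norm (f x) powr s"
      proof (cases "norm (f x) \<le> 1")
        case True
        then have "norm (f x) powr r \<le> 1 powr r" using assms(2) by (intro powr_mono2) auto
        then show ?thesis by (simp add: add_increasing2)
      next
        case False
        then have "norm (f x) powr r \<le> norm (f x) powr s" using assms(3) by (intro powr_mono) auto
        then show ?thesis by simp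
      qed
      then show "norm (norm (f x) powr r) \<le> norm (1 + norm (f x) powr s)" by simp
    qed
  qed (use f in \<open>auto simp: Lp_def\<close>)
  then show "f \<in> Lp \<Omega> r" by (simp add: Lp_def)
qed

text \<open>Bounded functions form the common test class: on a finite measure space they lie in every L^p, and they suffice to
  compute L^p norms by duality.\<close>

definition bounded_measurable :: "'a measure \<Rightarrow> ('a \<Rightarrow> complex) set" where
  "bounded_measurable M = {f \<in> borel_measurable M. \<exists>b. \<forall>x. norm (f x) \<le> b}"

lemma bounded_measurable_Lp:
  assumes "finite_measure (lebesgue_on \<Omega>)" "f \<in> bounded_measurable (lebesgue_on \<Omega>)" "r > 0"
  shows "f \<in> Lp \<Omega> r"
proof -
  interpret finite_measure "lebesgue_on \<Omega>" by (rule assms(1))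
  from assms(2) obtain b where b: "\<And>x. norm (f x) \<le> b" and [measurable]: "f \<in> borel_measurable (lebesgue_on \<Omega>)"
    by (auto simp: bounded_measurable_def)
  have "integrable (lebesgue_on \<Omega>) (\<lambda>x. norm (f x) powr r)"
    by (rule integrable_const_bound[of _ "b powr r"]) (use b assms(3) in \<open>auto intro!: AE_I2 powr_mono2\<close>)
  then show ?thesis by (simp add: Lp_def)
qed

lemma Lp_norm_nonneg: "Lp_norm \<Omega> p f \<ge> 0" by (simp add: Lp_norm_def)

lemma Lp_holder:
  assumes "p > 1" "1 / p + 1 / q = 1" "f \<in> Lp \<Omega> p" "g \<in> Lp \<Omega> q"
  shows "integrable (lebesgue_on \<Omega>) (\<lambda>x. f x * cnj (g x))"
    and "norm (LINT x|lebesgue_on \<Omega>. f x * cnj (g x)) \<le> Lp_norm \<Omega> p f * Lp_norm \<Omega> q g"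
proof -
  have m: "f \<in> borel_measurable (lebesgue_on \<Omega>)" "(\<lambda>x. cnj (g x)) \<in> borel_measurable (lebesgue_on \<Omega>)"
    "integrable (lebesgue_on \<Omega>) (\<lambda>x. norm (f x) powr p)" "integrable (lebesgue_on \<Omega>) (\<lambda>x. norm (cnj (g x)) powr q)"
    using assms(3,4) by (auto simp: Lp_def)
  show "integrable (lebesgue_on \<Omega>) (\<lambda>x. f x * cnj (g x))" by (rule holder(1)[OF assms(1,2) m])
  have "norm (LINT x|lebesgue_on \<Omega>. f x * cnj (g x)) \<le> (LINT x|lebesgue_on \<Omega>. norm (f x * cnj (g x)))"
    by (rule integral_norm_bound)
  also have "\<dots> \<le> Lp_norm \<Omega> p f * Lp_norm \<Omega> q g"
    using holder(2)[OF assms(1,2) m] by (simp add: Lp_norm_def)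
  finally show "norm (LINT x|lebesgue_on \<Omega>. f x * cnj (g x)) \<le> Lp_norm \<Omega> p f * Lp_norm \<Omega> q g" .
qed

lemma bergman_projection_self_adjoint:
  assumes \<Omega>: "open \<Omega>" and f: "f \<in> Lp \<Omega> 2" and u: "u \<in> Lp \<Omega> 2"
  shows "(LINT x|lebesgue_on \<Omega>. bergman_projection \<Omega> f x * cnj (u x)) =
    (LINT x|lebesgue_on \<Omega>. f x * cnj (bergman_projection \<Omega> u x))"
proof -
  let ?M = "lebesgue_on \<Omega>" let ?P = "bergman_projection \<Omega>"
  have L: "f \<in> L2 ?M" "u \<in> L2 ?M" "?P f \<in> L2 ?M" "?P u \<in> L2 ?M"
    using f u bergman_projection_spec(1)[OF \<Omega>] by (auto simp: Lp_2_eq_L2 bergman_space_def)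
  note i = L2_inner_integrable[OF _ L2_cnj]
  have swap: "(LINT x|?M. h x * cnj (k x)) = cnj (LINT x|?M. k x * cnj (h x))" for h k
  proof -
    have "(\<lambda>x. h x * cnj (k x)) = (\<lambda>x. cnj (k x * cnj (h x)))" by (simp add: fun_eq_iff mult.commute)
    then show ?thesis by (simp only: Bochner_Integration.integral_cnj)
  qed
  have "(LINT x|?M. ?P f x * cnj (u x)) - (LINT x|?M. ?P f x * cnj (?P u x)) = (LINT x|?M. ?P f x * cnj (u x - ?P u x))"
    using i[OF L(3) L(2)] i[OF L(3) L(4)] by (simp add: right_diff_distrib)
  also have "\<dots> = cnj (LINT x|?M. (u x - ?P u x) * cnj (?P f x))" by (rule swap)
  also have "\<dots> = 0" using bergman_projection_spec(3)[OF \<Omega> u bergman_projection_spec(1)[OF \<Omega> f]] by simp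
  finally have 1: "(LINT x|?M. ?P f x * cnj (u x)) = (LINT x|?M. ?P f x * cnj (?P u x))" by simp
  have "(LINT x|?M. f x * cnj (?P u x)) - (LINT x|?M. ?P f x * cnj (?P u x)) = (LINT x|?M. (f x - ?P f x) * cnj (?P u x))"
    using i[OF L(1) L(4)] i[OF L(3) L(4)] by (simp add: left_diff_distrib)
  also have "\<dots> = 0" using bergman_projection_spec(3)[OF \<Omega> f bergman_projection_spec(1)[OF \<Omega> u]] by simp
  finally show ?thesis using 1 by simp
qed

lemma bergman_projection_contractive:
  assumes \<Omega>: "open \<Omega>" and f: "f \<in> Lp \<Omega> 2"
  shows "sqint (lebesgue_on \<Omega>) (bergman_projection \<Omega> f) \<le> sqint (lebesgue_on \<Omega>) f"
proof -
  let ?M = "lebesgue_on \<Omega>" let ?P = "bergman_projection \<Omega>"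
  have L: "f \<in> L2 ?M" "?P f \<in> L2 ?M"
    using f bergman_projection_spec(1)[OF \<Omega>] by (auto simp: Lp_2_eq_L2 bergman_space_def)
  have fP: "(\<lambda>x. f x - ?P f x) \<in> L2 ?M" by (rule L2_diff[OF L])
  have "sqint ?M (\<lambda>x. (f x - ?P f x) - (- ?P f x)) = sqint ?M (\<lambda>x. f x - ?P f x) + sqint ?M (\<lambda>x. - ?P f x)
      - 2 * Re (LINT x|?M. (f x - ?P f x) * cnj (- ?P f x))"
    by (rule sqint_diff[OF fP L2_uminus[OF L(2)]])
  moreover have "(LINT x|?M. (f x - ?P f x) * cnj (- ?P f x)) = 0"
    using bergman_projection_spec(3)[OF \<Omega> f bergman_projection_spec(1)[OF \<Omega> f]] by simp
  moreover have "sqint ?M (\<lambda>x. - ?P f x) = sqint ?M (?P f)" by (simp add: sqint_def)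
  ultimately show ?thesis using sqint_nonneg[of ?M "\<lambda>x. f x - ?P f x"] by simp
qed

text \<open>If P is bounded on L^q, self-adjointness moves it to the other factor and gives the bound for p.\<close>

lemma bilinear_bound_dual:
  assumes \<Omega>: "open \<Omega>" and fin: "finite_measure (lebesgue_on \<Omega>)" and p: "p > 2" and pq: "1 / p + 1 / q = 1"
    and C: "\<And>f. f \<in> Lp \<Omega> q \<inter> Lp \<Omega> 2 \<Longrightarrow> bergman_projection \<Omega> f \<in> Lp \<Omega> q \<and>
             Lp_norm \<Omega> q (bergman_projection \<Omega> f) \<le> C * Lp_norm \<Omega> q f"
    and f: "f \<in> bounded_measurable (lebesgue_on \<Omega>)" and u: "u \<in> bounded_measurable (lebesgue_on \<Omega>)"
  shows "norm (LINT x|lebesgue_on \<Omega>. bergman_projection \<Omega> f x * cnj (u x)) \<le> C * Lp_norm \<Omega> p f * Lp_norm \<Omega> q u"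
proof -
  have p1: "p > 1" using p by simp
  have q: "q > 1" by (rule conjugate_exponent_gt_1[OF p1 pq])
  have "norm (LINT x|lebesgue_on \<Omega>. f x * cnj (bergman_projection \<Omega> u x)) \<le> Lp_norm \<Omega> p f * Lp_norm \<Omega> q (bergman_projection \<Omega> u)"
    by (rule Lp_holder(2)[OF p1 pq]) (use C bounded_measurable_Lp[OF fin] f u p q in auto)
  also have "\<dots> \<le> Lp_norm \<Omega> p f * (C * Lp_norm \<Omega> q u)"
    by (intro mult_left_mono Lp_norm_nonneg) (use C bounded_measurable_Lp[OF fin u] q in auto)
  finally show ?thesis
    using bergman_projection_self_adjoint[OF \<Omega>, of f u] bounded_measurable_Lp[OF fin] f u by (simp add: mult_ac)
qed

text \<open>For p > 2 the assumption is mere invariance of L^p without a bound. If the bilinear form were unbounded, the functions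
  P u_j, with u_j normalized, would have unbounded norms as functionals on L^p, and the gliding hump lemma would produce f in L^p
  for which the pairings of P f with the u_j are unbounded, although P f lies in L^p.\<close>

lemma bilinear_bound_closed_graph:
  assumes \<Omega>: "open \<Omega>" and fin: "finite_measure (lebesgue_on \<Omega>)" and p: "p > 2" and pq: "1 / p + 1 / q = 1"
    and maps: "\<And>f. f \<in> Lp \<Omega> p \<Longrightarrow> bergman_projection \<Omega> f \<in> Lp \<Omega> p"
  shows "\<exists>C. \<forall>f u. f \<in> bounded_measurable (lebesgue_on \<Omega>) \<longrightarrow> u \<in> bounded_measurable (lebesgue_on \<Omega>) \<longrightarrow>
    norm (LINT x|lebesgue_on \<Omega>. bergman_projection \<Omega> f x * cnj (u x)) \<le> C * Lp_norm \<Omega> p f * Lp_norm \<Omega> q u"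
proof (rule ccontr)
  let ?M = "lebesgue_on \<Omega>" let ?P = "bergman_projection \<Omega>"
  assume neg: "\<not> ?thesis"
  have p1: "p > 1" using p by simp
  have q: "q > 1" by (rule conjugate_exponent_gt_1[OF p1 pq])
  have q2: "q < 2"
  proof -
    have "1 / p < 1 / 2" using p by (simp add: field_simps)
    then have "1 / q > 1 / 2" using pq by linarith
    then show ?thesis using q by (simp add: field_simps)
  qed
  have sub: "Lp \<Omega> p \<subseteq> Lp \<Omega> 2" "Lp \<Omega> 2 \<subseteq> Lp \<Omega> q"
    using Lp_subset_finite_measure[OF fin, of 2 p] Lp_subset_finite_measure[OF fin, of q 2] p q q2 by auto
  have ex: "\<exists>f u. f \<in> bounded_measurable ?M \<and> u \<in> bounded_measurable ?M \<and>
     norm (LINT x|?M. ?P f x * cnj (u x)) > 4 ^ j * Lp_norm \<Omega> p f * Lp_norm \<Omega> q u" for j :: nat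
    using neg by (meson not_le)
  then have "\<forall>j :: nat. \<exists>w. fst w \<in> bounded_measurable ?M \<and> snd w \<in> bounded_measurable ?M \<and>
     norm (LINT x|?M. ?P (fst w) x * cnj (snd w x)) > 4 ^ j * Lp_norm \<Omega> p (fst w) * Lp_norm \<Omega> q (snd w)"
    by (simp only: split_paired_Ex fst_conv snd_conv ex) simp
  from choice[OF this] obtain w where w: "\<forall>j :: nat. fst (w j) \<in> bounded_measurable ?M \<and> snd (w j) \<in> bounded_measurable ?M \<and>
     norm (LINT x|?M. ?P (fst (w j)) x * cnj (snd (w j) x)) > 4 ^ j * Lp_norm \<Omega> p (fst (w j)) * Lp_norm \<Omega> q (snd (w j))"
    by (rule exE)
  define f where "f j = fst (w j)" for j
  define u where "u j = snd (w j)" for j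
  have f: "f j \<in> bounded_measurable ?M" and u: "u j \<in> bounded_measurable ?M"
    and big: "norm (LINT x|?M. ?P (f j) x * cnj (u j x)) > 4 ^ j * Lp_norm \<Omega> p (f j) * Lp_norm \<Omega> q (u j)" for j
    using spec[OF w, of j] unfolding f_def u_def by simp_all
  have fL: "f j \<in> Lp \<Omega> p" and uL: "u j \<in> Lp \<Omega> q" and uL2: "u j \<in> Lp \<Omega> 2" for j
    using bounded_measurable_Lp[OF fin f] bounded_measurable_Lp[OF fin u] p q by auto
  define a where "a j = Lp_norm \<Omega> q (u j)" for j
  have a: "a j > 0" for j
  proof (rule ccontr)
    assume "\<not> a j > 0"
    then have "a j = 0" using Lp_norm_nonneg[of \<Omega> q "u j"] by (simp add: a_def)
    then have "norm (LINT x|?M. ?P (f j) x * cnj (u j x)) \<le> 0"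
      using Lp_holder(2)[OF p1 pq maps[OF fL[of j]] uL[of j]] by (simp add: a_def)
    then show False using big[of j] \<open>a j = 0\<close> by (simp add: a_def)
  qed
  define v where "v j x = cnj (?P (u j) x) / of_real (a j)" for j x
  have PuL: "?P (u j) \<in> Lp \<Omega> q" for j
    using bergman_projection_spec(1)[OF \<Omega> uL2[of j]] sub by (auto simp: bergman_space_def)
  have vm: "v j \<in> borel_measurable ?M" for j
  proof -
    have [measurable]: "?P (u j) \<in> borel_measurable ?M" using PuL[of j] by (simp add: Lp_def)
    show ?thesis unfolding v_def by measurable
  qed
  have vn: "norm (v j x) powr q = norm (?P (u j) x) powr q / a j powr q" for j x
    using a[of j] by (simp add: v_def norm_divide powr_divide)
  have vi: "integrable ?M (\<lambda>x. norm (v j x) powr q)" for j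
    unfolding vn using PuL[of j] by (simp add: Lp_def)
  have pair: "(LINT x|?M. g x * v j x) = (LINT x|?M. ?P g x * cnj (u j x)) / of_real (a j)" if "g \<in> Lp \<Omega> 2" for g j
    using bergman_projection_self_adjoint[OF \<Omega> that uL2[of j]] by (simp add: v_def)
  have large: "(LINT x|?M. norm (v j x) powr q) powr (1 / q) \<ge> 4 ^ j" for j
  proof -
    let ?N = "(LINT x|?M. norm (v j x) powr q) powr (1 / q)"
    have f2: "f j \<in> Lp \<Omega> 2" using fL sub by blast
    have "4 ^ j * Lp_norm \<Omega> p (f j) < norm (LINT x|?M. f j x * v j x)"
      unfolding pair[OF f2] using big[of j] a[of j] by (simp add: a_def norm_divide field_simps)
    also have "\<dots> \<le> (LINT x|?M. norm (f j x * v j x))" by (rule integral_norm_bound)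
    also have "\<dots> \<le> Lp_norm \<Omega> p (f j) * ?N"
      using holder(2)[OF p1 pq _ vm _ vi] fL[of j] by (auto simp: Lp_def Lp_norm_def)
    finally have "Lp_norm \<Omega> p (f j) * 4 ^ j < Lp_norm \<Omega> p (f j) * ?N" by (simp add: mult.commute)
    then show ?thesis using Lp_norm_nonneg[of \<Omega> p "f j"] by (simp add: mult_less_cancel_left)
  qed
  obtain F where F: "F \<in> borel_measurable ?M" "integrable ?M (\<lambda>x. norm (F x) powr p)"
    and low: "\<And>j. norm (LINT x|?M. F x * v j x) \<ge> (4/3) ^ j / 2"
    using weakly_bounded_imp_norm_bounded[OF p1 pq vm vi large] by blast
  have FL: "F \<in> Lp \<Omega> p" using F by (simp add: Lp_def)
  have up: "norm (LINT x|?M. F x * v j x) \<le> Lp_norm \<Omega> p (?P F)" for j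
  proof -
    have "norm (LINT x|?M. F x * v j x) = norm (LINT x|?M. ?P F x * cnj (u j x)) / a j"
      using pair[of F j] FL sub a[of j] by (auto simp: norm_divide)
    also have "\<dots> \<le> (Lp_norm \<Omega> p (?P F) * a j) / a j"
      using Lp_holder(2)[OF p1 pq maps[OF FL] uL[of j]] a[of j] by (intro divide_right_mono) (auto simp: a_def)
    finally show ?thesis using a[of j] by simp
  qed
  obtain j where "2 * Lp_norm \<Omega> p (?P F) < (4/3) ^ j"
    using real_arch_pow[of "4/3" "2 * Lp_norm \<Omega> p (?P F)"] by auto
  then show False using up[of j] low[of j] by simp
qed

text \<open>Duality: test with truncations of the function that is extremal in the Hoelder inequality and let the truncation level
  tend to infinity.\<close>

lemma Lp_bound_from_bilinear_bound:
  assumes \<Omega>: "open \<Omega>" and fin: "finite_measure (lebesgue_on \<Omega>)" and p: "p > 2" and pq: "1 / p + 1 / q = 1"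
    and C: "\<And>u. u \<in> bounded_measurable (lebesgue_on \<Omega>) \<Longrightarrow>
      norm (LINT x|lebesgue_on \<Omega>. g x * cnj (u x)) \<le> B * Lp_norm \<Omega> q u" and B: "B \<ge> 0"
    and g: "g \<in> borel_measurable (lebesgue_on \<Omega>)"
  shows "g \<in> Lp \<Omega> p" "Lp_norm \<Omega> p g \<le> B"
proof -
  let ?M = "lebesgue_on \<Omega>"
  interpret finite_measure ?M by (rule fin)
  have p1: "p > 1" using p by simp
  have q: "q > 1" by (rule conjugate_exponent_gt_1[OF p1 pq])
  have pq': "(p - 1) * q = p" using pq q p by (simp add: field_simps)
  note [measurable] = g
  define w where "w m x = (if norm (g x) \<le> real m then g x * of_real (norm (g x) powr (p - 2)) else 0)" for m x
  define A where "A m x = (if norm (g x) \<le> real m then norm (g x) powr p else 0)" for m x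
  have wn: "norm (w m x) = (if norm (g x) \<le> real m then norm (g x) powr (p - 1) else 0)" for m x
  proof -
    have "norm (g x) * norm (g x) powr (p - 2) = norm (g x) powr (p - 1)"
      using powr_mult_base[of "norm (g x)" "p - 2"] by simp
    then show ?thesis by (simp add: w_def norm_mult)
  qed
  have wm[measurable]: "w m \<in> borel_measurable ?M" for m unfolding w_def by measurable
  have wb: "w m \<in> bounded_measurable ?M" for m
    unfolding bounded_measurable_def using wm p
    by (auto simp: wn intro!: exI[of _ "real m powr (p - 1)"] powr_mono2)
  have Am[measurable]: "A m \<in> borel_measurable ?M" for m unfolding A_def by measurable
  have Ai: "integrable ?M (A m)" for m
    by (rule integrable_const_bound[of _ "real m powr p"]) (use p in \<open>auto intro!: AE_I2 powr_mono2 simp: A_def\<close>)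
  have Anon: "A m x \<ge> 0" for m x by (simp add: A_def)
  have gw: "g x * cnj (w m x) = of_real (A m x)" for m x
  proof -
    have "g x * cnj (g x) * of_real (norm (g x) powr (p - 2)) = of_real (norm (g x) powr p)"
    proof (cases "g x = 0")
      case False
      have "(norm (g x))\<^sup>2 * norm (g x) powr (p - 2) = norm (g x) powr p"
        using powr_add[of "norm (g x)" 2 "p - 2"] False by simp
      then show ?thesis by (simp only: complex_norm_square[symmetric] of_real_mult[symmetric])
    qed (use p in simp)
    then show ?thesis by (simp add: w_def A_def mult.assoc)
  qed
  have wq: "norm (w m x) powr q = A m x" for m x
    using pq' q by (simp add: wn A_def powr_powr)
  have bound: "(LINT x|?M. A m x) \<le> B powr p" for m
  proof -
    define I where "I = (LINT x|?M. A m x)"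
    have I0: "I \<ge> 0" unfolding I_def using Anon by (simp add: integral_nonneg_AE)
    have "I = norm (LINT x|?M. g x * cnj (w m x))"
      unfolding gw using I0 by (simp add: I_def)
    also have "\<dots> \<le> B * I powr (1 / q)"
      using C[OF wb[of m]] by (simp add: Lp_norm_def wq I_def)
    finally have le: "I \<le> B * I powr (1 / q)" .
    have "I \<le> B powr p"
    proof (cases "I = 0")
      case False
      then have Ipos: "I > 0" using I0 by simp
      have "I powr (1/p) * I powr (1/q) = I" using Ipos pq by (simp add: powr_add[symmetric])
      then have "I powr (1/p) * I powr (1/q) \<le> B * I powr (1/q)" using le by simp
      then have "I powr (1/p) \<le> B" using Ipos by simp
      then have "(I powr (1/p)) powr p \<le> B powr p" using p by (intro powr_mono2) auto
      then show ?thesis using Ipos p by (simp add: powr_powr)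
    qed simp
    then show ?thesis by (simp add: I_def)
  qed
  have lim: "(\<lambda>m. A m x) \<longlonglongrightarrow> norm (g x) powr p" for x
  proof (rule tendsto_eventually, rule eventually_sequentiallyI)
    fix m assume "m \<ge> nat \<lceil>norm (g x)\<rceil>"
    then have "norm (g x) \<le> real m" by linarith
    then show "A m x = norm (g x) powr p" by (simp add: A_def)
  qed
  note fat = fatou_integrable[of ?M A "\<lambda>x. norm (g x) powr p" "B powr p", OF Ai Anon _ lim bound]
  show "g \<in> Lp \<Omega> p" using fat(1) g by (simp add: Lp_def)
  have "(LINT x|?M. norm (g x) powr p) powr (1/p) \<le> (B powr p) powr (1/p)"
    using fat(2) p by (intro powr_mono2) auto
  then show "Lp_norm \<Omega> p g \<le> B" using B p by (simp add: Lp_norm_def powr_powr)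
qed

text \<open>The two ranges of exponents in the theorem are exchanged by duality. Either hypothesis on a pair of conjugate exponents leads
  to the same norm inequality for the larger exponent, tested on bounded functions.\<close>

lemma Lp_bound_of_maps:
  assumes \<Omega>: "open \<Omega>" and fin: "finite_measure (lebesgue_on \<Omega>)" and p: "p > 2" and pq: "1 / p + 1 / q = 1"
    and nsub: "\<not> Lp \<Omega> q \<subseteq> Lp \<Omega> 2"
    and maps: "bergman_projection_maps_Lp \<Omega> p \<or> bergman_projection_maps_Lp \<Omega> q"
  obtains C where "C \<ge> 0" "\<And>f. f \<in> bounded_measurable (lebesgue_on \<Omega>) \<Longrightarrow> bergman_projection \<Omega> f \<in> Lp \<Omega> p"
    "\<And>f. f \<in> bounded_measurable (lebesgue_on \<Omega>) \<Longrightarrow> Lp_norm \<Omega> p (bergman_projection \<Omega> f) \<le> C * Lp_norm \<Omega> p f"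
proof -
  let ?M = "lebesgue_on \<Omega>" let ?P = "bergman_projection \<Omega>"
  have psub: "Lp \<Omega> p \<subseteq> Lp \<Omega> 2" using Lp_subset_finite_measure[OF fin, of 2 p] p by simp
  have "\<exists>C. \<forall>f u. f \<in> bounded_measurable ?M \<longrightarrow> u \<in> bounded_measurable ?M \<longrightarrow>
    norm (LINT x|?M. ?P f x * cnj (u x)) \<le> C * Lp_norm \<Omega> p f * Lp_norm \<Omega> q u"
    using maps
  proof
    assume "bergman_projection_maps_Lp \<Omega> p"
    then have "\<And>f. f \<in> Lp \<Omega> p \<Longrightarrow> ?P f \<in> Lp \<Omega> p" using psub by (simp add: bergman_projection_maps_Lp_def)
    then show ?thesis by (rule bilinear_bound_closed_graph[OF \<Omega> fin p pq])
  next
    assume "bergman_projection_maps_Lp \<Omega> q"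
    then obtain C where "\<And>f. f \<in> Lp \<Omega> q \<inter> Lp \<Omega> 2 \<Longrightarrow> ?P f \<in> Lp \<Omega> q \<and> Lp_norm \<Omega> q (?P f) \<le> C * Lp_norm \<Omega> q f"
      using nsub unfolding bergman_projection_maps_Lp_def by auto
    then show ?thesis using bilinear_bound_dual[OF \<Omega> fin p pq] by blast
  qed
  then obtain C where C: "\<And>f u. f \<in> bounded_measurable ?M \<Longrightarrow> u \<in> bounded_measurable ?M \<Longrightarrow>
    norm (LINT x|?M. ?P f x * cnj (u x)) \<le> C * Lp_norm \<Omega> p f * Lp_norm \<Omega> q u" by blast
  have C': "norm (LINT x|?M. ?P f x * cnj (u x)) \<le> (\<bar>C\<bar> * Lp_norm \<Omega> p f) * Lp_norm \<Omega> q u"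
    if "f \<in> bounded_measurable ?M" "u \<in> bounded_measurable ?M" for f u
  proof -
    have "C * Lp_norm \<Omega> p f * Lp_norm \<Omega> q u \<le> \<bar>C\<bar> * Lp_norm \<Omega> p f * Lp_norm \<Omega> q u"
      by (intro mult_right_mono Lp_norm_nonneg) auto
    then show ?thesis using C[OF that] by linarith
  qed
  have meas: "?P f \<in> borel_measurable ?M" if "f \<in> bounded_measurable ?M" for f
    using bergman_projection_spec(1)[OF \<Omega> bounded_measurable_Lp[OF fin that]] by (simp add: bergman_space_def Lp_def)
  show thesis
  proof (rule that[of "\<bar>C\<bar>"])
    fix f assume f: "f \<in> bounded_measurable ?M"
    have nn: "\<bar>C\<bar> * Lp_norm \<Omega> p f \<ge> 0" by (simp add: Lp_norm_nonneg)
    show "?P f \<in> Lp \<Omega> p" by (rule Lp_bound_from_bilinear_bound(1)[OF \<Omega> fin p pq C'[OF f] nn meas[OF f]])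
    show "Lp_norm \<Omega> p (?P f) \<le> \<bar>C\<bar> * Lp_norm \<Omega> p f"
      by (rule Lp_bound_from_bilinear_bound(2)[OF \<Omega> fin p pq C'[OF f] nn meas[OF f]])
  qed simp
qed

section \<open>Geometry of the worm domain and the logarithm on it\<close>

definition worm_angle :: "real \<Rightarrow> 'm::finite cspace \<Rightarrow> real" where
  "worm_angle \<alpha> z = 2 * \<alpha> * ln (cmod (snd (snd z)))"

text \<open>Multiplication by exp (- i \<theta>), \<theta> = 2 \<alpha> ln |z_n|, undoes the rotation of the disc in which z_1 lies. On the worm domain the result has
  positive real part.\<close>

definition worm_unwound :: "real \<Rightarrow> 'm::finite cspace \<Rightarrow> complex" where
  "worm_unwound \<alpha> z = fst z * exp (- \<i> * of_real (worm_angle \<alpha> z))"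

text \<open>A branch of ln z_1 on the whole worm domain: the unwound coordinate lies in the right half plane, where the principal
  logarithm is smooth, and the rotation is added back. The domain winds around z_1 = 0, so the principal branch would not do.\<close>

definition worm_log :: "real \<Rightarrow> 'm::finite cspace \<Rightarrow> complex" where
  "worm_log \<alpha> z = Ln (worm_unwound \<alpha> z) + \<i> * of_real (worm_angle \<alpha> z)"

lemma worm_sigma_nonneg: "M > 0 \<Longrightarrow> worm_sigma M t \<ge> 0"
  by (simp add: worm_sigma_def)

lemma norm_exp_minus_ii [simp]: "norm (exp (- \<i> * of_real x)) = 1"
  by (simp add: norm_exp_eq_Re)

lemma norm_worm_unwound: "norm (worm_unwound \<alpha> z) = norm (fst z)"
  unfolding worm_unwound_def norm_mult norm_exp_minus_ii by simp

lemma worm_domain_iff: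
  "z \<in> worm_domain \<alpha> \<beta> M \<longleftrightarrow> snd (snd z) \<noteq> 0 \<and>
     (cmod (worm_unwound \<alpha> z - 1))\<^sup>2 + (norm (fst (snd z)))\<^sup>2
     + worm_sigma M ((cmod (snd (snd z)))\<^sup>2 - \<beta>\<^sup>2) + worm_sigma M (1 - (cmod (snd (snd z)))\<^sup>2) < 1"
proof -
  obtain z1 z' zn where z: "z = (z1, z', zn)" by (cases z) auto
  define e where "e = exp (- \<i> * of_real (worm_angle \<alpha> z))"
  have ne: "norm e = 1" unfolding e_def by (rule norm_exp_minus_ii)
  have "exp (2 * \<i> * of_real (\<alpha> * ln (cmod zn))) * e = 1"
    unfolding e_def exp_add[symmetric] by (simp add: worm_angle_def z)
  then have "worm_unwound \<alpha> z - 1 = (z1 - exp (2 * \<i> * of_real (\<alpha> * ln (cmod zn)))) * e"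
    by (simp add: worm_unwound_def e_def z left_diff_distrib)
  then have "cmod (worm_unwound \<alpha> z - 1) = cmod (z1 - exp (2 * \<i> * of_real (\<alpha> * ln (cmod zn))))"
    by (simp add: norm_mult ne)
  then show ?thesis by (auto simp: worm_domain_def worm_r_def z)
qed

lemma cmod_minus_1_sq: "(cmod (w - 1))\<^sup>2 = (cmod w)\<^sup>2 - 2 * Re w + 1"
  unfolding cmod_power2 by (simp add: power2_eq_square algebra_simps)

lemma worm_domain_props:
  assumes "z \<in> worm_domain \<alpha> \<beta> M" "M > 0"
  shows "snd (snd z) \<noteq> 0" "(norm (fst z))\<^sup>2 + (norm (fst (snd z)))\<^sup>2 < 2 * Re (worm_unwound \<alpha> z)"
    "Re (worm_unwound \<alpha> z) > 0" "fst z \<noteq> 0" "norm (fst z) < 2" "(norm (fst (snd z)))\<^sup>2 < 2 * norm (fst z)"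
    "worm_sigma M ((cmod (snd (snd z)))\<^sup>2 - \<beta>\<^sup>2) + worm_sigma M (1 - (cmod (snd (snd z)))\<^sup>2) < min 1 (2 * norm (fst z))"
proof -
  note * = assms(1)[unfolded worm_domain_iff]
  define w where "w = worm_unwound \<alpha> z"
  define s1 where "s1 = worm_sigma M ((cmod (snd (snd z)))\<^sup>2 - \<beta>\<^sup>2)"
  define s2 where "s2 = worm_sigma M (1 - (cmod (snd (snd z)))\<^sup>2)"
  define q where "q = (norm (fst (snd z)))\<^sup>2"
  have q0: "q \<ge> 0" by (simp add: q_def)
  have s: "s1 \<ge> 0" "s2 \<ge> 0" using worm_sigma_nonneg[OF assms(2)] by (auto simp: s1_def s2_def)
  have main: "(cmod (w - 1))\<^sup>2 + q + s1 + s2 < 1" using * by (simp add: w_def s1_def s2_def q_def)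
  have nw: "cmod w = norm (fst z)" by (simp add: w_def norm_worm_unwound)
  have 2: "(cmod w)\<^sup>2 + q + s1 + s2 < 2 * Re w" using main unfolding cmod_minus_1_sq by linarith
  have Re: "Re w \<le> cmod w" by (rule complex_Re_le_cmod)
  show "snd (snd z) \<noteq> 0" using * by simp
  show "(norm (fst z))\<^sup>2 + (norm (fst (snd z)))\<^sup>2 < 2 * Re (worm_unwound \<alpha> z)"
    using 2 s by (simp add: w_def[symmetric] q_def[symmetric] nw[symmetric])
  show pos: "Re (worm_unwound \<alpha> z) > 0"
    using 2 s q0 zero_le_power2[of "cmod w"] unfolding w_def[symmetric] by linarith
  show "fst z \<noteq> 0" using pos by (auto simp: worm_unwound_def)
  have "(cmod w)\<^sup>2 < 2 * cmod w" using 2 s q0 Re by linarith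
  then have "cmod w * cmod w < 2 * cmod w" by (simp add: power2_eq_square)
  then show "norm (fst z) < 2" unfolding nw[symmetric]
    by (metis mult_less_cancel_right norm_ge_zero not_less)
  show "(norm (fst (snd z)))\<^sup>2 < 2 * norm (fst z)" unfolding q_def[symmetric] nw[symmetric]
    using 2 s Re zero_le_power2[of "cmod w"] by linarith
  have "s1 + s2 < 2 * cmod w" using 2 Re zero_le_power2[of "cmod w"] q0 by linarith
  moreover have "s1 + s2 < 1" using main q0 zero_le_power2[of "cmod (w - 1)"] by linarith
  ultimately show "worm_sigma M ((cmod (snd (snd z)))\<^sup>2 - \<beta>\<^sup>2) + worm_sigma M (1 - (cmod (snd (snd z)))\<^sup>2) < min 1 (2 * norm (fst z))"
    by (simp add: s1_def s2_def nw)
qed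

lemma worm_domain_core:
  assumes "1 \<le> cmod (snd (snd z))" "cmod (snd (snd z)) \<le> \<beta>"
    "(norm (fst z))\<^sup>2 + (norm (fst (snd z)))\<^sup>2 < 2 * Re (worm_unwound \<alpha> z)"
  shows "z \<in> worm_domain \<alpha> \<beta> M"
proof -
  have "(cmod (snd (snd z)))\<^sup>2 \<le> \<beta>\<^sup>2" "1 \<le> (cmod (snd (snd z)))\<^sup>2"
    using assms by (auto intro: power_mono one_le_power)
  then have "worm_sigma M ((cmod (snd (snd z)))\<^sup>2 - \<beta>\<^sup>2) = 0" "worm_sigma M (1 - (cmod (snd (snd z)))\<^sup>2) = 0"
    by (auto simp: worm_sigma_def)
  moreover have "snd (snd z) \<noteq> 0" using assms(1) by auto
  ultimately show ?thesis
    unfolding worm_domain_iff cmod_minus_1_sq norm_worm_unwound using assms(3) by simp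
qed

lemma worm_log_props:
  assumes "fst z \<noteq> 0"
  shows "exp (worm_log \<alpha> z) = fst z" "Re (worm_log \<alpha> z) = ln (norm (fst z))"
    "Re (worm_unwound \<alpha> z) = norm (fst z) * cos (Im (worm_log \<alpha> z) - worm_angle \<alpha> z)"
    "Re (worm_unwound \<alpha> z) > 0 \<Longrightarrow> \<bar>Im (worm_log \<alpha> z) - worm_angle \<alpha> z\<bar> < pi / 2"
proof -
  have w0: "worm_unwound \<alpha> z \<noteq> 0" using assms by (simp add: worm_unwound_def)
  have L: "exp (Ln (worm_unwound \<alpha> z)) = worm_unwound \<alpha> z" using w0 by simp
  show "exp (worm_log \<alpha> z) = fst z"
    unfolding worm_log_def exp_add L unfolding worm_unwound_def
    by (simp add: mult.assoc exp_add[symmetric])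
  show "Re (worm_log \<alpha> z) = ln (norm (fst z))"
    using w0 assms by (simp add: worm_log_def Re_Ln norm_worm_unwound)
  have u: "Im (worm_log \<alpha> z) - worm_angle \<alpha> z = Im (Ln (worm_unwound \<alpha> z))" by (simp add: worm_log_def)
  have "Re (worm_unwound \<alpha> z) = Re (exp (Ln (worm_unwound \<alpha> z)))" by (simp add: L)
  also have "\<dots> = exp (Re (Ln (worm_unwound \<alpha> z))) * cos (Im (Ln (worm_unwound \<alpha> z)))" by (rule Re_exp)
  also have "exp (Re (Ln (worm_unwound \<alpha> z))) = norm (fst z)" using w0 assms by (simp add: Re_Ln norm_worm_unwound)
  finally show "Re (worm_unwound \<alpha> z) = norm (fst z) * cos (Im (worm_log \<alpha> z) - worm_angle \<alpha> z)" by (simp add: u)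
  show "\<bar>Im (worm_log \<alpha> z) - worm_angle \<alpha> z\<bar> < pi / 2" if "Re (worm_unwound \<alpha> z) > 0"
    unfolding u using Re_Ln_pos_lt[OF w0] that by simp
qed

lemma worm_angle_has_derivative:
  fixes z :: "'m::finite cspace"
  assumes "snd (snd z) \<noteq> 0"
  shows "(worm_angle \<alpha> has_derivative (\<lambda>v. 2 * \<alpha> * ((snd (snd v) \<bullet> snd (snd z)) / (cmod (snd (snd z)))\<^sup>2))) (at z)"
proof -
  have "((\<lambda>z. snd (snd z)) has_derivative (\<lambda>v. snd (snd v))) (at z)"
    by (intro bounded_linear_imp_has_derivative bounded_linear_compose[OF bounded_linear_snd] bounded_linear_snd)
  from has_derivative_compose[OF this ln_norm_has_derivative[OF assms]]
  show ?thesis unfolding worm_angle_def[abs_def] by (rule has_derivative_mult_right)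
qed

lemma worm_log_has_derivative:
  fixes z :: "'m::finite cspace"
  assumes "snd (snd z) \<noteq> 0" "Re (worm_unwound \<alpha> z) > 0"
  shows "(worm_log \<alpha> has_derivative (\<lambda>v. fst v / fst z)) (at z)"
proof -
  define T where "T v = 2 * \<alpha> * ((snd (snd v) \<bullet> snd (snd z)) / (cmod (snd (snd z)))\<^sup>2)" for v :: "'m cspace"
  define E where "E = exp (- \<i> * of_real (worm_angle \<alpha> z))"
  have z1: "fst z \<noteq> 0" "E \<noteq> 0" using assms(2) by (auto simp: worm_unwound_def E_def)
  have d1: "(worm_angle \<alpha> has_derivative T) (at z)" unfolding T_def[abs_def] by (rule worm_angle_has_derivative[OF assms(1)])
  have d2: "((\<lambda>z. complex_of_real (worm_angle \<alpha> z)) has_derivative (\<lambda>v. of_real (T v))) (at z)"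
    by (rule has_derivative_of_real[OF d1])
  have "((\<lambda>z. exp (- \<i> * complex_of_real (worm_angle \<alpha> z))) has_derivative (\<lambda>v. E * (- \<i> * of_real (T v)))) (at z)"
    using has_derivative_compose[OF has_derivative_mult_right[OF d2, of "- \<i>"] 
        DERIV_exp[of "- \<i> * of_real (worm_angle \<alpha> z)", unfolded has_field_derivative_def]]
    by (simp add: E_def)
  from has_derivative_mult[OF bounded_linear_imp_has_derivative[OF bounded_linear_fst] this]
  have d3: "(worm_unwound \<alpha> has_derivative (\<lambda>v. fst z * (E * (- \<i> * of_real (T v))) + fst v * E)) (at z)"
    by (simp add: worm_unwound_def[abs_def] E_def)
  have w: "worm_unwound \<alpha> z = fst z * E" by (simp add: worm_unwound_def E_def)
  have "worm_unwound \<alpha> z \<notin> \<real>\<^sub>\<le>\<^sub>0" using assms(2) by (auto simp: complex_nonpos_Reals_iff)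
  from has_derivative_compose[OF d3 has_field_derivative_Ln[OF this, unfolded has_field_derivative_def]]
  have d4: "((\<lambda>z. Ln (worm_unwound \<alpha> z)) has_derivative
      (\<lambda>v. inverse (fst z * E) * (fst z * (E * (- \<i> * of_real (T v))) + fst v * E))) (at z)"
    by (simp add: w)
  have "(worm_log \<alpha> has_derivative (\<lambda>v. inverse (fst z * E) * (fst z * (E * (- \<i> * of_real (T v))) + fst v * E) + \<i> * of_real (T v))) (at z)"
    unfolding worm_log_def[abs_def] by (rule has_derivative_add[OF d4 has_derivative_mult_right[OF d2]])
  moreover have "inverse (fst z * E) * (fst z * (E * (- \<i> * of_real (T v))) + fst v * E) + \<i> * of_real (T v) = fst v / fst z" for v
    using z1 by (simp add: field_simps)
  ultimately show ?thesis by simp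
qed

lemma worm_log_holomorphic:
  assumes "M > 0" shows "holomorphic_fun_on (worm_log \<alpha>) (worm_domain \<alpha> \<beta> M)"
  unfolding holomorphic_fun_on_def
proof
  fix z :: "'a cspace" assume z: "z \<in> worm_domain \<alpha> \<beta> M"
  show "\<exists>D. (worm_log \<alpha> has_derivative D) (at z) \<and> (\<forall>c v. D (cscale c v) = c * D v)"
    using worm_log_has_derivative[OF worm_domain_props(1,3)[OF z assms]]
    by (intro exI[of _ "\<lambda>v. fst v / fst z"]) simp
qed

lemma inverse_zn_holomorphic:
  assumes "M > 0" shows "holomorphic_fun_on (\<lambda>z. 1 / snd (snd z)) (worm_domain \<alpha> \<beta> M)"
proof -
  have lin: "holomorphic_fun_on (\<lambda>z. snd (snd z)) (worm_domain \<alpha> \<beta> M)"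
    unfolding holomorphic_fun_on_def
    by (intro ballI exI[of _ "\<lambda>v. snd (snd v)"] conjI bounded_linear_imp_has_derivative 
          bounded_linear_compose[OF bounded_linear_snd] bounded_linear_snd) simp
  show ?thesis
  proof (rule holomorphic_fun_on_compose[OF lin, of "\<lambda>x. 1 / x" "\<lambda>z. - 1 / (snd (snd z))^2"])
    fix z :: "'a cspace" assume "z \<in> worm_domain \<alpha> \<beta> M"
    then have "snd (snd z) \<noteq> 0" by (rule worm_domain_props(1)[OF _ assms])
    then show "((\<lambda>x. 1 / x) has_field_derivative - 1 / (snd (snd z))\<^sup>2) (at (snd (snd z)))"
      by (auto intro!: derivative_eq_intros simp: power2_eq_square)
  qed
qed

text \<open>If M \<le> e, the domain reaches z_n = 0: it contains the points (1, 0, c) for a sequence of circles |c| = x_k shrinking to 0, so P = (1, 0, 0)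
  is a boundary point. A defining function is negative on these circles, which forces its gradient at P to vanish
  in the directions z_n; it is nonnegative on the slice z_n = 0, which is disjoint from the domain, so the gradient vanishes in the other directions
  too. This contradicts smoothness of the boundary. The bound M > e is what keeps |z_n| away from 0.\<close>

lemma worm_smooth_imp_M_large:
  fixes \<Omega> :: "'m::finite cspace set"
  assumes "\<alpha> > 0" "\<beta> > 1" "M > 0" and \<Omega>: "\<Omega> = worm_domain \<alpha> \<beta> M" and sm: "smooth_boundary \<Omega>"
  shows "M > exp 1"
proof (rule ccontr)
  assume "\<not> M > exp 1"
  then have M: "M \<le> exp 1" by simp
  define P where "P = ((1, 0, 0) :: 'm cspace)"
  define x where "x k = exp (- pi * real (Suc k) / \<alpha>)" for k
  have x: "0 < x k" "x k < 1" for k using assms(1) by (auto simp: x_def intro!: divide_pos_pos mult_pos_pos)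
  have xlim: "x \<longlonglongrightarrow> 0"
  proof -
    have "x = (\<lambda>k. exp (- pi / \<alpha>) ^ Suc k)"
      unfolding exp_of_nat_mult[symmetric] by (simp add: x_def fun_eq_iff mult.commute)
    moreover have "(\<lambda>k. exp (- pi / \<alpha>) ^ Suc k) \<longlonglongrightarrow> 0"
      by (intro LIMSEQ_Suc LIMSEQ_realpow_zero) (use assms(1) in auto)
    ultimately show ?thesis by (simp only:)
  qed
  have inO: "(1, 0, c) \<in> \<Omega>" if c: "cmod c = x k" for c k
  proof -
    have "worm_angle \<alpha> ((1, 0, c) :: 'm cspace) = - (2 * pi * real (Suc k))"
      using assms(1) by (simp add: worm_angle_def c x_def)
    then have "worm_unwound \<alpha> ((1, 0, c) :: 'm cspace) = exp (2 * of_nat (Suc k) * pi * \<i>)"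
      by (simp add: worm_unwound_def mult_ac)
    also have "\<dots> = 1" using exp_integer_2pi[of "of_nat (Suc k)"] by (simp add: mult_ac)
    finally have w: "worm_unwound \<alpha> ((1, 0, c) :: 'm cspace) = 1" .
    have xx: "0 < (x k)\<^sup>2" "(x k)\<^sup>2 < 1" using x[of k] by (auto simp: power_less_one_iff)
    have b: "1 < \<beta>\<^sup>2" using assms(2) by (simp add: power2_eq_square) (metis less_1_mult)
    have "1 / (1 - (x k)\<^sup>2) > 1" using xx by (simp add: field_simps)
    then have "M * exp (- 1 / (1 - (x k)\<^sup>2)) < exp 1 * exp (- 1)"
      using M assms(3) by (intro mult_le_less_imp_less) auto
    then have "M * exp (- 1 / (1 - (x k)\<^sup>2)) < 1" by (simp add: exp_minus_inverse)
    then show ?thesis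
      using xx b c x(1)[of k] unfolding \<Omega> worm_domain_iff w by (auto simp: worm_sigma_def)
  qed
  have PO: "P \<notin> \<Omega>" by (simp add: \<Omega> worm_domain_iff P_def)
  have near: "(\<lambda>k. P + x k *\<^sub>R (0, 0, v)) \<longlonglongrightarrow> P" for v :: complex
  proof -
    have "(\<lambda>k. P + x k *\<^sub>R (0, 0, v)) \<longlonglongrightarrow> P + 0 *\<^sub>R (0, 0, v)" by (intro tendsto_intros xlim)
    then show ?thesis by (simp only: scaleR_zero_left add_0_right)
  qed
  have ray: "P + x k *\<^sub>R (0, 0, v) \<in> \<Omega>" if "cmod v = 1" for v k
    using inO[of "x k *\<^sub>R v" k] that x(1)[of k] by (simp add: P_def)
  have "P \<in> closure \<Omega>"
    unfolding closure_sequential by (intro exI[of _ "\<lambda>k. P + x k *\<^sub>R (0, 0, 1)"] conjI allI ray near) simp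
  then have "P \<in> frontier \<Omega>" using PO interior_subset by (auto simp: frontier_def)
  define good where "good U \<rho> \<longleftrightarrow> open U \<and> P \<in> U \<and> (\<forall>k. Ck_on k U \<rho>) \<and>
      (\<forall>y\<in>U. frechet_derivative \<rho> (at y) \<noteq> (\<lambda>v. 0)) \<and> \<Omega> \<inter> U = {y \<in> U. \<rho> y < 0}" for U and \<rho> :: "'m cspace \<Rightarrow> real"
  have "\<exists>U \<rho>. good U \<rho>"
    using sm \<open>P \<in> frontier \<Omega>\<close> unfolding smooth_boundary_def good_def by (rule bspec)
  then obtain U \<rho> where "good U \<rho>" by blast
  note * = this[unfolded good_def]
  have U: "open U" "P \<in> U" and Ck: "Ck_on k U \<rho>" and sub: "\<Omega> \<inter> U = {y \<in> U. \<rho> y < 0}" for k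
    using * by simp_all
  have grad: "frechet_derivative \<rho> (at P) \<noteq> (\<lambda>v. 0)" using conjunct2[OF conjunct2[OF conjunct2[OF *]]] U(2) by (elim conjE) (rule bspec)
  define D where "D = frechet_derivative \<rho> (at P)"
  have "\<rho> differentiable (at P)" using Ck[of 1] U(2) by simp
  then have D: "(\<rho> has_derivative D) (at P)" unfolding D_def frechet_derivative_works .
  have linD: "linear D" by (rule has_derivative_linear[OF D])
  have neg: "\<rho> y < 0" if "y \<in> U" "y \<in> \<Omega>" for y using that eqset_imp_iff[OF sub, of y] by simp
  have nonneg: "\<rho> y \<ge> 0" if "y \<in> U" "y \<notin> \<Omega>" for y using that eqset_imp_iff[OF sub, of y] by simp
  have evneg: "\<forall>\<^sub>F k in sequentially. \<rho> (P + x k *\<^sub>R (0, 0, v)) < 0" if "cmod v = 1" for v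
    using topological_tendstoD[OF near U] by eventually_elim (rule neg[OF _ ray[OF that]])
  have \<rho>P: "\<rho> P = 0"
  proof (rule antisym)
    have "isCont \<rho> P" using D by (rule has_derivative_continuous)
    then have "(\<lambda>k. \<rho> (P + x k *\<^sub>R (0, 0, 1))) \<longlonglongrightarrow> \<rho> P" by (rule isCont_tendsto_compose[OF _ near])
    then show "\<rho> P \<le> 0"
      by (rule tendsto_upperbound) (use evneg[of 1] in \<open>auto elim: eventually_mono\<close>)
    show "0 \<le> \<rho> P" by (rule nonneg[OF U(2) PO])
  qed
  have dn: "D (0, 0, v) \<le> 0" if "cmod v = 1" for v
  proof -
    have "(\<lambda>k. (1 / x k) *\<^sub>R (\<rho> (P + x k *\<^sub>R (0, 0, v)) - \<rho> P)) \<longlonglongrightarrow> D (0, 0, v)"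
      by (rule directional_quotient_tendsto[OF D xlim]) (use x in \<open>simp add: less_imp_neq[symmetric]\<close>)
    then show ?thesis
    proof (rule tendsto_upperbound)
      show "\<forall>\<^sub>F k in sequentially. (1 / x k) *\<^sub>R (\<rho> (P + x k *\<^sub>R (0, 0, v)) - \<rho> P) \<le> 0"
        using evneg[OF that] by eventually_elim (use x \<rho>P in \<open>simp add: divide_nonpos_pos\<close>)
    qed simp
  qed
  have dn0: "D (0, 0, v) = 0" for v
  proof (cases "v = 0")
    case True
    then show ?thesis using linear_0[OF linD] by (simp add: zero_prod_def)
  next
    case False
    define e where "e = v /\<^sub>R cmod v"
    have e: "cmod e = 1" "cmod (- e) = 1" using False by (auto simp: e_def)
    have "D (0, 0, - e) = - D (0, 0, e)" using linear_neg[OF linD, of "(0, 0, e)"] by simp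
    then have "D (0, 0, e) = 0" using dn[OF e(1)] dn[OF e(2)] by simp
    moreover have "(0, 0, v) = cmod v *\<^sub>R ((0, 0, e) :: 'm cspace)" using False by (simp add: e_def)
    ultimately show ?thesis using linear_cmul[OF linD, of "cmod v" "(0, 0, e)"] by simp
  qed
  have ds: "D (a, b, 0) = 0" for a b
  proof -
    define v where "v = ((a, b, 0) :: 'm cspace)"
    define \<phi> where "\<phi> t = \<rho> (P + t *\<^sub>R v)" for t :: real
    have "((\<lambda>t. P + t *\<^sub>R v) has_derivative (\<lambda>t. t *\<^sub>R v)) (at 0)" by (auto intro!: derivative_eq_intros)
    then have "(\<phi> has_derivative (\<lambda>t. D (t *\<^sub>R v))) (at 0)"
      unfolding \<phi>_def using has_derivative_compose[of "\<lambda>t. P + t *\<^sub>R v" "\<lambda>t. t *\<^sub>R v" 0 UNIV \<rho> D] D by simp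
    then have der: "(\<phi> has_real_derivative D v) (at 0)"
      unfolding has_field_derivative_def by (simp add: linear_cmul[OF linD] mult_commute_abs)
    have "open ((\<lambda>t. P + t *\<^sub>R v) -` U)" by (intro open_vimage U(1) continuous_intros)
    moreover have "0 \<in> (\<lambda>t. P + t *\<^sub>R v) -` U" using U(2) by simp
    ultimately obtain d where d: "d > 0" "ball 0 d \<subseteq> (\<lambda>t. P + t *\<^sub>R v) -` U" using openE by blast
    have "\<phi> 0 \<le> \<phi> t" if "\<bar>0 - t\<bar> < d" for t
    proof -
      have "t \<in> ball 0 d" using that by simp
      then have "P + t *\<^sub>R v \<in> U" using d(2) by blast
      moreover have "P + t *\<^sub>R v \<notin> \<Omega>" by (simp add: \<Omega> worm_domain_iff P_def v_def)
      ultimately show ?thesis using nonneg \<rho>P by (simp add: \<phi>_def)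
    qed
    then have "D v = 0" using DERIV_local_min[OF der d(1)] by blast
    then show ?thesis by (simp add: v_def)
  qed
  have "D v = 0" for v
  proof -
    have "v = (fst v, fst (snd v), 0) + (0, 0, snd (snd v))" by (simp add: prod_eq_iff)
    then have "D v = D (fst v, fst (snd v), 0) + D (0, 0, snd (snd v))" using linear_add[OF linD] by metis
    then show ?thesis using ds dn0 by simp
  qed
  then show False using grad unfolding D_def by blast
qed

lemma worm_zn_bounds:
  assumes "M > exp 1" "z \<in> worm_domain \<alpha> \<beta> M"
  shows "1 - 1 / ln M < (cmod (snd (snd z)))\<^sup>2" "(cmod (snd (snd z)))\<^sup>2 < \<beta>\<^sup>2 + 1 / ln M"
proof -
  have M: "M > 0" using assms(1) exp_gt_zero order_less_trans by blast
  have lnM: "ln M > 1" using assms(1) M by (metis exp_less_cancel_iff exp_ln)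
  have key: "t < 1 / ln M" if "worm_sigma M t < 1" for t
  proof (cases "t > 0")
    case True
    have "ln M + (- 1 / t) < 0"
    proof -
      have "exp (ln M + (- 1 / t)) = M * exp (- 1 / t)" unfolding exp_add using M by simp
      then have "exp (ln M + (- 1 / t)) < exp 0" using that True by (simp add: worm_sigma_def)
      then show ?thesis by (simp only: exp_less_cancel_iff)
    qed
    then show ?thesis using True lnM by (simp add: field_simps)
  next
    case False
    moreover have "0 < 1 / ln M" using lnM by simp
    ultimately show ?thesis by linarith
  qed
  define s1 where "s1 = (cmod (snd (snd z)))\<^sup>2 - \<beta>\<^sup>2"
  define s2 where "s2 = 1 - (cmod (snd (snd z)))\<^sup>2"
  have "worm_sigma M s1 + worm_sigma M s2 < 1" using worm_domain_props(7)[OF assms(2) M] by (simp add: s1_def s2_def)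
  then have "worm_sigma M s1 < 1" "worm_sigma M s2 < 1"
    using worm_sigma_nonneg[OF M, of s1] worm_sigma_nonneg[OF M, of s2] by linarith+
  from key[OF this(1)] key[OF this(2)] 
  show "1 - 1 / ln M < (cmod (snd (snd z)))\<^sup>2" "(cmod (snd (snd z)))\<^sup>2 < \<beta>\<^sup>2 + 1 / ln M"
    by (simp_all add: s1_def s2_def)
qed

section \<open>The period identity\<close>

text \<open>The real part of the flow multiplies z_n by a positive factor and rotates z_1 and z' by the amount needed to follow the winding;
  i times the field contracts z_1 and z' with weights 2 and 1 and rotates z_n. Neither flow changes worm_height.\<close>

definition worm_field :: "real \<Rightarrow> 'm::finite cspace \<Rightarrow> 'm cspace" where
  "worm_field \<alpha> z = (2 * of_real \<alpha> * \<i> * fst z, (of_real \<alpha> * \<i>) *s fst (snd z), snd (snd z))"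

lemma linear_worm_field: "linear (worm_field \<alpha>)"
  by (rule linearI) (auto simp: worm_field_def vec_eq_iff algebra_simps scaleR_conv_of_real[where 'a=complex])

lemma sum_Basis_inner_self: "(\<Sum>e\<in>Basis. e \<bullet> (e::'a::euclidean_space)) = real DIM('a)"
  by (simp add: inner_same_Basis)

lemma sum_Basis_prod_split:
  fixes f :: "'a::euclidean_space \<times> 'b::euclidean_space \<Rightarrow> real"
  shows "(\<Sum>e\<in>Basis. f e) = (\<Sum>e\<in>Basis. f (e, 0)) + (\<Sum>e\<in>Basis. f (0, e))"
  unfolding Basis_prod_def
  by (subst sum.union_disjoint) (auto simp: Basis_prod_def sum.reindex inj_on_def nonzero_Basis)

lemma worm_field_traces:
  shows "(\<Sum>e\<in>Basis. worm_field \<alpha> e \<bullet> (e::'m::finite cspace)) = 2" 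
    and "(\<Sum>e\<in>Basis. cscale \<i> (worm_field \<alpha> e) \<bullet> (e::'m::finite cspace)) = - 2 * \<alpha> * real (CARD('m) + 2)"
proof -
  have inner_ii: "(of_real a * \<i> * c) \<bullet> c = 0" "(\<i> * c) \<bullet> c = 0" for a and c :: complex
    by (auto simp: inner_complex_def algebra_simps)
  have inner_iv: "((of_real a * \<i>) *s v) \<bullet> v = 0" for a and v :: "complex ^ 'm"
    by (simp add: inner_vec_def inner_complex_def algebra_simps)
  have inner_rv: "((\<i> * (of_real a * \<i>)) *s v) \<bullet> v = - a * (v \<bullet> v)" for a and v :: "complex ^ 'm"
    by (simp add: inner_vec_def inner_complex_def sum_distrib_left sum_negf[symmetric] algebra_simps)
  have inner_rc: "(\<i> * (2 * of_real a * \<i> * c)) \<bullet> c = - 2 * a * (c \<bullet> c)" for a and c :: complex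
    by (simp add: inner_complex_def algebra_simps)
  have f1: "worm_field \<alpha> e \<bullet> e = snd (snd e) \<bullet> snd (snd e)" for e :: "'m cspace"
    using inner_ii(1)[of "2 * \<alpha>" "fst e"] by (simp add: worm_field_def inner_prod_def inner_iv)
  have f2: "cscale \<i> (worm_field \<alpha> e) \<bullet> e = - 2 * \<alpha> * (fst e \<bullet> fst e) - \<alpha> * (fst (snd e) \<bullet> fst (snd e))" for e :: "'m cspace"
    by (simp add: worm_field_def cscale_eq inner_prod_def inner_rv inner_rc inner_ii)
  show "(\<Sum>e\<in>Basis. worm_field \<alpha> e \<bullet> (e::'m::finite cspace)) = 2"
    unfolding f1 by (subst sum_Basis_prod_split, subst sum_Basis_prod_split) (use sum_Basis_inner_self[where 'a=complex] in simp)
  have "(\<Sum>e\<in>Basis. cscale \<i> (worm_field \<alpha> e) \<bullet> (e::'m::finite cspace)) = 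
     (\<Sum>e\<in>(Basis::complex set). - 2 * \<alpha> * (e \<bullet> e)) + (\<Sum>e\<in>(Basis::(complex^'m) set). - \<alpha> * (e \<bullet> e))"
    unfolding f2 by (subst sum_Basis_prod_split, subst sum_Basis_prod_split) simp
  also have "\<dots> = - 2 * \<alpha> * 2 + - \<alpha> * (2 * real CARD('m))"
    unfolding sum_distrib_left[symmetric] sum_Basis_inner_self by simp
  finally show "(\<Sum>e\<in>Basis. cscale \<i> (worm_field \<alpha> e) \<bullet> (e::'m::finite cspace)) = - 2 * \<alpha> * real (CARD('m) + 2)"
    by (simp add: algebra_simps)
qed

lemma sphere_null_lborel: "r > 0 \<Longrightarrow> sphere (0::complex) r \<in> null_sets lborel"
proof -
  assume "r > 0"
  have "negligible (frontier (ball (0::complex) r))" by (rule negligible_convex_frontier[OF convex_ball])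
  then have "negligible (sphere (0::complex) r)" using \<open>r > 0\<close> by simp
  then show ?thesis by (simp add: negligible_iff_null_sets null_sets_completion_iff)
qed

lemma zn_sphere_null:
  assumes "r > 0" shows "{z :: 'm::finite cspace. cmod (snd (snd z)) = r} \<in> null_sets lborel"
proof -
  have eq: "{z :: 'm cspace. cmod (snd (snd z)) = r} = UNIV \<times> (UNIV \<times> sphere 0 r)" by (auto simp: set_eq_iff)
  have 1: "(UNIV :: (complex^'m) set) \<times> sphere (0::complex) r \<in> null_sets (lborel \<Otimes>\<^sub>M lborel)"
    by (rule lborel.times_in_null_sets2) (use sphere_null_lborel[OF assms] in auto)
  have "(UNIV :: complex set) \<times> ((UNIV :: (complex^'m) set) \<times> sphere (0::complex) r) \<in> null_sets (lborel \<Otimes>\<^sub>M lborel)"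
    by (rule lborel.times_in_null_sets2) (use 1 in \<open>auto simp: lborel_prod\<close>)
  then show ?thesis by (simp add: eq lborel_prod)
qed

text \<open>(2 Re (worm_unwound z) - |z'|^2) / |z_1|, a function that is constant along the field and along i times the field. The core is
  given by height > |z_1|, so a cutoff to height > \<kappa> stays inside it for |z_1| < \<kappa> and costs nothing in the integration by parts.\<close>

definition worm_height :: "real \<Rightarrow> 'm::finite cspace \<Rightarrow> real" where
  "worm_height \<alpha> z = 2 * cos (Im (worm_log \<alpha> z) - worm_angle \<alpha> z)
      - (fst (snd z) \<bullet> fst (snd z)) * exp (- Re (worm_log \<alpha> z))"

text \<open>The function z_1^b / z_n. For b = - n/2 - period its pairing with holomorphic functions vanishes formally; it has modulus
  comparable to |z_1|^b.\<close>

definition worm_power :: "real \<Rightarrow> real \<Rightarrow> 'm::finite cspace \<Rightarrow> complex" where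
  "worm_power \<alpha> b z = exp (of_real b * worm_log \<alpha> z) * (1 / snd (snd z))"

text \<open>The primitive of exp (2 i s t) that vanishes at t = 0. It vanishes again at t = \<pi> / s, which is the total winding 2 \<alpha> ln \<beta> for the critical s.\<close>

definition period_primitive :: "real \<Rightarrow> real \<Rightarrow> complex" where
  "period_primitive s t = (exp (2 * \<i> * of_real s * of_real t) - 1) / (2 * \<i> * of_real s)"

lemma worm_height_eq:
  assumes "fst z \<noteq> 0"
  shows "worm_height \<alpha> z * norm (fst z) = 2 * Re (worm_unwound \<alpha> z) - (norm (fst (snd z)))\<^sup>2"
proof -
  have "exp (- Re (worm_log \<alpha> z)) = 1 / norm (fst z)"
    using worm_log_props(2)[OF assms, of \<alpha>] assms by (simp add: exp_minus inverse_eq_divide)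
  then show ?thesis using worm_log_props(3)[OF assms, of \<alpha>] assms
    by (simp add: worm_height_def dot_square_norm field_simps)
qed

lemma worm_power_holomorphic:
  assumes "M > 0" shows "holomorphic_fun_on (worm_power \<alpha> b) (worm_domain \<alpha> \<beta> M)"
  unfolding worm_power_def[abs_def]
  by (intro holomorphic_fun_on_mult inverse_zn_holomorphic assms
     holomorphic_fun_on_compose[of _ _ exp "\<lambda>z. exp (of_real b * worm_log \<alpha> z)"]
     holomorphic_fun_on_const worm_log_holomorphic DERIV_exp)

lemma worm_power_has_derivative:
  fixes z :: "'m::finite cspace"
  assumes "snd (snd z) \<noteq> 0" "Re (worm_unwound \<alpha> z) > 0"
  shows "(worm_power \<alpha> b has_derivative (\<lambda>v. worm_power \<alpha> b z * (of_real b * (fst v / fst z) - snd (snd v) / snd (snd z)))) (at z)"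
proof -
  have 1: "((\<lambda>z. exp (of_real b * worm_log \<alpha> z)) has_derivative 
      (\<lambda>v. exp (of_real b * worm_log \<alpha> z) * (of_real b * (fst v / fst z)))) (at z)"
    using has_derivative_compose[OF has_derivative_mult_right[OF worm_log_has_derivative[OF assms], of "of_real b"]
        DERIV_exp[unfolded has_field_derivative_def]] by simp
  have "((\<lambda>z::'m cspace. snd (snd z)) has_derivative (\<lambda>v. snd (snd v))) (at z)"
    by (intro bounded_linear_imp_has_derivative bounded_linear_compose[OF bounded_linear_snd] bounded_linear_snd)
  moreover have "((\<lambda>x. 1 / x) has_field_derivative (- 1 / (snd (snd z))\<^sup>2)) (at (snd (snd z)))"
    using assms(1) by (auto intro!: derivative_eq_intros simp: power2_eq_square)
  ultimately have 2: "((\<lambda>z. 1 / snd (snd z)) has_derivative (\<lambda>v. - 1 / (snd (snd z))\<^sup>2 * snd (snd v))) (at z)"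
    using has_derivative_compose[of "\<lambda>z::'m cspace. snd (snd z)" "\<lambda>v. snd (snd v)" z UNIV "\<lambda>x. 1 / x"]
    unfolding has_field_derivative_def by blast
  have "(worm_power \<alpha> b has_derivative (\<lambda>v. exp (of_real b * worm_log \<alpha> z) * (- 1 / (snd (snd z))\<^sup>2 * snd (snd v)) +
      exp (of_real b * worm_log \<alpha> z) * (of_real b * (fst v / fst z)) * (1 / snd (snd z)))) (at z)"
    unfolding worm_power_def[abs_def] by (rule has_derivative_mult[OF 1 2])
  moreover have "(\<lambda>v :: 'm cspace. exp (of_real b * worm_log \<alpha> z) * (- 1 / (snd (snd z))\<^sup>2 * snd (snd v)) +
      exp (of_real b * worm_log \<alpha> z) * (of_real b * (fst v / fst z)) * (1 / snd (snd z))) =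
      (\<lambda>v. worm_power \<alpha> b z * (of_real b * (fst v / fst z) - snd (snd v) / snd (snd z)))"
    using assms(1) by (intro ext) (simp add: worm_power_def field_simps power2_eq_square)
  ultimately show ?thesis by (simp only:)
qed

lemma worm_height_has_derivative:
  fixes z :: "'m::finite cspace"
  assumes "snd (snd z) \<noteq> 0" "Re (worm_unwound \<alpha> z) > 0"
  shows "\<exists>Y. (worm_height \<alpha> has_derivative Y) (at z) \<and> Y (worm_field \<alpha> z) = 0 \<and> Y (cscale \<i> (worm_field \<alpha> z)) = 0"
proof -
  have z1: "fst z \<noteq> 0" using assms(2) by (auto simp: worm_unwound_def)
  define T where "T v = 2 * \<alpha> * ((snd (snd v) \<bullet> snd (snd z)) / (cmod (snd (snd z)))\<^sup>2)" for v :: "'m cspace"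
  note L = worm_log_has_derivative[OF assms]
  have dT: "(worm_angle \<alpha> has_derivative T) (at z)" unfolding T_def[abs_def] by (rule worm_angle_has_derivative[OF assms(1)])
  have dIm: "((\<lambda>z. Im (worm_log \<alpha> z)) has_derivative (\<lambda>v. Im (fst v / fst z))) (at z)"
    by (rule bounded_linear.has_derivative[OF bounded_linear_Im L])
  have dRe: "((\<lambda>z. Re (worm_log \<alpha> z)) has_derivative (\<lambda>v. Re (fst v / fst z))) (at z)"
    by (rule bounded_linear.has_derivative[OF bounded_linear_Re L])
  have dv: "((\<lambda>z::'m cspace. fst (snd z)) has_derivative (\<lambda>v. fst (snd v))) (at z)"
    by (intro bounded_linear_imp_has_derivative bounded_linear_compose[OF bounded_linear_fst] bounded_linear_snd)
  define u where "u = Im (worm_log \<alpha> z) - worm_angle \<alpha> z"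
  define E where "E = exp (- Re (worm_log \<alpha> z))"
  have d1: "((\<lambda>z. 2 * cos (Im (worm_log \<alpha> z) - worm_angle \<alpha> z)) has_derivative (\<lambda>v. 2 * (- sin u * (Im (fst v / fst z) - T v)))) (at z)"
    using has_derivative_mult_right[OF has_derivative_compose[OF has_derivative_diff[OF dIm dT] DERIV_cos[unfolded has_field_derivative_def]], of 2]
    by (simp add: u_def)
  have d2: "((\<lambda>z. exp (- Re (worm_log \<alpha> z))) has_derivative (\<lambda>v. E * (- Re (fst v / fst z)))) (at z)"
    using has_derivative_compose[OF has_derivative_minus[OF dRe] DERIV_exp[unfolded has_field_derivative_def]] by (simp add: E_def)
  have d3: "((\<lambda>z. fst (snd z) \<bullet> fst (snd z)) has_derivative (\<lambda>v. fst (snd z) \<bullet> fst (snd v) + fst (snd v) \<bullet> fst (snd z))) (at z)"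
    by (rule has_derivative_inner[OF dv dv])
  define Y where "Y v = 2 * (- sin u * (Im (fst v / fst z) - T v)) - ((fst (snd z) \<bullet> fst (snd z)) * (E * (- Re (fst v / fst z)))
      + (fst (snd z) \<bullet> fst (snd v) + fst (snd v) \<bullet> fst (snd z)) * E)" for v :: "'m cspace"
  have "(worm_height \<alpha> has_derivative Y) (at z)"
    unfolding worm_height_def[abs_def] Y_def[abs_def] E_def
    by (rule has_derivative_diff[OF d1 has_derivative_mult[OF d3 d2, unfolded E_def]])
  moreover have nz: "(cmod (snd (snd z)))\<^sup>2 \<noteq> 0" using assms(1) by simp
  have "T (worm_field \<alpha> z) = 2 * \<alpha>" using nz by (simp add: T_def worm_field_def dot_square_norm)
  moreover have "T (cscale \<i> (worm_field \<alpha> z)) = 0"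
    by (simp add: T_def worm_field_def cscale_eq inner_complex_def)
  moreover have "fst (snd z) \<bullet> fst (snd (worm_field \<alpha> z)) = 0" "fst (snd (worm_field \<alpha> z)) \<bullet> fst (snd z) = 0"
    by (auto simp: worm_field_def inner_vec_def inner_complex_def algebra_simps)
  moreover have "fst (snd z) \<bullet> fst (snd (cscale \<i> (worm_field \<alpha> z))) = - \<alpha> * (fst (snd z) \<bullet> fst (snd z))"
     "fst (snd (cscale \<i> (worm_field \<alpha> z))) \<bullet> fst (snd z) = - \<alpha> * (fst (snd z) \<bullet> fst (snd z))"
    by (auto simp: worm_field_def cscale_eq inner_vec_def inner_complex_def sum_distrib_left sum_negf[symmetric] algebra_simps)
  moreover have "fst (worm_field \<alpha> z) / fst z = 2 * of_real \<alpha> * \<i>" "fst (cscale \<i> (worm_field \<alpha> z)) / fst z = - 2 * of_real \<alpha>"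
    using z1 by (simp_all add: worm_field_def)
  ultimately show ?thesis
    by (intro exI[of _ Y] conjI) (simp_all add: Y_def algebra_simps)
qed

lemma loc_lip_clamp: "loc_lip (\<lambda>t::real. max 0 (min c t)) x"
  by (rule loc_lipI[of 1 1]) (auto intro!: lipschitz_onI simp: dist_real_def)

text \<open>The solution Q of Q' = exp (2 i \<eta> t) - 2 i (s - \<eta>) Q with Q 0 = 0. Since it vanishes at both ends of the winding, it extends by 0 to a Lipschitz function.\<close>

definition phase_factor :: "real \<Rightarrow> real \<Rightarrow> real \<Rightarrow> complex" where
  "phase_factor s \<eta> t = exp (- 2 * \<i> * of_real (s - \<eta>) * of_real t) * period_primitive s t"

lemma phase_factor_derivative:
  assumes "s \<noteq> 0"
  shows "(phase_factor s \<eta> has_vector_derivative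
      (exp (2 * \<i> * of_real \<eta> * of_real t) - 2 * \<i> * of_real (s - \<eta>) * phase_factor s \<eta> t)) (at t)"
proof -
  define F where "F z = exp (- 2 * \<i> * of_real (s - \<eta>) * z) * ((exp (2 * \<i> * of_real s * z) - 1) / (2 * \<i> * of_real s))" for z
  have e: "exp (- 2 * \<i> * of_real (s - \<eta>) * of_real t) * exp (2 * \<i> * of_real s * of_real t) = exp (2 * \<i> * of_real \<eta> * complex_of_real t)"
    unfolding exp_add[symmetric] by (simp add: algebra_simps)
  have "(F has_field_derivative
     (exp (- 2 * \<i> * of_real (s - \<eta>) * of_real t) * exp (2 * \<i> * of_real s * of_real t) - 2 * \<i> * of_real (s - \<eta>) * F (of_real t))) (at (of_real t))"
    unfolding F_def[abs_def] using assms by (auto intro!: derivative_eq_intros simp: field_simps)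
  then have "(F has_field_derivative
     (exp (2 * \<i> * of_real \<eta> * of_real t) - 2 * \<i> * of_real (s - \<eta>) * F (of_real t))) (at (of_real t))"
    unfolding e .
  from has_vector_derivative_real_field[OF this]
  show ?thesis by (simp add: F_def phase_factor_def[abs_def] period_primitive_def o_def)
qed

lemma period_primitive_norm: "s > 0 \<Longrightarrow> norm (period_primitive s t) \<le> 1 / s"
proof -
  assume s: "s > 0"
  have "norm (exp (2 * \<i> * of_real s * of_real t) - 1) \<le> 1 + 1"
    by (rule order_trans[OF norm_triangle_ineq4]) (simp add: norm_exp_eq_Re)
  then show ?thesis using s by (simp add: period_primitive_def norm_divide norm_mult field_simps)
qed

text \<open>A cutoff in t = ln |z_1|, equal to 1 for 1 - k \<le> t \<le> T - 1 and to 0 outside - k \<le> t \<le> T.\<close>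

definition worm_cut :: "real \<Rightarrow> real \<Rightarrow> real \<Rightarrow> real" where
  "worm_cut T k t = smoothstep (T - t) * smoothstep (t + k)"

definition worm_cut' :: "real \<Rightarrow> real \<Rightarrow> real \<Rightarrow> real" where
  "worm_cut' T k t = smoothstep (T - t) * smoothstep' (t + k) - smoothstep' (T - t) * smoothstep (t + k)"

lemma worm_cut_DERIV: "(worm_cut T k has_real_derivative worm_cut' T k t) (at t)"
proof -
  have 1: "((\<lambda>t. smoothstep (T - t)) has_real_derivative (smoothstep' (T - t) * (-1))) (at t)"
    by (rule DERIV_chain2[OF smoothstep_DERIV]) (auto intro!: derivative_eq_intros)
  have 2: "((\<lambda>t. smoothstep (t + k)) has_real_derivative (smoothstep' (t + k) * 1)) (at t)"
    by (rule DERIV_chain2[OF smoothstep_DERIV]) (auto intro!: derivative_eq_intros)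
  show ?thesis unfolding worm_cut_def[abs_def] worm_cut'_def
    using DERIV_mult[OF 1 2] by (simp add: algebra_simps)
qed

lemma worm_cut'_continuous: "continuous_on UNIV (worm_cut' T k)"
  unfolding worm_cut'_def[abs_def]
  by (intro continuous_intros continuous_on_compose2[OF smoothstep_continuous[of UNIV]]
      continuous_on_compose2[OF smoothstep'_continuous[of UNIV]]) auto

definition worm_core :: "real \<Rightarrow> real \<Rightarrow> real \<Rightarrow> 'm::finite cspace set" where
  "worm_core \<alpha> \<beta> M = {z \<in> worm_domain \<alpha> \<beta> M. 1 < cmod (snd (snd z)) \<and> cmod (snd (snd z)) < \<beta>}"

text \<open>Integration by parts along the worm field of g times conj h, the phase factor of the angle, and cutoffs. The field moves the angle with unit
  speed (up to 2 \<alpha>), and the exponent b is chosen so that the divergence, the derivative of conj h and the ODE for the phase factor combine to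
  exp (2 i \<eta> \<theta>). There are no boundary terms at |z_n| = 1 and |z_n| = \<beta>, because the phase factor vanishes there, and none from the height, which is
  invariant. Only the derivative of the cutoff in |z_1| survives. With \<eta> = 0 the identity says that the pairing of g and h vanishes up to the
  cutoffs.\<close>

lemma worm_key_identity:
  fixes g :: "'m::finite cspace \<Rightarrow> complex"
  assumes \<alpha>: "\<alpha> > 0" and \<beta>: "\<beta> > 1" and M: "M > 0" and op: "open (worm_domain \<alpha> \<beta> M :: 'm cspace set)"
    and s: "s = pi / (2 * \<alpha> * ln \<beta>)" and b: "b = - real (CARD('m) + 2) / 2 - s + \<eta>"
    and \<kappa>: "0 < \<kappa>" "exp T < \<kappa>" and g: "holomorphic_fun_on g (worm_domain \<alpha> \<beta> M)"
  shows "has_bochner_integral lborel (\<lambda>z. indicator (worm_core \<alpha> \<beta> M) z *\<^sub>R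
    (g z * cnj (worm_power \<alpha> b z) * of_real (smoothstep ((worm_height \<alpha> z - \<kappa>) / \<kappa>)) *
      (exp (2 * \<i> * of_real \<eta> * of_real (worm_angle \<alpha> z)) * of_real (worm_cut T k (Re (worm_log \<alpha> z)))
       - \<i> * phase_factor s \<eta> (worm_angle \<alpha> z) * of_real (worm_cut' T k (Re (worm_log \<alpha> z)))))) 0"
proof -
  define \<Omega> where "\<Omega> = (worm_domain \<alpha> \<beta> M :: 'm cspace set)"
  define \<Theta> where "\<Theta> = 2 * \<alpha> * ln \<beta>"
  have ln\<beta>: "ln \<beta> > 0" using \<beta> by simp
  have \<Theta>: "\<Theta> > 0" using \<alpha> ln\<beta> by (simp add: \<Theta>_def)
  have s0: "s > 0" using \<alpha> ln\<beta> by (simp add: s)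
  have s\<Theta>: "s * \<Theta> = pi" using \<alpha> ln\<beta> by (simp add: s \<Theta>_def)
  have E0: "phase_factor s \<eta> 0 = 0" by (simp add: phase_factor_def period_primitive_def)
  have E\<Theta>: "phase_factor s \<eta> \<Theta> = 0"
  proof -
    have "2 * \<i> * of_real s * of_real \<Theta> = 2 * complex_of_real (s * \<Theta>) * \<i>" by simp
    then have "2 * \<i> * of_real s * of_real \<Theta> = 2 * complex_of_real pi * \<i>" unfolding s\<Theta> .
    then have "exp (2 * \<i> * of_real s * of_real \<Theta>) = 1" by (simp only: exp_two_pi_i)
    then show ?thesis by (simp add: phase_factor_def period_primitive_def)
  qed
  \<comment> \<open>The angle is clamped to the interval of one full period, so that H vanishes identically over |z_n| \<le> 1 and |z_n| \<ge> \<beta>.\<close>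
  define cl where "cl t = max 0 (min \<Theta> t)" for t :: real
  define \<Lambda> where "\<Lambda> z = smoothstep ((worm_height \<alpha> z - \<kappa>) / \<kappa>)" for z :: "'m cspace"
  define h where "h = (worm_power \<alpha> b :: 'm cspace \<Rightarrow> complex)"
  define Q where "Q = phase_factor s \<eta>"
  define W where "W = worm_cut T k"
  define W' where "W' = worm_cut' T k"
  define H where "H z = cnj (h z) * Q (cl (worm_angle \<alpha> z)) * (of_real (\<Lambda> z) * of_real (W (Re (worm_log \<alpha> z))))" for z
  define Q' where "Q' t = exp (2 * \<i> * of_real \<eta> * of_real t) - 2 * \<i> * of_real (s - \<eta>) * Q t" for t
  have Qder: "(Q has_vector_derivative Q' t) (at t)" for t unfolding Q_def Q'_def by (rule phase_factor_derivative) (use s0 in simp)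
  have Qcont: "continuous_on UNIV Q"
    using Qder by (meson continuous_at_imp_continuous_on has_vector_derivative_continuous)
  have props: "snd (snd z) \<noteq> 0" "Re (worm_unwound \<alpha> z) > 0" "fst z \<noteq> 0" if "z \<in> \<Omega>" for z
    using worm_domain_props[OF that[unfolded \<Omega>_def] M] by auto
  have angle: "worm_angle \<alpha> z \<le> 0 \<longleftrightarrow> cmod (snd (snd z)) \<le> 1" "\<Theta> \<le> worm_angle \<alpha> z \<longleftrightarrow> \<beta> \<le> cmod (snd (snd z))"
    if "z \<in> \<Omega>" for z
    using props(1)[OF that] \<alpha> \<beta> by (auto simp: worm_angle_def \<Theta>_def mult_le_0_iff)
  have Q0: "Q (cl (worm_angle \<alpha> z)) = 0" if "z \<in> \<Omega>" "cmod (snd (snd z)) \<le> 1 \<or> \<beta> \<le> cmod (snd (snd z))" for z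
    using angle[OF that(1)] that(2) \<Theta> E0 E\<Theta> by (auto simp: cl_def Q_def max_def min_def)
  define Y where "Y z = (SOME Y. (worm_height \<alpha> has_derivative Y) (at z) \<and> Y (worm_field \<alpha> z) = 0 \<and> Y (cscale \<i> (worm_field \<alpha> z)) = 0)" for z :: "'m cspace"
  have Y: "(worm_height \<alpha> has_derivative Y z) (at z)" "Y z (worm_field \<alpha> z) = 0" "Y z (cscale \<i> (worm_field \<alpha> z)) = 0" if "z \<in> \<Omega>" for z
    using someI_ex[OF worm_height_has_derivative[OF props(1,2)[OF that]]] unfolding Y_def by blast+
  define Tv where "Tv z v = 2 * \<alpha> * ((snd (snd v) \<bullet> snd (snd z)) / (cmod (snd (snd z)))\<^sup>2)" for z v :: "'m cspace"
  define \<Lambda>' where "\<Lambda>' z v = Y z v / \<kappa> * smoothstep' ((worm_height \<alpha> z - \<kappa>) / \<kappa>)" for z v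
  define H' where "H' z v = (if z \<in> worm_core \<alpha> \<beta> M then
     cnj (h z) * Q (worm_angle \<alpha> z) * (of_real (\<Lambda> z) * of_real (Re (fst v / fst z) * W' (Re (worm_log \<alpha> z))) 
        + of_real (\<Lambda>' z v) * of_real (W (Re (worm_log \<alpha> z)))) +
     (cnj (h z) * (Tv z v *\<^sub>R Q' (worm_angle \<alpha> z)) + cnj (h z * (of_real b * (fst v / fst z) - snd (snd v) / snd (snd z))) * Q (worm_angle \<alpha> z))
        * (of_real (\<Lambda> z) * of_real (W (Re (worm_log \<alpha> z)))) else 0)" for z v
  define N where "N = {z :: 'm cspace. cmod (snd (snd z)) = 1} \<union> {z. cmod (snd (snd z)) = \<beta>}"
  define S0 where "S0 = {z :: 'm cspace. 1 \<le> cmod (snd (snd z))} \<inter> {z. cmod (snd (snd z)) \<le> \<beta>} \<inter>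
     ({z. exp (- k) \<le> norm (fst z)} \<inter> {z. norm (fst z) \<le> exp T})"
  define K where "K = {z \<in> S0. (norm (fst (snd z)))\<^sup>2 + \<kappa> * norm (fst z) \<le> 2 * Re (worm_unwound \<alpha> z)}"
  have clS0: "closed S0" unfolding S0_def
    by (intro closed_Int closed_Collect_le continuous_intros)
  have clK: "closed K" unfolding K_def
  proof (rule continuous_on_closed_Collect_le[OF _ _ clS0])
    show "continuous_on S0 (\<lambda>z. 2 * Re (worm_unwound \<alpha> z))"
      unfolding worm_unwound_def worm_angle_def by (intro continuous_intros) (auto simp: S0_def)
  qed (intro continuous_intros)
  have KO: "K \<subseteq> \<Omega>"
  proof
    fix z assume z: "z \<in> K"
    then have z': "1 \<le> cmod (snd (snd z))" "cmod (snd (snd z)) \<le> \<beta>" "exp (- k) \<le> norm (fst z)" "norm (fst z) \<le> exp T"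
      and le: "(norm (fst (snd z)))\<^sup>2 + \<kappa> * norm (fst z) \<le> 2 * Re (worm_unwound \<alpha> z)" by (auto simp: K_def S0_def)
    have "norm (fst z) > 0" using z'(3) exp_gt_zero[of "- k"] by linarith
    then have "norm (fst z) * norm (fst z) < \<kappa> * norm (fst z)" using z'(4) \<kappa> by (intro mult_strict_right_mono) auto
    then show "z \<in> \<Omega>" unfolding \<Omega>_def using le
      by (intro worm_domain_core[OF z'(1,2)]) (simp add: power2_eq_square)
  qed
  have bK: "bounded K"
  proof (rule boundedI[of _ "exp T + sqrt (2 * exp T) + \<beta>"])
    fix z assume z: "z \<in> K"
    then have z': "cmod (snd (snd z)) \<le> \<beta>" "norm (fst z) \<le> exp T" by (auto simp: K_def S0_def)
    have "(norm (fst (snd z)))\<^sup>2 < 2 * norm (fst z)" using worm_domain_props(6)[OF _ M] subsetD[OF KO z] unfolding \<Omega>_def by blast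
    then have "(norm (fst (snd z)))\<^sup>2 \<le> 2 * exp T" using z'(2) by linarith
    then have "norm (fst (snd z)) \<le> sqrt (2 * exp T)" by (rule real_le_rsqrt)
    moreover have "norm z \<le> norm (fst z) + (norm (fst (snd z)) + norm (snd (snd z)))"
      using norm_Pair_le[of "fst z" "snd z"] norm_Pair_le[of "fst (snd z)" "snd (snd z)"] by simp
    ultimately show "norm z \<le> exp T + sqrt (2 * exp T) + \<beta>" using z' by linarith
  qed
  have K: "compact K" using clK bK compact_eq_bounded_closed by blast
  have logl: "loc_lip (worm_log \<alpha>) z" if "z \<in> \<Omega>" for z
    by (rule holomorphic_fun_loc_lip[OF worm_log_holomorphic[OF M]]) (use that op in \<open>auto simp: \<Omega>_def\<close>)
  have Rel: "loc_lip (\<lambda>z. Re (worm_log \<alpha> z)) z" "loc_lip (\<lambda>z. Im (worm_log \<alpha> z)) z" if "z \<in> \<Omega>" for z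
    by (rule loc_lip_compose[OF logl[OF that]], rule loc_lip_bounded_linear, rule bounded_linear_Re bounded_linear_Im)+
  have angl: "loc_lip (worm_angle \<alpha>) z" if "z \<in> \<Omega>" for z
  proof -
    have "loc_lip (\<lambda>z :: 'm cspace. snd (snd z)) z"
      by (intro loc_lip_bounded_linear bounded_linear_compose[OF bounded_linear_snd] bounded_linear_snd)
    from loc_lip_compose[OF loc_lip_compose[OF this loc_lip_norm] loc_lip_ln]
    show ?thesis unfolding worm_angle_def[abs_def] using props(1)[OF that] 
      by (intro loc_lip_mult loc_lip_const) auto
  qed
  have hl: "loc_lip h z" if "z \<in> \<Omega>" for z unfolding h_def
    by (rule holomorphic_fun_loc_lip[OF worm_power_holomorphic[OF M]]) (use that op in \<open>auto simp: \<Omega>_def\<close>)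
  have heightl: "loc_lip (worm_height \<alpha>) z" if z: "z \<in> \<Omega>" for z
  proof -
    have c: "loc_lip cos x" for x :: real
      by (rule loc_lip_DERIV[OF DERIV_cos]) (intro continuous_intros)
    have e: "loc_lip exp x" for x :: real
      by (rule loc_lip_DERIV[OF DERIV_exp]) (intro continuous_intros)
    have v: "loc_lip (\<lambda>z :: 'm cspace. fst (snd z) \<bullet> fst (snd z)) z"
    proof -
      have "loc_lip (\<lambda>z :: 'm cspace. norm (fst (snd z)) * norm (fst (snd z))) z"
        by (intro loc_lip_mult loc_lip_compose[OF loc_lip_bounded_linear loc_lip_norm]
           bounded_linear_compose[OF bounded_linear_fst] bounded_linear_snd)
      then show ?thesis by (simp add: dot_square_norm power2_eq_square)
    qed
    have r: "loc_lip (\<lambda>z. - Re (worm_log \<alpha> z)) z"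
      using loc_lip_diff[OF loc_lip_const[of 0] Rel(1)[OF z]] by simp
    show ?thesis unfolding worm_height_def[abs_def]
      by (intro loc_lip_diff loc_lip_mult loc_lip_const v
         loc_lip_compose[OF loc_lip_diff[OF Rel(2)[OF z] angl[OF z]] c] loc_lip_compose[OF r e])
  qed
  have Hl: "loc_lip H z" if z: "z \<in> \<Omega>" for z
  proof -
    have 1: "loc_lip (\<lambda>z. cnj (h z)) z"
      by (rule loc_lip_compose[OF hl[OF z]], rule loc_lip_bounded_linear, rule bounded_linear_cnj)
    have "continuous_on UNIV Q'" unfolding Q'_def[abs_def] by (intro continuous_intros Qcont)
    then have "loc_lip Q x" for x by (intro loc_lip_real_C1[of UNIV x Q Q'] Qder) auto
    then have 2: "loc_lip (\<lambda>z. Q (cl (worm_angle \<alpha> z))) z"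
      unfolding cl_def using loc_lip_compose[OF loc_lip_compose[OF angl[OF z] loc_lip_clamp]] by blast
    have sl: "loc_lip smoothstep x" for x by (rule loc_lip_DERIV[OF smoothstep_DERIV smoothstep'_continuous])
    have "loc_lip \<Lambda> z" unfolding \<Lambda>_def[abs_def] divide_inverse
      by (rule loc_lip_compose[OF loc_lip_mult[OF loc_lip_diff[OF heightl[OF z] loc_lip_const] loc_lip_const] sl])
    then have 3: "loc_lip (\<lambda>z. complex_of_real (\<Lambda> z)) z" by (rule loc_lip_of_real)
    have "loc_lip W x" for x unfolding W_def by (rule loc_lip_DERIV[OF worm_cut_DERIV worm_cut'_continuous])
    then have "loc_lip (\<lambda>z. W (Re (worm_log \<alpha> z))) z" by (rule loc_lip_compose[OF Rel(1)[OF z]])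
    then have 4: "loc_lip (\<lambda>z. complex_of_real (W (Re (worm_log \<alpha> z)))) z" by (rule loc_lip_of_real)
    show ?thesis unfolding H_def[abs_def] by (intro loc_lip_mult 1 2 3 4)
  qed
  have H0: "H z = 0" if z: "z \<in> \<Omega> - K" for z
  proof -
    have zO: "z \<in> \<Omega>" using z by simp
    have z1: "norm (fst z) > 0" using props(3)[OF zO] by simp
    have Re: "Re (worm_log \<alpha> z) = ln (norm (fst z))" using worm_log_props(2)[OF props(3)[OF zO]] .
    consider "cmod (snd (snd z)) \<le> 1 \<or> \<beta> \<le> cmod (snd (snd z))" | "norm (fst z) < exp (- k)" | "norm (fst z) > exp T" 
      | "(norm (fst (snd z)))\<^sup>2 + \<kappa> * norm (fst z) > 2 * Re (worm_unwound \<alpha> z)"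
      using z by (auto simp: K_def S0_def not_le)
    then show ?thesis
    proof cases
      case 1 then show ?thesis using Q0[OF zO] by (simp add: H_def)
    next
      case 2
      then have "ln (norm (fst z)) < - k" using z1 by (metis exp_less_cancel_iff exp_ln)
      then show ?thesis by (simp add: H_def W_def worm_cut_def Re smoothstep_eq_0)
    next
      case 3
      then have "T < ln (norm (fst z))" using z1 by (metis exp_less_cancel_iff exp_ln)
      then show ?thesis by (simp add: H_def W_def worm_cut_def Re smoothstep_eq_0)
    next
      case 4
      then have "worm_height \<alpha> z * norm (fst z) < \<kappa> * norm (fst z)" using worm_height_eq[OF props(3)[OF zO], of \<alpha>] by linarith
      then have "worm_height \<alpha> z < \<kappa>" using z1 by simp
      then have "\<Lambda> z = 0" unfolding \<Lambda>_def using \<kappa>(1) by (intro smoothstep_eq_0) (simp add: divide_nonpos_pos)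
      then show ?thesis by (simp add: H_def)
    qed
  qed
  have Nnull: "N \<in> null_sets lborel" unfolding N_def
    by (intro null_sets.Un zn_sphere_null) (use \<beta> in auto)
  have opc: "open (worm_core \<alpha> \<beta> M :: 'm cspace set)"
  proof -
    have "worm_core \<alpha> \<beta> M = (worm_domain \<alpha> \<beta> M :: 'm cspace set) \<inter> ({z. 1 < cmod (snd (snd z))} \<inter> {z. cmod (snd (snd z)) < \<beta>})"
      by (auto simp: worm_core_def)
    also have "open \<dots>" by (intro open_Int op open_Collect_less continuous_intros)
    finally show ?thesis .
  qed
  have coreO: "z \<in> \<Omega>" if "z \<in> worm_core \<alpha> \<beta> M" for z using that by (simp add: worm_core_def \<Omega>_def)
  have cl: "cl (worm_angle \<alpha> z) = worm_angle \<alpha> z" if "z \<in> worm_core \<alpha> \<beta> M" for z :: "'m cspace"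
    using that angle[OF coreO[OF that]] by (auto simp: cl_def worm_core_def max_def min_def)
  have Hd: "(H has_derivative H' z) (at z)" if z: "z \<in> \<Omega> - N" for z
  proof (cases "z \<in> worm_core \<alpha> \<beta> M")
    case True
    have zO: "z \<in> \<Omega>" using z by simp
    have d1: "((\<lambda>z. cnj (h z)) has_derivative (\<lambda>v. cnj (h z * (of_real b * (fst v / fst z) - snd (snd v) / snd (snd z))))) (at z)"
      unfolding h_def by (rule bounded_linear.has_derivative[OF bounded_linear_cnj worm_power_has_derivative[OF props(1,2)[OF zO]]])
    have d2: "((\<lambda>z. Q (worm_angle \<alpha> z)) has_derivative (\<lambda>v. Tv z v *\<^sub>R Q' (worm_angle \<alpha> z))) (at z)"
      using has_derivative_compose[OF worm_angle_has_derivative[OF props(1)[OF zO]] Qder[unfolded has_vector_derivative_def]]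
      by (simp add: Tv_def)
    have "((\<lambda>z. (worm_height \<alpha> z - \<kappa>) / \<kappa>) has_derivative (\<lambda>v. Y z v / \<kappa>)) (at z)"
      using has_derivative_mult_left[OF has_derivative_diff[OF Y(1)[OF zO] has_derivative_const[of \<kappa>]], of "1 / \<kappa>"] by simp
    from has_derivative_compose[OF this smoothstep_DERIV[unfolded has_field_derivative_def]]
    have "(\<Lambda> has_derivative \<Lambda>' z) (at z)"
      by (simp add: \<Lambda>_def[abs_def] \<Lambda>'_def[abs_def] mult.commute)
    then have d3: "((\<lambda>z. complex_of_real (\<Lambda> z)) has_derivative (\<lambda>v. of_real (\<Lambda>' z v))) (at z)"
      by (rule has_derivative_of_real)
    have "((\<lambda>z. Re (worm_log \<alpha> z)) has_derivative (\<lambda>v. Re (fst v / fst z))) (at z)"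
      by (rule bounded_linear.has_derivative[OF bounded_linear_Re worm_log_has_derivative[OF props(1,2)[OF zO]]])
    from has_derivative_compose[OF this worm_cut_DERIV[of T k, unfolded has_field_derivative_def]]
    have "((\<lambda>z. W (Re (worm_log \<alpha> z))) has_derivative (\<lambda>v. Re (fst v / fst z) * W' (Re (worm_log \<alpha> z)))) (at z)"
      unfolding W_def W'_def by (simp add: mult.commute)
    then have d4: "((\<lambda>z. complex_of_real (W (Re (worm_log \<alpha> z)))) has_derivative (\<lambda>v. of_real (Re (fst v / fst z) * W' (Re (worm_log \<alpha> z))))) (at z)"
      by (rule has_derivative_of_real)
    have "((\<lambda>z. cnj (h z) * Q (worm_angle \<alpha> z) * (of_real (\<Lambda> z) * of_real (W (Re (worm_log \<alpha> z))))) has_derivative H' z) (at z)"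
      using has_derivative_mult[OF has_derivative_mult[OF d1 d2] has_derivative_mult[OF d3 d4]] True by (simp add: H'_def[abs_def])
    then show ?thesis
      by (rule has_derivative_transform_within_open[OF _ opc True]) (simp add: H_def cl)
  next
    case False
    define V where "V = \<Omega> \<inter> ({z. cmod (snd (snd z)) < 1} \<union> {z. \<beta> < cmod (snd (snd z))})"
    have oV: "open V" unfolding V_def \<Omega>_def by (intro open_Int op open_Un open_Collect_less continuous_intros)
    have zV: "z \<in> V" using z False by (auto simp: V_def N_def worm_core_def \<Omega>_def)
    have "((\<lambda>_. 0) has_derivative H' z) (at z)" using False by (simp add: H'_def[abs_def])
    then show ?thesis
      by (rule has_derivative_transform_within_open[OF _ oV zV]) (use Q0 in \<open>auto simp: V_def H_def\<close>)
  qed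
  have I: "has_bochner_integral lborel (\<lambda>x. indicator (\<Omega> - N) x *\<^sub>R
     (g x * (H' x (worm_field \<alpha> x) + \<i> * H' x (cscale \<i> (worm_field \<alpha> x)) + 
      (of_real 2 + \<i> * of_real (- 2 * \<alpha> * real (CARD('m) + 2))) * H x))) 0"
    by (rule dbar_field_integral[OF _ K KO _ Hl H0 Nnull Hd linear_worm_field])
      (use op g in \<open>simp_all add: \<Omega>_def worm_field_traces\<close>)
  define R where "R z = g z * cnj (h z) * of_real (\<Lambda> z) * (exp (2 * \<i> * of_real \<eta> * of_real (worm_angle \<alpha> z)) * of_real (W (Re (worm_log \<alpha> z)))
       - \<i> * Q (worm_angle \<alpha> z) * of_real (W' (Re (worm_log \<alpha> z))))" for z
  have eq: "indicator (\<Omega> - N) x *\<^sub>R (g x * (H' x (worm_field \<alpha> x) + \<i> * H' x (cscale \<i> (worm_field \<alpha> x)) + 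
      (of_real 2 + \<i> * of_real (- 2 * \<alpha> * real (CARD('m) + 2))) * H x)) = 
      (2 * of_real \<alpha>) * (indicator (worm_core \<alpha> \<beta> M) x *\<^sub>R R x)" for x
  proof (cases "x \<in> worm_core \<alpha> \<beta> M")
    case True
    have xO: "x \<in> \<Omega>" by (rule coreO[OF True])
    have xN: "x \<notin> N" using True by (auto simp: N_def worm_core_def)
    define w where "w = complex_of_real (W (Re (worm_log \<alpha> x)))"
    define w' where "w' = complex_of_real (W' (Re (worm_log \<alpha> x)))"
    define l where "l = complex_of_real (\<Lambda> x)"
    define q where "q = Q (worm_angle \<alpha> x)"
    define e where "e = exp (2 * \<i> * of_real \<eta> * complex_of_real (worm_angle \<alpha> x))"
    define c where "c = cnj (h x)"
    have Qe: "Q' (worm_angle \<alpha> x) = e - 2 * \<i> * of_real (s - \<eta>) * q" by (simp only: Q'_def e_def q_def)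
    have nz: "(cmod (snd (snd x)))\<^sup>2 \<noteq> 0" using props(1)[OF xO] by simp
    have T1: "Tv x (worm_field \<alpha> x) = 2 * \<alpha>" using nz by (simp add: Tv_def worm_field_def dot_square_norm)
    have T2: "Tv x (cscale \<i> (worm_field \<alpha> x)) = 0" by (simp add: Tv_def worm_field_def cscale_eq inner_complex_def)
    have L0: "\<Lambda>' x (worm_field \<alpha> x) = 0" "\<Lambda>' x (cscale \<i> (worm_field \<alpha> x)) = 0" using Y(2,3)[OF xO] by (simp_all add: \<Lambda>'_def)
    have q1: "fst (worm_field \<alpha> x) / fst x = 2 * of_real \<alpha> * \<i>" "fst (cscale \<i> (worm_field \<alpha> x)) / fst x = - 2 * of_real \<alpha>"
      "snd (snd (worm_field \<alpha> x)) / snd (snd x) = 1" "snd (snd (cscale \<i> (worm_field \<alpha> x))) / snd (snd x) = \<i>"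
      using props(1,3)[OF xO] by (simp_all add: worm_field_def)
    have h1: "H' x (worm_field \<alpha> x) = (c * (2 * of_real \<alpha> * (e - 2 * \<i> * of_real (s - \<eta>) * q)) + c * (- 2 * of_real (\<alpha> * b) * \<i> - 1) * q) * (l * w)"
      unfolding H'_def if_P[OF True] q1 T1 L0
      by (simp add: c_def[symmetric] q_def[symmetric] l_def[symmetric] w_def[symmetric] Qe
        scaleR_conv_of_real algebra_simps)
    have h2: "H' x (cscale \<i> (worm_field \<alpha> x)) = c * q * (l * (- 2 * of_real \<alpha> * w')) + c * (- 2 * of_real (\<alpha> * b) + \<i>) * q * (l * w)"
      unfolding H'_def if_P[OF True] q1 T2 L0
      by (simp add: c_def[symmetric] q_def[symmetric] l_def[symmetric] w_def[symmetric] w'_def[symmetric] algebra_simps)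
    have h3: "H x = c * q * (l * w)" by (simp add: H_def cl[OF True] c_def q_def l_def w_def)
    have h4: "of_real (- 2 * \<alpha> * real (CARD('m) + 2)) = complex_of_real (4 * \<alpha> * (b + s - \<eta>))"
      unfolding b by (simp add: algebra_simps)
    have h5: "H' x (worm_field \<alpha> x) + \<i> * H' x (cscale \<i> (worm_field \<alpha> x)) + 
      (of_real 2 + \<i> * of_real (- 2 * \<alpha> * real (CARD('m) + 2))) * H x = 2 * of_real \<alpha> * (c * l * (e * w - \<i> * q * w'))"
      unfolding h1 h2 h3 h4 by (simp add: algebra_simps)
    show ?thesis unfolding h5 using True xO xN 
      by (simp add: R_def c_def l_def e_def w_def q_def w'_def mult_ac)
  next
    case False
    have "H' x = (\<lambda>v. 0)" using False by (simp add: H'_def fun_eq_iff)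
    moreover have "H x = 0" if "x \<in> \<Omega> - N"
      using Q0[of x] that False by (auto simp: H_def worm_core_def \<Omega>_def N_def)
    ultimately show ?thesis using False by (cases "x \<in> \<Omega> - N") auto
  qed
  have "has_bochner_integral lborel (\<lambda>x. (1 / (2 * of_real \<alpha>)) * ((2 * of_real \<alpha>) * (indicator (worm_core \<alpha> \<beta> M) x *\<^sub>R R x))) ((1 / (2 * of_real \<alpha>)) * 0)"
    by (rule has_bochner_integral_mult_right) (use I[unfolded eq] in simp)
  then have "has_bochner_integral lborel (\<lambda>x. indicator (worm_core \<alpha> \<beta> M) x *\<^sub>R R x) 0"
    using \<alpha> by simp
  then show ?thesis unfolding R_def h_def \<Lambda>_def Q_def W_def W'_def .
qed

section \<open>Volume estimates near the degenerate set\<close>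

lemma ennreal_term_le_suminf: "f k \<le> (\<Sum>k. f k)" for f :: "nat \<Rightarrow> ennreal"
  by (rule order_trans[OF _ sum_le_suminf[OF summableI, of "{k}"]]) auto

text \<open>Layers r < \<delta> / 2^k have mass at most c (\<delta> / 2^k)^n, so the integral is dominated by a geometric series.\<close>

lemma dyadic_integral_near:
  fixes r :: "'a \<Rightarrow> real" and n :: nat
  assumes [measurable]: "r \<in> borel_measurable M" "D \<in> sets M" and r0: "\<And>x. x \<in> D \<Longrightarrow> r x > 0"
    and bd: "\<And>\<rho>. 0 < \<rho> \<Longrightarrow> \<rho> \<le> \<delta> \<Longrightarrow> emeasure M {x \<in> space M. x \<in> D \<and> r x < \<rho>} \<le> ennreal (c * \<rho> ^ n)"
    and c: "c \<ge> 0" and \<delta>: "\<delta> > 0" and a: "a < 0" "a + real n > 0"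
  shows "(\<integral>\<^sup>+x. ennreal (r x powr a) * indicator {x \<in> space M. x \<in> D \<and> r x < \<delta>} x \<partial>M)
    \<le> ennreal (c * 2 powr (- a) * \<delta> powr (a + n) / (1 - 2 powr (- (a + n))))"
proof -
  define S where "S k = {x \<in> space M. x \<in> D \<and> r x < \<delta> / 2 ^ k}" for k
  have Sm[measurable]: "S k \<in> sets M" for k unfolding S_def by measurable
  define \<theta> where "\<theta> = 2 powr (- (a + real n))"
  have \<theta>: "0 < \<theta>" "\<theta> < 1" using a powr_less_mono[of "- (a + real n)" 0 2] by (auto simp: \<theta>_def)
  define e where "e k = (\<delta> / 2 ^ Suc k) powr a * (c * (\<delta> / 2 ^ k) ^ n)" for k :: nat
  have e_eq: "e k = c * 2 powr (- a) * \<delta> powr (a + n) * \<theta> ^ k" for k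
  proof -
    have 1: "(\<delta> / 2 ^ Suc k) powr a = \<delta> powr a * 2 powr (- a) * 2 powr (- a * real k)"
    proof -
      have "(\<delta> / 2 ^ Suc k) powr a = \<delta> powr a / (2 ^ Suc k) powr a" using \<delta> by (simp add: powr_divide)
      also have "(2 ^ Suc k :: real) powr a = 2 powr (real (Suc k) * a)" 
        by (subst powr_realpow[of 2 "Suc k", symmetric]) (simp, simp only: powr_powr)
      finally have "(\<delta> / 2 ^ Suc k) powr a = \<delta> powr a / 2 powr (real (Suc k) * a)" .
      moreover have "2 powr (- a) * 2 powr (- a * real k) = 2 powr (- (real (Suc k) * a))"
        by (subst powr_add[symmetric]) (simp add: algebra_simps)
      moreover have "2 powr (- (real (Suc k) * a)) = 1 / 2 powr (real (Suc k) * a)" by (rule powr_minus_divide)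
      ultimately show ?thesis by (simp only: mult.assoc) simp
    qed
    have 2: "(\<delta> / 2 ^ k) ^ n = \<delta> powr n * 2 powr (- real n * real k)"
    proof -
      have "(\<delta> / 2 ^ k) ^ n = \<delta> ^ n / 2 ^ (k * n)" by (simp add: power_divide power_mult)
      also have "\<dots> = \<delta> powr n / 2 powr (real k * real n)" using \<delta> by (simp add: powr_realpow[symmetric])
      finally show ?thesis using powr_minus_divide[of 2 "real k * real n"] by (simp add: mult.commute)
    qed
    have 3: "\<theta> ^ k = 2 powr (- a * real k) * 2 powr (- real n * real k)"
      using \<theta> by (simp add: powr_realpow[symmetric] \<theta>_def powr_powr powr_add[symmetric] algebra_simps)
    show ?thesis unfolding e_def 1 2 3 by (simp add: powr_add)
  qed
  have pw: "ennreal (r x powr a) * indicator {x \<in> space M. x \<in> D \<and> r x < \<delta>} x \<le> (\<Sum>k. ennreal ((\<delta> / 2 ^ Suc k) powr a) * indicator (S k) x)" 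
    for x
  proof (cases "x \<in> space M \<and> x \<in> D \<and> r x < \<delta>")
    case True
    then have rx: "r x > 0" using r0 by blast
    have "\<exists>k. \<delta> / 2 ^ k \<le> r x"
    proof -
      obtain k where "\<delta> / r x < 2 ^ k" using real_arch_pow[of 2 "\<delta> / r x"] by auto
      then show ?thesis using rx by (intro exI[of _ k]) (simp add: field_simps)
    qed
    define j where "j = (LEAST k. \<delta> / 2 ^ k \<le> r x)"
    have j: "\<delta> / 2 ^ j \<le> r x" using \<open>\<exists>k. _\<close> unfolding j_def by (rule LeastI_ex)
    have "j \<noteq> 0" using j True by (intro notI) simp
    then obtain k where k: "j = Suc k" by (cases j) auto
    have "\<not> \<delta> / 2 ^ k \<le> r x" using not_less_Least[of k "\<lambda>k. \<delta> / 2 ^ k \<le> r x"] k by (simp add: j_def[symmetric])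
    then have "x \<in> S k" using True by (simp add: S_def)
    have "r x powr a \<le> (\<delta> / 2 ^ Suc k) powr a"
      by (rule powr_mono2') (use a j k \<delta> in auto)
    then have "ennreal (r x powr a) * indicator {x \<in> space M. x \<in> D \<and> r x < \<delta>} x \<le> ennreal ((\<delta> / 2 ^ Suc k) powr a) * indicator (S k) x"
      using True \<open>x \<in> S k\<close> by (simp add: ennreal_leI)
    also have "\<dots> \<le> (\<Sum>k. ennreal ((\<delta> / 2 ^ Suc k) powr a) * indicator (S k) x)"
      by (rule ennreal_term_le_suminf)
    finally show ?thesis .
  qed simp
  have "(\<integral>\<^sup>+x. ennreal (r x powr a) * indicator {x \<in> space M. x \<in> D \<and> r x < \<delta>} x \<partial>M)
     \<le> (\<integral>\<^sup>+x. (\<Sum>k. ennreal ((\<delta> / 2 ^ Suc k) powr a) * indicator (S k) x) \<partial>M)"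
    by (intro nn_integral_mono pw)
  also have "\<dots> = (\<Sum>k. \<integral>\<^sup>+x. ennreal ((\<delta> / 2 ^ Suc k) powr a) * indicator (S k) x \<partial>M)"
    by (intro nn_integral_suminf) measurable
  also have "\<dots> = (\<Sum>k. ennreal ((\<delta> / 2 ^ Suc k) powr a) * emeasure M (S k))"
    by (simp add: nn_integral_cmult_indicator)
  also have "\<dots> \<le> (\<Sum>k. ennreal (e k))"
  proof (intro suminf_le)
    fix k
    have "emeasure M (S k) \<le> ennreal (c * (\<delta> / 2 ^ k) ^ n)"
      unfolding S_def by (rule bd) (use \<delta> in \<open>auto simp: divide_le_eq\<close>)
    then have "ennreal ((\<delta> / 2 ^ Suc k) powr a) * emeasure M (S k) \<le> ennreal ((\<delta> / 2 ^ Suc k) powr a) * ennreal (c * (\<delta> / 2 ^ k) ^ n)"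
      by (intro mult_left_mono) auto
    then show "ennreal ((\<delta> / 2 ^ Suc k) powr a) * emeasure M (S k) \<le> ennreal (e k)"
      using c \<delta> by (simp add: e_def ennreal_mult[symmetric])
  qed auto
  also have "\<dots> = ennreal (\<Sum>k. e k)"
    unfolding e_eq using c \<theta> by (intro suminf_ennreal2) (auto intro!: summable_mult summable_geometric mult_nonneg_nonneg)
  also have "(\<Sum>k. e k) = c * 2 powr (- a) * \<delta> powr (a + n) / (1 - \<theta>)"
    unfolding e_eq using suminf_mult[OF summable_geometric[of \<theta>]] suminf_geometric[of \<theta>] \<theta> by simp
  finally show ?thesis by (simp add: \<theta>_def)
qed

lemma dyadic_integral_far:
  fixes r :: "'a \<Rightarrow> real" and n :: nat
  assumes [measurable]: "r \<in> borel_measurable M" "D \<in> sets M"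
    and bd: "\<And>\<rho>. 0 < \<rho> \<Longrightarrow> emeasure M {x \<in> space M. x \<in> D \<and> r x < \<rho>} \<le> ennreal (c * \<rho> ^ n)"
    and c: "c \<ge> 0" and \<delta>: "\<delta> > 0" and a: "a + real n < 0"
  shows "(\<integral>\<^sup>+x. ennreal (r x powr a) * indicator {x \<in> space M. x \<in> D \<and> \<delta> \<le> r x} x \<partial>M)
    \<le> ennreal (c * 2 ^ n * \<delta> powr (a + n) / (1 - 2 powr (a + n)))"
proof -
  have a0: "a < 0" using a by linarith
  define S where "S k = {x \<in> space M. x \<in> D \<and> r x < \<delta> * 2 ^ Suc k}" for k
  have Sm[measurable]: "S k \<in> sets M" for k unfolding S_def by measurable
  define \<theta> where "\<theta> = 2 powr (a + real n)"
  have \<theta>: "0 < \<theta>" "\<theta> < 1" using a powr_less_mono[of "a + real n" 0 2] by (auto simp: \<theta>_def)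
  define e where "e k = (\<delta> * 2 ^ k) powr a * (c * (\<delta> * 2 ^ Suc k) ^ n)" for k :: nat
  have e_eq: "e k = c * 2 ^ n * \<delta> powr (a + n) * \<theta> ^ k" for k
  proof -
    have 1: "(\<delta> * 2 ^ k) powr a = \<delta> powr a * 2 powr (a * real k)"
      using \<delta> by (simp add: powr_mult powr_realpow[symmetric] powr_powr mult.commute)
    have 2: "(\<delta> * 2 ^ Suc k) ^ n = \<delta> powr n * 2 ^ n * 2 powr (real n * real k)"
    proof -
      have "(\<delta> * 2 ^ Suc k) ^ n = \<delta> ^ n * 2 ^ n * 2 ^ (k * n)" by (simp add: power_mult_distrib power_mult)
      then show ?thesis using \<delta> by (simp add: powr_realpow[symmetric] mult.commute)
    qed
    have 3: "\<theta> ^ k = 2 powr (a * real k) * 2 powr (real n * real k)"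
      using \<theta> by (simp add: powr_realpow[symmetric] \<theta>_def powr_powr powr_add[symmetric] algebra_simps)
    show ?thesis unfolding e_def 1 2 3 by (simp add: powr_add)
  qed
  have pw: "ennreal (r x powr a) * indicator {x \<in> space M. x \<in> D \<and> \<delta> \<le> r x} x \<le> (\<Sum>k. ennreal ((\<delta> * 2 ^ k) powr a) * indicator (S k) x)" 
    for x
  proof (cases "x \<in> space M \<and> x \<in> D \<and> \<delta> \<le> r x")
    case True
    have ex: "\<exists>k. r x < \<delta> * 2 ^ k"
    proof -
      obtain k where "r x / \<delta> < 2 ^ k" using real_arch_pow[of 2 "r x / \<delta>"] by auto
      then show ?thesis using \<delta> by (intro exI[of _ k]) (simp add: field_simps)
    qed
    define j where "j = (LEAST k. r x < \<delta> * 2 ^ k)"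
    have j: "r x < \<delta> * 2 ^ j" using ex unfolding j_def by (rule LeastI_ex)
    have "j \<noteq> 0" using j True by (intro notI) simp
    then obtain k where k: "j = Suc k" by (cases j) auto
    have nk: "\<not> r x < \<delta> * 2 ^ k" using not_less_Least[of k "\<lambda>k. r x < \<delta> * 2 ^ k"] k by (simp add: j_def[symmetric])
    have "x \<in> S k" using True j k by (simp add: S_def)
    have "r x powr a \<le> (\<delta> * 2 ^ k) powr a"
      by (rule powr_mono2') (use a0 nk \<delta> in auto)
    then have "ennreal (r x powr a) * indicator {x \<in> space M. x \<in> D \<and> \<delta> \<le> r x} x \<le> ennreal ((\<delta> * 2 ^ k) powr a) * indicator (S k) x"
      using True \<open>x \<in> S k\<close> by (simp add: ennreal_leI)
    also have "\<dots> \<le> (\<Sum>k. ennreal ((\<delta> * 2 ^ k) powr a) * indicator (S k) x)"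
      by (rule ennreal_term_le_suminf)
    finally show ?thesis .
  qed simp
  have "(\<integral>\<^sup>+x. ennreal (r x powr a) * indicator {x \<in> space M. x \<in> D \<and> \<delta> \<le> r x} x \<partial>M)
     \<le> (\<integral>\<^sup>+x. (\<Sum>k. ennreal ((\<delta> * 2 ^ k) powr a) * indicator (S k) x) \<partial>M)"
    by (intro nn_integral_mono pw)
  also have "\<dots> = (\<Sum>k. \<integral>\<^sup>+x. ennreal ((\<delta> * 2 ^ k) powr a) * indicator (S k) x \<partial>M)"
    by (intro nn_integral_suminf) measurable
  also have "\<dots> = (\<Sum>k. ennreal ((\<delta> * 2 ^ k) powr a) * emeasure M (S k))"
    by (simp add: nn_integral_cmult_indicator)
  also have "\<dots> \<le> (\<Sum>k. ennreal (e k))"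
  proof (intro suminf_le)
    fix k
    have "emeasure M (S k) \<le> ennreal (c * (\<delta> * 2 ^ Suc k) ^ n)"
      unfolding S_def by (rule bd) (use \<delta> in auto)
    then have "ennreal ((\<delta> * 2 ^ k) powr a) * emeasure M (S k) \<le> ennreal ((\<delta> * 2 ^ k) powr a) * ennreal (c * (\<delta> * 2 ^ Suc k) ^ n)"
      by (intro mult_left_mono) auto
    then show "ennreal ((\<delta> * 2 ^ k) powr a) * emeasure M (S k) \<le> ennreal (e k)"
      using c \<delta> by (simp add: e_def ennreal_mult[symmetric])
  qed auto
  also have "\<dots> = ennreal (\<Sum>k. e k)"
    unfolding e_eq using c \<theta> by (intro suminf_ennreal2) (auto intro!: summable_mult summable_geometric mult_nonneg_nonneg)
  also have "(\<Sum>k. e k) = c * 2 ^ n * \<delta> powr (a + n) / (1 - \<theta>)"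
    unfolding e_eq using suminf_mult[OF summable_geometric[of \<theta>]] suminf_geometric[of \<theta>] \<theta> by simp
  finally show ?thesis by (simp add: \<theta>_def)
qed

lemma emeasure_lebesgue_on_borel:
  fixes D :: "'a::euclidean_space set"
  assumes "\<Omega> \<in> sets borel" "D \<in> sets borel" "D \<subseteq> \<Omega>"
  shows "emeasure (lebesgue_on \<Omega>) D = emeasure lborel D"
  using assms by (subst emeasure_restrict_space) auto

lemma emeasure_lborel_triple:
  assumes "A \<in> sets borel" "B \<in> sets borel" "C \<in> sets borel"
  shows "emeasure lborel (A \<times> (B \<times> C)) = emeasure lborel (A :: 'a::euclidean_space set) * 
    (emeasure lborel (B :: 'b::euclidean_space set) * emeasure lborel (C :: 'c::euclidean_space set))"
proof -
  have BC: "B \<times> C \<in> sets (lborel \<Otimes>\<^sub>M lborel)" using assms by (intro pair_measureI) auto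
  then have BC: "B \<times> C \<in> sets lborel" by (simp only: lborel_prod)
  have "emeasure lborel (A \<times> (B \<times> C)) = emeasure (lborel \<Otimes>\<^sub>M lborel) (A \<times> (B \<times> C))" by (simp only: lborel_prod)
  also have "\<dots> = emeasure lborel A * emeasure lborel (B \<times> C)"
    by (rule lborel.emeasure_pair_measure_Times) (use assms(1) BC in simp_all)
  also have "emeasure lborel (B \<times> C) = emeasure (lborel \<Otimes>\<^sub>M lborel) (B \<times> C)" by (simp only: lborel_prod)
  also have "\<dots> = emeasure lborel B * emeasure lborel C"
    by (rule lborel.emeasure_pair_measure_Times) (use assms in auto)
  finally show ?thesis .
qed

text \<open>The volume of the product of the unit disc with the ball of radius sqrt 2 in the z' variables.\<close>

definition ball_const :: "'m::finite itself \<Rightarrow> real" where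
  "ball_const _ = unit_ball_vol 2 * (unit_ball_vol (2 * real CARD('m)) * 2 ^ CARD('m))"

lemma ball_const_pos: "ball_const TYPE('m::finite) > 0"
  by (simp add: ball_const_def)

lemma emeasure_cball_vec:
  assumes "R \<ge> 0"
  shows "emeasure lborel (cball (0 :: complex ^ 'm::finite) (sqrt R)) = ennreal (unit_ball_vol (2 * real CARD('m)) * R ^ CARD('m))"
proof -
  have "sqrt R ^ (2 * CARD('m)) = R ^ CARD('m)" using assms by (simp add: power_mult)
  then show ?thesis using emeasure_cball[of "sqrt R" "0 :: complex ^ 'm"] assms by (simp add: mult.commute)
qed

lemma emeasure_cylinder:
  assumes "\<rho> \<ge> 0" "C \<in> sets borel"
  shows "emeasure lborel (cball (0::complex) \<rho> \<times> (cball (0 :: complex ^ 'm::finite) (sqrt (2 * \<rho>)) \<times> C)) =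
    ennreal (ball_const TYPE('m) * \<rho> ^ (CARD('m) + 2)) * emeasure lborel (C :: complex set)"
proof -
  have "emeasure lborel (cball (0::complex) \<rho>) = ennreal (unit_ball_vol 2 * \<rho> ^ 2)"
    using emeasure_cball[of \<rho> "0::complex"] assms(1) by simp
  moreover have "emeasure lborel (cball (0 :: complex ^ 'm) (sqrt (2 * \<rho>))) = ennreal (unit_ball_vol (2 * real CARD('m)) * (2 * \<rho>) ^ CARD('m))"
    by (rule emeasure_cball_vec) (use assms in simp)
  ultimately have "emeasure lborel (cball (0::complex) \<rho> \<times> (cball (0 :: complex ^ 'm) (sqrt (2 * \<rho>)) \<times> C)) =
    ennreal (unit_ball_vol 2 * \<rho> ^ 2) * (ennreal (unit_ball_vol (2 * real CARD('m)) * (2 * \<rho>) ^ CARD('m)) * emeasure lborel C)"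
    using assms(2) by (subst emeasure_lborel_triple) auto
  also have "\<dots> = ennreal ((unit_ball_vol 2 * \<rho> ^ 2) * (unit_ball_vol (2 * real CARD('m)) * (2 * \<rho>) ^ CARD('m))) * emeasure lborel C"
    using assms(1) by (subst ennreal_mult) (auto simp: mult.assoc)
  also have "(unit_ball_vol 2 * \<rho> ^ 2) * (unit_ball_vol (2 * real CARD('m)) * (2 * \<rho>) ^ CARD('m)) = ball_const TYPE('m) * \<rho> ^ (CARD('m) + 2)"
    by (simp add: ball_const_def power_add power_mult_distrib power2_eq_square mult_ac)
  finally show ?thesis .
qed

lemma power_diff_le:
  fixes X x :: real
  assumes "0 \<le> x" "x \<le> X" "m \<ge> 1"
  shows "X ^ m - x ^ m \<le> real m * X ^ (m - 1) * (X - x)"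
proof -
  have "X ^ m - x ^ m = (X - x) * (\<Sum>i<m. x ^ (m - Suc i) * X ^ i)" by (rule power_diff_sumr2)
  also have "\<dots> \<le> (X - x) * (\<Sum>i<m. X ^ (m - 1))"
  proof (intro mult_left_mono sum_mono)
    fix i assume i: "i \<in> {..<m}"
    have "x ^ (m - Suc i) * X ^ i \<le> X ^ (m - Suc i) * X ^ i"
      using assms by (intro mult_right_mono power_mono) auto
    also have "\<dots> = X ^ (m - 1)" using i by (simp add: power_add[symmetric])
    finally show "x ^ (m - Suc i) * X ^ i \<le> X ^ (m - 1)" .
  qed (use assms in auto)
  finally show ?thesis by (simp add: mult_ac)
qed

text \<open>In terms of |v|^2 the volume of the ball is a power of degree CARD('m), so a shell of thickness d has volume at most the derivative at the outer
  end times d.\<close>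

lemma emeasure_shell:
  fixes a X d :: real
  assumes "X \<le> 2 * \<rho>" "X - a \<le> d" "\<rho> \<ge> 0"
  shows "emeasure lborel {v :: complex ^ 'm::finite. a < (norm v)\<^sup>2 \<and> (norm v)\<^sup>2 \<le> X} \<le> 
    ennreal (unit_ball_vol (2 * real CARD('m)) * (real CARD('m) * (2 * \<rho>) ^ (CARD('m) - 1) * d))"
proof (cases "X < 0 \<or> X \<le> a")
  case True
  then have "{v :: complex ^ 'm. a < (norm v)\<^sup>2 \<and> (norm v)\<^sup>2 \<le> X} = {}"
    by (smt (verit) empty_Collect_eq zero_le_power2)
  then show ?thesis by (simp only: emeasure_empty zero_le)
next
  case False
  define m where "m = CARD('m)"
  have m: "m \<ge> 1" by (simp add: m_def Suc_le_eq)
  define x where "x = max a 0"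
  have x: "0 \<le> x" "x \<le> X" "0 \<le> X" "X - x \<le> d" using False assms by (auto simp: x_def)
  define V where "V = unit_ball_vol (2 * real m)"
  have V: "V \<ge> 0" by (simp add: V_def)
  have nn: "norm v \<le> sqrt y \<longleftrightarrow> (norm v)\<^sup>2 \<le> y" if "y \<ge> 0" for v :: "complex ^ 'm" and y
    using that by (metis norm_ge_zero real_le_rsqrt real_sqrt_le_iff real_sqrt_unique)
  have eX: "emeasure lborel (cball (0 :: complex ^ 'm) (sqrt X)) = ennreal (V * X ^ m)"
    unfolding V_def m_def by (rule emeasure_cball_vec[OF x(3)])
  have ex: "emeasure lborel (cball (0 :: complex ^ 'm) (sqrt x)) = ennreal (V * x ^ m)"
    unfolding V_def m_def by (rule emeasure_cball_vec[OF x(1)])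
  have fin: "V * X ^ m - V * x ^ m \<le> V * (real m * (2 * \<rho>) ^ (m - 1) * d)"
  proof -
    have "X ^ m - x ^ m \<le> real m * X ^ (m - 1) * (X - x)" by (rule power_diff_le[OF x(1,2) m])
    also have "\<dots> \<le> real m * (2 * \<rho>) ^ (m - 1) * d"
      using x assms by (intro mult_mono power_mono) auto
    finally show ?thesis using V by (simp add: right_diff_distrib[symmetric] mult_left_mono)
  qed
  show ?thesis
  proof (cases "a < 0")
    case True
    have "emeasure lborel {v :: complex ^ 'm. a < (norm v)\<^sup>2 \<and> (norm v)\<^sup>2 \<le> X} \<le> emeasure lborel (cball (0 :: complex ^ 'm) (sqrt X))"
      by (intro emeasure_mono) (auto simp: nn[OF x(3)])
    also have "\<dots> = ennreal (V * X ^ m - V * x ^ m)" using True m eX by (simp add: x_def power_0_left)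
    finally show ?thesis using fin unfolding V_def m_def by (meson ennreal_leI order_trans)
  next
    case False
    then have xa: "x = a" by (simp add: x_def)
    have "{v :: complex ^ 'm. a < (norm v)\<^sup>2 \<and> (norm v)\<^sup>2 \<le> X} = cball 0 (sqrt X) - cball 0 (sqrt x)"
      using nn[OF x(1)] nn[OF x(3)] by (auto simp: xa not_le)
    also have "emeasure lborel \<dots> = emeasure lborel (cball (0 :: complex ^ 'm) (sqrt X)) - emeasure lborel (cball (0 :: complex ^ 'm) (sqrt x))"
      using x by (intro emeasure_Diff subset_cball real_sqrt_le_mono) (auto simp: ex)
    also have "\<dots> = ennreal (V * X ^ m - V * x ^ m)" unfolding eX ex using V x by (simp add: ennreal_minus)
    finally show ?thesis using fin unfolding V_def m_def by (simp add: ennreal_leI)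
  qed
qed

text \<open>The function |z - z_0|^(-d/2), d the real dimension, lies in L^q for q < 2 but just fails to be square integrable at z_0.\<close>

lemma Lp_not_subset_L2:
  fixes \<Omega> :: "'m::finite cspace set"
  assumes \<Omega>: "open \<Omega>" "\<Omega> \<noteq> {}" "bounded \<Omega>" and q: "1 < q" "q < 2"
  shows "\<not> Lp \<Omega> q \<subseteq> Lp \<Omega> 2"
proof
  assume sub: "Lp \<Omega> q \<subseteq> Lp \<Omega> 2"
  let ?M = "lebesgue_on \<Omega>"
  define d where "d = DIM('m cspace)"
  have d: "d \<ge> 1" by (simp add: d_def)
  obtain z0 where z0: "z0 \<in> \<Omega>" using \<Omega>(2) by blast
  obtain R where R: "R > 0" "cball z0 R \<subseteq> \<Omega>" using \<Omega>(1) z0 open_contains_cball by blast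
  obtain R1 where R1: "R1 > 0" "\<Omega> \<subseteq> ball z0 R1" using bounded_subset_ballD[OF \<Omega>(3)] by blast
  define r where "r z = dist z0 z" for z :: "'m cspace"
  define D where "D = \<Omega> - {z0}"
  define V where "V = unit_ball_vol (real d)"
  have V: "V > 0" by (simp add: V_def)
  have rm[measurable]: "r \<in> borel_measurable ?M" unfolding r_def
    by (intro continuous_imp_measurable_on_sets_lebesgue continuous_intros) (use \<Omega>(1) in auto)
  have \<Omega>b: "\<Omega> \<in> sets borel" by (rule borel_open[OF \<Omega>(1)])
  have Db: "D \<in> sets borel" using \<Omega>b by (auto simp: D_def)
  have D[measurable]: "D \<in> sets ?M" using \<Omega>(1) Db by (auto simp: D_def sets_restrict_space_iff)
  have cb: "emeasure lborel (cball z0 \<rho>) = ennreal (V * \<rho> ^ d)" if "\<rho> \<ge> 0" for \<rho>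
    using emeasure_cball[OF that, of z0] unfolding V_def d_def .
  have near: "(\<integral>\<^sup>+x. ennreal (r x powr (- real d * q / 2)) * indicator {x \<in> space ?M. x \<in> D \<and> r x < R1} x \<partial>?M)
    \<le> ennreal (V * 2 powr (- (- real d * q / 2)) * R1 powr (- real d * q / 2 + d) / (1 - 2 powr (- (- real d * q / 2 + d))))"
  proof (rule dyadic_integral_near[OF rm D])
    show "emeasure ?M {x \<in> space ?M. x \<in> D \<and> r x < \<rho>} \<le> ennreal (V * \<rho> ^ d)" if \<rho>: "0 < \<rho>" "\<rho> \<le> R1" for \<rho>
    proof -
      have eq: "{x \<in> space ?M. x \<in> D \<and> r x < \<rho>} = D \<inter> ball z0 \<rho>" by (auto simp: D_def r_def)
      have "emeasure ?M (D \<inter> ball z0 \<rho>) = emeasure lborel (D \<inter> ball z0 \<rho>)"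
        by (rule emeasure_lebesgue_on_borel[OF \<Omega>b]) (use Db in \<open>auto simp: D_def\<close>)
      also have "\<dots> \<le> emeasure lborel (cball z0 \<rho>)" by (intro emeasure_mono) auto
      finally show ?thesis using cb[of \<rho>] \<rho> eq by simp
    qed
    show "- real d * q / 2 < 0" using d q by simp
    have "real d * q < real d * 2" using d q by (intro mult_strict_left_mono) auto
    then show "- real d * q / 2 + real d > 0" by simp
  qed (use R1 V in \<open>auto simp: D_def r_def\<close>)
  define f where "f z = complex_of_real (r z powr (- real d / 2))" for z
  have fm[measurable]: "f \<in> borel_measurable ?M" unfolding f_def by measurable
  have fn: "norm (f z) powr t = r z powr (- real d * t / 2)" for z t
    by (simp add: f_def powr_powr)
  have "f \<in> Lp \<Omega> q" unfolding Lp_def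
  proof (intro CollectI conjI fm)
    show "integrable ?M (\<lambda>z. norm (f z) powr q)"
    proof (rule integrableI_nonneg)
      have "(\<integral>\<^sup>+z. ennreal (norm (f z) powr q) \<partial>?M) = 
         (\<integral>\<^sup>+x. ennreal (r x powr (- real d * q / 2)) * indicator {x \<in> space ?M. x \<in> D \<and> r x < R1} x \<partial>?M)"
      proof (rule nn_integral_cong)
        fix z assume "z \<in> space ?M"
        then have z: "z \<in> \<Omega>" by simp
        then have "r z < R1" using R1 by (auto simp: r_def)
        then show "ennreal (norm (f z) powr q) = ennreal (r z powr (- real d * q / 2)) * indicator {x \<in> space ?M. x \<in> D \<and> r x < R1} z"
          unfolding fn using z q by (cases "z = z0") (auto simp: D_def r_def)
      qed
      also have "\<dots> < \<infinity>" using near by (rule le_less_trans) simp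
      finally show "(\<integral>\<^sup>+z. ennreal (norm (f z) powr q) \<partial>?M) < \<infinity>" .
    qed (auto intro!: AE_I2)
  qed
  then have "f \<in> Lp \<Omega> 2" using sub by blast
  then have "integrable ?M (\<lambda>z. norm (f z) powr 2)" unfolding Lp_def by (elim CollectE conjE)
  then have i2: "integrable ?M (\<lambda>z. r z powr (- real d))" unfolding fn by simp
  define A where "A k = cball z0 (R / 2 ^ k) - cball z0 (R / 2 ^ Suc k)" for k :: nat
  have A_sub: "A k \<subseteq> \<Omega>" for k
  proof -
    have "R / 2 ^ k \<le> R" using R by (simp add: divide_le_eq)
    then have "cball z0 (R / 2 ^ k) \<subseteq> cball z0 R" by (rule subset_cball)
    then show ?thesis using R by (auto simp: A_def)
  qed
  have Ab: "A k \<in> sets borel" for k by (auto simp: A_def)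
  have Am[measurable]: "A k \<in> sets ?M" for k using A_sub Ab \<Omega>(1) by (auto simp: sets_restrict_space_iff)
  have disj: "disjoint_family A"
    unfolding disjoint_family_on_def
  proof (intro ballI impI)
    fix i j :: nat assume "i \<noteq> j"
    have *: "A i \<inter> A j = {}" if "i < j" for i j
    proof -
      have "R / 2 ^ j \<le> R / 2 ^ Suc i" using that R by (intro divide_left_mono power_increasing) auto
      then show ?thesis by (auto simp: A_def)
    qed
    show "A i \<inter> A j = {}" using *[of i j] *[of j i] \<open>i \<noteq> j\<close> by (cases "i < j") auto
  qed
  define c where "c = V * (1 - 1 / 2 ^ d)"
  have c: "c > 0" using V d by (simp add: c_def power_eq_0_iff)
  have eA: "emeasure ?M (A k) = ennreal (c * (R / 2 ^ k) ^ d)" for k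
  proof -
    have "emeasure ?M (A k) = emeasure lborel (A k)" by (rule emeasure_lebesgue_on_borel[OF \<Omega>b Ab A_sub])
    also have "\<dots> = emeasure lborel (cball z0 (R / 2 ^ k)) - emeasure lborel (cball z0 (R / 2 ^ Suc k))"
      unfolding A_def using R by (intro emeasure_Diff subset_cball) (auto simp: cb divide_left_mono)
    also have "\<dots> = ennreal (V * (R / 2 ^ k) ^ d - V * (R / 2 ^ Suc k) ^ d)"
      using R V by (simp add: cb ennreal_minus)
    also have "V * (R / 2 ^ k) ^ d - V * (R / 2 ^ Suc k) ^ d = c * (R / 2 ^ k) ^ d"
      by (simp add: c_def power_divide power_mult_distrib field_simps)
    finally show ?thesis .
  qed
  have low: "ennreal c \<le> (\<integral>\<^sup>+x. ennreal (r x powr (- real d)) * indicator (A k) x \<partial>?M)" for k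
  proof -
    have "c = (R / 2 ^ k) powr (- real d) * (c * (R / 2 ^ k) ^ d)"
      using R by (simp add: powr_minus powr_realpow)
    then have "ennreal c = ennreal ((R / 2 ^ k) powr (- real d)) * ennreal (c * (R / 2 ^ k) ^ d)"
      using c R by (metis ennreal_mult' powr_ge_zero)
    also have "\<dots> = (\<integral>\<^sup>+x. ennreal ((R / 2 ^ k) powr (- real d)) * indicator (A k) x \<partial>?M)"
      by (simp add: nn_integral_cmult_indicator eA)
    also have "\<dots> \<le> (\<integral>\<^sup>+x. ennreal (r x powr (- real d)) * indicator (A k) x \<partial>?M)"
    proof (rule nn_integral_mono)
      fix x
      show "ennreal ((R / 2 ^ k) powr (- real d)) * indicator (A k) x \<le> ennreal (r x powr (- real d)) * indicator (A k) x"
      proof (cases "x \<in> A k")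
        case True
        then have rx: "r x \<le> R / 2 ^ k" "r x > R / 2 ^ Suc k" by (auto simp: A_def r_def)
        have "R / 2 ^ Suc k > 0" using R by simp
        then have "r x > 0" using rx(2) by linarith
        then have "(R / 2 ^ k) powr (- real d) \<le> r x powr (- real d)" using rx(1) d by (intro powr_mono2') auto
        then show ?thesis using True by (simp add: ennreal_leI)
      qed simp
    qed
    finally show ?thesis .
  qed
  define B where "B = (LINT z|?M. r z powr (- real d))"
  have B0: "B \<ge> 0" by (simp add: B_def integral_nonneg_AE)
  have up: "(\<Sum>k. ennreal c) \<le> ennreal B"
  proof -
    have "(\<Sum>k. ennreal c) \<le> (\<Sum>k. \<integral>\<^sup>+x. ennreal (r x powr (- real d)) * indicator (A k) x \<partial>?M)"
      by (intro suminf_le low) auto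
    also have "\<dots> = (\<integral>\<^sup>+x. (\<Sum>k. ennreal (r x powr (- real d)) * indicator (A k) x) \<partial>?M)"
      by (intro nn_integral_suminf[symmetric]) measurable
    also have "\<dots> \<le> (\<integral>\<^sup>+x. ennreal (r x powr (- real d)) \<partial>?M)"
    proof (rule nn_integral_mono)
      fix x
      have "(\<Sum>k. ennreal (r x powr (- real d)) * indicator (A k) x) = ennreal (r x powr (- real d)) * (\<Sum>k. indicator (A k) x)"
        by (rule ennreal_suminf_cmult)
      also have "(\<Sum>k. indicator (A k) x :: ennreal) = indicator (\<Union>k. A k) x" by (rule suminf_indicator[OF disj])
      also have "ennreal (r x powr (- real d)) * indicator (\<Union>k. A k) x \<le> ennreal (r x powr (- real d))"
        by (simp add: indicator_def)
      finally show "(\<Sum>k. ennreal (r x powr (- real d)) * indicator (A k) x) \<le> ennreal (r x powr (- real d))" .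
    qed
    also have "\<dots> = ennreal B" unfolding B_def by (rule nn_integral_eq_integral[OF i2]) auto
    finally show ?thesis .
  qed
  obtain K :: nat where K: "B < real K * c" using reals_Archimedean3[OF c] by blast
  have "ennreal (real K * c) = (\<Sum>k<K. ennreal c)" using c by (simp add: ennreal_mult ennreal_of_nat_eq_real_of_nat)
  also have "\<dots> \<le> (\<Sum>k. ennreal c)" by (rule sum_le_suminf) auto
  also note up
  finally have "real K * c \<le> B" using B0 by simp
  then show False using K by simp
qed

text \<open>On the domain |z'|^2 \<le> 2 |z_1|, so |z_1| < \<rho> confines z' to a ball of volume of order \<rho>^(n-2) and z_1 to a disc of area of order \<rho>^2: the degenerate
  set behaves as if it had real codimension n. This is the origin of n in the exponent.\<close>

lemma worm_mass_bound:
  fixes D :: "'m::finite cspace set"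
  assumes D: "\<And>z. z \<in> D \<Longrightarrow> (norm (fst (snd z)))\<^sup>2 \<le> 2 * norm (fst z)" "\<And>z. z \<in> D \<Longrightarrow> snd (snd z) \<in> C"
    and C: "C \<in> sets borel" and \<rho>: "\<rho> \<ge> 0"
  shows "emeasure lborel {z \<in> D. norm (fst z) < \<rho>} \<le> ennreal (ball_const TYPE('m) * \<rho> ^ (CARD('m) + 2)) * emeasure lborel C"
proof -
  have "{z \<in> D. norm (fst z) < \<rho>} \<subseteq> cball 0 \<rho> \<times> (cball 0 (sqrt (2 * \<rho>)) \<times> C)"
  proof
    fix z assume z: "z \<in> {z \<in> D. norm (fst z) < \<rho>}"
    then have "(norm (fst (snd z)))\<^sup>2 \<le> 2 * \<rho>" using D(1)[of z] by auto
    then have "norm (fst (snd z)) \<le> sqrt (2 * \<rho>)" by (rule real_le_rsqrt)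
    then show "z \<in> cball 0 \<rho> \<times> (cball 0 (sqrt (2 * \<rho>)) \<times> C)" using z D(2)[of z] by (auto simp: mem_Times_iff)
  qed
  then have "emeasure lborel {z \<in> D. norm (fst z) < \<rho>} \<le> emeasure lborel (cball 0 \<rho> \<times> (cball 0 (sqrt (2 * \<rho>)) \<times> C) :: 'm cspace set)"
    by (rule emeasure_mono) (use C in \<open>simp add: borel_Times\<close>)
  then show ?thesis using emeasure_cylinder[OF \<rho> C, where 'm='m] by simp
qed

text \<open>For fixed z_1 and z_n the points of small height form a thin shell in z', of relative thickness \<kappa>.\<close>

lemma worm_layer_bound:
  fixes L :: "'m::finite cspace set" and a X :: "complex \<Rightarrow> complex \<Rightarrow> real"
  assumes L: "L \<in> sets borel"
    and sub: "\<And>z. z \<in> L \<Longrightarrow> norm (fst z) \<le> \<rho> \<and> cmod (snd (snd z)) \<le> \<beta> \<and> a (fst z) (snd (snd z)) < (norm (fst (snd z)))\<^sup>2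
        \<and> (norm (fst (snd z)))\<^sup>2 \<le> X (fst z) (snd (snd z)) \<and> X (fst z) (snd (snd z)) \<le> 2 * \<rho>
        \<and> X (fst z) (snd (snd z)) - a (fst z) (snd (snd z)) \<le> 2 * \<kappa> * \<rho>"
    and \<rho>: "\<rho> \<ge> 0" and \<kappa>: "\<kappa> \<ge> 0" and \<beta>: "\<beta> \<ge> 0"
  shows "emeasure lborel L \<le> ennreal (ball_const TYPE('m) * (real CARD('m) * (unit_ball_vol 2 * \<beta>\<^sup>2)) * \<kappa> * \<rho> ^ (CARD('m) + 2))"
proof -
  define m where "m = CARD('m)"
  have m: "m \<ge> 1" by (simp add: m_def Suc_le_eq)
  define W where "W = unit_ball_vol (2 * real m) * (real m * (2 * \<rho>) ^ (m - 1) * (2 * \<kappa> * \<rho>))"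
  have W: "W \<ge> 0" using \<rho> \<kappa> by (simp add: W_def)
  have Lm: "L \<in> sets (lborel \<Otimes>\<^sub>M (lborel \<Otimes>\<^sub>M lborel))" unfolding lborel_prod using L by simp
  have slice: "emeasure lborel ((\<lambda>v. (v, zn)) -` (Pair z1 -` L)) \<le> ennreal W * indicator (cball 0 \<beta>) zn * indicator (cball 0 \<rho>) z1" for z1 zn
  proof (cases "\<exists>v. (z1, v, zn) \<in> L")
    case True
    then obtain v0 where v0: "(z1, v0, zn) \<in> L" by blast
    note s0 = sub[OF v0, simplified]
    have "(\<lambda>v. (v, zn)) -` (Pair z1 -` L) \<subseteq> {v. a z1 zn < (norm v)\<^sup>2 \<and> (norm v)\<^sup>2 \<le> X z1 zn}"
      using sub by fastforce
    then have "emeasure lborel ((\<lambda>v. (v, zn)) -` (Pair z1 -` L)) \<le> emeasure lborel {v :: complex^'m. a z1 zn < (norm v)\<^sup>2 \<and> (norm v)\<^sup>2 \<le> X z1 zn}"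
    proof (rule emeasure_mono)
      have "{v :: complex^'m. a z1 zn < (norm v)\<^sup>2 \<and> (norm v)\<^sup>2 \<le> X z1 zn} = {v. a z1 zn < (norm v)\<^sup>2} \<inter> {v. (norm v)\<^sup>2 \<le> X z1 zn}" by auto
      also have "\<dots> \<in> sets borel"
        by (intro sets.Int borel_open borel_closed open_Collect_less closed_Collect_le continuous_intros)
      finally show "{v :: complex^'m. a z1 zn < (norm v)\<^sup>2 \<and> (norm v)\<^sup>2 \<le> X z1 zn} \<in> sets lborel" by simp
    qed
    also have "\<dots> \<le> ennreal W" unfolding W_def m_def
      by (rule emeasure_shell) (use s0 \<rho> in auto)
    finally show ?thesis using s0 by (simp add: indicator_def)
  next
    case False
    then have "(\<lambda>v. (v, zn)) -` (Pair z1 -` L) = {}" by auto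
    then show ?thesis by simp
  qed
  have inner: "emeasure lborel (Pair z1 -` L) \<le> (\<integral>\<^sup>+(zn::complex). ennreal W * indicator (cball 0 \<beta>) zn * indicator (cball 0 \<rho>) z1 \<partial>lborel)" for z1 :: complex
  proof -
    have Pm: "Pair z1 -` L \<in> sets (lborel \<Otimes>\<^sub>M lborel)" by (rule sets_Pair1[OF Lm])
    have "emeasure lborel (Pair z1 -` L) = emeasure (lborel \<Otimes>\<^sub>M lborel) (Pair z1 -` L)" by (simp only: lborel_prod)
    also have "\<dots> = (\<integral>\<^sup>+zn. emeasure lborel ((\<lambda>v. (v, zn)) -` (Pair z1 -` L)) \<partial>lborel)"
      by (rule lborel_pair.emeasure_pair_measure_alt2[OF Pm])
    also have "\<dots> \<le> (\<integral>\<^sup>+(zn::complex). ennreal W * indicator (cball 0 \<beta>) zn * indicator (cball 0 \<rho>) z1 \<partial>lborel)"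
    proof (rule nn_integral_mono)
      fix zn :: complex
      show "emeasure lborel ((\<lambda>v. (v, zn)) -` (Pair z1 -` L)) \<le> ennreal W * indicator (cball 0 \<beta>) zn * indicator (cball 0 \<rho>) z1"
        by (rule slice)
    qed
    finally show ?thesis .
  qed
  have eb: "emeasure lborel (cball (0::complex) t) = ennreal (unit_ball_vol 2 * t ^ 2)" if "t \<ge> 0" for t
    using emeasure_cball[OF that, of "0::complex"] by simp
  have "emeasure lborel L = emeasure (lborel \<Otimes>\<^sub>M (lborel \<Otimes>\<^sub>M lborel)) L" by (simp only: lborel_prod)
  also have "\<dots> = (\<integral>\<^sup>+z1. emeasure (lborel \<Otimes>\<^sub>M lborel) (Pair z1 -` L) \<partial>lborel)"
    unfolding lborel_prod[where 'a="complex^'m" and 'b=complex]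
    by (rule lborel.emeasure_pair_measure_alt) (unfold lborel_prod, use L in simp)
  also have "\<dots> \<le> (\<integral>\<^sup>+(z1::complex). (\<integral>\<^sup>+(zn::complex). ennreal W * indicator (cball 0 \<beta>) zn * indicator (cball 0 \<rho>) z1 \<partial>lborel) \<partial>lborel)"
    unfolding lborel_prod
  proof (rule nn_integral_mono)
    fix z1 :: complex
    show "emeasure lborel (Pair z1 -` L) \<le> (\<integral>\<^sup>+(zn::complex). ennreal W * indicator (cball 0 \<beta>) zn * indicator (cball 0 \<rho>) z1 \<partial>lborel)"
      by (rule inner)
  qed
  also have "\<dots> = (\<integral>\<^sup>+(z1::complex). ennreal W * emeasure lborel (cball (0::complex) \<beta>) * indicator (cball 0 \<rho>) z1 \<partial>lborel)"
  proof (rule nn_integral_cong)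
    fix z1 :: complex
    have "(\<integral>\<^sup>+(zn::complex). ennreal W * indicator (cball 0 \<beta>) zn * indicator (cball 0 \<rho>) z1 \<partial>lborel)
      = (\<integral>\<^sup>+(zn::complex). (ennreal W * indicator (cball 0 \<rho>) z1) * indicator (cball 0 \<beta>) zn \<partial>lborel)"
      by (intro nn_integral_cong) (simp only: mult_ac)
    also have "\<dots> = (ennreal W * indicator (cball 0 \<rho>) z1) * emeasure lborel (cball (0::complex) \<beta>)"
      by (rule nn_integral_cmult_indicator) simp
    finally show "(\<integral>\<^sup>+(zn::complex). ennreal W * indicator (cball 0 \<beta>) zn * indicator (cball 0 \<rho>) z1 \<partial>lborel)
      = ennreal W * emeasure lborel (cball (0::complex) \<beta>) * indicator (cball 0 \<rho>) z1"
      by (simp only: mult_ac)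
  qed
  also have "\<dots> = ennreal W * emeasure lborel (cball (0::complex) \<beta>) * emeasure lborel (cball (0::complex) \<rho>)"
    by (subst nn_integral_cmult_indicator) auto
  also have "\<dots> = ennreal (W * (unit_ball_vol 2 * \<beta>\<^sup>2) * (unit_ball_vol 2 * \<rho>\<^sup>2))"
    unfolding eb[OF \<beta>] eb[OF \<rho>] using W by (simp add: ennreal_mult)
  also have "W * (unit_ball_vol 2 * \<beta>\<^sup>2) * (unit_ball_vol 2 * \<rho>\<^sup>2) = ball_const TYPE('m) * (real CARD('m) * (unit_ball_vol 2 * \<beta>\<^sup>2)) * \<kappa> * \<rho> ^ (CARD('m) + 2)"
  proof -
    have "(2 * \<rho>) ^ (m - 1) * (2 * \<rho>) = (2 * \<rho>) ^ m" using m by (cases m) auto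
    then have "W = unit_ball_vol (2 * real m) * (real m * (2 ^ m * \<rho> ^ m) * \<kappa>)"
      by (simp add: W_def power_mult_distrib mult_ac)
    then show ?thesis by (simp add: ball_const_def m_def power_add power2_eq_square mult_ac)
  qed
  finally show ?thesis .
qed

section \<open>The model function pairs almost to zero with holomorphic functions\<close>

lemma power_le_fact_exp: "x \<ge> (0::real) \<Longrightarrow> x ^ k \<le> fact k * exp x"
proof -
  assume x: "x \<ge> 0"
  have "(\<Sum>i\<in>{k}. x ^ i /\<^sub>R fact i) \<le> (\<Sum>i. x ^ i /\<^sub>R fact i)"
    by (rule sum_le_suminf[OF summable_exp_generic]) (use x in auto)
  then have "x ^ k / fact k \<le> exp x" by (simp add: exp_def divide_inverse mult.commute)
  then show ?thesis by (simp add: divide_le_eq mult.commute)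
qed

text \<open>A chord is at most as long as its arc.\<close>

lemma norm_exp_ii_minus_1_le: "norm (1 - exp (\<i> * of_real x)) \<le> \<bar>x\<bar>"
proof -
  have "(norm (1 - exp (\<i> * of_real x)))\<^sup>2 = 2 - 2 * cos x"
    unfolding cmod_power2 by (simp add: Re_exp Im_exp power2_diff algebra_simps)
  also have "\<dots> = (2 * sin (x / 2))\<^sup>2" using cos_double_sin[of "x / 2"] by (simp add: power_mult_distrib)
  also have "\<dots> \<le> (2 * (x / 2))\<^sup>2"
    using abs_sin_x_le_abs_x[of "x / 2"] by (subst abs_le_square_iff[symmetric]) (simp add: abs_mult)
  finally have "(norm (1 - exp (\<i> * of_real x)))\<^sup>2 \<le> \<bar>x\<bar>\<^sup>2" by simp
  then show ?thesis by (rule power2_le_imp_le) simp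
qed

lemma integrable_lebesgue_on_eq:
  fixes u :: "'a::euclidean_space \<Rightarrow> 'b::{banach, second_countable_topology}"
  assumes "\<Omega> \<in> sets lebesgue" "integrable lborel u" "\<And>x. x \<notin> \<Omega> \<Longrightarrow> u x = 0"
  shows "integrable (lebesgue_on \<Omega>) u"
proof -
  have "integrable lebesgue u" using assms(2) by (simp add: integrable_completion borel_measurable_integrable)
  moreover have "(\<lambda>x. indicator \<Omega> x *\<^sub>R u x) = u" using assms(3) by (auto simp: indicator_def fun_eq_iff)
  ultimately show ?thesis using assms(1) by (subst integrable_restrict_space) auto
qed

lemma integral_lincomb4:
  fixes f1 f2 f3 f4 :: "'a \<Rightarrow> real"
  assumes "integrable M f1" "integrable M f2" "integrable M f3" "integrable M f4"
  shows "(LINT x|M. c1 * f1 x + c2 * f2 x + c3 * f3 x + c4 * f4 x) =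
    c1 * (LINT x|M. f1 x) + c2 * (LINT x|M. f2 x) + c3 * (LINT x|M. f3 x) + c4 * (LINT x|M. f4 x)"
  using assms by simp

definition cylinder_mass :: "'m::finite cspace set \<Rightarrow> real \<Rightarrow> real" where
  "cylinder_mass \<Omega> R = ball_const TYPE('m) * (unit_ball_vol 2 * R\<^sup>2)"

text \<open>The condition M > e is the part of smoothness of the boundary that the estimates use.\<close>

locale worm =
  fixes \<alpha> \<beta> M :: real and \<Omega> :: "'m::finite cspace set"
  assumes \<alpha>: "\<alpha> > 0" and \<beta>: "\<beta> > 1" and Me: "M > exp 1" and \<Omega>_eq: "\<Omega> = worm_domain \<alpha> \<beta> M" and open_\<Omega>: "open \<Omega>"
begin

abbreviation "\<mu> \<equiv> lebesgue_on \<Omega>"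
abbreviation "rad \<equiv> (\<lambda>z :: 'm cspace. norm (fst z))"

definition "period = pi / (2 * \<alpha> * ln \<beta>)"
definition "zmin = sqrt (1 - 1 / ln M)"
definition "zmax = sqrt (\<beta>\<^sup>2 + 1 / ln M)"
abbreviation "mass \<equiv> cylinder_mass \<Omega> zmax"

lemma M0: "M > 0" using Me exp_gt_zero order_less_trans by blast
lemma lnM: "ln M > 1" using Me M0 by (metis exp_less_cancel_iff exp_ln)
lemma period_pos: "period > 0" using \<alpha> \<beta> by (simp add: period_def)
lemma zmin_pos: "zmin > 0" using lnM by (simp add: zmin_def)
lemma zmax_pos: "zmax > 0" using lnM \<beta> by (simp add: zmax_def add_pos_pos)
lemma mass_pos: "mass > 0" using zmax_pos ball_const_pos[where 'm='m] by (simp add: cylinder_mass_def)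

lemma borel_\<Omega>: "\<Omega> \<in> sets borel" by (rule borel_open[OF open_\<Omega>])
lemma lebesgue_\<Omega>: "\<Omega> \<in> sets lebesgue" using borel_\<Omega> by simp

lemma props:
  assumes "z \<in> \<Omega>"
  shows "snd (snd z) \<noteq> 0" "Re (worm_unwound \<alpha> z) > 0" "fst z \<noteq> 0" "rad z < 2" "(norm (fst (snd z)))\<^sup>2 < 2 * rad z"
    "zmin < cmod (snd (snd z))" "cmod (snd (snd z)) < zmax" "rad z > 0"
proof -
  note p = worm_domain_props[OF assms[unfolded \<Omega>_eq] M0] worm_zn_bounds[OF Me assms[unfolded \<Omega>_eq]]
  show "snd (snd z) \<noteq> 0" "Re (worm_unwound \<alpha> z) > 0" "fst z \<noteq> 0" "rad z < 2" "(norm (fst (snd z)))\<^sup>2 < 2 * rad z"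
    using p by auto
  show "zmin < cmod (snd (snd z))" unfolding zmin_def using p(8) by (intro real_less_lsqrt) auto
  show "cmod (snd (snd z)) < zmax" unfolding zmax_def using p(9) by (intro real_less_rsqrt)
  show "rad z > 0" using p(4) by simp
qed

lemma norm_worm_power:
  assumes "z \<in> \<Omega>"
  shows "norm (worm_power \<alpha> b z) = rad z powr b / cmod (snd (snd z))"
proof -
  have "norm (exp (of_real b * worm_log \<alpha> z)) = exp (b * ln (rad z))"
    using worm_log_props(2)[OF props(3)[OF assms], of \<alpha>] by (simp add: norm_exp_eq_Re)
  also have "\<dots> = rad z powr b" using props(3)[OF assms] by (simp add: powr_def)
  finally show ?thesis by (simp add: worm_power_def norm_mult norm_divide)
qed

lemma norm_worm_power_le: "z \<in> \<Omega> \<Longrightarrow> norm (worm_power \<alpha> b z) \<le> rad z powr b / zmin"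
  using props(1,6)[of z] zmin_pos by (subst norm_worm_power) (auto intro!: divide_left_mono)

lemma rad_measurable [measurable]: "rad \<in> borel_measurable \<mu>"
  by (rule continuous_imp_measurable_on_sets_lebesgue) (use lebesgue_\<Omega> in \<open>auto intro!: continuous_intros\<close>)

lemma rad_powr_measurable [measurable]: "(\<lambda>z. rad z powr a) \<in> borel_measurable \<mu>"
proof -
  have "(\<lambda>x::real. x powr a) \<in> borel_measurable borel" by measurable
  from measurable_compose[OF rad_measurable this] show ?thesis .
qed

lemma rad_sets:
  assumes "D \<in> sets \<mu>"
  shows "{x \<in> space \<mu>. x \<in> D \<and> rad x < c} \<in> sets \<mu>" "{x \<in> space \<mu>. x \<in> D \<and> c \<le> rad x} \<in> sets \<mu>"
proof -
  have "{x \<in> space \<mu>. x \<in> D \<and> rad x < c} = D \<inter> (rad -` {..<c} \<inter> space \<mu>)"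
    "{x \<in> space \<mu>. x \<in> D \<and> c \<le> rad x} = D \<inter> (rad -` {c..} \<inter> space \<mu>)"
    using sets.sets_into_space[OF assms] by auto
  moreover have "rad -` {..<c} \<inter> space \<mu> \<in> sets \<mu>" "rad -` {c..} \<inter> space \<mu> \<in> sets \<mu>"
    by (intro measurable_sets[OF rad_measurable]; simp)+
  ultimately show "{x \<in> space \<mu>. x \<in> D \<and> rad x < c} \<in> sets \<mu>" "{x \<in> space \<mu>. x \<in> D \<and> c \<le> rad x} \<in> sets \<mu>"
    using assms by auto
qed

lemma sets_\<mu>: "D \<in> sets borel \<Longrightarrow> D \<subseteq> \<Omega> \<Longrightarrow> D \<in> sets \<mu>"
  using lebesgue_\<Omega> by (auto simp: sets_restrict_space_iff)

lemma \<Omega>_in_\<mu> [measurable]: "\<Omega> \<in> sets \<mu>" by (rule sets_\<mu>[OF borel_\<Omega>]) simp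

lemma mass_le:
  assumes "\<rho> > 0"
  shows "emeasure \<mu> {x \<in> space \<mu>. x \<in> \<Omega> \<and> rad x < \<rho>} \<le> ennreal (mass * \<rho> ^ (CARD('m) + 2))"
proof -
  have "{z \<in> \<Omega>. rad z < \<rho>} = \<Omega> \<inter> {z. rad z < \<rho>}" by auto
  also have "\<dots> \<in> sets borel" by (intro sets.Int borel_\<Omega> borel_open open_Collect_less continuous_intros)
  finally have b: "{z \<in> \<Omega>. rad z < \<rho>} \<in> sets borel" .
  have "emeasure \<mu> {x \<in> space \<mu>. x \<in> \<Omega> \<and> rad x < \<rho>} = emeasure \<mu> {z \<in> \<Omega>. rad z < \<rho>}" by (rule arg_cong[where f="emeasure \<mu>"]) auto
  also have "\<dots> = emeasure lborel {z \<in> \<Omega>. rad z < \<rho>}" by (rule emeasure_lebesgue_on_borel[OF borel_\<Omega> b]) auto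
  also have "\<dots> \<le> ennreal (ball_const TYPE('m) * \<rho> ^ (CARD('m) + 2)) * emeasure lborel (cball (0::complex) zmax)"
  proof (rule worm_mass_bound)
    fix z assume z: "z \<in> \<Omega>"
    show "(norm (fst (snd z)))\<^sup>2 \<le> 2 * norm (fst z)" using props(5)[OF z] by simp
    show "snd (snd z) \<in> cball 0 zmax" using props(7)[OF z] by simp
  qed (use assms in auto)
  also have "emeasure lborel (cball (0::complex) zmax) = ennreal (unit_ball_vol 2 * zmax\<^sup>2)"
    using emeasure_cball[of zmax "0::complex"] zmax_pos by simp
  also have "ennreal (ball_const TYPE('m) * \<rho> ^ (CARD('m) + 2)) * ennreal (unit_ball_vol 2 * zmax\<^sup>2) = ennreal (mass * \<rho> ^ (CARD('m) + 2))"
    using assms ball_const_pos[where 'm='m] by (subst ennreal_mult[symmetric]) (auto simp: cylinder_mass_def mult_ac)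
  finally show ?thesis .
qed

lemma finite_\<mu>: "finite_measure \<mu>"
proof (rule finite_measureI)
  have "space \<mu> = {x \<in> space \<mu>. x \<in> \<Omega> \<and> rad x < 2}" using props(4) by auto
  then have "emeasure \<mu> (space \<mu>) \<le> ennreal (mass * 2 ^ (CARD('m) + 2))" using mass_le[of 2] by simp
  then show "emeasure \<mu> (space \<mu>) \<noteq> \<infinity>" by (metis ennreal_neq_top infinity_ennreal_def neq_top_trans)
qed

text \<open>Since the part |z_1| < \<rho> has mass of order \<rho>^n, powers |z_1|^a are integrable near the degenerate set for a > - n. The constant c
  is kept explicit: it is small for the exceptional part of the domain.\<close>

lemma rad_powr_integral:
  assumes D: "D \<subseteq> \<Omega>" "D \<in> sets \<mu>" and bd: "\<And>\<rho>. 0 < \<rho> \<Longrightarrow> \<rho> \<le> \<delta> \<Longrightarrow> emeasure \<mu> {x \<in> space \<mu>. x \<in> D \<and> rad x < \<rho>} \<le> ennreal (c * \<rho> ^ (CARD('m) + 2))"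
    and c: "c \<ge> 0" and \<delta>: "\<delta> > 0" and a: "a < 0" "a + real (CARD('m) + 2) > 0"
  shows "integrable \<mu> (\<lambda>z. rad z powr a * indicator {z \<in> D. rad z < \<delta>} z)"
    and "(LINT z|\<mu>. rad z powr a * indicator {z \<in> D. rad z < \<delta>} z) \<le> c * 2 powr (- a) * \<delta> powr (a + real (CARD('m) + 2)) / (1 - 2 powr (- (a + real (CARD('m) + 2))))"
proof -
  define B where "B = c * 2 powr (- a) * \<delta> powr (a + real (CARD('m) + 2)) / (1 - 2 powr (- (a + real (CARD('m) + 2))))"
  have "2 powr (- (a + real (CARD('m) + 2))) \<le> 2 powr 0" using a by (intro powr_mono) auto
  then have B: "B \<ge> 0" unfolding B_def using c by (intro divide_nonneg_nonneg mult_nonneg_nonneg) auto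
  have near: "(\<integral>\<^sup>+x. ennreal (rad x powr a) * indicator {x \<in> space \<mu>. x \<in> D \<and> rad x < \<delta>} x \<partial>\<mu>) \<le> ennreal B"
    unfolding B_def by (rule dyadic_integral_near[OF rad_measurable D(2) _ bd c \<delta> a]) (use props(8) D(1) in auto)
  have eq: "{z \<in> D. rad z < \<delta>} = {x \<in> space \<mu>. x \<in> D \<and> rad x < \<delta>}" using D(1) by auto
  note [measurable] = D(2)
  have meas[measurable]: "(\<lambda>z. rad z powr a * indicator {z \<in> D. rad z < \<delta>} z) \<in> borel_measurable \<mu>"
    unfolding eq by (intro borel_measurable_times rad_powr_measurable borel_measurable_indicator rad_sets D)
  have nn: "(\<integral>\<^sup>+x. ennreal (rad x powr a * indicator {z \<in> D. rad z < \<delta>} x) \<partial>\<mu>) \<le> ennreal B"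
    unfolding eq using near by (simp add: ennreal_mult' ennreal_indicator)
  show int: "integrable \<mu> (\<lambda>z. rad z powr a * indicator {z \<in> D. rad z < \<delta>} z)"
    by (rule integrableI_nonneg) (use nn in \<open>auto simp: le_less_trans\<close>)
  have "(\<integral>\<^sup>+x. ennreal (rad x powr a * indicator {z \<in> D. rad z < \<delta>} x) \<partial>\<mu>) = ennreal (LINT z|\<mu>. rad z powr a * indicator {z \<in> D. rad z < \<delta>} z)"
    by (rule nn_integral_eq_integral[OF int]) auto
  with nn B show "(LINT z|\<mu>. rad z powr a * indicator {z \<in> D. rad z < \<delta>} z) \<le> c * 2 powr (- a) * \<delta> powr (a + real (CARD('m) + 2)) / (1 - 2 powr (- (a + real (CARD('m) + 2))))"
    unfolding B_def[symmetric] by simp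
qed

lemma rad_powr_integral_far:
  assumes \<delta>: "\<delta> > 0" and a: "a + real (CARD('m) + 2) < 0"
  shows "integrable \<mu> (\<lambda>z. rad z powr a * indicator {z \<in> \<Omega>. \<delta> \<le> rad z} z)"
    and "(LINT z|\<mu>. rad z powr a * indicator {z \<in> \<Omega>. \<delta> \<le> rad z} z) \<le> mass * 2 ^ (CARD('m) + 2) * \<delta> powr (a + real (CARD('m) + 2)) / (1 - 2 powr (a + real (CARD('m) + 2)))"
proof -
  define B where "B = mass * 2 ^ (CARD('m) + 2) * \<delta> powr (a + real (CARD('m) + 2)) / (1 - 2 powr (a + real (CARD('m) + 2)))"
  have "2 powr (a + real (CARD('m) + 2)) \<le> 2 powr 0" using a by (intro powr_mono) auto
  then have B: "B \<ge> 0" unfolding B_def using mass_pos by (intro divide_nonneg_nonneg mult_nonneg_nonneg) auto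
  have near: "(\<integral>\<^sup>+x. ennreal (rad x powr a) * indicator {x \<in> space \<mu>. x \<in> \<Omega> \<and> \<delta> \<le> rad x} x \<partial>\<mu>) \<le> ennreal B"
    unfolding B_def by (rule dyadic_integral_far[OF rad_measurable \<Omega>_in_\<mu> mass_le _ \<delta> a]) (use mass_pos in auto)
  have eq: "{z \<in> \<Omega>. \<delta> \<le> rad z} = {x \<in> space \<mu>. x \<in> \<Omega> \<and> \<delta> \<le> rad x}" by auto
  have meas[measurable]: "(\<lambda>z. rad z powr a * indicator {z \<in> \<Omega>. \<delta> \<le> rad z} z) \<in> borel_measurable \<mu>"
    unfolding eq by (intro borel_measurable_times rad_powr_measurable borel_measurable_indicator rad_sets \<Omega>_in_\<mu>)
  have nn: "(\<integral>\<^sup>+x. ennreal (rad x powr a * indicator {z \<in> \<Omega>. \<delta> \<le> rad z} x) \<partial>\<mu>) \<le> ennreal B"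
    unfolding eq using near by (simp add: ennreal_mult' ennreal_indicator)
  show int: "integrable \<mu> (\<lambda>z. rad z powr a * indicator {z \<in> \<Omega>. \<delta> \<le> rad z} z)"
    by (rule integrableI_nonneg) (use nn in \<open>auto simp: le_less_trans\<close>)
  have "(\<integral>\<^sup>+x. ennreal (rad x powr a * indicator {z \<in> \<Omega>. \<delta> \<le> rad z} x) \<partial>\<mu>) = ennreal (LINT z|\<mu>. rad z powr a * indicator {z \<in> \<Omega>. \<delta> \<le> rad z} z)"
    by (rule nn_integral_eq_integral[OF int]) auto
  with nn B show "(LINT z|\<mu>. rad z powr a * indicator {z \<in> \<Omega>. \<delta> \<le> rad z} z) \<le> mass * 2 ^ (CARD('m) + 2) * \<delta> powr (a + real (CARD('m) + 2)) / (1 - 2 powr (a + real (CARD('m) + 2)))"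
    unfolding B_def[symmetric] by simp
qed

lemma rad_powr_integrable:
  assumes "a < 0" "a + real (CARD('m) + 2) > 0"
  shows "integrable \<mu> (\<lambda>z. rad z powr a)"
proof -
  have "integrable \<mu> (\<lambda>z. rad z powr a * indicator {z \<in> \<Omega>. rad z < 2} z)"
    by (rule rad_powr_integral(1)[of \<Omega> 2 mass]) (use mass_le mass_pos assms in auto)
  then show ?thesis
    by (rule Bochner_Integration.integrable_cong[THEN iffD1, OF refl, rotated]) (use props(4) in \<open>auto simp: indicator_def\<close>)
qed

lemma norm_worm_log_le: "\<exists>A. \<forall>z\<in>\<Omega>. norm (worm_log \<alpha> z) \<le> A - ln (rad z)"
proof -
  define Lb where "Lb = \<bar>ln zmin\<bar> + \<bar>ln zmax\<bar>"
  have "norm (worm_log \<alpha> z) \<le> (2 * \<alpha> * Lb + pi / 2 + 2 * ln 2) - ln (rad z)" if z: "z \<in> \<Omega>" for z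
  proof -
    have r: "ln (rad z) < ln 2" using props(3,4)[OF z] by simp
    have "\<bar>Re (worm_log \<alpha> z)\<bar> \<le> 2 * ln 2 - ln (rad z)"
      using r worm_log_props(2)[OF props(3)[OF z], of \<alpha>] by (simp add: abs_if) linarith?
    moreover have "\<bar>Im (worm_log \<alpha> z)\<bar> \<le> 2 * \<alpha> * Lb + pi / 2"
    proof -
      have "ln zmin \<le> ln (cmod (snd (snd z)))" "ln (cmod (snd (snd z))) \<le> ln zmax"
        using props(1,6,7)[OF z] zmin_pos zmax_pos by auto
      then have "\<bar>ln (cmod (snd (snd z)))\<bar> \<le> Lb" unfolding Lb_def by linarith
      then have "\<bar>worm_angle \<alpha> z\<bar> \<le> 2 * \<alpha> * Lb" using \<alpha> by (simp add: worm_angle_def abs_mult)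
      then show ?thesis using worm_log_props(4)[OF props(3)[OF z] props(2)[OF z]] by linarith
    qed
    ultimately show ?thesis using cmod_le[of "worm_log \<alpha> z"] by linarith
  qed
  then show ?thesis by blast
qed

text \<open>Logarithms are square integrable, whereas the powers z_1^b of interest are not.\<close>

lemma worm_log_power_in_bergman_space: "(\<lambda>z. worm_log \<alpha> z ^ k * (1 / snd (snd z))) \<in> bergman_space \<Omega>"
proof -
  obtain A where A: "\<And>z. z \<in> \<Omega> \<Longrightarrow> norm (worm_log \<alpha> z) \<le> A - ln (rad z)" using norm_worm_log_le by blast
  have hol: "holomorphic_fun_on (\<lambda>z. worm_log \<alpha> z ^ k * (1 / snd (snd z))) \<Omega>"
    unfolding \<Omega>_eq by (intro holomorphic_fun_on_mult inverse_zn_holomorphic M0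
       holomorphic_fun_on_compose[OF worm_log_holomorphic[OF M0], where h="\<lambda>x. x ^ k" and h'="\<lambda>z. of_nat k * worm_log \<alpha> z ^ (k - 1)"])
      (auto intro!: derivative_eq_intros)
  note m[measurable] = holomorphic_fun_measurable[OF open_\<Omega> hol]
  have "integrable \<mu> (\<lambda>z. (norm (worm_log \<alpha> z ^ k * (1 / snd (snd z))))\<^sup>2)"
  proof (rule Bochner_Integration.integrable_bound[of _ "\<lambda>z. (fact (2 * k) * exp A / zmin\<^sup>2) * rad z powr (-1)"])
    show "integrable \<mu> (\<lambda>z. (fact (2 * k) * exp A / zmin\<^sup>2) * rad z powr (-1))"
      by (intro integrable_mult_right rad_powr_integrable) auto
    show "AE z in \<mu>. norm ((norm (worm_log \<alpha> z ^ k * (1 / snd (snd z))))\<^sup>2) \<le> norm ((fact (2 * k) * exp A / zmin\<^sup>2) * rad z powr (-1))"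
    proof (rule AE_I2)
      fix z assume "z \<in> space \<mu>"
      then have z: "z \<in> \<Omega>" by simp
      have "norm (worm_log \<alpha> z) ^ (2 * k) \<le> fact (2 * k) * exp (norm (worm_log \<alpha> z))" by (rule power_le_fact_exp) simp
      also have "\<dots> \<le> fact (2 * k) * exp (A - ln (rad z))" using A[OF z] by simp
      also have "exp (A - ln (rad z)) = exp A * rad z powr (-1)" using props(3)[OF z] by (simp add: exp_diff powr_minus divide_inverse)
      finally have 1: "norm (worm_log \<alpha> z) ^ (2 * k) \<le> fact (2 * k) * (exp A * rad z powr (-1))" .
      have 2: "1 / (cmod (snd (snd z)))\<^sup>2 \<le> 1 / zmin\<^sup>2"
        using props(1,6)[OF z] zmin_pos by (auto intro!: divide_left_mono power_mono mult_pos_pos)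
      have "(norm (worm_log \<alpha> z ^ k * (1 / snd (snd z))))\<^sup>2 = norm (worm_log \<alpha> z) ^ (2 * k) * (1 / (cmod (snd (snd z)))\<^sup>2)"
        by (simp add: norm_mult norm_divide norm_power power_mult_distrib power_divide power_mult[symmetric] mult.commute)
      also have "\<dots> \<le> (fact (2 * k) * (exp A * rad z powr (-1))) * (1 / zmin\<^sup>2)"
        by (intro mult_mono 1 2) auto
      finally show "norm ((norm (worm_log \<alpha> z ^ k * (1 / snd (snd z))))\<^sup>2) \<le> norm ((fact (2 * k) * exp A / zmin\<^sup>2) * rad z powr (-1))"
        by (simp add: abs_mult mult.commute)
    qed
  qed measurable
  then show ?thesis using hol m by (simp add: bergman_space_def Lp_2_eq_L2 L2_def)
qed

text \<open>The function h need not be square integrable, so orthogonality to the Bergman space does not apply to it directly. The partial sums of the exponential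
  series exp (b log z_1) / z_n are Bergman functions, and they are dominated by a multiple of |z_1|^b because b < 0 and log z_1 differs from ln |z_1| by a
  bounded amount.\<close>

lemma worm_power_orthogonal:
  assumes f[measurable]: "f \<in> borel_measurable \<mu>" and orth: "\<And>k. k \<in> bergman_space \<Omega> \<Longrightarrow> (LINT z|\<mu>. f z * cnj (k z)) = 0"
    and b: "b < 0" and int: "integrable \<mu> (\<lambda>z. norm (f z) * rad z powr b)"
  shows "(LINT z|\<mu>. f z * cnj (worm_power \<alpha> b z)) = 0"
proof -
  obtain A where A: "\<And>z. z \<in> \<Omega> \<Longrightarrow> norm (worm_log \<alpha> z) \<le> A - ln (rad z)" using norm_worm_log_le by blast
  define S where "S K z = (\<Sum>k<K. (of_real b * worm_log \<alpha> z) ^ k /\<^sub>R fact k) * (1 / snd (snd z))" for K and z :: "'m cspace"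
  have SB: "S K \<in> bergman_space \<Omega>" for K
  proof (induction K)
    case 0
    have "(\<lambda>z. worm_log \<alpha> z ^ 0 * (1 / snd (snd z)) - worm_log \<alpha> z ^ 0 * (1 / snd (snd z))) \<in> bergman_space \<Omega>"
      by (rule bergman_space_diff; rule worm_log_power_in_bergman_space)
    then show ?case by (simp add: S_def)
  next
    case (Suc K)
    have "(\<lambda>z. S K z + (of_real b ^ K / fact K) * (worm_log \<alpha> z ^ K * (1 / snd (snd z)))) \<in> bergman_space \<Omega>"
      by (rule bergman_space_lincomb[OF Suc worm_log_power_in_bergman_space])
    then show ?case by (simp add: S_def[abs_def] power_mult_distrib scaleR_conv_of_real algebra_simps add_divide_distrib divide_inverse)
  qed
  have Sm[measurable]: "S K \<in> borel_measurable \<mu>" for K using SB[of K] by (simp add: bergman_space_def Lp_def)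
  have hm[measurable]: "worm_power \<alpha> b \<in> borel_measurable \<mu>"
    by (rule holomorphic_fun_measurable[OF open_\<Omega>]) (simp add: \<Omega>_eq worm_power_holomorphic[OF M0])
  define w where "w z = (exp (- b * A) / zmin) * (norm (f z) * rad z powr b)" for z
  have "(\<lambda>K. LINT z|\<mu>. f z * cnj (S K z)) \<longlonglongrightarrow> (LINT z|\<mu>. f z * cnj (worm_power \<alpha> b z))"
  proof (rule integral_dominated_convergence[where w=w])
    show "integrable \<mu> w" unfolding w_def using int by simp
    show "AE z in \<mu>. (\<lambda>K. f z * cnj (S K z)) \<longlonglongrightarrow> f z * cnj (worm_power \<alpha> b z)"
    proof (rule AE_I2)
      fix z :: "'m cspace"
      have "(\<lambda>K. \<Sum>k<K. (of_real b * worm_log \<alpha> z) ^ k /\<^sub>R fact k) \<longlonglongrightarrow> exp (of_real b * worm_log \<alpha> z)"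
        using exp_converges[of "of_real b * worm_log \<alpha> z"] by (simp add: sums_def)
      then show "(\<lambda>K. f z * cnj (S K z)) \<longlonglongrightarrow> f z * cnj (worm_power \<alpha> b z)"
        unfolding S_def worm_power_def by (intro tendsto_intros)
    qed
    show "AE z in \<mu>. norm (f z * cnj (S K z)) \<le> w z" for K
    proof (rule AE_I2)
      fix z assume "z \<in> space \<mu>"
      then have z: "z \<in> \<Omega>" by simp
      let ?x = "norm (of_real b * worm_log \<alpha> z)"
      have "norm (\<Sum>k<K. (of_real b * worm_log \<alpha> z) ^ k /\<^sub>R fact k) \<le> (\<Sum>k<K. ?x ^ k /\<^sub>R fact k)"
        by (rule order_trans[OF norm_sum]) (simp add: norm_power)
      also have "\<dots> \<le> (\<Sum>k. ?x ^ k /\<^sub>R fact k)" by (rule sum_le_suminf[OF summable_exp_generic]) auto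
      also have "\<dots> = exp ?x" by (simp add: exp_def)
      also have "\<dots> \<le> exp (- b * (A - ln (rad z)))"
        using A[OF z] b by (simp add: norm_mult mult_left_mono)
      also have "\<dots> = exp (- b * A) * rad z powr b"
        using props(3)[OF z] by (simp add: powr_def exp_add[symmetric] algebra_simps)
      finally have 1: "norm (\<Sum>k<K. (of_real b * worm_log \<alpha> z) ^ k /\<^sub>R fact k) \<le> exp (- b * A) * rad z powr b" .
      have 2: "1 / cmod (snd (snd z)) \<le> 1 / zmin" using props(1,6)[OF z] zmin_pos by (auto intro!: divide_left_mono mult_pos_pos)
      have "norm (S K z) \<le> (exp (- b * A) * rad z powr b) * (1 / zmin)"
        unfolding S_def norm_mult norm_divide norm_one by (intro mult_mono 1 2) auto
      from mult_left_mono[OF this, of "norm (f z)"]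
      show "norm (f z * cnj (S K z)) \<le> w z" by (simp add: norm_mult w_def mult_ac)
    qed
  qed measurable
  moreover have "(LINT z|\<mu>. f z * cnj (S K z)) = 0" for K by (rule orth[OF SB])
  ultimately show ?thesis by (simp add: LIMSEQ_const_iff)
qed

text \<open>The part of the core on which the cutoff in the height equals 1.\<close>

definition "good_part \<kappa> = {z \<in> worm_core \<alpha> \<beta> M. 2 * \<kappa> \<le> worm_height \<alpha> z}"

lemma core_open: "open (worm_core \<alpha> \<beta> M :: 'm cspace set)"
proof -
  have "worm_core \<alpha> \<beta> M = \<Omega> \<inter> ({z. 1 < cmod (snd (snd z))} \<inter> {z. cmod (snd (snd z)) < \<beta>})"
    by (auto simp: worm_core_def \<Omega>_eq)
  also have "open \<dots>" by (intro open_Int open_\<Omega> open_Collect_less continuous_intros)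
  finally show ?thesis .
qed

lemma core_sub: "worm_core \<alpha> \<beta> M \<subseteq> \<Omega>" by (auto simp: worm_core_def \<Omega>_eq)

lemma height_continuous: "continuous_on \<Omega> (worm_height \<alpha>)"
proof (intro continuous_at_imp_continuous_on ballI)
  fix z assume z: "z \<in> \<Omega>"
  have "\<exists>Y. (worm_height \<alpha> has_derivative Y) (at z)"
    by (rule exE[OF worm_height_has_derivative[OF props(1,2)[OF z]]], rule exI, erule conjunct1)
  then have "worm_height \<alpha> differentiable (at z)" unfolding differentiable_def .
  then show "isCont (worm_height \<alpha>) z" by (rule differentiable_imp_continuous_within)
qed

lemma low_height_borel: "{z \<in> worm_core \<alpha> \<beta> M. worm_height \<alpha> z < c} \<in> sets (borel :: 'm cspace measure)"
proof -
  have "open (worm_core \<alpha> \<beta> M \<inter> worm_height \<alpha> -` {..<c} :: 'm cspace set)"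
    by (rule continuous_open_preimage[OF continuous_on_subset[OF height_continuous core_sub] core_open]) auto
  then have "worm_core \<alpha> \<beta> M \<inter> worm_height \<alpha> -` {..<c} \<in> sets (borel :: 'm cspace measure)" by (rule borel_open)
  moreover have "(worm_core \<alpha> \<beta> M :: 'm cspace set) \<inter> worm_height \<alpha> -` {..<c} = {z \<in> worm_core \<alpha> \<beta> M. worm_height \<alpha> z < c}" by auto
  ultimately show ?thesis by (simp only:)
qed

lemma bad_part_borel: "\<Omega> - good_part \<kappa> \<in> sets borel"
proof -
  have "\<Omega> - good_part \<kappa> = (\<Omega> - worm_core \<alpha> \<beta> M) \<union> {z \<in> worm_core \<alpha> \<beta> M. worm_height \<alpha> z < 2 * \<kappa>}"
    using core_sub by (auto simp: good_part_def not_le)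
  then show ?thesis using borel_\<Omega> borel_open[OF core_open] low_height_borel by (simp add: sets.Diff sets.Un)
qed

lemma bad_part_in_\<mu> [measurable]: "\<Omega> - good_part \<kappa> \<in> sets \<mu>"
  by (rule sets_\<mu>[OF bad_part_borel]) auto

text \<open>The key identity subtracts 0 from the pairing. The remaining multiplier of g conj h is bounded everywhere, and on the good part below exp (T - 1) it equals
  1 - exp (2 i \<eta> \<theta>), which is of order \<eta>. The three terms are the contributions of points far from the degenerate set, of the good part, and of the
  exceptional part; the inner cutoff disappears in the limit k \<rightarrow> \<infinity>.\<close>

lemma pairing_bound:
  assumes g: "holomorphic_fun_on g \<Omega>" and int: "integrable \<mu> (\<lambda>z. norm (g z) * norm (worm_power \<alpha> b z))"
    and b: "b = - real (CARD('m) + 2) / 2 - period + \<eta>" and \<eta>: "\<eta> \<ge> 0" and \<kappa>: "0 < \<kappa>" "exp T < \<kappa>"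
  defines "C \<equiv> 2 + 3 / period" and "G \<equiv> \<lambda>z. norm (g z) * norm (worm_power \<alpha> b z)"
  shows "norm (LINT z|\<mu>. g z * cnj (worm_power \<alpha> b z)) \<le>
    C * (LINT z|\<mu>. G z * indicator {z \<in> \<Omega>. exp (T - 1) \<le> rad z} z)
    + 4 * \<eta> * \<alpha> * ln \<beta> * (LINT z|\<mu>. G z * indicator {z \<in> \<Omega>. rad z < exp T} z)
    + C * (LINT z|\<mu>. G z * indicator {z \<in> \<Omega> - good_part \<kappa>. rad z < exp T} z)"
proof -
  define h where "h = (worm_power \<alpha> b :: 'm cspace \<Rightarrow> complex)"
  have s: "period > 0" by (rule period_pos)
  have C: "C \<ge> 0" using s by (simp add: C_def)
  have hm[measurable]: "h \<in> borel_measurable \<mu>" unfolding h_def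
    by (rule holomorphic_fun_measurable[OF open_\<Omega>]) (simp add: \<Omega>_eq worm_power_holomorphic[OF M0])
  have gm[measurable]: "g \<in> borel_measurable \<mu>" by (rule holomorphic_fun_measurable[OF open_\<Omega> g])
  have Gm[measurable]: "G \<in> borel_measurable \<mu>" unfolding G_def h_def[symmetric] by measurable
  have Gi: "integrable \<mu> G" using int by (simp add: G_def)
  have G0: "G z \<ge> 0" for z by (simp add: G_def)
  have Fi: "integrable \<mu> (\<lambda>z. g z * cnj (h z))"
    by (rule Bochner_Integration.integrable_bound[OF Gi]) (measurable, simp add: G_def h_def norm_mult)
  define e where "e z = exp (2 * \<i> * of_real \<eta> * complex_of_real (worm_angle \<alpha> z))" for z :: "'m cspace"
  define \<Lambda> where "\<Lambda> z = smoothstep ((worm_height \<alpha> z - \<kappa>) / \<kappa>)" for z :: "'m cspace"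
  define \<Psi> where "\<Psi> k z = of_real (indicator (worm_core \<alpha> \<beta> M) z * \<Lambda> z) * (e z * of_real (worm_cut T k (Re (worm_log \<alpha> z)))
       - \<i> * phase_factor period \<eta> (worm_angle \<alpha> z) * of_real (worm_cut' T k (Re (worm_log \<alpha> z))))" for k and z :: "'m cspace"
  have key: "has_bochner_integral lborel (\<lambda>z. indicator (worm_core \<alpha> \<beta> M) z *\<^sub>R
    (g z * cnj (h z) * of_real (\<Lambda> z) * (e z * of_real (worm_cut T k (Re (worm_log \<alpha> z)))
       - \<i> * phase_factor period \<eta> (worm_angle \<alpha> z) * of_real (worm_cut' T k (Re (worm_log \<alpha> z)))))) 0" for k
    unfolding h_def \<Lambda>_def e_def
    by (rule worm_key_identity[OF \<alpha> \<beta> M0 _ period_def b \<kappa>]) (use open_\<Omega> g \<Omega>_eq in auto)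
  have eq: "indicator (worm_core \<alpha> \<beta> M) z *\<^sub>R
    (g z * cnj (h z) * of_real (\<Lambda> z) * (e z * of_real (worm_cut T k (Re (worm_log \<alpha> z)))
       - \<i> * phase_factor period \<eta> (worm_angle \<alpha> z) * of_real (worm_cut' T k (Re (worm_log \<alpha> z)))))
     = g z * cnj (h z) * \<Psi> k z" for z k
    by (cases "z \<in> worm_core \<alpha> \<beta> M") (simp_all add: \<Psi>_def)
  note key' = key[unfolded eq]
  have off: "g z * cnj (h z) * \<Psi> k z = 0" if "z \<notin> \<Omega>" for z k
    using that core_sub by (auto simp: \<Psi>_def indicator_def)
  have i2: "integrable \<mu> (\<lambda>z. g z * cnj (h z) * \<Psi> k z)" for k
    by (rule integrable_lebesgue_on_eq[OF lebesgue_\<Omega> _ off]) (use key' in \<open>auto simp: has_bochner_integral_iff\<close>)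
  have z2: "(LINT z|\<mu>. g z * cnj (h z) * \<Psi> k z) = 0" for k
  proof -
    have "(LINT z|\<mu>. g z * cnj (h z) * \<Psi> k z) = (LINT z|lborel. g z * cnj (h z) * \<Psi> k z)"
      by (rule integral_lebesgue_on_eq[OF lebesgue_\<Omega> _ off])
        (use borel_measurable_integrable[OF has_bochner_integral_iff[THEN iffD1, OF key'[of k], THEN conjunct1]] in simp)
    then show ?thesis using key'[of k] by (simp add: has_bochner_integral_iff)
  qed
  define m where "m k z = C * indicator {z \<in> \<Omega>. exp (T - 1) \<le> rad z} z + 4 * \<eta> * \<alpha> * ln \<beta> * indicator {z \<in> \<Omega>. rad z < exp T} z
     + C * indicator {z \<in> \<Omega> - good_part \<kappa>. rad z < exp T} z + C * indicator {z \<in> \<Omega>. rad z < exp (1 - k)} z" for k and z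
  have mb: "norm (1 - \<Psi> k z) \<le> m k z" if z: "z \<in> \<Omega>" for k z
  proof -
    define t where "t = ln (rad z)"
    have Re: "Re (worm_log \<alpha> z) = t" using worm_log_props(2)[OF props(3)[OF z]] by (simp add: t_def)
    have et: "exp t = rad z" using props(8)[OF z] by (simp add: t_def)
    have ne: "norm (e z) = 1" by (simp add: e_def norm_exp_eq_Re)
    have nph: "norm (phase_factor period \<eta> (worm_angle \<alpha> z)) \<le> 1 / period"
      using period_primitive_norm[OF s] by (simp add: phase_factor_def norm_mult norm_exp_eq_Re)
    have l: "0 \<le> indicator (worm_core \<alpha> \<beta> M) z * \<Lambda> z" "indicator (worm_core \<alpha> \<beta> M) z * \<Lambda> z \<le> 1"
      using smoothstep_bounds by (auto simp: \<Lambda>_def indicator_def)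
    have w: "\<bar>worm_cut T k t\<bar> \<le> 1" unfolding worm_cut_def abs_mult
      using smoothstep_bounds by (intro mult_le_one) auto
    have w': "\<bar>worm_cut' T k t\<bar> \<le> 3"
    proof -
      have "\<bar>smoothstep (T - t) * smoothstep' (t + k)\<bar> \<le> 1 * (3/2)" "\<bar>smoothstep' (T - t) * smoothstep (t + k)\<bar> \<le> (3/2) * 1"
        unfolding abs_mult using smoothstep_bounds smoothstep'_bounds by (intro mult_mono; auto)+
      then show ?thesis unfolding worm_cut'_def by linarith
    qed
    have "norm (\<Psi> k z) \<le> 1 * (1 * 1 + (1 / period) * 3)"
    proof -
      have "norm (e z * of_real (worm_cut T k t) - \<i> * phase_factor period \<eta> (worm_angle \<alpha> z) * of_real (worm_cut' T k t))
         \<le> norm (e z * of_real (worm_cut T k t)) + norm (\<i> * phase_factor period \<eta> (worm_angle \<alpha> z) * of_real (worm_cut' T k t))"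
        by (rule norm_triangle_ineq4)
      also have "\<dots> \<le> 1 * 1 + (1 / period) * 3"
        unfolding norm_mult ne norm_of_real norm_ii mult_1 using w w' nph s by (intro add_mono mult_mono) auto
      finally have 2: "norm (e z * of_real (worm_cut T k t) - \<i> * phase_factor period \<eta> (worm_angle \<alpha> z) * of_real (worm_cut' T k t))
         \<le> 1 * 1 + (1 / period) * 3" .
      have "norm (\<Psi> k z) = \<bar>indicator (worm_core \<alpha> \<beta> M) z * \<Lambda> z\<bar> * norm (e z * of_real (worm_cut T k t) 
          - \<i> * phase_factor period \<eta> (worm_angle \<alpha> z) * of_real (worm_cut' T k t))"
        by (simp only: \<Psi>_def Re norm_mult norm_of_real)
      also have "\<dots> \<le> 1 * (1 * 1 + (1 / period) * 3)" using l s by (intro mult_mono 2) auto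
      finally show ?thesis .
    qed
    then have gen: "norm (1 - \<Psi> k z) \<le> C" using norm_triangle_ineq4[of 1 "\<Psi> k z"] by (simp add: C_def)
    have parts: "0 \<le> 4 * \<eta> * \<alpha> * ln \<beta>" using \<eta> \<alpha> \<beta> by simp
    consider "exp (T - 1) \<le> rad z" | "rad z < exp (1 - k)" | "rad z < exp (T - 1)" "z \<notin> good_part \<kappa>" 
      | "rad z < exp (T - 1)" "exp (1 - k) \<le> rad z" "z \<in> good_part \<kappa>" by linarith
    then show ?thesis
    proof cases
      case 1
      have "C \<le> m k z" unfolding m_def using 1 z C parts by (simp add: indicator_def)
      then show ?thesis using gen by linarith
    next
      case 2
      have "C \<le> m k z" unfolding m_def using 2 z C parts by (simp add: indicator_def)
      then show ?thesis using gen by linarith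
    next
      case 3
      have "rad z < exp T" using 3(1) exp_less_mono[of "T - 1" T] by linarith
      then have "C \<le> m k z" unfolding m_def using 3 z C parts by (simp add: indicator_def)
      then show ?thesis using gen by linarith
    next
      case 4
      have tT: "t < T - 1" using 4(1) et by (metis exp_less_cancel_iff)
      have tk: "1 - k \<le> t" using 4(2) et by (metis exp_le_cancel_iff)
      have core: "z \<in> worm_core \<alpha> \<beta> M" and ht: "2 * \<kappa> \<le> worm_height \<alpha> z" using 4(3) by (auto simp: good_part_def)
      have "1 \<le> (worm_height \<alpha> z - \<kappa>) / \<kappa>" using ht \<kappa>(1) by (simp add: field_simps)
      then have "\<Lambda> z = 1" unfolding \<Lambda>_def by (rule smoothstep_eq_1)
      moreover have "worm_cut T k t = 1" "worm_cut' T k t = 0"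
        using tT tk by (simp_all add: worm_cut_def worm_cut'_def smoothstep_eq_1 smoothstep'_eq_0)
      ultimately have "\<Psi> k z = e z" using core by (simp add: \<Psi>_def Re)
      then have "norm (1 - \<Psi> k z) = norm (1 - exp (\<i> * of_real (2 * \<eta> * worm_angle \<alpha> z)))" by (simp add: e_def mult_ac)
      also have "\<dots> \<le> \<bar>2 * \<eta> * worm_angle \<alpha> z\<bar>" by (rule norm_exp_ii_minus_1_le)
      also have "\<dots> \<le> 4 * \<eta> * \<alpha> * ln \<beta>"
      proof -
        have c: "1 < cmod (snd (snd z))" "cmod (snd (snd z)) < \<beta>" using core by (auto simp: worm_core_def)
        have "0 \<le> ln (cmod (snd (snd z)))" using c(1) by simp
        moreover have "ln (cmod (snd (snd z))) \<le> ln \<beta>" by (subst ln_le_cancel_iff) (use c \<beta> in linarith)+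
        ultimately have "0 \<le> worm_angle \<alpha> z" "worm_angle \<alpha> z \<le> 2 * \<alpha> * ln \<beta>" using \<alpha> by (auto simp: worm_angle_def)
        then have "2 * \<eta> * worm_angle \<alpha> z \<le> 2 * \<eta> * (2 * \<alpha> * ln \<beta>)" using \<eta> by (intro mult_left_mono) auto
        then show ?thesis using \<eta> \<open>0 \<le> worm_angle \<alpha> z\<close> by (simp add: abs_mult)
      qed
      also have "\<dots> \<le> m k z"
      proof -
        have "rad z < exp T" using 4(1) exp_less_mono[of "T - 1" T] by linarith
        then show ?thesis unfolding m_def using z C by (simp add: indicator_def)
      qed
      finally show ?thesis .
    qed
  qed
  have Sm: "{z \<in> \<Omega>. exp (T - 1) \<le> rad z} \<in> sets \<mu>" "{z \<in> \<Omega>. rad z < c} \<in> sets \<mu>" "{z \<in> \<Omega> - good_part \<kappa>. rad z < exp T} \<in> sets \<mu>" for c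
  proof -
    have "{z \<in> \<Omega>. exp (T - 1) \<le> rad z} = {z \<in> space \<mu>. z \<in> \<Omega> \<and> exp (T - 1) \<le> rad z}" by auto
    also have "\<dots> \<in> sets \<mu>" by (intro rad_sets \<Omega>_in_\<mu> bad_part_in_\<mu>)
    finally show "{z \<in> \<Omega>. exp (T - 1) \<le> rad z} \<in> sets \<mu>" .
    have "{z \<in> \<Omega>. rad z < c} = {z \<in> space \<mu>. z \<in> \<Omega> \<and> rad z < c}" by auto
    also have "\<dots> \<in> sets \<mu>" by (intro rad_sets \<Omega>_in_\<mu> bad_part_in_\<mu>)
    finally show "{z \<in> \<Omega>. rad z < c} \<in> sets \<mu>" .
    have "{z \<in> \<Omega> - good_part \<kappa>. rad z < exp T} = {z \<in> space \<mu>. z \<in> \<Omega> - good_part \<kappa> \<and> rad z < exp T}" by auto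
    also have "\<dots> \<in> sets \<mu>" by (intro rad_sets \<Omega>_in_\<mu> bad_part_in_\<mu>)
    finally show "{z \<in> \<Omega> - good_part \<kappa>. rad z < exp T} \<in> sets \<mu>" .
  qed
  have GI: "integrable \<mu> (\<lambda>z. G z * indicator S z)" if "S \<in> sets \<mu>" for S
    using integrable_mult_indicator[OF that Gi] by (simp add: mult.commute)
  define rest where "rest k = (LINT z|\<mu>. G z * indicator {z \<in> \<Omega>. rad z < exp (1 - real k)} z)" for k
  have main: "norm (LINT z|\<mu>. g z * cnj (h z)) \<le> C * (LINT z|\<mu>. G z * indicator {z \<in> \<Omega>. exp (T - 1) \<le> rad z} z)
    + 4 * \<eta> * \<alpha> * ln \<beta> * (LINT z|\<mu>. G z * indicator {z \<in> \<Omega>. rad z < exp T} z)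
    + C * (LINT z|\<mu>. G z * indicator {z \<in> \<Omega> - good_part \<kappa>. rad z < exp T} z) + C * rest k" for k
  proof -
    have "(LINT z|\<mu>. g z * cnj (h z) - g z * cnj (h z) * \<Psi> (real k) z)
        = (LINT z|\<mu>. g z * cnj (h z)) - (LINT z|\<mu>. g z * cnj (h z) * \<Psi> (real k) z)"
      by (rule Bochner_Integration.integral_diff[OF Fi i2])
    then have eq0: "norm (LINT z|\<mu>. g z * cnj (h z)) = norm (LINT z|\<mu>. g z * cnj (h z) - g z * cnj (h z) * \<Psi> (real k) z)"
      by (simp only: z2 diff_zero)
    have le1: "norm (LINT z|\<mu>. g z * cnj (h z) - g z * cnj (h z) * \<Psi> (real k) z) \<le> (LINT z|\<mu>. C * (G z * indicator {z \<in> \<Omega>. exp (T - 1) \<le> rad z} z) 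
        + 4 * \<eta> * \<alpha> * ln \<beta> * (G z * indicator {z \<in> \<Omega>. rad z < exp T} z)
        + C * (G z * indicator {z \<in> \<Omega> - good_part \<kappa>. rad z < exp T} z) + C * (G z * indicator {z \<in> \<Omega>. rad z < exp (1 - real k)} z))"
    proof (rule order_trans[OF integral_norm_bound integral_mono])
      show "integrable \<mu> (\<lambda>z. norm (g z * cnj (h z) - g z * cnj (h z) * \<Psi> (real k) z))"
        by (intro integrable_norm Bochner_Integration.integrable_diff Fi i2)
      show "integrable \<mu> (\<lambda>z. C * (G z * indicator {z \<in> \<Omega>. exp (T - 1) \<le> rad z} z) 
        + 4 * \<eta> * \<alpha> * ln \<beta> * (G z * indicator {z \<in> \<Omega>. rad z < exp T} z)
        + C * (G z * indicator {z \<in> \<Omega> - good_part \<kappa>. rad z < exp T} z) + C * (G z * indicator {z \<in> \<Omega>. rad z < exp (1 - real k)} z))"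
        by (intro Bochner_Integration.integrable_add integrable_mult_right GI Sm)
      fix z assume "z \<in> space \<mu>"
      then have z: "z \<in> \<Omega>" by simp
      have "g z * cnj (h z) - g z * cnj (h z) * \<Psi> (real k) z = (g z * cnj (h z)) * (1 - \<Psi> (real k) z)" by (simp add: algebra_simps)
      then have "norm (g z * cnj (h z) - g z * cnj (h z) * \<Psi> (real k) z) = G z * norm (1 - \<Psi> (real k) z)"
        by (simp add: norm_mult G_def h_def)
      also have "\<dots> \<le> G z * m (real k) z" by (intro mult_left_mono mb z G0)
      finally show "norm (g z * cnj (h z) - g z * cnj (h z) * \<Psi> (real k) z) \<le> C * (G z * indicator {z \<in> \<Omega>. exp (T - 1) \<le> rad z} z) 
        + 4 * \<eta> * \<alpha> * ln \<beta> * (G z * indicator {z \<in> \<Omega>. rad z < exp T} z)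
        + C * (G z * indicator {z \<in> \<Omega> - good_part \<kappa>. rad z < exp T} z) + C * (G z * indicator {z \<in> \<Omega>. rad z < exp (1 - real k)} z)"
        by (simp add: m_def algebra_simps)
    qed
    have le2: "(LINT z|\<mu>. C * (G z * indicator {z \<in> \<Omega>. exp (T - 1) \<le> rad z} z) 
        + 4 * \<eta> * \<alpha> * ln \<beta> * (G z * indicator {z \<in> \<Omega>. rad z < exp T} z)
        + C * (G z * indicator {z \<in> \<Omega> - good_part \<kappa>. rad z < exp T} z) + C * (G z * indicator {z \<in> \<Omega>. rad z < exp (1 - real k)} z))
     = C * (LINT z|\<mu>. G z * indicator {z \<in> \<Omega>. exp (T - 1) \<le> rad z} z)
    + 4 * \<eta> * \<alpha> * ln \<beta> * (LINT z|\<mu>. G z * indicator {z \<in> \<Omega>. rad z < exp T} z)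
    + C * (LINT z|\<mu>. G z * indicator {z \<in> \<Omega> - good_part \<kappa>. rad z < exp T} z) + C * rest k"
      unfolding rest_def by (rule integral_lincomb4[OF GI[OF Sm(1)] GI[OF Sm(2)] GI[OF Sm(3)] GI[OF Sm(2)]])
    show ?thesis unfolding eq0 using le1 unfolding le2 .
  qed
  have "rest \<longlonglongrightarrow> (LINT z|\<mu>. 0)"
    unfolding rest_def
  proof (rule integral_dominated_convergence[where w=G])
    show "AE z in \<mu>. (\<lambda>k. G z * indicator {z \<in> \<Omega>. rad z < exp (1 - real k)} z) \<longlonglongrightarrow> 0"
    proof (rule AE_I2)
      fix z assume "z \<in> space \<mu>"
      then have z: "z \<in> \<Omega>" by simp
      obtain N :: nat where N: "1 - ln (rad z) < real N" using reals_Archimedean2 by blast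
      have "G z * indicator {z \<in> \<Omega>. rad z < exp (1 - real k)} z = 0" if "k \<ge> N" for k
      proof -
        have "1 - real k < ln (rad z)" using N that by linarith
        then have "exp (1 - real k) < exp (ln (rad z))" by (simp only: exp_less_cancel_iff)
        then have "exp (1 - real k) < rad z" using props(8)[OF z] by (simp only: exp_ln)
        then show ?thesis by (simp add: indicator_def)
      qed
      then show "(\<lambda>k. G z * indicator {z \<in> \<Omega>. rad z < exp (1 - real k)} z) \<longlonglongrightarrow> 0"
        by (intro tendsto_eventually eventually_sequentiallyI[of N]) auto
    qed
    show "AE z in \<mu>. norm (G z * indicator {z \<in> \<Omega>. rad z < exp (1 - real k)} z) \<le> G z" for k
      using G0 by (intro AE_I2) (auto simp: indicator_def abs_mult)
    show "(\<lambda>z. 0 :: real) \<in> borel_measurable \<mu>" by simp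
    show "(\<lambda>z. G z * indicator {z \<in> \<Omega>. rad z < exp (1 - real k)} z) \<in> borel_measurable \<mu>" for k
      by (rule borel_measurable_integrable[OF GI[OF Sm(2)]])
    show "integrable \<mu> G" by (rule Gi)
  qed
  then have lim: "rest \<longlonglongrightarrow> 0" by simp
  define J where "J = C * (LINT z|\<mu>. G z * indicator {z \<in> \<Omega>. exp (T - 1) \<le> rad z} z)
    + 4 * \<eta> * \<alpha> * ln \<beta> * (LINT z|\<mu>. G z * indicator {z \<in> \<Omega>. rad z < exp T} z)
    + C * (LINT z|\<mu>. G z * indicator {z \<in> \<Omega> - good_part \<kappa>. rad z < exp T} z)"
  have "(\<lambda>k. J + C * rest k) \<longlonglongrightarrow> J + C * 0" by (intro tendsto_intros lim)
  then have "norm (LINT z|\<mu>. g z * cnj (h z)) \<le> J + C * 0"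
    by (rule LIMSEQ_le_const) (use main in \<open>simp add: J_def\<close>)
  then show ?thesis by (simp add: J_def h_def)
qed

end

section \<open>Smallness of the exceptional part\<close>

lemma borel_measurable_worm_sigma [measurable]: "worm_sigma M \<in> borel_measurable borel"
  unfolding worm_sigma_def[abs_def] by measurable

context worm
begin

text \<open>Contains all values of z_n outside 1 < |z_n| < \<beta> over which the domain comes within |z_1| < 1 / (2 (k + 1)) of the degenerate set.\<close>

definition "thin_part k = {w :: complex. cmod w \<le> zmax \<and> \<not> (1 < cmod w \<and> cmod w < \<beta>) \<and>
    worm_sigma M ((cmod w)\<^sup>2 - \<beta>\<^sup>2) + worm_sigma M (1 - (cmod w)\<^sup>2) < 1 / real (Suc k)}"

lemma thin_part_borel: "thin_part k \<in> sets borel"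
proof -
  have "thin_part k = {w \<in> space borel. cmod w \<le> zmax \<and> \<not> (1 < cmod w \<and> cmod w < \<beta>) \<and>
    worm_sigma M ((cmod w)\<^sup>2 - \<beta>\<^sup>2) + worm_sigma M (1 - (cmod w)\<^sup>2) < 1 / real (Suc k)}" by (simp add: thin_part_def)
  also have "\<dots> \<in> sets borel" by measurable
  finally show ?thesis .
qed

lemma worm_sigma_eq_0: "worm_sigma M t = 0 \<longleftrightarrow> t \<le> 0"
  using M0 by (simp add: worm_sigma_def)

text \<open>The sets decrease to a subset of two circles.\<close>

lemma thin_part_small:
  assumes "\<epsilon> > 0" shows "\<exists>k. emeasure lborel (thin_part k) < ennreal \<epsilon>"
proof -
  have dec: "decseq thin_part"
  proof (rule decseq_SucI)
    fix k
    have "1 / real (Suc (Suc k)) \<le> 1 / real (Suc k)" by (simp add: field_simps)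
    then show "thin_part (Suc k) \<subseteq> thin_part k" unfolding thin_part_def by auto
  qed
  have sub: "(\<Inter>k. thin_part k) \<subseteq> sphere 0 1 \<union> sphere 0 \<beta>"
  proof
    fix w assume w: "w \<in> (\<Inter>k. thin_part k)"
    define a where "a = worm_sigma M ((cmod w)\<^sup>2 - \<beta>\<^sup>2)"
    define b where "b = worm_sigma M (1 - (cmod w)\<^sup>2)"
    have ab: "a \<ge> 0" "b \<ge> 0" using worm_sigma_nonneg[OF M0] by (auto simp: a_def b_def)
    have lt: "a + b < 1 / real (Suc k)" for k using w by (auto simp: thin_part_def a_def b_def)
    have "a + b \<le> 0"
    proof (rule ccontr)
      assume "\<not> a + b \<le> 0"
      then obtain k where "1 / real (Suc k) < a + b" using nat_approx_posE[of "a + b"] by auto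
      then show False using lt[of k] by linarith
    qed
    then have "a = 0" "b = 0" using ab by linarith+
    then have "(cmod w)\<^sup>2 \<le> \<beta>\<^sup>2" "1\<^sup>2 \<le> (cmod w)\<^sup>2" by (auto simp: a_def b_def worm_sigma_eq_0)
    then have "cmod w \<le> \<beta>" "1 \<le> cmod w" using \<beta> by (auto intro: power2_le_imp_le)
    moreover have "\<not> (1 < cmod w \<and> cmod w < \<beta>)" using w by (auto simp: thin_part_def)
    ultimately show "w \<in> sphere 0 1 \<union> sphere 0 \<beta>" by auto
  qed
  have "sphere (0::complex) 1 \<union> sphere 0 \<beta> \<in> null_sets lborel"
    by (intro null_sets.Un sphere_null_lborel) (use \<beta> in auto)
  then have "emeasure lborel (\<Inter>k. thin_part k) = 0"
    using emeasure_mono[OF sub, of lborel] by (auto simp: null_sets_def)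
  moreover have "(\<lambda>k. emeasure lborel (thin_part k)) \<longlonglongrightarrow> emeasure lborel (\<Inter>k. thin_part k)"
  proof (rule Lim_emeasure_decseq[OF _ dec])
    show "range thin_part \<subseteq> sets lborel" using thin_part_borel by auto
    fix k
    have "emeasure lborel (thin_part k) \<le> emeasure lborel (cball (0::complex) zmax)"
      by (intro emeasure_mono) (auto simp: thin_part_def)
    also have "\<dots> < \<infinity>" by (rule emeasure_lborel_cball_finite)
    finally show "emeasure lborel (thin_part k) \<noteq> \<infinity>" by simp
  qed
  ultimately have "(\<lambda>k. emeasure lborel (thin_part k)) \<longlonglongrightarrow> 0" by simp
  from order_tendstoD(2)[OF this, of "ennreal \<epsilon>"] assms show ?thesis
    by (auto simp: eventually_sequentially)
qed

text \<open>The exceptional part consists of points over the thin values of z_n and of points of low height. Both take an arbitrarily small proportion of the mass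
  near the degenerate set.\<close>

lemma bad_part_small:
  assumes \<tau>: "\<tau> > 0"
  obtains \<kappa> \<delta> where "\<kappa> > 0" "\<delta> > 0" "\<delta> < \<kappa>"
    "\<And>\<rho>. 0 < \<rho> \<Longrightarrow> \<rho> \<le> \<delta> \<Longrightarrow> emeasure \<mu> {x \<in> space \<mu>. x \<in> \<Omega> - good_part \<kappa> \<and> rad x < \<rho>} \<le> ennreal (\<tau> * \<rho> ^ (CARD('m) + 2))"
proof -
  define c1 where "c1 = ball_const TYPE('m)"
  define c2 where "c2 = ball_const TYPE('m) * (real CARD('m) * (unit_ball_vol 2 * \<beta>\<^sup>2))"
  have c: "c1 > 0" "c2 > 0" using ball_const_pos[where 'm='m] \<beta> by (auto simp: c1_def c2_def intro!: mult_pos_pos)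
  obtain k where k: "emeasure lborel (thin_part k) < ennreal (\<tau> / (2 * c1))" using thin_part_small[of "\<tau> / (2 * c1)"] \<tau> c by auto
  \<comment> \<open>Half of the allowed mass is spent on the thin values of z_n, half on the layer of small height.\<close>
  define \<kappa> where "\<kappa> = \<tau> / (2 * c2)"
  have \<kappa>: "\<kappa> > 0" using \<tau> c by (simp add: \<kappa>_def)
  define \<delta> where "\<delta> = min (\<kappa> / 2) (1 / (2 * real (Suc k)))"
  have \<delta>: "\<delta> > 0" "\<delta> < \<kappa>" using \<kappa> by (auto simp: \<delta>_def)
  show thesis
  proof (rule that[OF \<kappa> \<delta>])
    fix \<rho> assume \<rho>: "0 < \<rho>" "\<rho> \<le> \<delta>"
    define D1 where "D1 = {z \<in> \<Omega>. snd (snd z) \<in> thin_part k}"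
    define L where "L = {z \<in> worm_core \<alpha> \<beta> M. worm_height \<alpha> z < 2 * \<kappa>} \<inter> {z :: 'm cspace. rad z < \<rho>}"
    have Lb: "L \<in> sets borel" unfolding L_def
      by (intro sets.Int low_height_borel borel_open open_Collect_less continuous_intros)
    have D1b: "{z \<in> D1. rad z < \<rho>} \<in> sets borel"
    proof -
      have "(\<lambda>z :: 'm cspace. snd (snd z)) \<in> borel_measurable borel"
        by (intro borel_measurable_continuous_onI continuous_intros)
      from measurable_sets[OF this thin_part_borel[of k]]
      have "(\<lambda>z :: 'm cspace. snd (snd z)) -` thin_part k \<in> sets borel" by simp
      moreover have "{z \<in> D1. rad z < \<rho>} = \<Omega> \<inter> ((\<lambda>z. snd (snd z)) -` thin_part k) \<inter> {z. rad z < \<rho>}" by (auto simp: D1_def)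
      moreover have "{z :: 'm cspace. rad z < \<rho>} \<in> sets borel" by (intro borel_open open_Collect_less continuous_intros)
      ultimately show ?thesis using borel_\<Omega> by auto
    qed
    have cover: "{x \<in> space \<mu>. x \<in> \<Omega> - good_part \<kappa> \<and> rad x < \<rho>} \<subseteq> {z \<in> D1. rad z < \<rho>} \<union> L"
    proof
      fix z assume "z \<in> {x \<in> space \<mu>. x \<in> \<Omega> - good_part \<kappa> \<and> rad x < \<rho>}"
      then have z: "z \<in> \<Omega>" "z \<notin> good_part \<kappa>" "rad z < \<rho>" by auto
      show "z \<in> {z \<in> D1. rad z < \<rho>} \<union> L"
      proof (cases "z \<in> worm_core \<alpha> \<beta> M")
        case True
        then show ?thesis using z by (auto simp: L_def good_part_def)
      next
        case False
        have "2 * rad z < 1 / real (Suc k)"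
        proof -
          have "rad z < 1 / (2 * real (Suc k))" using z(3) \<rho>(2) by (simp add: \<delta>_def)
          then show ?thesis by (simp add: field_simps)
        qed
        then have "worm_sigma M ((cmod (snd (snd z)))\<^sup>2 - \<beta>\<^sup>2) + worm_sigma M (1 - (cmod (snd (snd z)))\<^sup>2) < 1 / real (Suc k)"
          using worm_domain_props(7)[OF z(1)[unfolded \<Omega>_eq] M0] by linarith
        moreover have "\<not> (1 < cmod (snd (snd z)) \<and> cmod (snd (snd z)) < \<beta>)" using False z(1) by (simp add: worm_core_def \<Omega>_eq)
        ultimately have "snd (snd z) \<in> thin_part k" using props(7)[OF z(1)] by (simp add: thin_part_def)
        then show ?thesis using z by (simp add: D1_def)
      qed
    qed
    have sub1: "{z \<in> D1. rad z < \<rho>} \<subseteq> \<Omega>" and sub2: "L \<subseteq> \<Omega>" using core_sub by (auto simp: D1_def L_def)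
    have e1: "emeasure lborel {z \<in> D1. rad z < \<rho>} \<le> ennreal (\<tau> / 2 * \<rho> ^ (CARD('m) + 2))"
    proof -
      have "emeasure lborel {z \<in> D1. rad z < \<rho>} \<le> ennreal (c1 * \<rho> ^ (CARD('m) + 2)) * emeasure lborel (thin_part k)"
        unfolding c1_def
      proof (rule worm_mass_bound[OF _ _ thin_part_borel])
        fix z assume "z \<in> D1"
        then have z: "z \<in> \<Omega>" "snd (snd z) \<in> thin_part k" by (auto simp: D1_def)
        show "(norm (fst (snd z)))\<^sup>2 \<le> 2 * norm (fst z)" using props(5)[OF z(1)] by simp
        show "snd (snd z) \<in> thin_part k" by (rule z(2))
      qed (use \<rho> in simp)
      also have "\<dots> \<le> ennreal (c1 * \<rho> ^ (CARD('m) + 2)) * ennreal (\<tau> / (2 * c1))"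
        using k by (intro mult_left_mono) (auto intro: less_imp_le)
      also have "\<dots> = ennreal ((c1 * \<rho> ^ (CARD('m) + 2)) * (\<tau> / (2 * c1)))"
        using c \<rho> \<tau> by (intro ennreal_mult[symmetric]) auto
      also have "(c1 * \<rho> ^ (CARD('m) + 2)) * (\<tau> / (2 * c1)) = \<tau> / 2 * \<rho> ^ (CARD('m) + 2)" using c by (simp add: field_simps)
      finally show ?thesis .
    qed
    have e2: "emeasure lborel L \<le> ennreal (\<tau> / 2 * \<rho> ^ (CARD('m) + 2))"
    proof -
      define X where "X z1 zn = 2 * Re (worm_unwound \<alpha> ((z1, 0, zn) :: 'm cspace))" for z1 zn
      have Xz: "X (fst z) (snd (snd z)) = 2 * Re (worm_unwound \<alpha> z)" for z :: "'m cspace"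
        by (simp add: X_def worm_unwound_def worm_angle_def)
      have "emeasure lborel L \<le> ennreal (ball_const TYPE('m) * (real CARD('m) * (unit_ball_vol 2 * \<beta>\<^sup>2)) * \<kappa> * \<rho> ^ (CARD('m) + 2))"
      proof (rule worm_layer_bound[OF Lb, where a="\<lambda>z1 zn. X z1 zn - 2 * \<kappa> * \<rho>" and X=X])
        fix z assume z: "z \<in> L"
        then have zc: "z \<in> worm_core \<alpha> \<beta> M" "worm_height \<alpha> z < 2 * \<kappa>" "rad z < \<rho>" by (auto simp: L_def)
        have zO: "z \<in> \<Omega>" using zc(1) core_sub by blast
        have "2 * Re (worm_unwound \<alpha> z) - (norm (fst (snd z)))\<^sup>2 < 2 * \<kappa> * rad z"
          using worm_height_eq[OF props(3)[OF zO], of \<alpha>] mult_strict_right_mono[OF zc(2) props(8)[OF zO]] by linarith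
        also have "\<dots> \<le> 2 * \<kappa> * \<rho>" using zc(3) \<kappa> by (intro mult_left_mono) auto
        finally have 1: "2 * Re (worm_unwound \<alpha> z) - 2 * \<kappa> * \<rho> < (norm (fst (snd z)))\<^sup>2" by linarith
        have 2: "(norm (fst (snd z)))\<^sup>2 \<le> 2 * Re (worm_unwound \<alpha> z)"
          using worm_domain_props(2)[OF zO[unfolded \<Omega>_eq] M0] zero_le_power2[of "rad z"] by linarith
        have 3: "2 * Re (worm_unwound \<alpha> z) \<le> 2 * \<rho>"
          using complex_Re_le_cmod[of "worm_unwound \<alpha> z"] zc(3) unfolding norm_worm_unwound by linarith
        show "norm (fst z) \<le> \<rho> \<and> cmod (snd (snd z)) \<le> \<beta> \<and> X (fst z) (snd (snd z)) - 2 * \<kappa> * \<rho> < (norm (fst (snd z)))\<^sup>2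
        \<and> (norm (fst (snd z)))\<^sup>2 \<le> X (fst z) (snd (snd z)) \<and> X (fst z) (snd (snd z)) \<le> 2 * \<rho>
        \<and> X (fst z) (snd (snd z)) - (X (fst z) (snd (snd z)) - 2 * \<kappa> * \<rho>) \<le> 2 * \<kappa> * \<rho>"
          unfolding Xz using 1 2 3 zc by (auto simp: worm_core_def)
      qed (use \<rho> \<kappa> \<beta> in auto)
      also have "ball_const TYPE('m) * (real CARD('m) * (unit_ball_vol 2 * \<beta>\<^sup>2)) * \<kappa> * \<rho> ^ (CARD('m) + 2) = \<tau> / 2 * \<rho> ^ (CARD('m) + 2)"
        unfolding c2_def[symmetric] using c by (simp add: \<kappa>_def)
      finally show ?thesis .
    qed
    have "emeasure \<mu> {x \<in> space \<mu>. x \<in> \<Omega> - good_part \<kappa> \<and> rad x < \<rho>} \<le> emeasure \<mu> ({z \<in> D1. rad z < \<rho>} \<union> L)"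
      by (rule emeasure_mono[OF cover]) (use D1b Lb sub1 sub2 in \<open>auto intro!: sets_\<mu>\<close>)
    also have "\<dots> = emeasure lborel ({z \<in> D1. rad z < \<rho>} \<union> L)"
      by (rule emeasure_lebesgue_on_borel[OF borel_\<Omega>]) (use D1b Lb sub1 sub2 in auto)
    also have "\<dots> \<le> emeasure lborel {z \<in> D1. rad z < \<rho>} + emeasure lborel L"
      by (rule emeasure_subadditive) (use D1b Lb in auto)
    also have "\<dots> \<le> ennreal (\<tau> / 2 * \<rho> ^ (CARD('m) + 2)) + ennreal (\<tau> / 2 * \<rho> ^ (CARD('m) + 2))" by (intro add_mono e1 e2)
    also have "\<dots> = ennreal (\<tau> * \<rho> ^ (CARD('m) + 2))" using \<tau> \<rho> by (subst ennreal_plus[symmetric]) auto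
    finally show "emeasure \<mu> {x \<in> space \<mu>. x \<in> \<Omega> - good_part \<kappa> \<and> rad x < \<rho>} \<le> ennreal (\<tau> * \<rho> ^ (CARD('m) + 2))" .
  qed
qed

definition "ring_part \<epsilon> = {z \<in> \<Omega>. \<epsilon> / 2 < rad z \<and> rad z < \<epsilon>}"

lemma ring_part_borel: "ring_part \<epsilon> \<in> sets borel"
proof -
  have "ring_part \<epsilon> = \<Omega> \<inter> ({z. \<epsilon> / 2 < rad z} \<inter> {z. rad z < \<epsilon>})" by (auto simp: ring_part_def)
  also have "\<dots> \<in> sets borel" by (intro sets.Int borel_\<Omega> borel_open open_Collect_less continuous_intros)
  finally show ?thesis .
qed

lemma ring_part_in_\<mu> [measurable]: "ring_part \<epsilon> \<in> sets \<mu>"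
  by (rule sets_\<mu>[OF ring_part_borel]) (auto simp: ring_part_def)

text \<open>For |z_n| close to 1 the winding angle is at most \<pi>/3, and z_1 near 3 \<epsilon> / 4 keeps the unwound coordinate well inside the right half plane; a product
  of two balls and an annulus then fits into the ring.\<close>

lemma ring_part_mass_lower:
  obtains c where "c > 0" "\<And>\<epsilon>. 0 < \<epsilon> \<Longrightarrow> \<epsilon> \<le> 1 / 4 \<Longrightarrow> ennreal (c * \<epsilon> ^ (CARD('m) + 2)) \<le> emeasure \<mu> (ring_part \<epsilon>)"
proof -
  \<comment> \<open>The second bound keeps the winding angle below \<pi>/3.\<close>
  define Z where "Z = {w :: complex. 1 < cmod w} \<inter> {w. cmod w < min \<beta> (exp (pi / (6 * \<alpha>)))}"
  have Zo: "open Z" unfolding Z_def by (intro open_Int open_Collect_less continuous_intros)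
  have e1: "1 < exp (pi / (6 * \<alpha>))" using \<alpha> by simp
  define t where "t = (1 + min \<beta> (exp (pi / (6 * \<alpha>)))) / 2"
  have t: "1 < t" "t < min \<beta> (exp (pi / (6 * \<alpha>)))" using \<beta> e1 by (auto simp: t_def min_def)
  then have "of_real t \<in> Z" by (simp add: Z_def)
  then have Zne: "Z \<noteq> {}" by blast
  have Zfin: "emeasure lborel Z < \<infinity>"
  proof -
    have "emeasure lborel Z \<le> emeasure lborel (cball (0::complex) \<beta>)" by (intro emeasure_mono) (auto simp: Z_def)
    also have "\<dots> < \<infinity>" by (rule emeasure_lborel_cball_finite)
    finally show ?thesis .
  qed
  define \<zeta> where "\<zeta> = measure lborel Z"
  have \<zeta>e: "emeasure lborel Z = ennreal \<zeta>" unfolding \<zeta>_def using Zfin by (simp add: emeasure_eq_ennreal_measure less_top[symmetric])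
  have \<zeta>: "\<zeta> > 0"
  proof (rule ccontr)
    assume "\<not> \<zeta> > 0"
    then have "\<zeta> = 0" by (simp add: \<zeta>_def zero_less_measure_iff)
    then have "Z \<in> null_sets lborel" using \<zeta>e Zo by (simp add: null_sets_def)
    then have "negligible Z" by (simp add: negligible_iff_null_sets null_sets_completionI)
    then show False using Zo Zne open_not_negligible by blast
  qed
  define V where "V = unit_ball_vol (2 * real CARD('m))"
  define c where "c = unit_ball_vol 2 * (1 / 8)^2 * (V * (1 / 8) ^ CARD('m) * \<zeta>)"
  have cpos: "c > 0" using \<zeta> by (simp add: c_def V_def)
  show thesis
  proof (rule that[OF cpos])
    fix \<epsilon> :: real assume \<epsilon>: "0 < \<epsilon>" "\<epsilon> \<le> 1 / 4"
    define P where "P = cball (complex_of_real (3 * \<epsilon> / 4)) (\<epsilon> / 8) \<times> (cball (0 :: complex ^ 'm) (sqrt (\<epsilon> / 8)) \<times> Z)"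
    have eP: "emeasure lborel P = ennreal (c * \<epsilon> ^ (CARD('m) + 2))"
    proof -
      have "emeasure lborel (cball (complex_of_real (3 * \<epsilon> / 4)) (\<epsilon> / 8)) = ennreal (unit_ball_vol 2 * (\<epsilon> / 8)^2)"
        using emeasure_cball[of "\<epsilon> / 8" "complex_of_real (3 * \<epsilon> / 4)"] \<epsilon> by simp
      moreover have "emeasure lborel (cball (0 :: complex ^ 'm) (sqrt (\<epsilon> / 8))) = ennreal (V * (\<epsilon> / 8) ^ CARD('m))"
        unfolding V_def by (rule emeasure_cball_vec) (use \<epsilon> in simp)
      ultimately have "emeasure lborel P = ennreal (unit_ball_vol 2 * (\<epsilon> / 8)^2) * (ennreal (V * (\<epsilon> / 8) ^ CARD('m)) * ennreal \<zeta>)"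
        unfolding P_def using Zo \<zeta>e by (subst emeasure_lborel_triple) auto
      also have "\<dots> = ennreal ((unit_ball_vol 2 * (\<epsilon> / 8)^2) * ((V * (\<epsilon> / 8) ^ CARD('m)) * \<zeta>))"
        using \<zeta> \<epsilon> by (simp add: ennreal_mult V_def)
      also have "(unit_ball_vol 2 * (\<epsilon> / 8)^2) * ((V * (\<epsilon> / 8) ^ CARD('m)) * \<zeta>) = c * \<epsilon> ^ (CARD('m) + 2)"
        by (simp add: c_def power_divide power_add power2_eq_square)
      finally show ?thesis .
    qed
    have sub: "P \<subseteq> ring_part \<epsilon>"
    proof
      fix z assume "z \<in> P"
      then have z: "dist (complex_of_real (3 * \<epsilon> / 4)) (fst z) \<le> \<epsilon> / 8" "norm (fst (snd z)) \<le> sqrt (\<epsilon> / 8)" "snd (snd z) \<in> Z"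
        by (auto simp: P_def)
      have zn: "1 < cmod (snd (snd z))" "cmod (snd (snd z)) < \<beta>" "cmod (snd (snd z)) < exp (pi / (6 * \<alpha>))"
        using z(3) by (auto simp: Z_def)
      have r: "5 * \<epsilon> / 8 \<le> rad z" "rad z \<le> 7 * \<epsilon> / 8"
        using norm_triangle_ineq2[of "complex_of_real (3 * \<epsilon> / 4)" "fst z"] norm_triangle_ineq2[of "fst z" "complex_of_real (3 * \<epsilon> / 4)"] z(1) \<epsilon>
        by (auto simp: dist_norm norm_minus_commute simp del: of_real_mult of_real_divide)
      define \<theta> where "\<theta> = worm_angle \<alpha> z"
      have \<theta>: "0 \<le> \<theta>" "\<theta> \<le> pi / 3"
      proof -
        have "0 \<le> ln (cmod (snd (snd z)))" using zn(1) by simp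
        moreover have "ln (cmod (snd (snd z))) \<le> ln (exp (pi / (6 * \<alpha>)))" by (subst ln_le_cancel_iff) (use zn in \<open>auto simp: less_imp_le\<close>)
        ultimately show "0 \<le> \<theta>" using \<alpha> by (simp add: \<theta>_def worm_angle_def)
        have "2 * \<alpha> * ln (cmod (snd (snd z))) \<le> 2 * \<alpha> * (pi / (6 * \<alpha>))"
          using \<open>ln (cmod (snd (snd z))) \<le> ln (exp (pi / (6 * \<alpha>)))\<close> \<alpha> by (intro mult_left_mono) auto
        then show "\<theta> \<le> pi / 3" using \<alpha> by (simp add: \<theta>_def worm_angle_def)
      qed
      have cos: "cos \<theta> \<ge> 1 / 2" using cos_monotone_0_pi_le[of \<theta> "pi / 3"] \<theta> by (simp add: cos_60)
      have Re: "Re (worm_unwound \<alpha> z) \<ge> \<epsilon> / 4"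
      proof -
        define E where "E = exp (- \<i> * of_real \<theta>)"
        have ReE: "Re E = cos \<theta>" by (simp add: E_def Re_exp)
        have nE: "norm E = 1" unfolding E_def by (rule norm_exp_minus_ii)
        have "worm_unwound \<alpha> z = complex_of_real (3 * \<epsilon> / 4) * E - (complex_of_real (3 * \<epsilon> / 4) - fst z) * E"
          by (simp add: worm_unwound_def E_def \<theta>_def algebra_simps)
        then have "Re (worm_unwound \<alpha> z) = (3 * \<epsilon> / 4) * cos \<theta> - Re ((complex_of_real (3 * \<epsilon> / 4) - fst z) * E)"
          by (simp add: ReE del: of_real_mult of_real_divide)
        moreover have "Re ((complex_of_real (3 * \<epsilon> / 4) - fst z) * E) \<le> \<epsilon> / 8"
          by (rule order_trans[OF complex_Re_le_cmod]) (use z(1) nE in \<open>simp add: norm_mult dist_norm del: of_real_mult of_real_divide\<close>)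
        moreover have "(3 * \<epsilon> / 4) * (1 / 2) \<le> (3 * \<epsilon> / 4) * cos \<theta>" using cos \<epsilon> by (intro mult_left_mono) auto
        ultimately show ?thesis by linarith
      qed
      have "(rad z)\<^sup>2 \<le> \<epsilon> * (1 / 4)"
      proof -
        have "(rad z)\<^sup>2 = rad z * rad z" by (simp add: power2_eq_square)
        also have "\<dots> \<le> \<epsilon> * (1 / 4)" using r \<epsilon> by (intro mult_mono) auto
        finally show ?thesis .
      qed
      moreover have "(norm (fst (snd z)))\<^sup>2 \<le> \<epsilon> / 8"
      proof -
        have "(norm (fst (snd z)))\<^sup>2 \<le> (sqrt (\<epsilon> / 8))\<^sup>2" using z(2) by (intro power_mono) auto
        then show ?thesis using \<epsilon> by simp
      qed
      ultimately have "z \<in> worm_domain \<alpha> \<beta> M"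
        using zn Re \<epsilon> by (intro worm_domain_core) auto
      then have "z \<in> \<Omega>" by (simp add: \<Omega>_eq)
      then show "z \<in> ring_part \<epsilon>" using r \<epsilon> by (simp add: ring_part_def)
    qed
    have Pb: "P \<in> sets borel" unfolding P_def using Zo by (intro borel_Times) auto
    have "emeasure lborel P = emeasure \<mu> P"
      by (rule emeasure_lebesgue_on_borel[OF borel_\<Omega> Pb, symmetric]) (use sub in \<open>auto simp: ring_part_def\<close>)
    also have "\<dots> \<le> emeasure \<mu> (ring_part \<epsilon>)" by (rule emeasure_mono[OF sub ring_part_in_\<mu>])
    finally show "ennreal (c * \<epsilon> ^ (CARD('m) + 2)) \<le> emeasure \<mu> (ring_part \<epsilon>)" by (simp add: eP)
  qed
qed

end

section \<open>The bound fails\<close>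

text \<open>Convexity of the exponential, in the form of the weighted inequality between arithmetic and geometric mean.\<close>

lemma one_minus_two_powr_ge:
  fixes x :: real
  assumes "0 < x" "x \<le> 1"
  shows "x / 2 \<le> 1 - 2 powr (- x)"
proof -
  have "1 powr (1 - x) * (1 / 2) powr x \<le> (1 - x) * 1 + x * (1 / 2 :: real)"
    by (rule Youngs_inequality_0) (use assms in auto)
  then show ?thesis by (simp add: powr_minus powr_divide inverse_eq_divide)
qed

lemma ex_large_powr_small:
  fixes X L t :: real
  assumes "X \<ge> 0" "L > 0" "t > 0"
  obtains R where "R \<ge> 1" "X * R powr (- t) < L"
proof (rule that[of "(X / L + 1) powr (1 / t)"])
  have pos: "X / L + 1 \<ge> 1" using assms by simp
  then show "(X / L + 1) powr (1 / t) \<ge> 1" using assms by (intro ge_one_powr_ge_zero) auto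
  have "((X / L + 1) powr (1 / t)) powr (- t) = (X / L + 1) powr (- 1)" using assms by (simp add: powr_powr)
  also have "\<dots> = 1 / (X / L + 1)" using pos by (simp add: powr_minus_divide)
  finally have eq: "((X / L + 1) powr (1 / t)) powr (- t) = 1 / (X / L + 1)" .
  show "X * ((X / L + 1) powr (1 / t)) powr (- t) < L"
    unfolding eq using assms by (simp add: field_simps)
qed

lemma ex_small_powr_small:
  fixes X L t c :: real
  assumes "X \<ge> 0" "L > 0" "t > 0" "c > 0"
  obtains r where "0 < r" "r \<le> c" "X * r powr t < L"
proof -
  obtain R where R: "R \<ge> 1" "X * R powr (- t) < L" using ex_large_powr_small[OF assms(1-3)] .
  have "min c (1 / R) powr t \<le> (1 / R) powr t" using R assms by (intro powr_mono2) auto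
  also have "\<dots> = R powr (- t)" using R by (simp add: powr_divide powr_minus_divide)
  finally have "X * min c (1 / R) powr t \<le> X * R powr (- t)" using assms by (intro mult_left_mono) auto
  then show thesis using R assms by (intro that[of "min c (1 / R)"]) auto
qed

text \<open>Bookkeeping of exponents for the part |z_1| < K \<epsilon>: all dependence on \<epsilon> is the factor \<epsilon>^(b+n). The geometric series contributes the factor (2 / \<eta>)^(1/q), which is
  what limits the rate at which \<eta> may tend to 0.\<close>

lemma near_power_bound:
  fixes m c \<epsilon> K p q n s \<eta> \<gamma> b :: real
  assumes m: "m > 0" and c: "c \<ge> 0" and \<epsilon>: "\<epsilon> > 0" and K: "K \<ge> 1" and q: "q > 1" and pq: "1 / p + 1 / q = 1"
    and \<eta>: "0 < \<eta>" "\<eta> \<le> 1" and \<gamma>: "\<gamma> = n / q - n / 2 - s" "\<gamma> \<ge> 0" and b: "b = - n / 2 - s + \<eta>"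
  shows "(m * \<epsilon> powr n) powr (1 / p) * (c * 2 powr (- (b * q)) * (K * \<epsilon>) powr (b * q + n) / (1 - 2 powr (- (b * q + n)))) powr (1 / q)
    \<le> m powr (1 / p) * c powr (1 / q) * (2 powr (n / 2 + s) * K powr (\<gamma> + 1) * (2 / \<eta>) powr (1 / q)) * \<epsilon> powr (b + n)"
proof -
  define y where "y = b * q + n"
  have y: "y = q * (\<gamma> + \<eta>)" using q by (simp add: y_def b \<gamma>(1) field_simps)
  have "1 * \<eta> \<le> y" unfolding y using q \<eta> \<gamma>(2) by (intro mult_mono) auto
  then have "2 powr (- y) \<le> 2 powr (- \<eta>)" by (intro powr_mono) auto
  then have A: "\<eta> / 2 \<le> 1 - 2 powr (- y)" using one_minus_two_powr_ge[OF \<eta>] by linarith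
  define U where "U = 2 powr (- (b * q))"
  define V where "V = (K * \<epsilon>) powr y"
  have UV: "U \<ge> 0" "V \<ge> 0" by (auto simp: U_def V_def)
  have h2: "0 \<le> 2 / \<eta>" using \<eta> by simp
  have "c * U * V / (1 - 2 powr (- y)) \<le> c * U * V / (\<eta> / 2)"
    using A \<eta> c UV by (intro divide_left_mono mult_pos_pos mult_nonneg_nonneg) auto
  then have "(c * U * V / (1 - 2 powr (- y))) powr (1 / q) \<le> (c * U * V * (2 / \<eta>)) powr (1 / q)"
    using A \<eta> c UV q by (intro powr_mono2) auto
  also have "\<dots> = c powr (1 / q) * U powr (1 / q) * V powr (1 / q) * (2 / \<eta>) powr (1 / q)"
    by (simp only: powr_mult mult_nonneg_nonneg c UV h2)
  also have "U powr (1 / q) = 2 powr (- b)" using q by (simp add: U_def powr_powr)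
  also have "V powr (1 / q) = K powr (\<gamma> + \<eta>) * \<epsilon> powr (\<gamma> + \<eta>)"
    using q K \<epsilon> by (simp add: V_def y powr_powr powr_mult)
  finally have 1: "(c * U * V / (1 - 2 powr (- y))) powr (1 / q)
    \<le> c powr (1 / q) * 2 powr (- b) * (K powr (\<gamma> + \<eta>) * \<epsilon> powr (\<gamma> + \<eta>)) * (2 / \<eta>) powr (1 / q)" .
  have 2: "(m * \<epsilon> powr n) powr (1 / p) = m powr (1 / p) * \<epsilon> powr (n / p)" using m \<epsilon> by (simp add: powr_mult powr_powr)
  have e: "\<epsilon> powr (n / p) * \<epsilon> powr (\<gamma> + \<eta>) = \<epsilon> powr (b + n)"
  proof -
    have "n / p + n / q = n * (1 / p + 1 / q)" by (simp add: distrib_left)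
    then have "n / p + (\<gamma> + \<eta>) = b + n" unfolding pq b \<gamma>(1) by linarith
    then show ?thesis by (simp only: powr_add[symmetric])
  qed
  have "(m * \<epsilon> powr n) powr (1 / p) * (c * U * V / (1 - 2 powr (- y))) powr (1 / q)
    \<le> (m powr (1 / p) * \<epsilon> powr (n / p)) * (c powr (1 / q) * 2 powr (- b) * (K powr (\<gamma> + \<eta>) * \<epsilon> powr (\<gamma> + \<eta>)) * (2 / \<eta>) powr (1 / q))"
    unfolding 2 by (intro mult_left_mono 1) auto
  also have "\<dots> = m powr (1 / p) * c powr (1 / q) * (2 powr (- b) * K powr (\<gamma> + \<eta>) * (2 / \<eta>) powr (1 / q)) * (\<epsilon> powr (n / p) * \<epsilon> powr (\<gamma> + \<eta>))"
    by (simp only: mult_ac)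
  also have "\<dots> \<le> m powr (1 / p) * c powr (1 / q) * (2 powr (n / 2 + s) * K powr (\<gamma> + 1) * (2 / \<eta>) powr (1 / q)) * (\<epsilon> powr (n / p) * \<epsilon> powr (\<gamma> + \<eta>))"
    using K \<eta> b by (intro mult_right_mono mult_left_mono mult_mono powr_mono) auto
  finally show ?thesis unfolding e U_def V_def y_def .
qed

text \<open>The same for the part |z_1| \<ge> K \<epsilon> / e in L^2; the gain is a negative power of K.\<close>

lemma far_power_bound:
  fixes m t \<epsilon> K n s \<eta> b :: real
  assumes m: "m > 0" and t: "t \<ge> 0" and \<epsilon>: "\<epsilon> > 0" and K: "K \<ge> exp 1" and s: "s > 0"
    and \<eta>: "\<eta> \<le> s / 2" and b: "b = - n / 2 - s + \<eta>"
  shows "(m * \<epsilon> powr n) powr (1 / 2) * (m * t * (K * \<epsilon> / exp 1) powr (b * 2 + n) / (1 - 2 powr (b * 2 + n))) powr (1 / 2)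
    \<le> m * (t / (1 - 2 powr (- s))) powr (1 / 2) * (K / exp 1) powr (- (s / 2)) * \<epsilon> powr (b + n)"
proof -
  define a where "a = b * 2 + n"
  define d where "d = 1 - 2 powr (- s)"
  define k where "k = K / exp 1"
  have a: "a \<le> - s" using \<eta> by (simp add: a_def b)
  have d: "d > 0" using s powr_less_mono[of "- s" 0 "2::real"] by (simp add: d_def)
  have k: "k \<ge> 1" using K by (simp add: k_def)
  have "2 powr a \<le> 2 powr (- s)" using a by (intro powr_mono) auto
  then have A: "d \<le> 1 - 2 powr a" by (simp add: d_def)
  define V where "V = (k * \<epsilon>) powr a"
  have V0: "0 \<le> V" by (simp add: V_def)
  have td: "0 \<le> t / d" using t d by simp
  have "m * t * V / (1 - 2 powr a) \<le> m * t * V / d"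
    using A d t m by (intro divide_left_mono mult_pos_pos mult_nonneg_nonneg) (auto simp: V_def)
  then have "(m * t * V / (1 - 2 powr a)) powr (1 / 2) \<le> (m * (t / d) * V) powr (1 / 2)"
    using A d t m by (intro powr_mono2) (auto simp: V_def)
  also have "\<dots> = m powr (1 / 2) * (t / d) powr (1 / 2) * V powr (1 / 2)" 
    by (simp only: powr_mult mult_nonneg_nonneg less_imp_le[OF m] td V0)
  also have "V powr (1 / 2) = k powr (a / 2) * \<epsilon> powr (a / 2)" using k \<epsilon> by (simp add: V_def powr_powr powr_mult)
  finally have 1: "(m * t * V / (1 - 2 powr a)) powr (1 / 2) \<le> m powr (1 / 2) * (t / d) powr (1 / 2) * (k powr (a / 2) * \<epsilon> powr (a / 2))" .
  have 2: "(m * \<epsilon> powr n) powr (1 / 2) = m powr (1 / 2) * \<epsilon> powr (n / 2)" using m \<epsilon> by (simp add: powr_mult powr_powr)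
  have e: "\<epsilon> powr (n / 2) * \<epsilon> powr (a / 2) = \<epsilon> powr (b + n)"
  proof -
    have "n / 2 + a / 2 = b + n" by (simp add: a_def field_simps)
    then show ?thesis by (simp only: powr_add[symmetric])
  qed
  have mm: "m powr (1 / 2) * m powr (1 / 2) = m" using m by (simp add: powr_add[symmetric])
  have "(m * \<epsilon> powr n) powr (1 / 2) * (m * t * V / (1 - 2 powr a)) powr (1 / 2)
     \<le> (m powr (1 / 2) * \<epsilon> powr (n / 2)) * (m powr (1 / 2) * (t / d) powr (1 / 2) * (k powr (a / 2) * \<epsilon> powr (a / 2)))"
    unfolding 2 by (intro mult_left_mono 1) auto
  also have "\<dots> = (m powr (1 / 2) * m powr (1 / 2)) * (t / d) powr (1 / 2) * k powr (a / 2) * (\<epsilon> powr (n / 2) * \<epsilon> powr (a / 2))"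
    by (simp only: mult_ac)
  also have "\<dots> \<le> m * (t / d) powr (1 / 2) * k powr (- (s / 2)) * \<epsilon> powr (b + n)"
    unfolding mm e using k a m by (intro mult_right_mono mult_left_mono powr_mono) auto
  finally show ?thesis by (simp add: V_def a_def d_def k_def)
qed

context worm
begin

lemma pairing_region:
  assumes S: "S \<in> sets \<mu>" "S \<subseteq> \<Omega>" and pq: "p > 1" "1 / p + 1 / q = 1" and g: "g \<in> Lp \<Omega> p"
    and i: "integrable \<mu> (\<lambda>z. rad z powr (b * q) * indicator S z)" and B: "(LINT z|\<mu>. rad z powr (b * q) * indicator S z) \<le> B"
  shows "(LINT z|\<mu>. norm (g z) * norm (worm_power \<alpha> b z) * indicator S z) \<le> Lp_norm \<Omega> p g * B powr (1 / q) / zmin"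
proof -
  have q: "q > 1" by (rule conjugate_exponent_gt_1[OF pq])
  define w where "w z = complex_of_real (rad z powr b * indicator S z)" for z :: "'m cspace"
  have gm[measurable]: "g \<in> borel_measurable \<mu>" and gi: "integrable \<mu> (\<lambda>z. norm (g z) powr p)" using g by (auto simp: Lp_def)
  note rad_powr_measurable[measurable] S(1)[measurable]
  have wm[measurable]: "w \<in> borel_measurable \<mu>" unfolding w_def
    by (intro borel_measurable_complex_of_real borel_measurable_times rad_powr_measurable borel_measurable_indicator S(1))
  have wq: "norm (w z) powr q = rad z powr (b * q) * indicator S z" for z
    by (cases "z \<in> S") (simp_all add: w_def powr_powr)
  have wi: "integrable \<mu> (\<lambda>z. norm (w z) powr q)" unfolding wq by (rule i)
  have "(LINT z|\<mu>. norm (g z * w z)) \<le> (LINT z|\<mu>. norm (g z) powr p) powr (1 / p) * (LINT z|\<mu>. norm (w z) powr q) powr (1 / q)"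
    by (rule holder(2)[OF pq gm wm gi wi])
  also have "\<dots> \<le> Lp_norm \<Omega> p g * B powr (1 / q)"
    unfolding Lp_norm_def wq using B q by (intro mult_left_mono powr_mono2 integral_nonneg_AE AE_I2) auto
  finally have 1: "(LINT z|\<mu>. norm (g z * w z)) \<le> Lp_norm \<Omega> p g * B powr (1 / q)" .
  have "(LINT z|\<mu>. norm (g z) * norm (worm_power \<alpha> b z) * indicator S z) \<le> (LINT z|\<mu>. norm (g z * w z) / zmin)"
  proof (rule integral_mono')
    show "integrable \<mu> (\<lambda>z. norm (g z * w z) / zmin)" by (intro integrable_divide integrable_norm holder(1)[OF pq gm wm gi wi])
    fix z assume "z \<in> space \<mu>"
    show "0 \<le> norm (g z * w z) / zmin" using zmin_pos by simp
    show "norm (g z) * norm (worm_power \<alpha> b z) * indicator S z \<le> norm (g z * w z) / zmin"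
    proof (cases "z \<in> S")
      case True
      then have "norm (g z) * norm (worm_power \<alpha> b z) \<le> norm (g z) * (rad z powr b / zmin)"
        using S(2) by (intro mult_left_mono norm_worm_power_le) auto
      then show ?thesis using True by (simp add: w_def norm_mult)
    qed (use zmin_pos in simp)
  qed
  also have "\<dots> = (LINT z|\<mu>. norm (g z * w z)) / zmin" by simp
  also have "\<dots> \<le> Lp_norm \<Omega> p g * B powr (1 / q) / zmin" using 1 zmin_pos by (intro divide_right_mono) auto
  finally show ?thesis .
qed

text \<open>The hypothesis on b and q says that h lies in L^q.\<close>

lemma Lp_worm_power_integrable:
  assumes pq: "p > 1" "1 / p + 1 / q = 1" and f: "f \<in> Lp \<Omega> p" and b: "b < 0" "b * q + real (CARD('m) + 2) > 0"
  shows "integrable \<mu> (\<lambda>z. norm (f z) * rad z powr b)" "integrable \<mu> (\<lambda>z. norm (f z) * norm (worm_power \<alpha> b z))"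
    "integrable \<mu> (\<lambda>z. f z * cnj (worm_power \<alpha> b z))"
proof -
  have q: "q > 1" by (rule conjugate_exponent_gt_1[OF pq])
  have fm[measurable]: "f \<in> borel_measurable \<mu>" and fi: "integrable \<mu> (\<lambda>z. norm (f z) powr p)" using f by (auto simp: Lp_def)
  note rad_powr_measurable[measurable]
  have hm[measurable]: "worm_power \<alpha> b \<in> borel_measurable \<mu>"
    by (rule holomorphic_fun_measurable[OF open_\<Omega>]) (simp add: \<Omega>_eq worm_power_holomorphic[OF M0])
  have wm: "(\<lambda>z. complex_of_real (rad z powr b)) \<in> borel_measurable \<mu>"
    by (intro borel_measurable_complex_of_real rad_powr_measurable)
  have "integrable \<mu> (\<lambda>z. rad z powr (b * q))" using b q by (intro rad_powr_integrable) (auto simp: mult_neg_pos)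
  then have wi: "integrable \<mu> (\<lambda>z. norm (complex_of_real (rad z powr b)) powr q)" by (simp add: powr_powr)
  show 1: "integrable \<mu> (\<lambda>z. norm (f z) * rad z powr b)"
    using integrable_norm[OF holder(1)[OF pq fm wm fi wi]] by (simp add: norm_mult)
  show 2: "integrable \<mu> (\<lambda>z. norm (f z) * norm (worm_power \<alpha> b z))"
  proof (rule Bochner_Integration.integrable_bound[OF integrable_divide[OF 1, of zmin]])
    show "AE z in \<mu>. norm (norm (f z) * norm (worm_power \<alpha> b z)) \<le> norm (norm (f z) * rad z powr b / zmin)"
    proof (rule AE_I2)
      fix z assume "z \<in> space \<mu>"
      then have "norm (f z) * norm (worm_power \<alpha> b z) \<le> norm (f z) * (rad z powr b / zmin)"
        by (intro mult_left_mono norm_worm_power_le) auto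
      then show "norm (norm (f z) * norm (worm_power \<alpha> b z)) \<le> norm (norm (f z) * rad z powr b / zmin)"
        using zmin_pos by simp
    qed
  qed measurable
  show "integrable \<mu> (\<lambda>z. f z * cnj (worm_power \<alpha> b z))"
    by (rule Bochner_Integration.integrable_bound[OF 2]) (measurable, simp add: norm_mult)
qed

text \<open>The test function \<phi> is the phase of h on the ring of radius \<epsilon>, and g is its projection. As \<phi> - g is orthogonal to h, the pairings of \<phi> and of g with h agree. The first
  is the integral of |h| over the ring, of order \<epsilon>^(b+n). The second is bounded by the previous estimates: the far part through the L^2 norm of g, the
  others through its L^p norm. Both sides scale as \<epsilon>^(b+n), which cancels.\<close>

lemma projection_estimate:
  assumes p: "p > 2" and pq: "1 / p + 1 / q = 1"
    and maps: "\<And>f. f \<in> bounded_measurable \<mu> \<Longrightarrow> bergman_projection \<Omega> f \<in> Lp \<Omega> p"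
      "\<And>f. f \<in> bounded_measurable \<mu> \<Longrightarrow> Lp_norm \<Omega> p (bergman_projection \<Omega> f) \<le> C0 * Lp_norm \<Omega> p f" and C0: "C0 \<ge> 0"
    and n: "n = real (CARD('m) + 2)" and \<gamma>: "\<gamma> = n / q - n / 2 - period" "\<gamma> \<ge> 0" and b: "b = - n / 2 - period + \<eta>"
    and \<eta>: "0 < \<eta>" "\<eta> \<le> 1" "\<eta> \<le> period / 2" and K: "K \<ge> exp 1" and \<epsilon>: "\<epsilon> > 0" and \<kappa>: "\<kappa> > 0" "K * \<epsilon> < \<kappa>"
    and \<tau>: "\<tau> \<ge> 0" and bad: "\<And>\<rho>. 0 < \<rho> \<Longrightarrow> \<rho> \<le> K * \<epsilon> \<Longrightarrow> emeasure \<mu> {x \<in> space \<mu>. x \<in> \<Omega> - good_part \<kappa> \<and> rad x < \<rho>} \<le> ennreal (\<tau> * \<rho> ^ (CARD('m) + 2))"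
    and low: "ennreal (c * \<epsilon> ^ (CARD('m) + 2)) \<le> emeasure \<mu> (ring_part \<epsilon>)" and c: "c \<ge> 0"
  defines "E \<equiv> C0 * mass powr (1 / p) * (2 powr (n / 2 + period) * K powr (\<gamma> + 1) * (2 / \<eta>) powr (1 / q)) / zmin"
  shows "c / zmax \<le> (2 + 3 / period) * (mass * (2 ^ (CARD('m) + 2) / (1 - 2 powr (- period))) powr (1 / 2) / zmin) * (K / exp 1) powr (- (period / 2))
    + 4 * \<eta> * \<alpha> * ln \<beta> * (mass powr (1 / q) * E) + (2 + 3 / period) * (\<tau> powr (1 / q) * E)"
proof -
  have p1: "p > 1" using p by simp
  have q: "q > 1" by (rule conjugate_exponent_gt_1[OF p1 pq])
  have n0: "n > 0" by (simp add: n)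
  have s: "period > 0" by (rule period_pos)
  have K1: "K \<ge> 1" using K exp_ge_add_one_self[of 1] by linarith
  have b0: "b < 0" using \<eta> s n0 by (simp add: b)
  have bq: "b * q + n = q * (\<gamma> + \<eta>)" using q by (simp add: b \<gamma>(1) field_simps)
  have bq0: "b * q + n > 0" unfolding bq using q \<gamma>(2) \<eta> by simp
  have bq_neg: "b * q < 0" using b0 q by (simp add: mult_neg_pos)
  have powN: "x ^ (CARD('m) + 2) = x powr n" if "x > 0" for x by (simp only: n powr_realpow[OF that])
  define h where "h = (worm_power \<alpha> b :: 'm cspace \<Rightarrow> complex)"
  have hm[measurable]: "h \<in> borel_measurable \<mu>" unfolding h_def
    by (rule holomorphic_fun_measurable[OF open_\<Omega>]) (simp add: \<Omega>_eq worm_power_holomorphic[OF M0])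
  define \<phi> where "\<phi> z = of_real (indicator (ring_part \<epsilon>) z) * (h z / of_real (norm (h z)))" for z :: "'m cspace"
  define g where "g = bergman_projection \<Omega> \<phi>"
  have \<phi>m[measurable]: "\<phi> \<in> borel_measurable \<mu>" unfolding \<phi>_def by measurable
  have \<phi>1: "norm (\<phi> z) \<le> indicator (ring_part \<epsilon>) z" for z by (simp add: \<phi>_def norm_mult norm_divide indicator_def)
  have "norm (\<phi> z) \<le> 1" for z by (rule order_trans[OF \<phi>1]) (simp add: indicator_def)
  \<comment> \<open>At zeros of h, division by 0 gives the value 0, so the bound holds everywhere.\<close>
  then have \<phi>b: "\<phi> \<in> bounded_measurable \<mu>" by (auto simp: bounded_measurable_def)
  have \<phi>L: "\<phi> \<in> Lp \<Omega> r" if "r > 0" for r by (rule bounded_measurable_Lp[OF finite_\<mu> \<phi>b that])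
  interpret finite_measure \<mu> by (rule finite_\<mu>)
  have ringfin: "emeasure \<mu> (ring_part \<epsilon>) = ennreal (measure \<mu> (ring_part \<epsilon>))" by (rule emeasure_eq_measure)
  have ring_le: "measure \<mu> (ring_part \<epsilon>) \<le> mass * \<epsilon> powr n"
  proof -
    have "emeasure \<mu> (ring_part \<epsilon>) \<le> emeasure \<mu> {x \<in> space \<mu>. x \<in> \<Omega> \<and> rad x < \<epsilon>}"
      by (intro emeasure_mono rad_sets \<Omega>_in_\<mu>) (auto simp: ring_part_def)
    also have "\<dots> \<le> ennreal (mass * \<epsilon> ^ (CARD('m) + 2))" by (rule mass_le[OF \<epsilon>])
    finally show ?thesis unfolding ringfin powN[OF \<epsilon>] using mass_pos by (subst (asm) ennreal_le_iff) auto
  qed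
  have ring_ge: "c * \<epsilon> powr n \<le> measure \<mu> (ring_part \<epsilon>)"
    using low unfolding ringfin powN[OF \<epsilon>] by (subst (asm) ennreal_le_iff) auto
  have \<phi>n: "Lp_norm \<Omega> r \<phi> \<le> (mass * \<epsilon> powr n) powr (1 / r)" if r: "r > 0" for r
  proof -
    have "(LINT z|\<mu>. norm (\<phi> z) powr r) \<le> (LINT z|\<mu>. indicator (ring_part \<epsilon>) z)"
    proof (rule integral_mono')
      show "integrable \<mu> (indicator (ring_part \<epsilon>) :: 'm cspace \<Rightarrow> real)"
        by (rule integrable_real_indicator) (auto simp: ringfin)
      fix z
      show "norm (\<phi> z) powr r \<le> indicator (ring_part \<epsilon>) z"
      proof (cases "z \<in> ring_part \<epsilon>")
        case True
        have "norm (\<phi> z) powr r \<le> 1 powr r" using \<phi>1[of z] True r by (intro powr_mono2) auto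
        then show ?thesis using True by simp
      next
        case False then show ?thesis by (simp add: \<phi>_def)
      qed
    qed simp
    also have "\<dots> = measure \<mu> (ring_part \<epsilon>)" by (simp add: ring_part_def Int_absorb2 subset_iff)
    also note ring_le
    finally show ?thesis unfolding Lp_norm_def using r by (intro powr_mono2 integral_nonneg_AE AE_I2) auto
  qed
  have \<phi>2: "\<phi> \<in> Lp \<Omega> 2" by (rule \<phi>L) simp
  have gB: "g \<in> bergman_space \<Omega>" unfolding g_def by (rule bergman_projection_spec(1)[OF open_\<Omega> \<phi>2])
  then have g2: "g \<in> Lp \<Omega> 2" and gh: "holomorphic_fun_on g \<Omega>" by (auto simp: bergman_space_def)
  have gp: "g \<in> Lp \<Omega> p" unfolding g_def by (rule maps(1)[OF \<phi>b])
  have \<phi>p: "\<phi> \<in> Lp \<Omega> p" by (rule \<phi>L) (use p in simp)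
  have gpn: "Lp_norm \<Omega> p g \<le> C0 * (mass * \<epsilon> powr n) powr (1 / p)"
    unfolding g_def by (rule order_trans[OF maps(2)[OF \<phi>b]]) (use C0 \<phi>n[of p] p in \<open>auto intro!: mult_left_mono\<close>)
  have Lp2: "Lp_norm \<Omega> 2 f = sqint \<mu> f powr (1 / 2)" for f by (simp add: Lp_norm_def sqint_def)
  have "Lp_norm \<Omega> 2 g \<le> Lp_norm \<Omega> 2 \<phi>"
    unfolding Lp2 g_def by (intro powr_mono2 sqint_nonneg bergman_projection_contractive[OF open_\<Omega> \<phi>2]) auto
  then have g2n: "Lp_norm \<Omega> 2 g \<le> (mass * \<epsilon> powr n) powr (1 / 2)" using \<phi>n[of 2] by simp
  note bqn = bq0[unfolded n]
  note i\<phi> = Lp_worm_power_integrable[OF p1 pq \<phi>p b0 bqn] and ig = Lp_worm_power_integrable[OF p1 pq gp b0 bqn]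
  have gm[measurable]: "g \<in> borel_measurable \<mu>" by (rule holomorphic_fun_measurable[OF open_\<Omega> gh])
  note rad_powr_measurable[measurable]
  have "(LINT z|\<mu>. (\<phi> z - g z) * cnj (worm_power \<alpha> b z)) = 0"
  proof (rule worm_power_orthogonal[OF _ _ b0])
    show "(\<lambda>z. \<phi> z - g z) \<in> borel_measurable \<mu>" by measurable
    show "(LINT z|\<mu>. (\<phi> z - g z) * cnj (k z)) = 0" if "k \<in> bergman_space \<Omega>" for k
      unfolding g_def by (rule bergman_projection_spec(3)[OF open_\<Omega> \<phi>2 that])
    show "integrable \<mu> (\<lambda>z. norm (\<phi> z - g z) * rad z powr b)"
    proof (rule Bochner_Integration.integrable_bound[OF Bochner_Integration.integrable_add[OF i\<phi>(1) ig(1)]])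
      show "AE z in \<mu>. norm (norm (\<phi> z - g z) * rad z powr b) \<le> norm (norm (\<phi> z) * rad z powr b + norm (g z) * rad z powr b)"
      proof (rule AE_I2)
        fix z
        have "norm (\<phi> z - g z) * rad z powr b \<le> (norm (\<phi> z) + norm (g z)) * rad z powr b"
          by (intro mult_right_mono norm_triangle_ineq4) auto
        then show "norm (norm (\<phi> z - g z) * rad z powr b) \<le> norm (norm (\<phi> z) * rad z powr b + norm (g z) * rad z powr b)"
          by (simp add: distrib_right)
      qed
      show "(\<lambda>z. norm (\<phi> z - g z) * rad z powr b) \<in> borel_measurable \<mu>"
        by (intro borel_measurable_times rad_powr_measurable) measurable
    qed
  qed
  moreover have "(LINT z|\<mu>. (\<phi> z - g z) * cnj (worm_power \<alpha> b z)) = (LINT z|\<mu>. \<phi> z * cnj (worm_power \<alpha> b z)) - (LINT z|\<mu>. g z * cnj (worm_power \<alpha> b z))"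
    unfolding left_diff_distrib by (rule Bochner_Integration.integral_diff[OF i\<phi>(3) ig(3)])
  ultimately have same: "(LINT z|\<mu>. \<phi> z * cnj (worm_power \<alpha> b z)) = (LINT z|\<mu>. g z * cnj (worm_power \<alpha> b z))" by simp
  have lower: "c / zmax * \<epsilon> powr (b + n) \<le> norm (LINT z|\<mu>. \<phi> z * cnj (worm_power \<alpha> b z))"
  proof -
    have eq: "\<phi> z * cnj (worm_power \<alpha> b z) = of_real (indicator (ring_part \<epsilon>) z * norm (h z))" for z
    proof (cases "h z = 0")
      case True then show ?thesis by (simp add: h_def \<phi>_def)
    next
      case False
      have "h z / of_real (norm (h z)) * cnj (h z) = (h z * cnj (h z)) / of_real (norm (h z))" by simp
      also have "\<dots> = of_real (norm (h z))" using False
        by (simp add: complex_norm_square[symmetric] power2_eq_square)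
      finally have "h z / of_real (norm (h z)) * cnj (h z) = of_real (norm (h z))" .
      then show ?thesis unfolding \<phi>_def h_def[symmetric] by (simp only: mult.assoc of_real_mult)
    qed
    have ci: "integrable \<mu> (\<lambda>z. indicator (ring_part \<epsilon>) z * norm (h z))"
      using i\<phi>(3) unfolding eq by (simp only: complex_of_real_integrable_eq)
    have "c / zmax * \<epsilon> powr (b + n) = \<epsilon> powr b / zmax * (c * \<epsilon> powr n)" by (simp add: powr_add)
    also have "\<dots> \<le> \<epsilon> powr b / zmax * measure \<mu> (ring_part \<epsilon>)" using zmax_pos by (intro mult_left_mono ring_ge) auto
    also have "\<dots> = (LINT z|\<mu>. \<epsilon> powr b / zmax * indicator (ring_part \<epsilon>) z)" by (simp add: ring_part_def Int_absorb2 subset_iff)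
    also have "\<dots> \<le> (LINT z|\<mu>. indicator (ring_part \<epsilon>) z * norm (h z))"
    proof (rule integral_mono'[OF ci])
      fix z assume "z \<in> space \<mu>"
      show "0 \<le> indicator (ring_part \<epsilon>) z * norm (h z)" by simp
      show "\<epsilon> powr b / zmax * indicator (ring_part \<epsilon>) z \<le> indicator (ring_part \<epsilon>) z * norm (h z)"
      proof (cases "z \<in> ring_part \<epsilon>")
        case True
        then have z: "z \<in> \<Omega>" "rad z < \<epsilon>" by (auto simp: ring_part_def)
        have "\<epsilon> powr b \<le> rad z powr b" using props(8)[OF z(1)] z(2) b0 by (intro powr_mono2') auto
        then have "\<epsilon> powr b / zmax \<le> rad z powr b / cmod (snd (snd z))"
          using props(1,7)[OF z(1)] by (intro frac_le) auto
        then show ?thesis using True by (simp add: h_def norm_worm_power[OF z(1)])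
      qed simp
    qed
    also have "\<dots> \<le> \<bar>LINT z|\<mu>. indicator (ring_part \<epsilon>) z * norm (h z)\<bar>" by simp
    also have "\<dots> = norm (LINT z|\<mu>. \<phi> z * cnj (worm_power \<alpha> b z))" unfolding eq by (simp only: integral_complex_of_real norm_of_real)
    finally show ?thesis .
  qed
  have Ke: "K * \<epsilon> > 0" using K1 \<epsilon> by simp
  define T where "T = ln (K * \<epsilon>)"
  have eT: "exp T = K * \<epsilon>" "exp (T - 1) = K * \<epsilon> / exp 1" using Ke by (simp_all add: T_def exp_diff)
  have PB: "norm (LINT z|\<mu>. g z * cnj (worm_power \<alpha> b z)) \<le>
    (2 + 3 / period) * (LINT z|\<mu>. norm (g z) * norm (worm_power \<alpha> b z) * indicator {z \<in> \<Omega>. K * \<epsilon> / exp 1 \<le> rad z} z)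
    + 4 * \<eta> * \<alpha> * ln \<beta> * (LINT z|\<mu>. norm (g z) * norm (worm_power \<alpha> b z) * indicator {z \<in> \<Omega>. rad z < K * \<epsilon>} z)
    + (2 + 3 / period) * (LINT z|\<mu>. norm (g z) * norm (worm_power \<alpha> b z) * indicator {z \<in> \<Omega> - good_part \<kappa>. rad z < K * \<epsilon>} z)"
    (is "_ \<le> ?C * ?F + _ * ?I + _ * ?B")
    by (rule pairing_bound[where T=T and \<kappa>=\<kappa>, unfolded eT, OF gh ig(2)]) (use b n \<eta> \<kappa> in auto)
  define X where "X = \<epsilon> powr (b + n)"
  have X: "X > 0" using \<epsilon> by (simp add: X_def)
  have F: "?F \<le> mass * (2 ^ (CARD('m) + 2) / (1 - 2 powr (- period))) powr (1 / 2) / zmin * (K / exp 1) powr (- (period / 2)) * X"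
  proof -
    have d: "K * \<epsilon> / exp 1 > 0" using Ke by simp
    have "b * 2 + n < 0" using \<eta> s by (simp add: b)
    then have a: "b * 2 + real (CARD('m) + 2) < 0" unfolding n .
    have eq: "{z \<in> \<Omega>. K * \<epsilon> / exp 1 \<le> rad z} = {x \<in> space \<mu>. x \<in> \<Omega> \<and> K * \<epsilon> / exp 1 \<le> rad x}" by auto
    have S: "{z \<in> \<Omega>. K * \<epsilon> / exp 1 \<le> rad z} \<in> sets \<mu>" unfolding eq by (intro rad_sets \<Omega>_in_\<mu>)
    have "?F \<le> Lp_norm \<Omega> 2 g * (mass * 2 ^ (CARD('m) + 2) * (K * \<epsilon> / exp 1) powr (b * 2 + real (CARD('m) + 2)) / (1 - 2 powr (b * 2 + real (CARD('m) + 2)))) powr (1 / 2) / zmin"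
      by (rule pairing_region[OF S _ _ _ g2 rad_powr_integral_far(1)[OF d a] rad_powr_integral_far(2)[OF d a]]) auto
    also have "\<dots> \<le> (mass * \<epsilon> powr n) powr (1 / 2) * (mass * 2 ^ (CARD('m) + 2) * (K * \<epsilon> / exp 1) powr (b * 2 + n) / (1 - 2 powr (b * 2 + n))) powr (1 / 2) / zmin"
      unfolding n[symmetric] using zmin_pos by (intro divide_right_mono mult_right_mono g2n) auto
    also have "\<dots> \<le> (mass * (2 ^ (CARD('m) + 2) / (1 - 2 powr (- period))) powr (1 / 2) * (K / exp 1) powr (- (period / 2)) * \<epsilon> powr (b + n)) / zmin"
      using zmin_pos by (intro divide_right_mono far_power_bound[OF mass_pos _ \<epsilon> K s \<eta>(3) b]) auto
    finally show ?thesis by (simp add: X_def)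
  qed
  have near: "(LINT z|\<mu>. norm (g z) * norm (worm_power \<alpha> b z) * indicator {z \<in> D. rad z < K * \<epsilon>} z) \<le> t powr (1 / q) * E * X"
    if D: "D \<subseteq> \<Omega>" "D \<in> sets \<mu>" and t: "t \<ge> 0"
      and bd: "\<And>\<rho>. 0 < \<rho> \<Longrightarrow> \<rho> \<le> K * \<epsilon> \<Longrightarrow> emeasure \<mu> {x \<in> space \<mu>. x \<in> D \<and> rad x < \<rho>} \<le> ennreal (t * \<rho> ^ (CARD('m) + 2))" for D t
  proof -
    have eq: "{z \<in> D. rad z < K * \<epsilon>} = {x \<in> space \<mu>. x \<in> D \<and> rad x < K * \<epsilon>}" using D(1) by auto
    have S: "{z \<in> D. rad z < K * \<epsilon>} \<in> sets \<mu>" unfolding eq by (intro rad_sets D)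
    note R = rad_powr_integral[OF D bd t Ke bq_neg bqn]
    have "(LINT z|\<mu>. norm (g z) * norm (worm_power \<alpha> b z) * indicator {z \<in> D. rad z < K * \<epsilon>} z)
       \<le> Lp_norm \<Omega> p g * (t * 2 powr (- (b * q)) * (K * \<epsilon>) powr (b * q + real (CARD('m) + 2)) / (1 - 2 powr (- (b * q + real (CARD('m) + 2))))) powr (1 / q) / zmin"
      by (rule pairing_region[OF S _ p1 pq gp R(1) R(2)]) (use D in auto)
    also have "\<dots> \<le> (C0 * (mass * \<epsilon> powr n) powr (1 / p)) * (t * 2 powr (- (b * q)) * (K * \<epsilon>) powr (b * q + n) / (1 - 2 powr (- (b * q + n)))) powr (1 / q) / zmin"
      unfolding n[symmetric] using zmin_pos by (intro divide_right_mono mult_right_mono gpn) auto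
    also have "\<dots> = C0 * ((mass * \<epsilon> powr n) powr (1 / p) * (t * 2 powr (- (b * q)) * (K * \<epsilon>) powr (b * q + n) / (1 - 2 powr (- (b * q + n)))) powr (1 / q)) / zmin"
      by simp
    also have "\<dots> \<le> C0 * (mass powr (1 / p) * t powr (1 / q) * (2 powr (n / 2 + period) * K powr (\<gamma> + 1) * (2 / \<eta>) powr (1 / q)) * \<epsilon> powr (b + n)) / zmin"
      using zmin_pos C0 by (intro divide_right_mono mult_left_mono near_power_bound[OF mass_pos t \<epsilon> K1 q pq \<eta>(1,2) \<gamma> b]) auto
    also have "\<dots> = t powr (1 / q) * E * X" by (simp add: E_def X_def)
    finally show ?thesis .
  qed
  have I: "?I \<le> mass powr (1 / q) * E * X" by (rule near[OF _ \<Omega>_in_\<mu>]) (use mass_pos mass_le in auto)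
  have B: "?B \<le> \<tau> powr (1 / q) * E * X" by (rule near[OF _ bad_part_in_\<mu> \<tau> bad]) auto
  have "c / zmax * X \<le> ?C * ?F + 4 * \<eta> * \<alpha> * ln \<beta> * ?I + ?C * ?B" using lower PB unfolding same X_def by linarith
  also have "\<dots> \<le> ?C * (mass * (2 ^ (CARD('m) + 2) / (1 - 2 powr (- period))) powr (1 / 2) / zmin * (K / exp 1) powr (- (period / 2)) * X)
     + 4 * \<eta> * \<alpha> * ln \<beta> * (mass powr (1 / q) * E * X) + ?C * (\<tau> powr (1 / q) * E * X)"
    using s \<eta> \<alpha> \<beta> by (intro add_mono mult_left_mono F I B) auto
  also have "\<dots> = (?C * (mass * (2 ^ (CARD('m) + 2) / (1 - 2 powr (- period))) powr (1 / 2) / zmin) * (K / exp 1) powr (- (period / 2))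
    + 4 * \<eta> * \<alpha> * ln \<beta> * (mass powr (1 / q) * E) + ?C * (\<tau> powr (1 / q) * E)) * X"
    by (simp only: distrib_right mult.assoc)
  finally show ?thesis using X by (simp only: mult_le_cancel_right_pos)
qed

text \<open>In the projection estimate the left side is a fixed positive number. Choosing K large, then \<eta> small, then the exceptional part small, makes each of the three
  terms on the right less than a third of it. The middle term is of order \<eta> \<eta>^(-1/q) = \<eta>^(1/p); this is why the end point of the range of p is included.\<close>

lemma no_uniform_bound:
  assumes p: "p > 2" and pq: "1 / p + 1 / q = 1" and le: "1 / p \<le> 1 / 2 - period / real (CARD('m) + 2)"
    and C0: "C0 \<ge> 0" and maps: "\<And>f. f \<in> bounded_measurable \<mu> \<Longrightarrow> bergman_projection \<Omega> f \<in> Lp \<Omega> p"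
      "\<And>f. f \<in> bounded_measurable \<mu> \<Longrightarrow> Lp_norm \<Omega> p (bergman_projection \<Omega> f) \<le> C0 * Lp_norm \<Omega> p f"
  shows False
proof -
  define n where "n = real (CARD('m) + 2)"
  \<comment> \<open>The excess of the exponent over the critical one; it vanishes exactly at the end point of the range of p.\<close>
  define \<gamma> where "\<gamma> = n / q - n / 2 - period"
  have n0: "n > 0" by (simp add: n_def)
  have s: "period > 0" by (rule period_pos)
  have p1: "p > 1" using p by simp
  have q: "q > 1" by (rule conjugate_exponent_gt_1[OF p1 pq])
  have \<gamma>: "\<gamma> \<ge> 0"
  proof -
    have "1 / q \<ge> 1 / 2 + period / n" using le pq unfolding n_def by linarith
    then have "n * (1 / 2 + period / n) \<le> n * (1 / q)" using n0 by (intro mult_left_mono) auto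
    then show ?thesis using n0 by (simp add: \<gamma>_def distrib_left)
  qed
  obtain c where c: "c > 0" "\<And>\<epsilon>. 0 < \<epsilon> \<Longrightarrow> \<epsilon> \<le> 1 / 4 \<Longrightarrow> ennreal (c * \<epsilon> ^ (CARD('m) + 2)) \<le> emeasure \<mu> (ring_part \<epsilon>)"
    using ring_part_mass_lower by blast
  define L where "L = c / zmax / 3"
  have L: "L > 0" using c zmax_pos by (simp add: L_def)
  define C where "C = 2 + 3 / period"
  have C: "C \<ge> 0" using s by (simp add: C_def)
  define X1 where "X1 = C * (mass * (2 ^ (CARD('m) + 2) / (1 - 2 powr (- period))) powr (1 / 2) / zmin)"
  have "X1 \<ge> 0" using C mass_pos zmin_pos by (simp add: X1_def)
  then obtain R where R: "R \<ge> 1" "X1 * R powr (- (period / 2)) < L" using ex_large_powr_small[of X1 L "period / 2"] L s by auto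
  define K where "K = exp 1 * R"
  have K: "K \<ge> exp 1" "K / exp 1 = R" using R by (auto simp: K_def)
  have K0: "K > 0" using K(1) exp_gt_zero[of "1 :: real"] by linarith
  define Y where "Y = C0 * mass powr (1 / p) * (2 powr (n / 2 + period) * K powr (\<gamma> + 1)) / zmin"
  have Y: "Y \<ge> 0" using C0 zmin_pos by (simp add: Y_def)
  define X2 where "X2 = 4 * \<alpha> * ln \<beta> * (mass powr (1 / q) * Y * 2 powr (1 / q))"
  have "X2 \<ge> 0" using \<alpha> \<beta> Y by (simp add: X2_def)
  then obtain \<eta> where \<eta>: "0 < \<eta>" "\<eta> \<le> min 1 (period / 2)" "X2 * \<eta> powr (1 / p) < L"
    using ex_small_powr_small[of X2 L "1 / p" "min 1 (period / 2)"] L s p by auto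
  define E where "E = C0 * mass powr (1 / p) * (2 powr (n / 2 + period) * K powr (\<gamma> + 1) * (2 / \<eta>) powr (1 / q)) / zmin"
  have E: "E = Y * (2 / \<eta>) powr (1 / q)" by (simp add: E_def Y_def)
  have "C * E \<ge> 0" using C Y by (simp add: E)
  then obtain \<tau> where \<tau>: "0 < \<tau>" "\<tau> \<le> 1" "C * E * \<tau> powr (1 / q) < L"
    using ex_small_powr_small[of "C * E" L "1 / q" 1] L q by auto
  obtain \<kappa> \<delta> where \<kappa>: "\<kappa> > 0" "\<delta> > 0" "\<delta> < \<kappa>"
    "\<And>\<rho>. 0 < \<rho> \<Longrightarrow> \<rho> \<le> \<delta> \<Longrightarrow> emeasure \<mu> {x \<in> space \<mu>. x \<in> \<Omega> - good_part \<kappa> \<and> rad x < \<rho>} \<le> ennreal (\<tau> * \<rho> ^ (CARD('m) + 2))"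
    using bad_part_small[OF \<tau>(1)] by blast
  define \<epsilon> where "\<epsilon> = min (1 / 4) (\<delta> / K)"
  have \<epsilon>: "0 < \<epsilon>" "\<epsilon> \<le> 1 / 4" "\<epsilon> \<le> \<delta> / K"
    unfolding \<epsilon>_def by (use \<kappa>(2) K0 in simp, rule min.cobounded1, rule min.cobounded2)
  have K\<epsilon>: "K * \<epsilon> \<le> \<delta>" using \<epsilon>(3) K0 by (simp add: field_simps)
  have "c / zmax \<le> (2 + 3 / period) * (mass * (2 ^ (CARD('m) + 2) / (1 - 2 powr (- period))) powr (1 / 2) / zmin) * (K / exp 1) powr (- (period / 2))
    + 4 * \<eta> * \<alpha> * ln \<beta> * (mass powr (1 / q) * E) + (2 + 3 / period) * (\<tau> powr (1 / q) * E)"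
    unfolding E_def
  proof (rule projection_estimate[OF p pq maps C0 n_def \<gamma>_def \<gamma> refl])
    show "emeasure \<mu> {x \<in> space \<mu>. x \<in> \<Omega> - good_part \<kappa> \<and> rad x < \<rho>} \<le> ennreal (\<tau> * \<rho> ^ (CARD('m) + 2))"
      if "0 < \<rho>" "\<rho> \<le> K * \<epsilon>" for \<rho> using that K\<epsilon> by (intro \<kappa>(4)) auto
    show "ennreal (c * \<epsilon> ^ (CARD('m) + 2)) \<le> emeasure \<mu> (ring_part \<epsilon>)" by (rule c(2)[OF \<epsilon>(1,2)])
    show "K * \<epsilon> < \<kappa>" using K\<epsilon> \<kappa>(3) by linarith
  qed (use \<eta> K \<epsilon> \<kappa> \<tau> c in auto)
  moreover have "4 * \<eta> * \<alpha> * ln \<beta> * (mass powr (1 / q) * E) = X2 * \<eta> powr (1 / p)"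
  proof -
    have "\<eta> = \<eta> powr (1 / p + 1 / q)" using \<eta>(1) unfolding pq by simp
    then have "\<eta> = \<eta> powr (1 / p) * \<eta> powr (1 / q)" by (simp only: powr_add)
    then have "\<eta> * (2 / \<eta>) powr (1 / q) = (\<eta> powr (1 / p) * \<eta> powr (1 / q)) * (2 powr (1 / q) / \<eta> powr (1 / q))"
      using \<eta>(1) by (metis less_eq_real_def powr_divide zero_le_numeral)
    also have "\<dots> = 2 powr (1 / q) * \<eta> powr (1 / p)" using \<eta>(1) by simp
    finally have 1: "\<eta> * (2 / \<eta>) powr (1 / q) = 2 powr (1 / q) * \<eta> powr (1 / p)" .
    have "4 * \<eta> * \<alpha> * ln \<beta> * (mass powr (1 / q) * E) = 4 * \<alpha> * ln \<beta> * (mass powr (1 / q) * Y * (\<eta> * (2 / \<eta>) powr (1 / q)))"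
      unfolding E by (simp only: mult_ac)
    then show ?thesis unfolding 1 X2_def by (simp only: mult_ac)
  qed
  moreover have "(2 + 3 / period) * (\<tau> powr (1 / q) * E) = C * E * \<tau> powr (1 / q)" by (simp add: C_def)
  moreover have "c / zmax = 3 * L" by (simp add: L_def)
  ultimately show False using R(2) \<eta>(3) \<tau>(3) unfolding K(2) X1_def C_def[symmetric] by linarith
qed

end

theorem corollary2:
  fixes n :: nat and \<alpha> \<beta> M p :: real and \<Omega> :: "'m::finite cspace set"
  assumes "n = CARD('m) + 2"
    and "\<alpha> > 0" and "\<beta> > 1" and "M > 0"
    and "\<Omega> = worm_domain \<alpha> \<beta> M"
    and "open \<Omega>" and "connected \<Omega>" and "bounded \<Omega>"
    and "pseudoconvex \<Omega>" and "smooth_boundary \<Omega>"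
    and "(0 < 1 / p \<and> 1 / p \<le> 1 / 2 - pi / (2 * real n * \<alpha> * ln \<beta>)) \<or>
         (1 / 2 + pi / (2 * real n * \<alpha> * ln \<beta>) \<le> 1 / p \<and> 1 / p < 1)"
  shows "\<not> bergman_projection_maps_Lp \<Omega> p"
proof
  assume mapsp: "bergman_projection_maps_Lp \<Omega> p"
  interpret worm \<alpha> \<beta> M \<Omega>
    by unfold_locales (use assms worm_smooth_imp_M_large[OF assms(2-5,10)] in auto)
  have sn: "pi / (2 * real n * \<alpha> * ln \<beta>) = period / real (CARD('m) + 2)" by (simp add: period_def assms(1))
  have sn0: "period / real (CARD('m) + 2) > 0" using period_pos by simp
  have ne: "\<Omega> \<noteq> {}"
  proof -
    obtain c where c: "c > 0" "\<And>\<epsilon>. 0 < \<epsilon> \<Longrightarrow> \<epsilon> \<le> 1 / 4 \<Longrightarrow> ennreal (c * \<epsilon> ^ (CARD('m) + 2)) \<le> emeasure \<mu> (ring_part \<epsilon>)"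
      using ring_part_mass_lower by blast
    have "0 < ennreal (c * (1 / 4) ^ (CARD('m) + 2))" using c(1) by simp
    also have "\<dots> \<le> emeasure \<mu> (ring_part (1 / 4))" by (rule c(2)) auto
    finally have "ring_part (1 / 4) \<noteq> {}" by auto
    then show ?thesis by (auto simp: ring_part_def)
  qed
  have key: False if P: "P > 2" and PQ: "1 / P + 1 / Q = 1" and le: "1 / P \<le> 1 / 2 - period / real (CARD('m) + 2)"
    and maps: "bergman_projection_maps_Lp \<Omega> P \<or> bergman_projection_maps_Lp \<Omega> Q" for P Q
  proof -
    have P1: "P > 1" using P by simp
    have Q: "Q > 1" by (rule conjugate_exponent_gt_1[OF P1 PQ])
    have "1 / P < 1 / 2" using P by (simp add: field_simps)
    then have "1 / 2 < 1 / Q" using PQ by linarith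
    then have Q2: "Q < 2" using Q by (simp add: field_simps)
    obtain C where C: "C \<ge> 0" "\<And>f. f \<in> bounded_measurable \<mu> \<Longrightarrow> bergman_projection \<Omega> f \<in> Lp \<Omega> P"
      "\<And>f. f \<in> bounded_measurable \<mu> \<Longrightarrow> Lp_norm \<Omega> P (bergman_projection \<Omega> f) \<le> C * Lp_norm \<Omega> P f"
      using Lp_bound_of_maps[OF open_\<Omega> finite_\<mu> P PQ Lp_not_subset_L2[OF open_\<Omega> ne assms(8) Q Q2] maps] by blast
    show False by (rule no_uniform_bound[OF P PQ le C])
  qed
  from assms(11)[unfolded sn] show False
  proof
    assume h: "0 < 1 / p \<and> 1 / p \<le> 1 / 2 - period / real (CARD('m) + 2)"
    have p0: "p > 0" using h by simp
    have lt: "1 / p < 1 / 2" using h sn0 by linarith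
    have p2: "p > 2" using p0 lt by (simp add: field_simps)
    have "1 / p + 1 / (1 / (1 - 1 / p)) = 1" by simp
    from key[OF p2 this] h mapsp show False by blast
  next
    assume h: "1 / 2 + period / real (CARD('m) + 2) \<le> 1 / p \<and> 1 / p < 1"
    then have gt: "1 / p > 1 / 2" using sn0 by linarith
    define P where "P = 1 / (1 - 1 / p)"
    have iP: "1 / P = 1 - 1 / p" by (simp add: P_def)
    have "P > 0" using h by (simp add: P_def)
    moreover have "1 / P < 1 / 2" using gt iP by linarith
    ultimately have P2: "P > 2" by (simp add: field_simps)
    have "1 / P + 1 / p = 1" using iP by simp
    from key[OF P2 this] h mapsp iP show False by (simp add: algebra_simps)
  qed
qed

end
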